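(* Let $(M,\mathscr{A})$ be a local $C^\infty$-ringed space, let $k\geq 1$, let $\gamma\in\mathbf{\Omega}^{k-1}_{\mathscr{A}}(M)$ be a global $C^\infty$-algebraic de Rham form and let $\sigma:(\Delta^k,C^\infty_{\Delta^k})\to(M,\mathscr{A})$ be a $k$-simplex. Then $$\int_\sigma d\gamma=\int_{\partial\sigma}\gamma .$$
   Context: A $C^\infty$-ring is a nonempty set $\mathscr{C}$ with, for every $m\ge 0$ and every $g\in C^\infty(\mathbb{R}^m)$, an operation $g_{\mathscr{C}}:\mathscr{C}^m\to\mathscr{C}$, such that coordinate functions act as projections and the operations are compatible with composition of smooth functions; maps of $C^\infty$-rings preserve all operations. Rings of smooth functions are $C^\infty$-rings via composition, as is $\mathbb{R}$ via evaluation. Modules over a $C^\infty$-ring are modules over its underlying commutative unital $\mathbb{R}$-algebra. An $\mathbb{R}$-point of $\mathscr{C}$ is a nonzero map of $C^\infty$-rings $\mathscr{C}\to\mathbb{R}$; $\mathscr{C}$ is local if it has exactly one $\mathbb{R}$-point. A local $C^\infty$-ringed space $(M,\mathscr{A})$ is a topological space with a sheaf of $C^\infty$-rings whose stalks are local. A map $(f,f_\#):(X,\mathscr{O}_X)\to(Y,\mathscr{O}_Y)$ is a continuous map $f$ with a map $f_\#:\mathscr{O}_Y\to f_*\mathscr{O}_X$ of sheaves of $C^\infty$-rings, where $(f_*\mathscr{S})(U)=\mathscr{S}(f^{-1}(U))$. A $C^\infty$-derivation of $\mathscr{C}$ with values in a $\mathscr{C}$-module $\mathscr{M}$ is a map $X:\mathscr{C}\to\mathscr{M}$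 with $X(h_{\mathscr{C}}(a_1,\ldots,a_n))=\sum_{i}(\partial_i h)_{\mathscr{C}}(a_1,\ldots,a_n)\cdot X(a_i)$. $d_{\mathscr{C}}:\mathscr{C}\to\Omega^1_{\mathscr{C}}$ is the universal $C^\infty$-derivation: every $C^\infty$-derivation $X:\mathscr{C}\to\mathscr{N}$ factors as $\varphi_X\circ d_{\mathscr{C}}$ for a unique $\mathscr{C}$-linear $\varphi_X$. $\Lambda^\bullet\Omega^1_{\mathscr{C}}=\{\Lambda^k\Omega^1_{\mathscr{C}}\}_{k}$ is the exterior algebra over $\mathscr{C}$ ($\Lambda^0=\mathscr{C}$) with the unique degree $+1$ graded derivation $d$ extending $d_{\mathscr{C}}$ with $d\circ d=0$; it is functorial in $\mathscr{C}$. $\mathbf{\Omega}^\bullet_{\mathscr{A}}$ is the sheaf of commutative differential graded algebras (CDGAs) obtained by degreewise sheafifying the presheaf $U\mapsto\Lambda^\bullet\Omega^1_{\mathscr{A}(U)}$ together with its product and differential; $d$ in the claim is its differential. For a manifold with corners $Q$ with its sheaf $C^\infty_Q$ of smooth functions, $\mathbf{\Omega}^\bullet_{C^\infty_Q}$ is canonically the sheaf $\mathbf{\Omega}^\bullet_{dR,Q}$ of ordinary differential forms. A map $(f,f_\#):(Q,C^\infty_Q)\to(M,\mathscr{A})$ gives a map of sheaves of CDGAs $\bar f:\mathbf{\Omega}^\bullet_{\mathscr{A}}\to f_*\mathbf{\Omega}^\bullet_{dR,Q}$, the unique one with degree-zero component $f_\#$ (it is induced by the maps $\Lambda^\bullet\Omega^1_{\mathscr{A}(U)}\to\Lambda^\bullet\Omega^1_{C^\infty(f^{-1}(U))}$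 functorially associated to $f_\#$); the pullback $f^*:\mathbf{\Omega}^\bullet_{\mathscr{A}}(M)\to\mathbf{\Omega}^\bullet_{dR}(Q)$ is its component on $U=M$. The standard simplex is $\Delta^k=\{(x_0,\ldots,x_k)\in\mathbb{R}^{k+1}\mid x_i\ge 0,\ x_0+\cdots+x_k=1\}$, a manifold with corners with its standard orientation (coordinates $x_1,\ldots,x_k$). The face maps $d_i:\Delta^{k-1}\to\Delta^k$, $0\le i\le k$, insert $0$ in the $i$-th slot: $d_i(x_0,\ldots,x_{k-1})=(x_0,\ldots,x_{i-1},0,x_i,\ldots,x_{k-1})$; being smooth, they define maps of local $C^\infty$-ringed spaces (by pullback of functions). A $k$-simplex of $(M,\mathscr{A})$ is a map $\sigma:(\Delta^k,C^\infty_{\Delta^k})\to(M,\mathscr{A})$ of local $C^\infty$-ringed spaces. $k$-chains are finite formal real linear combinations of $k$-simplices, and $\partial\sigma=\sum_{i=0}^k(-1)^i\,\sigma\circ d_i$. For $\omega\in\mathbf{\Omega}^k_{\mathscr{A}}(M)$, $\int_\sigma\omega:=\int_{\Delta^k}\sigma^*\omega$, and $\int_{\sum n_\sigma\sigma}\omega:=\sum n_\sigma\int_{\Delta^k}\sigma^*\omega$. *)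

theory Defs
  imports "HOL-Homology.Simplices" "HOL-Analysis.Analysis" "HOL-Algebra.AbelCoset" "HOL-Algebra.Module"
begin

section \<open>Smooth functions\<close>

text \<open>
  \<open>\<real>\<^sup>n\<close> is \<^const>\<open>Euclidean_space\<close>: the sequences vanishing from index \<open>n\<close> on. A smooth function on a
  subset \<open>V\<close> of it is represented by the HOL function that is \<^const>\<open>undefined\<close> off \<open>V\<close>, so that
  equality in HOL is equality of functions on \<open>V\<close>.
\<close>

abbreviation euclid :: "nat \<Rightarrow> (nat \<Rightarrow> real) set" where
  "euclid n \<equiv> topspace (Euclidean_space n)"

definition partial_deriv :: "nat \<Rightarrow> ((nat \<Rightarrow> real) \<Rightarrow> real) \<Rightarrow> (nat \<Rightarrow> real) \<Rightarrow> real" where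
  "partial_deriv i f x = deriv (\<lambda>t. f (x(i := t))) (x i)"

definition smooth_on_open :: "nat \<Rightarrow> (nat \<Rightarrow> real) set \<Rightarrow> ((nat \<Rightarrow> real) \<Rightarrow> real) \<Rightarrow> bool" where
  "smooth_on_open n V f \<longleftrightarrow>
     openin (Euclidean_space n) V \<and>
     (\<forall>is. set is \<subseteq> {..<n} \<longrightarrow>
        continuous_map (subtopology (Euclidean_space n) V) euclideanreal (foldr partial_deriv is f) \<and>
        (\<forall>i<n. \<forall>x\<in>V. (\<lambda>t. foldr partial_deriv is f (x(i := t))) differentiable (at (x i))))"

definition Cinf :: "nat \<Rightarrow> ((nat \<Rightarrow> real) \<Rightarrow> real) set" where
  "Cinf n = {g \<in> extensional (euclid n). smooth_on_open n (euclid n) g}"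

definition pd :: "nat \<Rightarrow> nat \<Rightarrow> ((nat \<Rightarrow> real) \<Rightarrow> real) \<Rightarrow> (nat \<Rightarrow> real) \<Rightarrow> real" where
  "pd n i g = (\<lambda>x\<in>euclid n. partial_deriv i g x)"

definition point :: "real list \<Rightarrow> nat \<Rightarrow> real" where
  "point xs = (\<lambda>i. if i < length xs then xs ! i else 0)"

text \<open>A smooth function on an arbitrary subset of \<open>\<real>\<^sup>n\<close> is one that extends smoothly near each point.\<close>

definition local_extension ::
  "nat \<Rightarrow> (nat \<Rightarrow> real) set \<Rightarrow> ((nat \<Rightarrow> real) \<Rightarrow> real) \<Rightarrow> (nat \<Rightarrow> real) \<Rightarrow> ((nat \<Rightarrow> real) \<Rightarrow> real) \<Rightarrow> bool"
  where
  "local_extension n U f x F \<longleftrightarrow>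
     (\<exists>V. x \<in> V \<and> smooth_on_open n V F \<and> (\<forall>y\<in>U \<inter> V. F y = f y))"

definition smooth_functions :: "nat \<Rightarrow> (nat \<Rightarrow> real) set \<Rightarrow> ((nat \<Rightarrow> real) \<Rightarrow> real) set" where
  "smooth_functions n U = {f \<in> extensional U. \<forall>x\<in>U. \<exists>F. local_extension n U f x F}"


section \<open>\<open>C\<^sup>\<infinity>\<close>-rings\<close>

definition tuples :: "nat \<Rightarrow> 'a set \<Rightarrow> 'a list set" where
  "tuples n A = {as. length as = n \<and> set as \<subseteq> A}"

record 'a cring_inf = "'a partial_object" +
  smooth_op :: "((nat \<Rightarrow> real) \<Rightarrow> real) \<Rightarrow> 'a list \<Rightarrow> 'a"

locale cinf_ring =
  fixes C :: "('a, 'e) cring_inf_scheme"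
  assumes nonempty: "carrier C \<noteq> {}"
    and op_closed: "\<And>m g as. g \<in> Cinf m \<Longrightarrow> as \<in> tuples m (carrier C) \<Longrightarrow> smooth_op C g as \<in> carrier C"
    and op_proj: "\<And>m i as. i < m \<Longrightarrow> as \<in> tuples m (carrier C) \<Longrightarrow>
          smooth_op C (\<lambda>x\<in>euclid m. x i) as = as ! i"
    and op_comp: "\<And>m n g hs as. g \<in> Cinf m \<Longrightarrow> hs \<in> tuples m (Cinf n) \<Longrightarrow> as \<in> tuples n (carrier C) \<Longrightarrow>
          smooth_op C (\<lambda>x\<in>euclid n. g (point (map (\<lambda>h. h x) hs))) as
            = smooth_op C g (map (\<lambda>h. smooth_op C h as) hs)"

definition cinf_hom :: "'a cring_inf \<Rightarrow> 'b cring_inf \<Rightarrow> ('a \<Rightarrow> 'b) set" where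
  "cinf_hom C D =
     {f \<in> carrier C \<rightarrow>\<^sub>E carrier D.
        \<forall>m. \<forall>g\<in>Cinf m. \<forall>as\<in>tuples m (carrier C). f (smooth_op C g as) = smooth_op D g (map f as)}"

definition underlying_ring :: "'a cring_inf \<Rightarrow> 'a ring" where
  "underlying_ring C =
     \<lparr>carrier = carrier C,
      monoid.mult = (\<lambda>a b. smooth_op C (\<lambda>x\<in>euclid 2. x 0 * x 1) [a, b]),
      one = smooth_op C (\<lambda>x\<in>euclid 0. 1) [],
      zero = smooth_op C (\<lambda>x\<in>euclid 0. 0) [],
      add = (\<lambda>a b. smooth_op C (\<lambda>x\<in>euclid 2. x 0 + x 1) [a, b])\<rparr>"

definition real_cinf :: "real cring_inf" where
  "real_cinf = \<lparr>carrier = UNIV, smooth_op = (\<lambda>g xs. g (point xs))\<rparr>"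

definition R_points :: "'a cring_inf \<Rightarrow> ('a \<Rightarrow> real) set" where
  "R_points C = {p \<in> cinf_hom C real_cinf. \<exists>a\<in>carrier C. p a \<noteq> 0}"

definition local_cinf_ring :: "'a cring_inf \<Rightarrow> bool" where
  "local_cinf_ring C \<longleftrightarrow> cinf_ring C \<and> (\<exists>!p. p \<in> R_points C)"


section \<open>Germs and sheafification\<close>

text \<open>
  A presheaf is a pair \<open>(S, r)\<close> of sets of sections \<open>S U\<close> and restrictions \<open>r U V : S U \<rightarrow> S V\<close>. Germs are
  equivalence classes of pairs (neighbourhood, section). Maps out of germs and out of quotient
  modules are written as unions over all representatives of the class of the resulting value; when
  the value does not depend on the representative, the union is that value.
\<close>

definition germ ::
  "'m topology \<Rightarrow> ('m set \<Rightarrow> 'b set) \<Rightarrow> ('m set \<Rightarrow> 'm set \<Rightarrow> 'b \<Rightarrow> 'b) \<Rightarrow> 'm \<Rightarrow> 'm set \<Rightarrow> 'b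
     \<Rightarrow> ('m set \<times> 'b) set" where
  "germ T S r x U s =
     {(V, t). openin T V \<and> x \<in> V \<and> t \<in> S V \<and>
        (\<exists>W. openin T W \<and> x \<in> W \<and> W \<subseteq> U \<inter> V \<and> r U W s = r V W t)}"

text \<open>Sections over \<open>U\<close> of the sheaf associated with the presheaf \<open>(S, r)\<close>.\<close>

definition sheafify ::
  "'m topology \<Rightarrow> ('m set \<Rightarrow> 'b set) \<Rightarrow> ('m set \<Rightarrow> 'm set \<Rightarrow> 'b \<Rightarrow> 'b) \<Rightarrow> 'm set
     \<Rightarrow> ('m \<Rightarrow> ('m set \<times> 'b) set) set" where
  "sheafify T S r U =
     {s \<in> extensional U. \<forall>x\<in>U. \<exists>V w. openin T V \<and> x \<in> V \<and> V \<subseteq> U \<and> w \<in> S V \<and>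
        (\<forall>y\<in>V. s y = germ T S r y V w)}"


section \<open>Local \<open>C\<^sup>\<infinity>\<close>-ringed spaces and their maps\<close>

record ('m, 'a) cinf_space =
  space_top :: "'m topology"
  sec :: "'m set \<Rightarrow> 'a cring_inf"
  res :: "'m set \<Rightarrow> 'm set \<Rightarrow> 'a \<Rightarrow> 'a"

definition cinf_sheaf :: "('m, 'a) cinf_space \<Rightarrow> bool" where
  "cinf_sheaf X \<longleftrightarrow>
     (\<forall>U. openin (space_top X) U \<longrightarrow> cinf_ring (sec X U)) \<and>
     (\<forall>U V. openin (space_top X) U \<and> openin (space_top X) V \<and> V \<subseteq> U \<longrightarrow>
        res X U V \<in> cinf_hom (sec X U) (sec X V)) \<and>
     (\<forall>U. openin (space_top X) U \<longrightarrow> (\<forall>s\<in>carrier (sec X U). res X U U s = s)) \<and>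
     (\<forall>U V W. openin (space_top X) U \<and> openin (space_top X) V \<and> openin (space_top X) W \<and>
        W \<subseteq> V \<and> V \<subseteq> U \<longrightarrow> (\<forall>s\<in>carrier (sec X U). res X V W (res X U V s) = res X U W s)) \<and>
     (\<forall>\<U> s. (\<forall>U\<in>\<U>. openin (space_top X) U \<and> s U \<in> carrier (sec X U)) \<and>
        (\<forall>U\<in>\<U>. \<forall>V\<in>\<U>. res X U (U \<inter> V) (s U) = res X V (U \<inter> V) (s V)) \<longrightarrow>
        (\<exists>!t. t \<in> carrier (sec X (\<Union>\<U>)) \<and> (\<forall>U\<in>\<U>. res X (\<Union>\<U>) U t = s U)))"

definition stalk :: "('m, 'a) cinf_space \<Rightarrow> 'm \<Rightarrow> ('m set \<times> 'a) set cring_inf" where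
  "stalk X x =
     (let gm = germ (space_top X) (\<lambda>U. carrier (sec X U)) (res X) x in
      \<lparr>carrier = {gm U s | U s. openin (space_top X) U \<and> x \<in> U \<and> s \<in> carrier (sec X U)},
       smooth_op = (\<lambda>g gs. \<Union>{gm U (smooth_op (sec X U) g ss) | U ss.
          openin (space_top X) U \<and> x \<in> U \<and> set ss \<subseteq> carrier (sec X U) \<and> gs = map (gm U) ss})\<rparr>)"

definition local_cinf_ringed_space :: "('m, 'a) cinf_space \<Rightarrow> bool" where
  "local_cinf_ringed_space X \<longleftrightarrow>
     cinf_sheaf X \<and> (\<forall>x\<in>topspace (space_top X). local_cinf_ring (stalk X x))"

record ('x, 'a, 'y, 'b) cinf_map =
  on_points :: "'x \<Rightarrow> 'y"
  on_sections :: "'y set \<Rightarrow> 'b \<Rightarrow> 'a"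

definition preim :: "('x, 'a) cinf_space \<Rightarrow> ('x, 'a, 'y, 'b) cinf_map \<Rightarrow> 'y set \<Rightarrow> 'x set" where
  "preim X f U = {x \<in> topspace (space_top X). on_points f x \<in> U}"

text \<open>The extensionality conditions only make equality in HOL the equality of maps.\<close>

definition is_cinf_map ::
  "('x, 'a) cinf_space \<Rightarrow> ('y, 'b) cinf_space \<Rightarrow> ('x, 'a, 'y, 'b) cinf_map \<Rightarrow> bool" where
  "is_cinf_map X Y f \<longleftrightarrow>
     continuous_map (space_top X) (space_top Y) (on_points f) \<and>
     on_points f \<in> extensional (topspace (space_top X)) \<and>
     on_sections f \<in> extensional {U. openin (space_top Y) U} \<and>
     (\<forall>U. openin (space_top Y) U \<longrightarrow> on_sections f U \<in> cinf_hom (sec Y U) (sec X (preim X f U))) \<and>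
     (\<forall>U V. openin (space_top Y) U \<and> openin (space_top Y) V \<and> V \<subseteq> U \<longrightarrow>
        (\<forall>s\<in>carrier (sec Y U).
           on_sections f V (res Y U V s) = res X (preim X f U) (preim X f V) (on_sections f U s)))"

definition cinf_comp ::
  "('x, 'a) cinf_space \<Rightarrow> ('y, 'b) cinf_space \<Rightarrow> ('z, 'c) cinf_space \<Rightarrow>
   ('y, 'b, 'z, 'c) cinf_map \<Rightarrow> ('x, 'a, 'y, 'b) cinf_map \<Rightarrow> ('x, 'a, 'z, 'c) cinf_map" where
  "cinf_comp X Y Z f g =
     \<lparr>on_points = compose (topspace (space_top X)) (on_points f) (on_points g),
      on_sections = (\<lambda>U\<in>{U. openin (space_top Z) U}.
         compose (carrier (sec Z U)) (on_sections g (preim Y f U)) (on_sections f U))\<rparr>"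


section \<open>Modules by generators and relations\<close>

text \<open>
  The \<open>mult\<close> and \<open>one\<close> fields of a module record carry no meaning; they are there only because
  HOL-Algebra's module records extend ring records.
\<close>

definition free_module :: "'a ring \<Rightarrow> 'x set \<Rightarrow> ('a, 'x \<Rightarrow> 'a) module" where
  "free_module R X =
     \<lparr>carrier = {v \<in> X \<rightarrow>\<^sub>E carrier R. finite {x \<in> X. v x \<noteq> \<zero>\<^bsub>R\<^esub>}},
      monoid.mult = undefined, one = undefined,
      zero = (\<lambda>x\<in>X. \<zero>\<^bsub>R\<^esub>),
      add = (\<lambda>v w. \<lambda>x\<in>X. v x \<oplus>\<^bsub>R\<^esub> w x),
      smult = (\<lambda>c v. \<lambda>x\<in>X. c \<otimes>\<^bsub>R\<^esub> v x)\<rparr>"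

definition basis_vec :: "'a ring \<Rightarrow> 'x set \<Rightarrow> 'x \<Rightarrow> 'x \<Rightarrow> 'a" where
  "basis_vec R X x = (\<lambda>y\<in>X. if y = x then \<one>\<^bsub>R\<^esub> else \<zero>\<^bsub>R\<^esub>)"

definition submodule_span :: "'a ring \<Rightarrow> ('a, 'n) module \<Rightarrow> 'n set \<Rightarrow> 'n set" where
  "submodule_span R N S = \<Inter>{H. submodule H R N \<and> S \<subseteq> H}"

definition quotient_module :: "('a, 'n) module \<Rightarrow> 'n set \<Rightarrow> ('a, 'n set) module" where
  "quotient_module N H =
     \<lparr>carrier = a_rcosets\<^bsub>N\<^esub> H,
      monoid.mult = undefined, one = undefined,
      zero = H,
      add = (\<lambda>v w. v <+>\<^bsub>N\<^esub> w),
      smult = (\<lambda>c v. \<Union>x\<in>v. H +>\<^bsub>N\<^esub> (c \<odot>\<^bsub>N\<^esub> x))\<rparr>"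

text \<open>
  The map of free modules that is given by \<open>f\<close> on the basis and by the ring map \<open>\<phi>\<close> on coefficients.
\<close>

definition free_map :: "'b ring \<Rightarrow> 'x set \<Rightarrow> 'a ring \<Rightarrow> 'y set \<Rightarrow> ('a \<Rightarrow> 'b) \<Rightarrow> ('x \<Rightarrow> 'y) \<Rightarrow> ('x \<Rightarrow> 'a) \<Rightarrow> 'y \<Rightarrow> 'b"
  where
  "free_map R' X R Y \<phi> f v =
     (\<lambda>y\<in>Y. finsum R' (\<lambda>x. \<phi> (v x)) {x \<in> X. v x \<noteq> \<zero>\<^bsub>R\<^esub> \<and> f x = y})"


section \<open>Kaehler differentials of a \<open>C\<^sup>\<infinity>\<close>-ring\<close>

text \<open>
  The universal \<open>C\<^sup>\<infinity>\<close>-derivation. A universal property over modules of all types cannot be a HOL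
  definition, so the standard model is used: generators \<open>da\<close> for \<open>a \<in> C\<close>, subject to exactly the
  relations \<open>d(h(a\<^sub>1, \<dots>, a\<^sub>n)) = \<Sum>\<^sub>i (\<partial>\<^sub>ih)(a\<^sub>1, \<dots>, a\<^sub>n) \<cdot> da\<^sub>i\<close> of a \<open>C\<^sup>\<infinity>\<close>-derivation.
\<close>

definition kaehler_free :: "'a cring_inf \<Rightarrow> ('a, 'a \<Rightarrow> 'a) module" where
  "kaehler_free C = free_module (underlying_ring C) (carrier C)"

definition kaehler_rels :: "'a cring_inf \<Rightarrow> ('a \<Rightarrow> 'a) set" where
  "kaehler_rels C =
     (let F = kaehler_free C; \<delta> = basis_vec (underlying_ring C) (carrier C) in
      {\<delta> (smooth_op C h as) \<ominus>\<^bsub>F\<^esub> (\<Oplus>\<^bsub>F\<^esub>i\<in>{..<n}. smooth_op C (pd n i h) as \<odot>\<^bsub>F\<^esub> \<delta> (as ! i))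
       | n h as. h \<in> Cinf n \<and> as \<in> tuples n (carrier C)})"

definition kaehler_span :: "'a cring_inf \<Rightarrow> ('a \<Rightarrow> 'a) set" where
  "kaehler_span C = submodule_span (underlying_ring C) (kaehler_free C) (kaehler_rels C)"

definition kaehler_class :: "'a cring_inf \<Rightarrow> ('a \<Rightarrow> 'a) \<Rightarrow> ('a \<Rightarrow> 'a) set" where
  "kaehler_class C v = kaehler_span C +>\<^bsub>kaehler_free C\<^esub> v"

definition kaehler :: "'a cring_inf \<Rightarrow> ('a, ('a \<Rightarrow> 'a) set) module" where
  "kaehler C = quotient_module (kaehler_free C) (kaehler_span C)"

definition kaehler_d :: "'a cring_inf \<Rightarrow> 'a \<Rightarrow> ('a \<Rightarrow> 'a) set" where
  "kaehler_d C a = kaehler_class C (basis_vec (underlying_ring C) (carrier C) a)"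

definition kaehler_map :: "'a cring_inf \<Rightarrow> 'b cring_inf \<Rightarrow> ('a \<Rightarrow> 'b) \<Rightarrow> ('a \<Rightarrow> 'a) set \<Rightarrow> ('b \<Rightarrow> 'b) set"
  where
  "kaehler_map C D \<phi> w =
     (\<Union>v\<in>w. kaehler_class D
        (free_map (underlying_ring D) (carrier C) (underlying_ring C) (carrier D) \<phi> \<phi> v))"


section \<open>The exterior algebra of a module\<close>

text \<open>
  The \<open>k\<close>-th exterior power of \<open>N\<close>: generators \<open>w\<^sub>1 \<and> \<dots> \<and> w\<^sub>k\<close> for tuples in \<open>N\<close>, subject to
  multilinearity and the alternating law.
\<close>

definition ext_free :: "'a ring \<Rightarrow> ('a, 'n) module \<Rightarrow> nat \<Rightarrow> ('a, 'n list \<Rightarrow> 'a) module" where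
  "ext_free R N k = free_module R (tuples k (carrier N))"

definition ext_rels :: "'a ring \<Rightarrow> ('a, 'n) module \<Rightarrow> nat \<Rightarrow> ('n list \<Rightarrow> 'a) set" where
  "ext_rels R N k =
     (let F = ext_free R N k; T = tuples k (carrier N); e = basis_vec R T in
      {e (ws[i := u \<oplus>\<^bsub>N\<^esub> v]) \<ominus>\<^bsub>F\<^esub> (e (ws[i := u]) \<oplus>\<^bsub>F\<^esub> e (ws[i := v]))
       | ws i u v. ws \<in> T \<and> i < k \<and> u \<in> carrier N \<and> v \<in> carrier N} \<union>
      {e (ws[i := c \<odot>\<^bsub>N\<^esub> u]) \<ominus>\<^bsub>F\<^esub> (c \<odot>\<^bsub>F\<^esub> e (ws[i := u]))
       | ws i c u. ws \<in> T \<and> i < k \<and> c \<in> carrier R \<and> u \<in> carrier N} \<union>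
      {e ws | ws i j. ws \<in> T \<and> i < j \<and> j < k \<and> ws ! i = ws ! j})"

definition ext_span :: "'a ring \<Rightarrow> ('a, 'n) module \<Rightarrow> nat \<Rightarrow> ('n list \<Rightarrow> 'a) set" where
  "ext_span R N k = submodule_span R (ext_free R N k) (ext_rels R N k)"

definition ext_class :: "'a ring \<Rightarrow> ('a, 'n) module \<Rightarrow> nat \<Rightarrow> ('n list \<Rightarrow> 'a) \<Rightarrow> ('n list \<Rightarrow> 'a) set" where
  "ext_class R N k v = ext_span R N k +>\<^bsub>ext_free R N k\<^esub> v"

definition ext_power :: "'a ring \<Rightarrow> ('a, 'n) module \<Rightarrow> nat \<Rightarrow> ('a, ('n list \<Rightarrow> 'a) set) module" where
  "ext_power R N k = quotient_module (ext_free R N k) (ext_span R N k)"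

definition ext_scalar :: "'a ring \<Rightarrow> ('a, 'n) module \<Rightarrow> 'a \<Rightarrow> ('n list \<Rightarrow> 'a) set" where
  "ext_scalar R N a = ext_class R N 0 (a \<odot>\<^bsub>ext_free R N 0\<^esub> basis_vec R (tuples 0 (carrier N)) [])"

definition ext_vector :: "'a ring \<Rightarrow> ('a, 'n) module \<Rightarrow> 'n \<Rightarrow> ('n list \<Rightarrow> 'a) set" where
  "ext_vector R N w = ext_class R N 1 (basis_vec R (tuples 1 (carrier N)) [w])"

definition wedge ::
  "'a ring \<Rightarrow> ('a, 'n) module \<Rightarrow> nat \<Rightarrow> nat \<Rightarrow> ('n list \<Rightarrow> 'a) set \<Rightarrow> ('n list \<Rightarrow> 'a) set
     \<Rightarrow> ('n list \<Rightarrow> 'a) set" where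
  "wedge R N p q \<alpha> \<beta> =
     (\<Union>v\<in>\<alpha>. \<Union>w\<in>\<beta>. ext_class R N (p + q)
        (\<lambda>ws\<in>tuples (p + q) (carrier N). v (take p ws) \<otimes>\<^bsub>R\<^esub> w (drop p ws)))"


section \<open>The algebraic de Rham algebra of a \<open>C\<^sup>\<infinity>\<close>-ring\<close>

type_synonym 'a form = "(('a \<Rightarrow> 'a) set list \<Rightarrow> 'a) set"

definition \<Lambda>\<Omega> :: "'a cring_inf \<Rightarrow> nat \<Rightarrow> ('a, 'a form) module" where
  "\<Lambda>\<Omega> C k = ext_power (underlying_ring C) (kaehler C) k"

definition \<Lambda>\<Omega>_map :: "'a cring_inf \<Rightarrow> 'b cring_inf \<Rightarrow> ('a \<Rightarrow> 'b) \<Rightarrow> nat \<Rightarrow> 'a form \<Rightarrow> 'b form" where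
  "\<Lambda>\<Omega>_map C D \<phi> k \<alpha> =
     (\<Union>v\<in>\<alpha>. ext_class (underlying_ring D) (kaehler D) k
        (free_map (underlying_ring D) (tuples k (carrier (kaehler C))) (underlying_ring C)
           (tuples k (carrier (kaehler D))) \<phi> (map (kaehler_map C D \<phi>)) v))"

text \<open>
  A square-zero graded derivation of degree \<open>1\<close> that extends \<^const>\<open>kaehler_d\<close>, where degrees \<open>0\<close> and \<open>1\<close>
  are identified with \<open>C\<close> and with the Kaehler module. Linearity over the reals is not listed: it
  follows from the Leibniz rule because \<^const>\<open>kaehler_d\<close> kills constants.
\<close>

definition is_exterior_derivative :: "'a cring_inf \<Rightarrow> (nat \<Rightarrow> 'a form \<Rightarrow> 'a form) \<Rightarrow> bool" where
  "is_exterior_derivative C D \<longleftrightarrow>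
     (let R = underlying_ring C; N = kaehler C in
      (\<forall>k. D k \<in> carrier (\<Lambda>\<Omega> C k) \<rightarrow>\<^sub>E carrier (\<Lambda>\<Omega> C (Suc k))) \<and>
      (\<forall>k. \<forall>\<alpha>\<in>carrier (\<Lambda>\<Omega> C k). \<forall>\<beta>\<in>carrier (\<Lambda>\<Omega> C k).
         D k (\<alpha> \<oplus>\<^bsub>\<Lambda>\<Omega> C k\<^esub> \<beta>) = D k \<alpha> \<oplus>\<^bsub>\<Lambda>\<Omega> C (Suc k)\<^esub> D k \<beta>) \<and>
      (\<forall>p q. \<forall>\<alpha>\<in>carrier (\<Lambda>\<Omega> C p). \<forall>\<beta>\<in>carrier (\<Lambda>\<Omega> C q).
         D (p + q) (wedge R N p q \<alpha> \<beta>) =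
           (if even p
            then wedge R N (Suc p) q (D p \<alpha>) \<beta> \<oplus>\<^bsub>\<Lambda>\<Omega> C (Suc (p + q))\<^esub> wedge R N p (Suc q) \<alpha> (D q \<beta>)
            else wedge R N (Suc p) q (D p \<alpha>) \<beta> \<ominus>\<^bsub>\<Lambda>\<Omega> C (Suc (p + q))\<^esub> wedge R N p (Suc q) \<alpha> (D q \<beta>))) \<and>
      (\<forall>a\<in>carrier C. D 0 (ext_scalar R N a) = ext_vector R N (kaehler_d C a)) \<and>
      (\<forall>k. \<forall>\<alpha>\<in>carrier (\<Lambda>\<Omega> C k). D (Suc k) (D k \<alpha>) = \<zero>\<^bsub>\<Lambda>\<Omega> C (Suc (Suc k))\<^esub>))"

definition ext_deriv :: "'a cring_inf \<Rightarrow> nat \<Rightarrow> 'a form \<Rightarrow> 'a form" where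
  "ext_deriv C = (THE D. is_exterior_derivative C D)"


section \<open>The sheaf of algebraic de Rham forms\<close>

type_synonym ('m, 'a) form_germ = "('m set \<times> 'a form) set"

definition form_germ ::
  "('m, 'a) cinf_space \<Rightarrow> nat \<Rightarrow> 'm \<Rightarrow> 'm set \<Rightarrow> 'a form \<Rightarrow> ('m, 'a) form_germ" where
  "form_germ X k =
     germ (space_top X) (\<lambda>U. carrier (\<Lambda>\<Omega> (sec X U) k)) (\<lambda>U V. \<Lambda>\<Omega>_map (sec X U) (sec X V) (res X U V) k)"

definition forms :: "('m, 'a) cinf_space \<Rightarrow> nat \<Rightarrow> 'm set \<Rightarrow> ('m \<Rightarrow> ('m, 'a) form_germ) set" where
  "forms X k U =
     sheafify (space_top X) (\<lambda>U. carrier (\<Lambda>\<Omega> (sec X U) k))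
       (\<lambda>U V. \<Lambda>\<Omega>_map (sec X U) (sec X V) (res X U V) k) U"

abbreviation global_forms :: "('m, 'a) cinf_space \<Rightarrow> nat \<Rightarrow> ('m \<Rightarrow> ('m, 'a) form_germ) set" where
  "global_forms X k \<equiv> forms X k (topspace (space_top X))"

definition form_d ::
  "('m, 'a) cinf_space \<Rightarrow> nat \<Rightarrow> 'm set \<Rightarrow> ('m \<Rightarrow> ('m, 'a) form_germ) \<Rightarrow> 'm \<Rightarrow> ('m, 'a) form_germ" where
  "form_d X k U \<omega> = (\<lambda>x\<in>U. \<Union>(V, w)\<in>\<omega> x. form_germ X (Suc k) x V (ext_deriv (sec X V) k w))"

text \<open>The component at \<open>U\<close> of the map of sheaves of forms induced by \<open>f : X \<rightarrow> Y\<close>.\<close>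

definition form_map ::
  "('x, 'a) cinf_space \<Rightarrow> ('y, 'b) cinf_space \<Rightarrow> ('x, 'a, 'y, 'b) cinf_map \<Rightarrow> nat \<Rightarrow> 'y set \<Rightarrow>
   ('y \<Rightarrow> ('y, 'b) form_germ) \<Rightarrow> 'x \<Rightarrow> ('x, 'a) form_germ" where
  "form_map X Y f k U \<omega> =
     (\<lambda>x\<in>preim X f U. \<Union>(V, w)\<in>\<omega> (on_points f x).
        form_germ X k x (preim X f V)
          (\<Lambda>\<Omega>_map (sec Y V) (sec X (preim X f V)) (on_sections f V) k w))"


section \<open>The standard simplex\<close>

definition simplex_sec :: "nat \<Rightarrow> (nat \<Rightarrow> real) set \<Rightarrow> ((nat \<Rightarrow> real) \<Rightarrow> real) cring_inf" where
  "simplex_sec n U =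
     \<lparr>carrier = smooth_functions (Suc n) U,
      smooth_op = (\<lambda>g fs. \<lambda>x\<in>U. g (point (map (\<lambda>f. f x) fs)))\<rparr>"

definition simplex_space :: "nat \<Rightarrow> (nat \<Rightarrow> real, (nat \<Rightarrow> real) \<Rightarrow> real) cinf_space" where
  "simplex_space n =
     \<lparr>space_top = subtopology (Euclidean_space (Suc n)) (standard_simplex n),
      sec = simplex_sec n,
      res = (\<lambda>U V. \<lambda>s\<in>carrier (simplex_sec n U). restrict s V)\<rparr>"

text \<open>The face map into the \<open>n\<close>-simplex that inserts \<open>0\<close> in the \<open>i\<close>-th slot.\<close>

definition face_map ::
  "nat \<Rightarrow> nat \<Rightarrow> (nat \<Rightarrow> real, (nat \<Rightarrow> real) \<Rightarrow> real, nat \<Rightarrow> real, (nat \<Rightarrow> real) \<Rightarrow> real) cinf_map" where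
  "face_map n i =
     \<lparr>on_points = restrict (simplical_face i) (standard_simplex (n - 1)),
      on_sections = (\<lambda>U\<in>{U. openin (space_top (simplex_space n)) U}.
         \<lambda>s\<in>carrier (simplex_sec n U).
           \<lambda>x\<in>{x \<in> standard_simplex (n - 1). simplical_face i x \<in> U}. s (simplical_face i x))\<rparr>"


section \<open>Ordinary differential forms on the simplex and their integrals\<close>

text \<open>
  A \<open>k\<close>-form on \<open>U\<close> assigns a number to \<open>x \<in> U\<close> and a list of \<open>k\<close> tangent vectors of the simplex at \<open>x\<close>,
  that is, vectors in \<open>\<real>\<^sup>n\<^sup>+\<^sup>1\<close> with coordinate sum \<open>0\<close>. On those, the differential of a smooth function
  does not depend on the choice of a local smooth extension.
\<close>

type_synonym dR_form = "(nat \<Rightarrow> real) \<Rightarrow> (nat \<Rightarrow> real) list \<Rightarrow> real"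

definition differential :: "nat \<Rightarrow> (nat \<Rightarrow> real) set \<Rightarrow> ((nat \<Rightarrow> real) \<Rightarrow> real) \<Rightarrow> (nat \<Rightarrow> real) \<Rightarrow> (nat \<Rightarrow> real) \<Rightarrow> real"
  where
  "differential n U f x v =
     (THE r. \<exists>F. local_extension (Suc n) U f x F \<and> r = (\<Sum>i\<le>n. partial_deriv i F x * v i))"

text \<open>
  The canonical map to ordinary forms is \<open>\<Sum> g df\<^sub>1 \<and> \<dots> \<and> df\<^sub>k \<mapsto> \<Sum> g df\<^sub>1 \<and> \<dots> \<and> df\<^sub>k\<close>, with the wedge of
  covectors being \<open>(\<alpha>\<^sub>1 \<and> \<dots> \<and> \<alpha>\<^sub>k)(v\<^sub>1, \<dots>, v\<^sub>k) = det (\<alpha>\<^sub>i(v\<^sub>j))\<close>. The sets below to which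
  \<^const>\<open>the_elem\<close> is applied consist of the values on all representatives of one class.
\<close>

definition eval_1form ::
  "nat \<Rightarrow> (nat \<Rightarrow> real) set \<Rightarrow> (((nat \<Rightarrow> real) \<Rightarrow> real) \<Rightarrow> ((nat \<Rightarrow> real) \<Rightarrow> real)) set
     \<Rightarrow> (nat \<Rightarrow> real) \<Rightarrow> (nat \<Rightarrow> real) \<Rightarrow> real" where
  "eval_1form n U w x v =
     (let R = underlying_ring (simplex_sec n U) in
      the_elem ((\<lambda>c. \<Sum>f | f \<in> carrier R \<and> c f \<noteq> \<zero>\<^bsub>R\<^esub>. c f x * differential n U f x v) ` w))"

definition eval_form :: "nat \<Rightarrow> nat \<Rightarrow> (nat \<Rightarrow> real) set \<Rightarrow> ((nat \<Rightarrow> real) \<Rightarrow> real) form \<Rightarrow> dR_form" where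
  "eval_form n k U \<alpha> x vs =
     (let R = underlying_ring (simplex_sec n U); N = kaehler (simplex_sec n U) in
      the_elem
        ((\<lambda>c. \<Sum>ws | ws \<in> tuples k (carrier N) \<and> c ws \<noteq> \<zero>\<^bsub>R\<^esub>.
            c ws x * (\<Sum>p | p permutes {..<k}.
              of_int (sign p) * (\<Prod>i<k. eval_1form n U (ws ! i) x (vs ! p i)))) ` \<alpha>))"

definition to_dR ::
  "nat \<Rightarrow> nat \<Rightarrow> ((nat \<Rightarrow> real) \<Rightarrow> (nat \<Rightarrow> real, (nat \<Rightarrow> real) \<Rightarrow> real) form_germ) \<Rightarrow> dR_form" where
  "to_dR n k \<omega> x vs = the_elem ((\<lambda>(U, \<alpha>). eval_form n k U \<alpha> x vs) ` \<omega> x)"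

text \<open>
  Integration in the coordinates \<open>x\<^sub>1, \<dots>, x\<^sub>k\<close>, the remaining one being \<open>x\<^sub>0 = 1 - x\<^sub>1 - \<dots> - x\<^sub>k\<close>;
  the coordinate vector field of \<open>x\<^sub>j\<close> is \<open>e\<^sub>j - e\<^sub>0\<close>.
\<close>

definition simplex_chart_domain :: "nat \<Rightarrow> (nat \<Rightarrow> real) set" where
  "simplex_chart_domain k = {y \<in> {1..k} \<rightarrow>\<^sub>E {0..}. (\<Sum>j=1..k. y j) \<le> 1}"

definition simplex_param :: "nat \<Rightarrow> (nat \<Rightarrow> real) \<Rightarrow> nat \<Rightarrow> real" where
  "simplex_param k y = (\<lambda>i. if i = 0 then 1 - (\<Sum>j=1..k. y j) else if i \<le> k then y i else 0)"

definition coord_vector :: "nat \<Rightarrow> nat \<Rightarrow> real" where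
  "coord_vector j = (\<lambda>i. if i = j then 1 else if i = 0 then -1 else 0)"

definition integral_simplex :: "nat \<Rightarrow> dR_form \<Rightarrow> real" where
  "integral_simplex k \<omega> =
     set_lebesgue_integral (Pi\<^sub>M {1..k} (\<lambda>_. lborel)) (simplex_chart_domain k)
       (\<lambda>y. \<omega> (simplex_param k y) (map coord_vector [1..<Suc k]))"


section \<open>Chains in a local \<open>C\<^sup>\<infinity>\<close>-ringed space\<close>

type_synonym ('m, 'a) cinf_simplex = "(nat \<Rightarrow> real, (nat \<Rightarrow> real) \<Rightarrow> real, 'm, 'a) cinf_map"

definition cinf_simplices :: "('m, 'a) cinf_space \<Rightarrow> nat \<Rightarrow> ('m, 'a) cinf_simplex set" where
  "cinf_simplices M k = {\<sigma>. is_cinf_map (simplex_space k) M \<sigma>}"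

definition pullback ::
  "('m, 'a) cinf_space \<Rightarrow> nat \<Rightarrow> ('m, 'a) cinf_simplex \<Rightarrow> nat \<Rightarrow> ('m \<Rightarrow> ('m, 'a) form_germ) \<Rightarrow> dR_form" where
  "pullback M n \<sigma> k \<omega> = to_dR n k (form_map (simplex_space n) M \<sigma> k (topspace (space_top M)) \<omega>)"

definition integral_over_simplex ::
  "('m, 'a) cinf_space \<Rightarrow> nat \<Rightarrow> ('m, 'a) cinf_simplex \<Rightarrow> ('m \<Rightarrow> ('m, 'a) form_germ) \<Rightarrow> real" where
  "integral_over_simplex M k \<sigma> \<omega> = integral_simplex k (pullback M k \<sigma> k \<omega>)"

definition face :: "('m, 'a) cinf_space \<Rightarrow> nat \<Rightarrow> ('m, 'a) cinf_simplex \<Rightarrow> nat \<Rightarrow> ('m, 'a) cinf_simplex" where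
  "face M k \<sigma> i = cinf_comp (simplex_space (k - 1)) (simplex_space k) M \<sigma> (face_map k i)"

text \<open>Real chains are finitely supported functions on simplices.\<close>

definition boundary :: "('m, 'a) cinf_space \<Rightarrow> nat \<Rightarrow> ('m, 'a) cinf_simplex \<Rightarrow> ('m, 'a) cinf_simplex \<Rightarrow>\<^sub>0 real"
  where
  "boundary M k \<sigma> = (\<Sum>i\<le>k. Poly_Mapping.single (face M k \<sigma> i) ((-1) ^ i))"

definition integral_over_chain ::
  "('m, 'a) cinf_space \<Rightarrow> nat \<Rightarrow> (('m, 'a) cinf_simplex \<Rightarrow>\<^sub>0 real) \<Rightarrow> ('m \<Rightarrow> ('m, 'a) form_germ) \<Rightarrow> real" where
  "integral_over_chain M k c \<omega> =
     (\<Sum>\<tau>\<in>Poly_Mapping.keys c. Poly_Mapping.lookup c \<tau> * integral_over_simplex M k \<tau> \<omega>)"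

end

theory Submission
  imports "Jordan_Normal_Form.Determinant" Defs
begin

text \<open>
  Near each point, \<open>\<gamma>\<close> is a sum of generators \<open>a db\<^sub>1 \<and> \<dots> \<and> db\<^sub>m\<close>, on which the exterior derivative is
  \<open>da \<and> db\<^sub>1 \<and> \<dots> \<and> db\<^sub>m\<close>. It commutes with the maps of forms induced by maps of \<open>C\<^sup>\<infinity>\<close>-rings, so that
  only forms on open subsets of the simplex matter. On the constant vector fields
  \<open>X\<^sub>j = e\<^sub>j\<^sub>+\<^sub>1 - e\<^sub>0\<close>, the value of \<open>d\<gamma>\<close> is the alternating sum of the derivatives along \<open>X\<^sub>j\<close> of the
  functions \<open>h\<^sub>j\<close> obtained by evaluating \<open>\<gamma>\<close> on all fields but \<open>X\<^sub>j\<close>. By the fundamental theorem of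
  calculus, the integral of the \<open>j\<close>-th derivative is the difference of the integrals of \<open>h\<^sub>j\<close> over the
  faces \<open>0\<close> and \<open>j + 1\<close>. On the face \<open>j + 1\<close>, \<open>h\<^sub>j\<close> is the pullback of \<open>\<gamma>\<close>; on the face \<open>0\<close>, whose
  edges are the differences \<open>X\<^sub>l\<^sub>+\<^sub>1 - X\<^sub>0\<close>, the pullback is the alternating sum of the \<open>h\<^sub>j\<close>.
\<close>

section \<open>Additive maps, free modules and quotient modules\<close>

text \<open>\<open>ext_deriv\<close> is a definite description, so an exterior derivative has to be
  constructed and shown unique before anything can be computed. The generators
  \<open>a db_1 ... db_m\<close> cannot define it, as the relations between them are not given
  directly. The construction uses the formula that the Leibniz rule forces on
  \<open>c w_1 ... w_m\<close> with arbitrary 1-forms \<open>w_i\<close>, and checks it against the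
  relations of the exterior power and of the Kaehler module. The derivative is only additive and
  evaluations land in the reals; maps out of modules given by generators and relations are therefore
  treated as additive maps and tested on all multiples of generators and relations. On the closed
  simplex a local smooth extension is not unique, so only derivatives along tangent vectors have a
  meaning, and at boundary points they are one-sided. The fields \<open>X_j\<close> are constant, so
  no bracket terms appear in \<open>d\<gamma>\<close>. Since \<open>x_0\<close> is the dependent
  coordinate, integration along \<open>x_j\<close> reaches the face 0 in a chart that depends on
  \<open>j\<close>, and these charts have to be compared.\<close>

lemma (in abelian_group) a_inv_zero: "\<ominus> \<zero> = \<zero>"
  by (rule minus_equality) simp_all

lemma (in abelian_group) a_minus_zero: "x \<in> carrier G \<Longrightarrow> x \<ominus> \<zero> = x"
  by (simp add: a_minus_def a_inv_zero)

lemma (in abelian_group) a_minus_eq_zero_iff: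
  assumes "x \<in> carrier G" "y \<in> carrier G"
  shows "x \<ominus> y = \<zero> \<longleftrightarrow> x = y"
proof
  assume "x \<ominus> y = \<zero>"
  then have "(x \<ominus> y) \<oplus> y = y" using assms by simp
  then show "x = y" using assms by (simp add: a_minus_def a_assoc l_neg)
qed (use assms in \<open>simp add: a_minus_def r_neg\<close>)

text \<open>Additivity alone is recorded, because the maps that have to factor through quotients are
  not linear over the ring: the differential obeys a Leibniz rule, and evaluation at a point has
  values in the reals. The target only needs an addition.\<close>

definition additive_map :: "('b, 'm) ring_scheme \<Rightarrow> ('c, 'n) ring_scheme \<Rightarrow> ('b \<Rightarrow> 'c) \<Rightarrow> bool" where
  "additive_map N P F \<longleftrightarrow>
     F \<in> carrier N \<rightarrow> carrier P \<and>
     (\<forall>u\<in>carrier N. \<forall>v\<in>carrier N. F (u \<oplus>\<^bsub>N\<^esub> v) = F u \<oplus>\<^bsub>P\<^esub> F v)"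

lemma additive_mapI:
  assumes "\<And>u. u \<in> carrier N \<Longrightarrow> F u \<in> carrier P"
    and "\<And>u v. u \<in> carrier N \<Longrightarrow> v \<in> carrier N \<Longrightarrow> F (u \<oplus>\<^bsub>N\<^esub> v) = F u \<oplus>\<^bsub>P\<^esub> F v"
  shows "additive_map N P F"
  using assms by (auto simp: additive_map_def)

lemma additive_map_closed: "additive_map N P F \<Longrightarrow> u \<in> carrier N \<Longrightarrow> F u \<in> carrier P"
  by (auto simp: additive_map_def)

lemma additive_map_add:
  "additive_map N P F \<Longrightarrow> u \<in> carrier N \<Longrightarrow> v \<in> carrier N \<Longrightarrow> F (u \<oplus>\<^bsub>N\<^esub> v) = F u \<oplus>\<^bsub>P\<^esub> F v"
  by (auto simp: additive_map_def)

locale additive_pair = N: abelian_group N + P: abelian_group P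
  for N :: "('b, 'm) ring_scheme" and P :: "('c, 'n) ring_scheme" +
  fixes F
  assumes additive: "additive_map N P F"
begin

lemma closed [simp]: "u \<in> carrier N \<Longrightarrow> F u \<in> carrier P"
  using additive by (auto simp: additive_map_def)

lemma add [simp]: "u \<in> carrier N \<Longrightarrow> v \<in> carrier N \<Longrightarrow> F (u \<oplus>\<^bsub>N\<^esub> v) = F u \<oplus>\<^bsub>P\<^esub> F v"
  using additive by (auto simp: additive_map_def)

lemma zero [simp]: "F \<zero>\<^bsub>N\<^esub> = \<zero>\<^bsub>P\<^esub>"
proof -
  have "F \<zero>\<^bsub>N\<^esub> \<oplus>\<^bsub>P\<^esub> F \<zero>\<^bsub>N\<^esub> = F \<zero>\<^bsub>N\<^esub> \<oplus>\<^bsub>P\<^esub> \<zero>\<^bsub>P\<^esub>"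
    by (simp flip: add)
  then show ?thesis
    using N.zero_closed P.zero_closed closed P.add.right_cancel P.add.m_comm by metis
qed

lemma uminus [simp]: "u \<in> carrier N \<Longrightarrow> F (\<ominus>\<^bsub>N\<^esub> u) = \<ominus>\<^bsub>P\<^esub> F u"
  by (metis N.a_inv_closed N.l_neg P.minus_equality closed add zero)

lemma diff [simp]: "u \<in> carrier N \<Longrightarrow> v \<in> carrier N \<Longrightarrow> F (u \<ominus>\<^bsub>N\<^esub> v) = F u \<ominus>\<^bsub>P\<^esub> F v"
  by (simp add: a_minus_def)

lemma finsum: "f \<in> A \<rightarrow> carrier N \<Longrightarrow> F (finsum N f A) = finsum P (\<lambda>x. F (f x)) A"
proof (induction A rule: infinite_finite_induct)
  case (insert a A)
  then show ?case by (simp add: Pi_iff)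
qed auto

end

lemma additive_map_comp:
  "additive_map N P F \<Longrightarrow> additive_map P Q G \<Longrightarrow> additive_map N Q (\<lambda>x. G (F x))"
  by (auto simp: additive_map_def Pi_iff)

lemma additive_map_plus:
  assumes "abelian_group P" "additive_map N P F" "additive_map N P G"
  shows "additive_map N P (\<lambda>x. F x \<oplus>\<^bsub>P\<^esub> G x)"
proof -
  interpret abelian_group P by fact
  show ?thesis
    using assms by (auto simp: additive_map_def Pi_iff a_ac)
qed

lemma additive_map_finsum:
  assumes "abelian_group P" "\<And>i. i \<in> I \<Longrightarrow> additive_map N P (F i)"
  shows "additive_map N P (\<lambda>x. finsum P (\<lambda>i. F i x) I)"
proof -
  interpret abelian_group P by fact
  show ?thesis
  proof (rule additive_mapI)
    fix u v assume uv: "u \<in> carrier N" "v \<in> carrier N"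
    have "finsum P (\<lambda>i. F i (u \<oplus>\<^bsub>N\<^esub> v)) I = finsum P (\<lambda>i. F i u \<oplus>\<^bsub>P\<^esub> F i v) I"
      by (rule finsum_cong') (use assms(2) uv in \<open>auto simp: additive_map_def Pi_iff\<close>)
    also have "\<dots> = finsum P (\<lambda>i. F i u) I \<oplus>\<^bsub>P\<^esub> finsum P (\<lambda>i. F i v) I"
      by (rule finsum_addf) (use assms(2) uv in \<open>auto simp: additive_map_def Pi_iff\<close>)
    finally show "finsum P (\<lambda>i. F i (u \<oplus>\<^bsub>N\<^esub> v)) I = finsum P (\<lambda>i. F i u) I \<oplus>\<^bsub>P\<^esub> finsum P (\<lambda>i. F i v) I" .
  qed (use assms(2) in \<open>auto simp: additive_map_def Pi_iff intro!: finsum_closed\<close>)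
qed

text \<open>Linear extension from a basis, weakened: \<open>g x\<close> is an additive function of
  the whole coefficient at \<open>x\<close>, not a vector scaled by it. The differential needs this,
  since a coefficient enters it through its own differential.\<close>

definition lin_ext ::
  "('c, 'n) ring_scheme \<Rightarrow> 'a ring \<Rightarrow> 'x set \<Rightarrow> ('x \<Rightarrow> 'a \<Rightarrow> 'c) \<Rightarrow> ('x \<Rightarrow> 'a) \<Rightarrow> 'c" where
  "lin_ext P R X g v = finsum P (\<lambda>x. g x (v x)) {x \<in> X. v x \<noteq> \<zero>\<^bsub>R\<^esub>}"

section \<open>Free modules and additive maps out of them\<close>

locale base_ring = cring R for R :: "'a ring" (structure)
begin

lemma free_carrier:
  "v \<in> carrier (free_module R X) \<longleftrightarrow> v \<in> X \<rightarrow>\<^sub>E carrier R \<and> finite {x \<in> X. v x \<noteq> \<zero>}"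
  by (simp add: free_module_def)

lemma free_zero: "\<zero>\<^bsub>free_module R X\<^esub> = (\<lambda>x\<in>X. \<zero>)"
  by (simp add: free_module_def)

lemma free_add: "v \<oplus>\<^bsub>free_module R X\<^esub> w = (\<lambda>x\<in>X. v x \<oplus> w x)"
  by (simp add: free_module_def)

lemma free_smult: "c \<odot>\<^bsub>free_module R X\<^esub> v = (\<lambda>x\<in>X. c \<otimes> v x)"
  by (simp add: free_module_def)

lemma free_add_closed:
  assumes "v \<in> carrier (free_module R X)" "w \<in> carrier (free_module R X)"
  shows "v \<oplus>\<^bsub>free_module R X\<^esub> w \<in> carrier (free_module R X)"
proof -
  have "finite {x \<in> X. (v \<oplus>\<^bsub>free_module R X\<^esub> w) x \<noteq> \<zero>}"
    by (rule finite_subset[of _ "{x \<in> X. v x \<noteq> \<zero>} \<union> {x \<in> X. w x \<noteq> \<zero>}"])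
       (use assms in \<open>auto simp: free_carrier free_add\<close>)
  then show ?thesis
    using assms unfolding free_carrier by (auto simp: free_add PiE_iff)
qed

lemma free_smult_closed:
  assumes "v \<in> carrier (free_module R X)" "c \<in> carrier R"
  shows "c \<odot>\<^bsub>free_module R X\<^esub> v \<in> carrier (free_module R X)"
proof -
  have "finite {x \<in> X. (c \<odot>\<^bsub>free_module R X\<^esub> v) x \<noteq> \<zero>}"
    by (rule finite_subset[of _ "{x \<in> X. v x \<noteq> \<zero>}"])
       (use assms in \<open>auto simp: free_carrier free_smult\<close>)
  then show ?thesis
    using assms unfolding free_carrier by (auto simp: free_smult PiE_iff)
qed

lemma free_abelian_group: "abelian_group (free_module R X)"
proof (rule abelian_groupI)
  fix v w u assume *: "v \<in> carrier (free_module R X)" "w \<in> carrier (free_module R X)" "u \<in> carrier (free_module R X)"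
  show "v \<oplus>\<^bsub>free_module R X\<^esub> w \<oplus>\<^bsub>free_module R X\<^esub> u = v \<oplus>\<^bsub>free_module R X\<^esub> (w \<oplus>\<^bsub>free_module R X\<^esub> u)"
    using * by (auto simp: free_carrier free_add PiE_iff fun_eq_iff a_assoc)
next
  fix v w assume *: "v \<in> carrier (free_module R X)" "w \<in> carrier (free_module R X)"
  show "v \<oplus>\<^bsub>free_module R X\<^esub> w = w \<oplus>\<^bsub>free_module R X\<^esub> v"
    using * by (auto simp: free_carrier free_add PiE_iff fun_eq_iff a_comm)
next
  fix v assume v: "v \<in> carrier (free_module R X)"
  show "\<zero>\<^bsub>free_module R X\<^esub> \<oplus>\<^bsub>free_module R X\<^esub> v = v"
    using v by (fastforce simp: free_carrier free_add free_zero PiE_iff fun_eq_iff extensional_def)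
  have "(\<ominus> \<one>) \<odot>\<^bsub>free_module R X\<^esub> v \<oplus>\<^bsub>free_module R X\<^esub> v = \<zero>\<^bsub>free_module R X\<^esub>"
    using v by (auto simp: free_carrier free_add free_zero free_smult PiE_iff fun_eq_iff l_minus l_neg)
  moreover have "(\<ominus> \<one>) \<odot>\<^bsub>free_module R X\<^esub> v \<in> carrier (free_module R X)"
    using v by (intro free_smult_closed) auto
  ultimately show "\<exists>w\<in>carrier (free_module R X). w \<oplus>\<^bsub>free_module R X\<^esub> v = \<zero>\<^bsub>free_module R X\<^esub>"
    by blast
qed (auto simp: free_add_closed, auto simp: free_carrier free_zero)

lemma free_module: "module R (free_module R X)"
proof (rule moduleI)
  show "cring R" ..
  show "abelian_group (free_module R X)"
    by (rule free_abelian_group)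
qed (auto simp: free_smult_closed,
     auto simp: free_carrier free_add free_smult PiE_iff fun_eq_iff l_distr r_distr m_assoc extensional_def)

lemma basis_vec_carrier: "x \<in> X \<Longrightarrow> basis_vec R X x \<in> carrier (free_module R X)"
  by (auto simp: free_carrier basis_vec_def)

lemma smult_basis_vec:
  "c \<in> carrier R \<Longrightarrow> c \<odot>\<^bsub>free_module R X\<^esub> basis_vec R X x = (\<lambda>y\<in>X. if y = x then c else \<zero>)"
  by (auto simp: free_smult basis_vec_def)

lemma free_induct [consumes 1, case_names zero add]:
  assumes v: "v \<in> carrier (free_module R X)"
    and zero: "Q \<zero>\<^bsub>free_module R X\<^esub>"
    and add: "\<And>v c x. v \<in> carrier (free_module R X) \<Longrightarrow> c \<in> carrier R \<Longrightarrow> x \<in> X \<Longrightarrow> Q v \<Longrightarrow>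
               Q (v \<oplus>\<^bsub>free_module R X\<^esub> c \<odot>\<^bsub>free_module R X\<^esub> basis_vec R X x)"
  shows "Q v"
proof -
  have "finite A \<Longrightarrow> A \<subseteq> X \<Longrightarrow> v \<in> carrier (free_module R X) \<Longrightarrow> {x \<in> X. v x \<noteq> \<zero>} = A \<Longrightarrow> Q v" for A
  proof (induction A arbitrary: v rule: finite_induct)
    case empty
    then have "v = \<zero>\<^bsub>free_module R X\<^esub>"
      by (auto simp: free_carrier free_zero PiE_iff fun_eq_iff extensional_def)
    then show ?case using zero by simp
  next
    case (insert a A)
    \<comment> \<open>Deleting the coordinate \<open>a\<close> shrinks the support, and the deleted
      part is a single multiple of a basis vector.\<close>
    define w where "w = (\<lambda>x\<in>X. if x = a then \<zero> else v x)"
    have w: "{x \<in> X. w x \<noteq> \<zero>} = A"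
      using insert by (auto simp: w_def split: if_splits)
    have vX: "v \<in> X \<rightarrow>\<^sub>E carrier R"
      using insert.prems by (simp add: free_carrier)
    have w': "w \<in> carrier (free_module R X)"
      unfolding free_carrier w using insert.hyps vX by (auto simp: w_def PiE_iff)
    have a: "a \<in> X" "v a \<in> carrier R"
      using insert vX by auto
    have "v = w \<oplus>\<^bsub>free_module R X\<^esub> v a \<odot>\<^bsub>free_module R X\<^esub> basis_vec R X a"
    proof
      fix x show "v x = (w \<oplus>\<^bsub>free_module R X\<^esub> v a \<odot>\<^bsub>free_module R X\<^esub> basis_vec R X a) x"
        using vX a by (cases "x \<in> X") (auto simp: free_add smult_basis_vec w_def PiE_iff extensional_def)
    qed
    moreover have "Q (w \<oplus>\<^bsub>free_module R X\<^esub> v a \<odot>\<^bsub>free_module R X\<^esub> basis_vec R X a)"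
      by (rule add) (use insert w w' a in auto)
    ultimately show ?case by simp
  qed
  then show ?thesis
    using v by (auto simp: free_carrier)
qed

text \<open>The sum in \<open>lin_ext\<close> runs over the support of its argument. Two vectors and
  their sum have different supports, so additivity is read off on one finite set that contains them
  all.\<close>

lemma lin_ext_superset:
  assumes "abelian_group P" "\<And>x. x \<in> X \<Longrightarrow> additive_map R P (g x)"
    and "v \<in> carrier (free_module R X)" "finite A" "A \<subseteq> X" "{x \<in> X. v x \<noteq> \<zero>} \<subseteq> A"
  shows "lin_ext P R X g v = finsum P (\<lambda>x. g x (v x)) A"
proof -
  interpret P: abelian_group P by fact
  have g0: "g x \<zero> = \<zero>\<^bsub>P\<^esub>" if "x \<in> X" for x
  proof -
    interpret additive_pair R P "g x"
      by (intro additive_pair.intro additive_pair_axioms.intro) (use that assms abelian_group_axioms in auto)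
    show ?thesis by simp
  qed
  have "v x \<in> carrier R" if "x \<in> A" for x
    using assms that by (auto simp: free_carrier)
  then have g: "(\<lambda>x. g x (v x)) \<in> A \<rightarrow> carrier P"
    using assms by (auto simp: additive_map_def Pi_iff)
  show ?thesis
    unfolding lin_ext_def
    by (rule P.add.finprod_mono_neutral_cong_left) (use assms g g0 in auto)
qed

lemma lin_ext_additive:
  assumes P: "abelian_group P" and g: "\<And>x. x \<in> X \<Longrightarrow> additive_map R P (g x)"
  shows "additive_map (free_module R X) P (lin_ext P R X g)"
proof (rule additive_mapI)
  interpret P: abelian_group P by fact
  have gc: "g x (v x) \<in> carrier P" if "v \<in> carrier (free_module R X)" "x \<in> X" for v x
    using that g by (auto simp: additive_map_def Pi_iff PiE_iff free_carrier)
  fix u assume u: "u \<in> carrier (free_module R X)"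
  show "lin_ext P R X g u \<in> carrier P"
    using gc[OF u] by (auto simp: lin_ext_def intro!: P.finsum_closed)
  fix v assume v: "v \<in> carrier (free_module R X)"
  define A where "A = {x \<in> X. u x \<noteq> \<zero>} \<union> {x \<in> X. v x \<noteq> \<zero>}"
  have A: "finite A" "A \<subseteq> X"
    using u v by (auto simp: free_carrier A_def)
  have uv: "u \<oplus>\<^bsub>free_module R X\<^esub> v \<in> carrier (free_module R X)"
    using u v by (rule free_add_closed)
  have ss: "{x \<in> X. (u \<oplus>\<^bsub>free_module R X\<^esub> v) x \<noteq> \<zero>} \<subseteq> A"
    by (auto simp: A_def free_add)
  have "lin_ext P R X g (u \<oplus>\<^bsub>free_module R X\<^esub> v) = finsum P (\<lambda>x. g x ((u \<oplus>\<^bsub>free_module R X\<^esub> v) x)) A"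
    by (rule lin_ext_superset[OF P g uv A ss])
  also have "\<dots> = finsum P (\<lambda>x. g x (u x) \<oplus>\<^bsub>P\<^esub> g x (v x)) A"
  proof (rule P.finsum_cong')
    fix x assume "x \<in> A"
    then have "x \<in> X" using A by auto
    then show "g x ((u \<oplus>\<^bsub>free_module R X\<^esub> v) x) = g x (u x) \<oplus>\<^bsub>P\<^esub> g x (v x)"
      using u v g[of x] by (auto simp: free_add additive_map_def free_carrier PiE_iff)
  qed (use A gc u v in auto)
  also have "\<dots> = finsum P (\<lambda>x. g x (u x)) A \<oplus>\<^bsub>P\<^esub> finsum P (\<lambda>x. g x (v x)) A"
    by (rule P.finsum_addf) (use A gc u v in auto)
  also have "finsum P (\<lambda>x. g x (u x)) A = lin_ext P R X g u"
    by (rule lin_ext_superset[OF P g u A, symmetric]) (auto simp: A_def)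
  also have "finsum P (\<lambda>x. g x (v x)) A = lin_ext P R X g v"
    by (rule lin_ext_superset[OF P g v A, symmetric]) (auto simp: A_def)
  finally show "lin_ext P R X g (u \<oplus>\<^bsub>free_module R X\<^esub> v) = lin_ext P R X g u \<oplus>\<^bsub>P\<^esub> lin_ext P R X g v" .
qed

lemma lin_ext_basis:
  assumes P: "abelian_group P" and g: "\<And>x. x \<in> X \<Longrightarrow> additive_map R P (g x)"
    and "x \<in> X" "c \<in> carrier R"
  shows "lin_ext P R X g (c \<odot>\<^bsub>free_module R X\<^esub> basis_vec R X x) = g x c"
proof -
  interpret P: abelian_group P by fact
  have c: "c \<odot>\<^bsub>free_module R X\<^esub> basis_vec R X x \<in> carrier (free_module R X)"
    using assms by (intro free_smult_closed basis_vec_carrier)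
  have "lin_ext P R X g (c \<odot>\<^bsub>free_module R X\<^esub> basis_vec R X x)
      = finsum P (\<lambda>y. g y ((c \<odot>\<^bsub>free_module R X\<^esub> basis_vec R X x) y)) {x}"
    by (rule lin_ext_superset[OF P g c])
       (use assms in \<open>auto simp: smult_basis_vec split: if_splits\<close>)
  also have "\<dots> = g x c"
    using assms g[of x] by (simp add: smult_basis_vec additive_map_def Pi_iff)
  finally show ?thesis .
qed

text \<open>For additive maps, agreement on the basis vectors would not suffice; agreement on all
  their multiples does.\<close>

lemma additive_free_eqI:
  assumes P: "abelian_group P"
    and F: "additive_map (free_module R X) P F" and G: "additive_map (free_module R X) P G"
    and eq: "\<And>x c. x \<in> X \<Longrightarrow> c \<in> carrier R \<Longrightarrow>
              F (c \<odot>\<^bsub>free_module R X\<^esub> basis_vec R X x) = G (c \<odot>\<^bsub>free_module R X\<^esub> basis_vec R X x)"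
    and v: "v \<in> carrier (free_module R X)"
  shows "F v = G v"
proof -
  interpret F: additive_pair "free_module R X" P F
    by (intro additive_pair.intro additive_pair_axioms.intro free_abelian_group P F)
  interpret G: additive_pair "free_module R X" P G
    by (intro additive_pair.intro additive_pair_axioms.intro free_abelian_group P G)
  from v show ?thesis
    by (induction rule: free_induct) (simp_all add: free_smult_closed basis_vec_carrier eq)
qed

section \<open>Submodules spanned by relations\<close>

lemma span_submodule:
  assumes N: "module R N" and S: "S \<subseteq> carrier N"
  shows "submodule (submodule_span R N S) R N"
proof -
  interpret module R N by fact
  have "submodule (carrier N) R N" by (rule carrier_is_submodule)
  then show ?thesis
    unfolding submodule_span_def using S
    by (intro submoduleI)
       (auto dest: submoduleE(1-4) subgroup.one_closed[OF submodule.axioms(1)] intro!: submoduleE(5))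
qed

lemma span_incl: "S \<subseteq> submodule_span R N S"
  by (auto simp: submodule_span_def)

text \<open>The kernel of an additive map need not be a submodule. The vectors all of whose
  multiples are killed do form one, \<open>H\<close>, so it suffices that every multiple of every
  relation is killed.\<close>

lemma additive_kills_span:
  assumes N: "module R N" and P: "abelian_group P" and F: "additive_map N P F"
    and S: "S \<subseteq> carrier N"
    and kill: "\<And>c s. c \<in> carrier R \<Longrightarrow> s \<in> S \<Longrightarrow> F (c \<odot>\<^bsub>N\<^esub> s) = \<zero>\<^bsub>P\<^esub>"
    and v: "v \<in> submodule_span R N S"
  shows "F v = \<zero>\<^bsub>P\<^esub>"
proof -
  interpret N: module R N by fact
  interpret additive_pair N P F
    by (intro additive_pair.intro additive_pair_axioms.intro N.abelian_group_axioms P F)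
  define H where "H = {v \<in> carrier N. \<forall>c\<in>carrier R. F (c \<odot>\<^bsub>N\<^esub> v) = \<zero>\<^bsub>P\<^esub>}"
  have "submodule H R N"
  proof (rule N.submoduleI)
    show "\<ominus>\<^bsub>N\<^esub> a \<in> H" if "a \<in> H" for a
      using that by (auto simp: H_def N.smult_r_minus)
    show "c \<odot>\<^bsub>N\<^esub> x \<in> H" if "c \<in> carrier R" "x \<in> H" for c x
      using that by (auto simp: H_def simp flip: N.smult_assoc1)
  qed (auto simp: H_def N.smult_r_distr)
  moreover have "S \<subseteq> H"
    using S kill by (auto simp: H_def)
  ultimately have "v \<in> H"
    using v by (auto simp: submodule_span_def)
  then show ?thesis
    unfolding H_def using N.smult_one[of v] by force
qed

end

section \<open>Quotient modules\<close>

locale module_quotient = N: module R N for R :: "'a ring" and N :: "('a, 'n) module" +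
  fixes H
  assumes submodule: "submodule H R N"
begin

abbreviation "Q \<equiv> quotient_module N H"
abbreviation "cls v \<equiv> H +>\<^bsub>N\<^esub> v"

sublocale H: abelian_subgroup H N
  by (rule abelian_subgroupI3)
     (use submodule in \<open>auto simp: submodule_def intro: additive_subgroupI N.abelian_group_axioms\<close>)

lemma Q_carrier: "carrier Q = cls ` carrier N"
  by (auto simp: quotient_module_def A_RCOSETS_def')

lemma cls_carrier [simp]: "v \<in> carrier N \<Longrightarrow> cls v \<in> carrier Q"
  by (auto simp: Q_carrier)

lemma cls_subset: "v \<in> carrier N \<Longrightarrow> cls v \<subseteq> carrier N"
  by (simp add: N.a_r_coset_subset_G H.a_subset)

lemma cls_add: "u \<in> carrier N \<Longrightarrow> v \<in> carrier N \<Longrightarrow> cls (u \<oplus>\<^bsub>N\<^esub> v) = cls u \<oplus>\<^bsub>Q\<^esub> cls v"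
  by (simp add: quotient_module_def H.a_rcos_sum)

lemma cls_self: "v \<in> carrier N \<Longrightarrow> v \<in> cls v"
  by (rule H.a_rcos_self)

lemma cls_eq_of_mem: "u \<in> cls v \<Longrightarrow> v \<in> carrier N \<Longrightarrow> cls u = cls v"
  by (metis H.a_repr_independence')

lemma cls_mem_iff: "u \<in> carrier N \<Longrightarrow> v \<in> carrier N \<Longrightarrow> u \<in> cls v \<longleftrightarrow> u \<ominus>\<^bsub>N\<^esub> v \<in> H"
  by (simp add: H.a_rcos_module a_minus_def)

lemma cls_eq_iff: "u \<in> carrier N \<Longrightarrow> v \<in> carrier N \<Longrightarrow> cls u = cls v \<longleftrightarrow> u \<ominus>\<^bsub>N\<^esub> v \<in> H"
  by (metis cls_eq_of_mem cls_mem_iff cls_self)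

lemma Q_zero: "\<zero>\<^bsub>Q\<^esub> = H"
  by (simp add: quotient_module_def)

lemma cls_zero: "cls \<zero>\<^bsub>N\<^esub> = \<zero>\<^bsub>Q\<^esub>"
  by (simp add: Q_zero H.a_subset)

lemma cls_zero_iff: "u \<in> carrier N \<Longrightarrow> cls u = \<zero>\<^bsub>Q\<^esub> \<longleftrightarrow> u \<in> H"
  using cls_eq_iff[of u "\<zero>\<^bsub>N\<^esub>"] by (simp add: cls_zero N.a_minus_zero)

lemma UN_cls:
  assumes "v \<in> carrier N" "\<And>u. u \<in> cls v \<Longrightarrow> f u = f v"
  shows "(\<Union>u\<in>cls v. f u) = f v"
  using assms cls_self by blast

lemma cls_smult: 
  assumes "c \<in> carrier R" "v \<in> carrier N"
  shows "cls (c \<odot>\<^bsub>N\<^esub> v) = c \<odot>\<^bsub>Q\<^esub> cls v"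
proof -
  have "(\<Union>u\<in>cls v. cls (c \<odot>\<^bsub>N\<^esub> u)) = cls (c \<odot>\<^bsub>N\<^esub> v)"
  proof (rule UN_cls)
    fix u assume u: "u \<in> cls v"
    then have u': "u \<in> carrier N" using cls_subset assms by auto
    have "u \<ominus>\<^bsub>N\<^esub> v \<in> H" using u u' assms by (simp add: cls_mem_iff)
    then have "c \<odot>\<^bsub>N\<^esub> (u \<ominus>\<^bsub>N\<^esub> v) \<in> H"
      using assms submodule by (simp add: submodule.smult_closed)
    also have "c \<odot>\<^bsub>N\<^esub> (u \<ominus>\<^bsub>N\<^esub> v) = c \<odot>\<^bsub>N\<^esub> u \<ominus>\<^bsub>N\<^esub> c \<odot>\<^bsub>N\<^esub> v"
      using assms u' by (simp add: a_minus_def N.smult_r_distr N.smult_r_minus)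
    finally show "cls (c \<odot>\<^bsub>N\<^esub> u) = cls (c \<odot>\<^bsub>N\<^esub> v)"
      using assms u' by (simp add: cls_eq_iff)
  qed (use assms in auto)
  then show ?thesis
    by (simp add: quotient_module_def)
qed

lemma Q_abelian_group: "abelian_group Q"
proof (rule abelian_groupI)
  show "\<zero>\<^bsub>Q\<^esub> \<in> carrier Q"
    unfolding cls_zero[symmetric] by (rule cls_carrier) simp
  fix x assume x: "x \<in> carrier Q"
  then obtain u where u: "u \<in> carrier N" "x = cls u" by (auto simp: Q_carrier)
  show "\<zero>\<^bsub>Q\<^esub> \<oplus>\<^bsub>Q\<^esub> x = x"
    using u by (simp flip: cls_zero cls_add)
  show "\<exists>y\<in>carrier Q. y \<oplus>\<^bsub>Q\<^esub> x = \<zero>\<^bsub>Q\<^esub>"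
    using u by (intro bexI[of _ "cls (\<ominus>\<^bsub>N\<^esub> u)"]) (simp_all flip: cls_zero cls_add add: N.l_neg)
qed (auto simp: Q_carrier simp flip: cls_add intro!: arg_cong[where f = cls], auto simp: N.a_ac)

lemma Q_module: "module R Q"
proof (rule moduleI)
  show "abelian_group Q" by (rule Q_abelian_group)
  show "cring R" by (rule N.R.cring_axioms)
qed (auto simp: Q_carrier N.smult_l_distr N.smult_r_distr N.smult_assoc1 simp flip: cls_smult cls_add)

lemma cls_additive: "additive_map N Q cls"
  by (rule additive_mapI) (auto simp: cls_add)

text \<open>The form in which maps descend to a quotient: the value is the same at every
  representative. This collapses the unions over representatives, and the sets of values under
  \<open>the_elem\<close>, by which maps out of quotients are defined.\<close>

lemma additive_const_on_cls:
  assumes P: "abelian_group P" and F: "additive_map N P F" and kill: "\<And>h. h \<in> H \<Longrightarrow> F h = \<zero>\<^bsub>P\<^esub>"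
    and "v \<in> carrier N" "u \<in> cls v"
  shows "F u = F v"
proof -
  interpret P: abelian_group P by fact
  interpret additive_pair N P F
    by (intro additive_pair.intro additive_pair_axioms.intro N.abelian_group_axioms P F)
  have u: "u \<in> carrier N" using cls_subset assms by auto
  have "F (u \<ominus>\<^bsub>N\<^esub> v) = \<zero>\<^bsub>P\<^esub>" using kill assms u by (simp flip: cls_mem_iff)
  then show ?thesis using u assms by (simp add: P.a_minus_eq_zero_iff)
qed

end

section \<open>Exterior powers\<close>

lemma tuples_update: "ws \<in> tuples k A \<Longrightarrow> u \<in> A \<Longrightarrow> ws[i := u] \<in> tuples k A"
  using set_update_subset_insert[of ws i u] by (auto simp: tuples_def)

lemma tuples_nth: "ws \<in> tuples k A \<Longrightarrow> i < k \<Longrightarrow> ws ! i \<in> A"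
  by (auto simp: tuples_def)

lemma tuples_length: "ws \<in> tuples k A \<Longrightarrow> length ws = k"
  by (auto simp: tuples_def)

lemma tuples_append: "ws \<in> tuples p A \<Longrightarrow> ws' \<in> tuples q A \<Longrightarrow> ws @ ws' \<in> tuples (p + q) A"
  by (auto simp: tuples_def)

lemma tuples_Cons: "w # ws \<in> tuples (Suc k) A \<longleftrightarrow> w \<in> A \<and> ws \<in> tuples k A"
  by (auto simp: tuples_def)

lemma tuples_0: "ws \<in> tuples 0 A \<longleftrightarrow> ws = []"
  by (auto simp: tuples_def)

lemma tuples_take: "ws \<in> tuples (p + q) A \<Longrightarrow> take p ws \<in> tuples p A"
  by (auto simp: tuples_def dest: in_set_takeD)

lemma tuples_drop: "ws \<in> tuples (p + q) A \<Longrightarrow> drop p ws \<in> tuples q A"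
  by (auto simp: tuples_def dest: in_set_dropD)

lemma tuples_map: "ws \<in> tuples k A \<Longrightarrow> (\<And>x. x \<in> A \<Longrightarrow> f x \<in> B) \<Longrightarrow> map f ws \<in> tuples k B"
  by (auto simp: tuples_def)

text \<open>Generation is encoded as the induction principle that it provides: every element is
  reached from zero by adding multiples of members of \<open>G\<close>. Finite linear combinations
  never have to be written down.\<close>

definition generates :: "'a ring \<Rightarrow> ('a, 'n) module \<Rightarrow> 'n set \<Rightarrow> bool" where
  "generates R N G \<longleftrightarrow> G \<subseteq> carrier N \<and>
     (\<forall>P. P \<zero>\<^bsub>N\<^esub> \<longrightarrow>
       (\<forall>w\<in>carrier N. \<forall>a\<in>carrier R. \<forall>g\<in>G. P w \<longrightarrow> P (w \<oplus>\<^bsub>N\<^esub> a \<odot>\<^bsub>N\<^esub> g)) \<longrightarrow> (\<forall>w\<in>carrier N. P w))"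

locale ext_algebra = N: module R N for R :: "'a ring" and N :: "('a, 'n) module"
begin

sublocale base_ring R
  by (rule base_ring.intro) (rule N.R.cring_axioms)

abbreviation "ebasis k ws \<equiv> basis_vec R (tuples k (carrier N)) ws"
abbreviation "simple k c ws \<equiv> c \<odot>\<^bsub>ext_free R N k\<^esub> ebasis k ws"

lemma ext_free_module: "module R (ext_free R N k)"
  unfolding ext_free_def by (rule free_module)

lemma ext_free_abelian_group: "abelian_group (ext_free R N k)"
  unfolding ext_free_def by (rule free_abelian_group)

lemma ebasis_closed: "ws \<in> tuples k (carrier N) \<Longrightarrow> ebasis k ws \<in> carrier (ext_free R N k)"
  unfolding ext_free_def by (rule basis_vec_carrier)

lemma simple_closed:
  "ws \<in> tuples k (carrier N) \<Longrightarrow> c \<in> carrier R \<Longrightarrow> simple k c ws \<in> carrier (ext_free R N k)"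
  unfolding ext_free_def by (intro free_smult_closed basis_vec_carrier)

lemma ext_rels_carrier: "ext_rels R N k \<subseteq> carrier (ext_free R N k)"
proof -
  interpret F: module R "ext_free R N k" by (rule ext_free_module)
  show ?thesis
    unfolding ext_rels_def Let_def
    by (auto intro!: F.minus_closed F.M.minus_closed F.M.a_closed ebasis_closed F.smult_closed tuples_update)
qed

lemma ext_quotient: "module_quotient R (ext_free R N k) (ext_span R N k)"
  by (intro module_quotient.intro module_quotient_axioms.intro ext_free_module)
     (simp add: ext_span_def span_submodule ext_free_module ext_rels_carrier)

lemma ext_power_eq: "ext_power R N k = quotient_module (ext_free R N k) (ext_span R N k)"
  by (simp add: ext_power_def)

lemma ext_power_abelian_group: "abelian_group (ext_power R N k)"
  unfolding ext_power_eq by (rule module_quotient.Q_abelian_group[OF ext_quotient])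

lemma ext_class_additive: "additive_map (ext_free R N k) (ext_power R N k) (ext_class R N k)"
proof -
  have "ext_class R N k = (+>\<^bsub>ext_free R N k\<^esub>) (ext_span R N k)"
    by (simp add: fun_eq_iff ext_class_def)
  then show ?thesis
    using module_quotient.cls_additive[OF ext_quotient, of k] by (simp add: ext_power_eq)
qed

lemma ext_class_pair: "additive_pair (ext_free R N k) (ext_power R N k) (ext_class R N k)"
  by (intro additive_pair.intro additive_pair_axioms.intro ext_free_abelian_group
      ext_power_abelian_group ext_class_additive)

lemma ext_class_zero_iff:
  "v \<in> carrier (ext_free R N k) \<Longrightarrow> ext_class R N k v = \<zero>\<^bsub>ext_power R N k\<^esub> \<longleftrightarrow> v \<in> ext_span R N k"
  using module_quotient.cls_zero_iff[OF ext_quotient, of v k] by (simp add: ext_power_eq ext_class_def)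

lemma ext_power_cases:
  assumes "\<alpha> \<in> carrier (ext_power R N k)"
  obtains v where "v \<in> carrier (ext_free R N k)" "\<alpha> = ext_class R N k v"
  using assms module_quotient.Q_carrier[OF ext_quotient, of k] by (auto simp: ext_power_eq ext_class_def)

lemma ext_class_subset:
  "v \<in> carrier (ext_free R N k) \<Longrightarrow> u \<in> ext_class R N k v \<Longrightarrow> u \<in> carrier (ext_free R N k)"
  using module_quotient.cls_subset[OF ext_quotient, of v k] by (auto simp: ext_class_def)

lemma ext_class_self: "v \<in> carrier (ext_free R N k) \<Longrightarrow> v \<in> ext_class R N k v"
  using module_quotient.cls_self[OF ext_quotient, of v k] by (auto simp: ext_class_def)

text \<open>The three hypotheses are the three families of relations of the exterior power, each
  multiplied by an arbitrary coefficient \<open>c\<close>, as an additive map requires. In the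
  second family the scalar \<open>a\<close> is moved into that coefficient.\<close>

lemma additive_kills_ext_span:
  assumes P: "abelian_group P" and F: "additive_map (ext_free R N k) P F"
    and slot_add: "\<And>c ws i u v. c \<in> carrier R \<Longrightarrow> ws \<in> tuples k (carrier N) \<Longrightarrow> i < k \<Longrightarrow>
          u \<in> carrier N \<Longrightarrow> v \<in> carrier N \<Longrightarrow>
          F (simple k c (ws[i := u \<oplus>\<^bsub>N\<^esub> v])) = F (simple k c (ws[i := u])) \<oplus>\<^bsub>P\<^esub> F (simple k c (ws[i := v]))"
    and slot_smult: "\<And>c ws i a u. c \<in> carrier R \<Longrightarrow> ws \<in> tuples k (carrier N) \<Longrightarrow> i < k \<Longrightarrow>
          a \<in> carrier R \<Longrightarrow> u \<in> carrier N \<Longrightarrow>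
          F (simple k c (ws[i := a \<odot>\<^bsub>N\<^esub> u])) = F (simple k (c \<otimes>\<^bsub>R\<^esub> a) (ws[i := u]))"
    and alt: "\<And>c ws i j. c \<in> carrier R \<Longrightarrow> ws \<in> tuples k (carrier N) \<Longrightarrow> i < j \<Longrightarrow> j < k \<Longrightarrow>
          ws ! i = ws ! j \<Longrightarrow> F (simple k c ws) = \<zero>\<^bsub>P\<^esub>"
    and v: "v \<in> ext_span R N k"
  shows "F v = \<zero>\<^bsub>P\<^esub>"
proof -
  interpret P: abelian_group P by fact
  interpret FN: module R "ext_free R N k" by (rule ext_free_module)
  interpret additive_pair "ext_free R N k" P F
    by (intro additive_pair.intro additive_pair_axioms.intro ext_free_abelian_group P F)
  have smult_diff: "c \<odot>\<^bsub>ext_free R N k\<^esub> (x \<ominus>\<^bsub>ext_free R N k\<^esub> y) =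
      c \<odot>\<^bsub>ext_free R N k\<^esub> x \<ominus>\<^bsub>ext_free R N k\<^esub> c \<odot>\<^bsub>ext_free R N k\<^esub> y"
    if "c \<in> carrier R" "x \<in> carrier (ext_free R N k)" "y \<in> carrier (ext_free R N k)" for c x y
    using that by (simp add: a_minus_def FN.smult_r_distr FN.smult_r_minus)
  show ?thesis
  proof (rule additive_kills_span[OF ext_free_module P F ext_rels_carrier _ v[unfolded ext_span_def]])
    fix c s assume c: "c \<in> carrier R" and s: "s \<in> ext_rels R N k"
    from s consider
      (1) ws i u v where "s = ebasis k (ws[i := u \<oplus>\<^bsub>N\<^esub> v]) \<ominus>\<^bsub>ext_free R N k\<^esub>
            (ebasis k (ws[i := u]) \<oplus>\<^bsub>ext_free R N k\<^esub> ebasis k (ws[i := v]))"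
          "ws \<in> tuples k (carrier N)" "i < k" "u \<in> carrier N" "v \<in> carrier N"
      | (2) ws i a u where "s = ebasis k (ws[i := a \<odot>\<^bsub>N\<^esub> u]) \<ominus>\<^bsub>ext_free R N k\<^esub> (simple k a (ws[i := u]))"
          "ws \<in> tuples k (carrier N)" "i < k" "a \<in> carrier R" "u \<in> carrier N"
      | (3) ws i j where "s = ebasis k ws" "ws \<in> tuples k (carrier N)" "i < j" "j < k" "ws ! i = ws ! j"
      unfolding ext_rels_def Let_def by blast
    then show "F (c \<odot>\<^bsub>ext_free R N k\<^esub> s) = \<zero>\<^bsub>P\<^esub>"
    proof cases
      case 1
      then show ?thesis
        using c slot_add[of c ws i u v]
        by (simp add: smult_diff FN.smult_r_distr ebasis_closed tuples_update P.a_minus_eq_zero_iff)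
    next
      case 2
      then have "c \<odot>\<^bsub>ext_free R N k\<^esub> simple k a (ws[i := u]) = simple k (c \<otimes>\<^bsub>R\<^esub> a) (ws[i := u])"
        using c by (simp add: FN.smult_assoc1 ebasis_closed tuples_update)
      with 2 show ?thesis
        using c slot_smult[of c ws i a u]
        by (simp add: smult_diff ebasis_closed tuples_update P.a_minus_eq_zero_iff)
    next
      case 3
      then show ?thesis using c alt by blast
    qed
  qed
qed

lemma const_on_ext_class:
  assumes "abelian_group P" "additive_map (ext_free R N k) P F"
    and "\<And>h. h \<in> ext_span R N k \<Longrightarrow> F h = \<zero>\<^bsub>P\<^esub>"
    and "v \<in> carrier (ext_free R N k)" "u \<in> ext_class R N k v"
  shows "F u = F v"
  using module_quotient.additive_const_on_cls[OF ext_quotient assms(1,2)] assms(3-)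
  by (simp add: ext_class_def)

text \<open>The element \<open>c w_1 \<and> ... \<and> w_k\<close>. The degree is read off the list,
  so that it need not be carried along and lists can be regrouped freely.\<close>

definition tens :: "'a \<Rightarrow> 'n list \<Rightarrow> ('n list \<Rightarrow> 'a) set" where
  "tens c ws = ext_class R N (length ws) (simple (length ws) c ws)"

lemma tens_eq: "ws \<in> tuples k (carrier N) \<Longrightarrow> tens c ws = ext_class R N k (simple k c ws)"
  by (simp add: tens_def tuples_length)

lemma tens_closed: "ws \<in> tuples k (carrier N) \<Longrightarrow> c \<in> carrier R \<Longrightarrow> tens c ws \<in> carrier (ext_power R N k)"
  by (simp add: tens_eq additive_map_closed[OF ext_class_additive] simple_closed)

lemma tens_additive:
  assumes "ws \<in> tuples k (carrier N)"
  shows "additive_map R (ext_power R N k) (\<lambda>c. tens c ws)"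
proof (rule additive_mapI)
  interpret FN: module R "ext_free R N k" by (rule ext_free_module)
  interpret additive_pair "ext_free R N k" "ext_power R N k" "ext_class R N k"
    by (rule ext_class_pair)
  fix u v assume "u \<in> carrier R" "v \<in> carrier R"
  then show "tens (u \<oplus>\<^bsub>R\<^esub> v) ws = tens u ws \<oplus>\<^bsub>ext_power R N k\<^esub> tens v ws"
    using assms by (simp add: tens_eq FN.smult_l_distr ebasis_closed)
qed (use assms tens_closed in auto)

lemma tens_pair:
  assumes "ws \<in> tuples k (carrier N)"
  shows "additive_pair R (ext_power R N k) (\<lambda>c. tens c ws)"
  by (intro additive_pair.intro additive_pair_axioms.intro ext_power_abelian_group tens_additive assms
      N.R.abelian_group_axioms)

lemma ext_class_rel:
  assumes "c \<in> carrier R" "s \<in> ext_rels R N k"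
  shows "ext_class R N k (c \<odot>\<^bsub>ext_free R N k\<^esub> s) = \<zero>\<^bsub>ext_power R N k\<^esub>"
proof -
  interpret FN: module R "ext_free R N k" by (rule ext_free_module)
  have "c \<odot>\<^bsub>ext_free R N k\<^esub> s \<in> ext_span R N k"
    unfolding ext_span_def
    using span_submodule[OF ext_free_module ext_rels_carrier] span_incl assms
    by (meson subsetD submodule.smult_closed)
  then show ?thesis
    using assms ext_rels_carrier by (subst ext_class_zero_iff) auto
qed

lemma tens_slot_add:
  assumes c: "c \<in> carrier R" and ws: "ws \<in> tuples k (carrier N)" "i < k" "u \<in> carrier N" "v \<in> carrier N"
  shows "tens c (ws[i := u \<oplus>\<^bsub>N\<^esub> v]) = tens c (ws[i := u]) \<oplus>\<^bsub>ext_power R N k\<^esub> tens c (ws[i := v])"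
proof -
  interpret FN: module R "ext_free R N k" by (rule ext_free_module)
  interpret additive_pair "ext_free R N k" "ext_power R N k" "ext_class R N k"
    by (rule ext_class_pair)
  have "ebasis k (ws[i := u \<oplus>\<^bsub>N\<^esub> v]) \<ominus>\<^bsub>ext_free R N k\<^esub>
      (ebasis k (ws[i := u]) \<oplus>\<^bsub>ext_free R N k\<^esub> ebasis k (ws[i := v])) \<in> ext_rels R N k" (is "?s \<in> _")
    unfolding ext_rels_def Let_def using ws by blast
  from ext_class_rel[OF c this] show ?thesis
    using ws c
    by (simp add: a_minus_def[of "ext_free R N k"] FN.smult_r_distr FN.smult_r_minus ebasis_closed tuples_update
        a_minus_def[of "ext_power R N k", symmetric] P.a_minus_eq_zero_iff tens_def tuples_length)
qed

lemma tens_slot_smult: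
  assumes c: "c \<in> carrier R" and ws: "ws \<in> tuples k (carrier N)" "i < k" "a \<in> carrier R" "u \<in> carrier N"
  shows "tens c (ws[i := a \<odot>\<^bsub>N\<^esub> u]) = tens (c \<otimes>\<^bsub>R\<^esub> a) (ws[i := u])"
proof -
  interpret FN: module R "ext_free R N k" by (rule ext_free_module)
  interpret additive_pair "ext_free R N k" "ext_power R N k" "ext_class R N k"
    by (rule ext_class_pair)
  have "ebasis k (ws[i := a \<odot>\<^bsub>N\<^esub> u]) \<ominus>\<^bsub>ext_free R N k\<^esub> (simple k a (ws[i := u])) \<in> ext_rels R N k" (is "?s \<in> _")
    unfolding ext_rels_def Let_def using ws by blast
  from ext_class_rel[OF c this] show ?thesis
    using ws c
    by (simp add: a_minus_def[of "ext_free R N k"] FN.smult_r_distr FN.smult_r_minus ebasis_closed tuples_update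
        a_minus_def[of "ext_power R N k", symmetric] P.a_minus_eq_zero_iff tens_def tuples_length FN.smult_assoc1)
qed

lemma tens_alt:
  assumes c: "c \<in> carrier R" and ws: "ws \<in> tuples k (carrier N)" "i < k" "j < k" "i \<noteq> j" "ws ! i = ws ! j"
  shows "tens c ws = \<zero>\<^bsub>ext_power R N k\<^esub>"
proof -
  have "ebasis k ws \<in> ext_rels R N k"
    unfolding ext_rels_def Let_def using ws by (cases "i < j") (auto, metis nat_neq_iff)
  from ext_class_rel[OF c this] show ?thesis
    using ws by (simp add: tens_eq)
qed

lemma tens_zero: "ws \<in> tuples k (carrier N) \<Longrightarrow> tens \<zero>\<^bsub>R\<^esub> ws = \<zero>\<^bsub>ext_power R N k\<^esub>"
  using additive_pair.zero[OF tens_pair] by simp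

lemma tens_slot_zero:
  assumes "c \<in> carrier R" "ws \<in> tuples k (carrier N)" "i < k"
  shows "tens c (ws[i := \<zero>\<^bsub>N\<^esub>]) = \<zero>\<^bsub>ext_power R N k\<^esub>"
  using tens_slot_smult[OF assms, of "\<zero>\<^bsub>R\<^esub>" "\<zero>\<^bsub>N\<^esub>"] assms
  by (simp add: tens_zero tuples_update)

lemma tens_slot_additive:
  assumes "c \<in> carrier R" "ws \<in> tuples k (carrier N)" "i < k"
  shows "additive_map N (ext_power R N k) (\<lambda>u. tens c (ws[i := u]))"
  using assms by (intro additive_mapI tens_closed tens_slot_add tuples_update)

lemma tens_slot_pair:
  assumes "c \<in> carrier R" "ws \<in> tuples k (carrier N)" "i < k"
  shows "additive_pair N (ext_power R N k) (\<lambda>u. tens c (ws[i := u]))"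
  by (intro additive_pair.intro additive_pair_axioms.intro ext_power_abelian_group tens_slot_additive assms
      N.abelian_group_axioms)

text \<open>Polarisation: the relations only say that a repeated entry gives zero, and expanding the
  vanishing product with \<open>u + v\<close> in both slots gives antisymmetry.\<close>

lemma tens_swap:
  assumes c: "c \<in> carrier R" and ws: "ws \<in> tuples k (carrier N)" "i < k" "j < k" "i \<noteq> j"
    and u: "u \<in> carrier N" and v: "v \<in> carrier N"
  shows "tens c (ws[i := u, j := v]) = \<ominus>\<^bsub>ext_power R N k\<^esub> tens c (ws[i := v, j := u])"
proof -
  interpret P: abelian_group "ext_power R N k" by (rule ext_power_abelian_group)
  let ?P = "ext_power R N k"
  let ?t = "\<lambda>a b. tens c (ws[i := a, j := b])"
  have cl: "?t a b \<in> carrier ?P" if "a \<in> carrier N" "b \<in> carrier N" for a b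
    using that assms by (intro tens_closed tuples_update)
  have len: "length ws = k" using ws by (simp add: tuples_length)
  have diag: "?t a a = \<zero>\<^bsub>?P\<^esub>" if "a \<in> carrier N" for a
    by (rule tens_alt[where i = i and j = j]) (use that assms len in \<open>auto intro!: tuples_update\<close>)
  have add1: "?t (a \<oplus>\<^bsub>N\<^esub> b) d = ?t a d \<oplus>\<^bsub>?P\<^esub> ?t b d"
    if "a \<in> carrier N" "b \<in> carrier N" "d \<in> carrier N" for a b d
    using that assms
    by (simp add: list_update_swap[of i j] tens_slot_add tuples_update)
  have add2: "?t d (a \<oplus>\<^bsub>N\<^esub> b) = ?t d a \<oplus>\<^bsub>?P\<^esub> ?t d b"
    if "a \<in> carrier N" "b \<in> carrier N" "d \<in> carrier N" for a b d
    using that assms by (simp add: tens_slot_add tuples_update)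
  have "?t (u \<oplus>\<^bsub>N\<^esub> v) (u \<oplus>\<^bsub>N\<^esub> v) = \<zero>\<^bsub>?P\<^esub>"
    using diag u v by simp
  then have "?t u v \<oplus>\<^bsub>?P\<^esub> ?t v u = \<zero>\<^bsub>?P\<^esub>"
    using u v P.a_comm[OF cl[OF u v] cl[OF v u]] by (simp add: add1 add2 diag[OF u] diag[OF v] cl)
  then show ?thesis
    using P.minus_equality[of "?t u v" "?t v u"] cl u v by simp
qed

text \<open>One swap carries \<open>w\<close> past one vector. The vectors are taken from the end of
  \<open>us\<close>, and a vector that has been passed joins \<open>ws\<close>, which is therefore
  kept arbitrary.\<close>

lemma tens_move:
  assumes c: "c \<in> carrier R" and w: "w \<in> carrier N"
  shows "us \<in> tuples p (carrier N) \<Longrightarrow> ws \<in> tuples q (carrier N) \<Longrightarrow>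
     tens c (us @ w # ws) = (if even p then tens c (w # us @ ws)
       else \<ominus>\<^bsub>ext_power R N (Suc (p + q))\<^esub> tens c (w # us @ ws))"
proof (induction us arbitrary: ws p q rule: rev_induct)
  case Nil
  then show ?case by (simp add: tuples_def)
next
  case (snoc u us)
  interpret P: abelian_group "ext_power R N (Suc (p + q))" by (rule ext_power_abelian_group)
  obtain p' where p: "p = Suc p'" "us \<in> tuples p' (carrier N)" "u \<in> carrier N"
    using snoc.prems by (cases p) (auto simp: tuples_def)
  let ?l = "us @ u # w # ws"
  have l: "?l \<in> tuples (Suc (p + q)) (carrier N)"
    using p snoc.prems w by (auto simp: tuples_def)
  interpret P': abelian_group "ext_power R N (Suc (Suc (p' + q)))" by (rule ext_power_abelian_group)
  have len: "length us = p'" using p by (simp add: tuples_length)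
  have "tens c ((us @ [u]) @ w # ws) = tens c (?l[p' := u, Suc p' := w])"
    by (simp add: list_update_append len)
  also have "\<dots> = \<ominus>\<^bsub>ext_power R N (Suc (p + q))\<^esub> tens c (?l[p' := w, Suc p' := u])"
    by (rule tens_swap[OF c l]) (use p w in auto)
  also have "?l[p' := w, Suc p' := u] = us @ w # (u # ws)"
    by (simp add: list_update_append len)
  also have "tens c \<dots> = (if even p' then tens c (w # us @ (u # ws))
       else \<ominus>\<^bsub>ext_power R N (Suc (p' + Suc q))\<^esub> tens c (w # us @ (u # ws)))"
    by (rule snoc.IH) (use p snoc.prems in \<open>auto simp: tuples_def\<close>)
  finally have "tens c ((us @ [u]) @ w # ws) = \<ominus>\<^bsub>ext_power R N (Suc (p + q))\<^esub>
      (if even p' then tens c (w # us @ (u # ws))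
       else \<ominus>\<^bsub>ext_power R N (Suc (p' + Suc q))\<^esub> tens c (w # us @ (u # ws)))" .
  moreover have "tens c (w # us @ (u # ws)) \<in> carrier (ext_power R N (Suc (p + q)))"
    by (rule tens_closed) (use p snoc.prems w c in \<open>auto simp: tuples_def\<close>)
  ultimately show ?case
    by (simp add: p(1) P'.minus_minus)
qed

lemma ext_induct [consumes 2, case_names zero tens add]:
  assumes G: "generates R N G" and \<alpha>: "\<alpha> \<in> carrier (ext_power R N k)"
    and zero: "Q \<zero>\<^bsub>ext_power R N k\<^esub>"
    and tens: "\<And>c ws. c \<in> carrier R \<Longrightarrow> ws \<in> tuples k G \<Longrightarrow> Q (tens c ws)"
    and add: "\<And>\<alpha> \<beta>. \<alpha> \<in> carrier (ext_power R N k) \<Longrightarrow> \<beta> \<in> carrier (ext_power R N k) \<Longrightarrow>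
                Q \<alpha> \<Longrightarrow> Q \<beta> \<Longrightarrow> Q (\<alpha> \<oplus>\<^bsub>ext_power R N k\<^esub> \<beta>)"
  shows "Q \<alpha>"
proof -
  have GN: "G \<subseteq> carrier N" using G by (simp add: generates_def)
  have gen: "P w" if "P \<zero>\<^bsub>N\<^esub>" "\<And>w a g. w \<in> carrier N \<Longrightarrow> a \<in> carrier R \<Longrightarrow> g \<in> G \<Longrightarrow> P w \<Longrightarrow> P (w \<oplus>\<^bsub>N\<^esub> a \<odot>\<^bsub>N\<^esub> g)"
      "w \<in> carrier N" for P w
    using G that unfolding generates_def by blast
  \<comment> \<open>Only the slots from \<open>m\<close> on are known to lie in \<open>G\<close>.
    Passing to \<open>Suc m\<close> frees slot \<open>m\<close>, and the generation principle is
    applied to the entry there. The coefficient stays quantified because it absorbs the scalar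
    \<open>a\<close> in front of a generator.\<close>
  have step: "\<forall>c\<in>carrier R. \<forall>ws\<in>tuples k (carrier N). (\<forall>i<k. m \<le> i \<longrightarrow> ws ! i \<in> G) \<longrightarrow> Q (tens c ws)"
    if "m \<le> k" for m
    using that
  proof (induction m)
    case 0
    show ?case
    proof (intro ballI impI)
      fix c ws assume *: "c \<in> carrier R" "ws \<in> tuples k (carrier N)" "\<forall>i<k. 0 \<le> i \<longrightarrow> ws ! i \<in> G"
      then have "ws \<in> tuples k G" by (auto simp: tuples_def in_set_conv_nth)
      then show "Q (tens c ws)" using tens * by blast
    qed
  next
    case (Suc m)
    show ?case
    proof (intro ballI impI)
      fix c ws assume c: "c \<in> carrier R" and ws: "ws \<in> tuples k (carrier N)" "\<forall>i<k. Suc m \<le> i \<longrightarrow> ws ! i \<in> G"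
      have m: "m < k" using Suc.prems by simp
      have "\<forall>c\<in>carrier R. Q (tens c (ws[m := w]))" if "w \<in> carrier N" for w
      proof (rule gen[OF _ _ that])
        show "\<forall>c\<in>carrier R. Q (tens c (ws[m := \<zero>\<^bsub>N\<^esub>]))"
          using m ws zero by (simp add: tens_slot_zero)
        fix w a g assume w: "w \<in> carrier N" and a: "a \<in> carrier R" and g: "g \<in> G"
          and IH: "\<forall>c\<in>carrier R. Q (tens c (ws[m := w]))"
        show "\<forall>c\<in>carrier R. Q (tens c (ws[m := w \<oplus>\<^bsub>N\<^esub> a \<odot>\<^bsub>N\<^esub> g]))"
        proof
          fix c assume c: "c \<in> carrier R"
          have gN: "g \<in> carrier N" using g GN by auto
          have "tens c (ws[m := w \<oplus>\<^bsub>N\<^esub> a \<odot>\<^bsub>N\<^esub> g]) =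
              tens c (ws[m := w]) \<oplus>\<^bsub>ext_power R N k\<^esub> tens (c \<otimes>\<^bsub>R\<^esub> a) (ws[m := g])"
            using c ws m w a gN by (simp add: tens_slot_add tens_slot_smult)
          moreover have "Q (tens (c \<otimes>\<^bsub>R\<^esub> a) (ws[m := g]))"
          proof -
            have "\<forall>i<k. m \<le> i \<longrightarrow> ws[m := g] ! i \<in> G"
              using ws g m by (auto simp: nth_list_update tuples_length)
            then show ?thesis
              using Suc c a ws gN by (simp add: tuples_update)
          qed
          ultimately show "Q (tens c (ws[m := w \<oplus>\<^bsub>N\<^esub> a \<odot>\<^bsub>N\<^esub> g]))"
            using c IH ws w a gN by (auto intro!: add tens_closed tuples_update)
        qed
      qed
      from this[of "ws ! m"] show "Q (tens c ws)"
        using c ws m by (simp add: tuples_nth)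
    qed
  qed
  from \<alpha> obtain v where v: "v \<in> carrier (ext_free R N k)" "\<alpha> = ext_class R N k v"
    by (rule ext_power_cases)
  interpret additive_pair "ext_free R N k" "ext_power R N k" "ext_class R N k"
    by (rule ext_class_pair)
  have "Q (ext_class R N k v)"
    using v(1) unfolding ext_free_def
  proof (induction rule: free_induct)
    case zero
    then show ?case
      using assms(3) local.zero by (simp flip: ext_free_def)
  next
    case (add v c ws)
    then have "Q (tens c ws)" using step[of k] by auto
    with add show ?case
      by (simp flip: ext_free_def add: simple_closed tens_closed tens_eq[symmetric])
         (auto intro!: assms(5) tens_closed)
  qed
  then show ?thesis using v by simp
qed

end

section \<open>Wedge products and functoriality\<close>

context ext_algebra
begin

section \<open>The wedge product\<close>

lemma ext_span_subset: "ext_span R N k \<subseteq> carrier (ext_free R N k)"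
  unfolding ext_span_def
  by (rule module.submoduleE(1)[OF ext_free_module span_submodule[OF ext_free_module ext_rels_carrier]])

text \<open>The function inside \<open>wedge\<close>, before passing to classes. It is biadditive,
  and on basis vectors it concatenates the tuples.\<close>

definition tensor :: "nat \<Rightarrow> nat \<Rightarrow> ('n list \<Rightarrow> 'a) \<Rightarrow> ('n list \<Rightarrow> 'a) \<Rightarrow> 'n list \<Rightarrow> 'a" where
  "tensor p q v w = (\<lambda>ws\<in>tuples (p + q) (carrier N). v (take p ws) \<otimes>\<^bsub>R\<^esub> w (drop p ws))"

lemma tensor_closed:
  assumes v: "v \<in> carrier (ext_free R N p)" and w: "w \<in> carrier (ext_free R N q)"
  shows "tensor p q v w \<in> carrier (ext_free R N (p + q))"
proof -
  let ?A = "{ws \<in> tuples p (carrier N). v ws \<noteq> \<zero>\<^bsub>R\<^esub>}" and ?B = "{ws \<in> tuples q (carrier N). w ws \<noteq> \<zero>\<^bsub>R\<^esub>}"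
  have vw: "v ws \<in> carrier R" if "ws \<in> tuples p (carrier N)" for ws
    using v that by (auto simp: ext_free_def free_carrier)
  have ww: "w ws \<in> carrier R" if "ws \<in> tuples q (carrier N)" for ws
    using w that by (auto simp: ext_free_def free_carrier)
  have "finite {ws \<in> tuples (p + q) (carrier N). tensor p q v w ws \<noteq> \<zero>\<^bsub>R\<^esub>}"
  proof (rule finite_subset)
    show "{ws \<in> tuples (p + q) (carrier N). tensor p q v w ws \<noteq> \<zero>\<^bsub>R\<^esub>} \<subseteq> (\<lambda>(a, b). a @ b) ` (?A \<times> ?B)"
    proof
      fix ws assume ws: "ws \<in> {ws \<in> tuples (p + q) (carrier N). tensor p q v w ws \<noteq> \<zero>\<^bsub>R\<^esub>}"
      then have "ws \<in> tuples (p + q) (carrier N)" by simp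
      note * = tuples_take[OF this] tuples_drop[OF this]
      have t: "v (take p ws) \<otimes>\<^bsub>R\<^esub> w (drop p ws) \<noteq> \<zero>\<^bsub>R\<^esub>"
        using \<open>ws \<in> tuples (p + q) (carrier N)\<close> ws by (simp add: tensor_def)
      have "v (take p ws) \<noteq> \<zero>\<^bsub>R\<^esub>"
        using t N.R.l_null[OF ww[OF *(2)]] by metis
      moreover have "w (drop p ws) \<noteq> \<zero>\<^bsub>R\<^esub>"
        using t N.R.r_null[OF vw[OF *(1)]] by metis
      ultimately have "(take p ws, drop p ws) \<in> ?A \<times> ?B" using * by simp
      then show "ws \<in> (\<lambda>(a, b). a @ b) ` (?A \<times> ?B)"
        by (rule image_eqI[rotated]) simp
    qed
    show "finite ((\<lambda>(a, b). a @ b) ` (?A \<times> ?B))"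
      using v w by (auto simp: ext_free_def free_carrier)
  qed
  moreover have "tensor p q v w \<in> tuples (p + q) (carrier N) \<rightarrow>\<^sub>E carrier R"
    unfolding tensor_def by (rule restrict_PiE_iff[THEN iffD2]) (auto intro!: vw ww tuples_take tuples_drop)
  ultimately show ?thesis
    by (simp add: ext_free_def free_carrier)
qed

lemma tensor_additive_left:
  assumes w: "w \<in> carrier (ext_free R N q)"
  shows "additive_map (ext_free R N p) (ext_free R N (p + q)) (\<lambda>v. tensor p q v w)"
proof (rule additive_mapI)
  fix u v assume "u \<in> carrier (ext_free R N p)" "v \<in> carrier (ext_free R N p)"
  then show "tensor p q (u \<oplus>\<^bsub>ext_free R N p\<^esub> v) w = tensor p q u w \<oplus>\<^bsub>ext_free R N (p + q)\<^esub> tensor p q v w"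
    using w unfolding ext_free_def free_add free_carrier tensor_def
    by (auto simp: fun_eq_iff tuples_take tuples_drop PiE_iff N.R.l_distr)
qed (use w in \<open>auto intro: tensor_closed\<close>)

lemma tensor_additive_right:
  assumes w: "w \<in> carrier (ext_free R N p)"
  shows "additive_map (ext_free R N q) (ext_free R N (p + q)) (\<lambda>v. tensor p q w v)"
proof (rule additive_mapI)
  fix u v assume "u \<in> carrier (ext_free R N q)" "v \<in> carrier (ext_free R N q)"
  then show "tensor p q w (u \<oplus>\<^bsub>ext_free R N q\<^esub> v) = tensor p q w u \<oplus>\<^bsub>ext_free R N (p + q)\<^esub> tensor p q w v"
    using w unfolding ext_free_def free_add free_carrier tensor_def
    by (auto simp: fun_eq_iff tuples_take tuples_drop PiE_iff N.R.r_distr)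
qed (use w in \<open>auto intro: tensor_closed\<close>)

lemma tensor_simple:
  assumes "ws \<in> tuples p (carrier N)" "ws' \<in> tuples q (carrier N)" "c \<in> carrier R" "d \<in> carrier R"
  shows "tensor p q (simple p c ws) (simple q d ws') = simple (p + q) (c \<otimes>\<^bsub>R\<^esub> d) (ws @ ws')"
proof
  fix us
  have "us = ws @ ws' \<longleftrightarrow> take p us = ws \<and> drop p us = ws'" if "us \<in> tuples (p + q) (carrier N)"
    using that assms by (metis append_take_drop_id append_eq_conv_conj tuples_length)
  then show "tensor p q (simple p c ws) (simple q d ws') us = simple (p + q) (c \<otimes>\<^bsub>R\<^esub> d) (ws @ ws') us"
    using assms by (auto simp: tensor_def ext_free_def smult_basis_vec tuples_take tuples_drop)
qed

text \<open>If \<open>w\<close> is a multiple of a basis vector, tensoring with it on the right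
  turns a relation among the first \<open>p\<close> slots into the same relation in degree
  \<open>p + q\<close>. Additivity in \<open>w\<close> gives the general case.\<close>

lemma class_tensor_left:
  assumes w: "w \<in> carrier (ext_free R N q)" and v: "v \<in> carrier (ext_free R N p)" "v' \<in> ext_class R N p v"
  shows "ext_class R N (p + q) (tensor p q v' w) = ext_class R N (p + q) (tensor p q v w)"
proof -
  let ?P = "ext_power R N (p + q)"
  let ?F = "\<lambda>w v. ext_class R N (p + q) (tensor p q v w)"
  interpret P: abelian_group ?P by (rule ext_power_abelian_group)
  have add: "additive_map (ext_free R N p) ?P (?F w)" if "w \<in> carrier (ext_free R N q)" for w
    by (rule additive_map_comp[OF tensor_additive_left ext_class_additive]) fact
  have add': "additive_map (ext_free R N q) ?P (\<lambda>w. ?F w v)" if "v \<in> carrier (ext_free R N p)" for v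
    by (rule additive_map_comp[OF tensor_additive_right ext_class_additive]) fact
  have F: "?F (simple q d ws') (simple p c ws) = tens (c \<otimes>\<^bsub>R\<^esub> d) (ws @ ws')"
    if "ws \<in> tuples p (carrier N)" "ws' \<in> tuples q (carrier N)" "c \<in> carrier R" "d \<in> carrier R" for c d ws ws'
    using that by (simp add: tensor_simple tens_eq[OF tuples_append])
  have kill: "?F w h = \<zero>\<^bsub>?P\<^esub>" if h: "h \<in> ext_span R N p" for h
  proof -
    have hc: "h \<in> carrier (ext_free R N p)"
      using h ext_span_subset by auto
    have "?F w h = (\<lambda>w. \<zero>\<^bsub>?P\<^esub>) w"
    proof (rule additive_free_eqI[where X = "tuples q (carrier N)" and P = ?P
          and F = "\<lambda>w. ?F w h" and G = "\<lambda>w. \<zero>\<^bsub>?P\<^esub>" and v = w])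
      show "additive_map (free_module R (tuples q (carrier N))) ?P (\<lambda>w. ?F w h)"
        using add'[OF hc] by (simp add: ext_free_def)
      show "additive_map (free_module R (tuples q (carrier N))) ?P (\<lambda>w. \<zero>\<^bsub>?P\<^esub>)"
        by (rule additive_mapI) auto
      show "w \<in> carrier (free_module R (tuples q (carrier N)))"
        using w by (simp add: ext_free_def)
      fix ws' d assume ws': "ws' \<in> tuples q (carrier N)" and d: "d \<in> carrier R"
      have "?F (simple q d ws') h = \<zero>\<^bsub>?P\<^esub>"
      proof (rule additive_kills_ext_span[OF P.abelian_group_axioms add[OF simple_closed[OF ws' d]] _ _ _ h])
        fix c ws i assume *: "c \<in> carrier R" "ws \<in> tuples p (carrier N)"
        have len: "length ws = p" using * by (simp add: tuples_length)
        note app = tuples_append[OF *(2) ws']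
        have upd: "ws[i := x] @ ws' = (ws @ ws')[i := x]" if "i < p" for i x
          using that len by (simp add: list_update_append1)
        note F' = F[OF _ ws' _ d]
        {
          fix u v assume "i < p" "u \<in> carrier N" "v \<in> carrier N"
          then show "?F (simple q d ws') (simple p c (ws[i := u \<oplus>\<^bsub>N\<^esub> v])) =
            ?F (simple q d ws') (simple p c (ws[i := u])) \<oplus>\<^bsub>?P\<^esub> ?F (simple q d ws') (simple p c (ws[i := v]))"
            using * d by (simp add: F' tuples_update upd tens_slot_add[OF _ app])
        next
          fix a u assume "i < p" "a \<in> carrier R" "u \<in> carrier N"
          then show "?F (simple q d ws') (simple p c (ws[i := a \<odot>\<^bsub>N\<^esub> u])) =
            ?F (simple q d ws') (simple p (c \<otimes>\<^bsub>R\<^esub> a) (ws[i := u]))"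
            using * d by (simp add: F' tuples_update upd tens_slot_smult[OF _ app] N.R.m_ac)
        next
          fix j assume ij: "i < j" "j < p" "ws ! i = ws ! j"
          have "tens (c \<otimes>\<^bsub>R\<^esub> d) (ws @ ws') = \<zero>\<^bsub>?P\<^esub>"
            by (rule tens_alt[OF _ app, of _ i j]) (use ij * d len in \<open>auto simp: nth_append\<close>)
          then show "?F (simple q d ws') (simple p c ws) = \<zero>\<^bsub>?P\<^esub>"
            using * d by (simp add: F')
        }
      qed
      then show "?F (d \<odot>\<^bsub>free_module R (tuples q (carrier N))\<^esub> ebasis q ws') h = \<zero>\<^bsub>?P\<^esub>"
        by (simp add: ext_free_def)
    qed (rule P.abelian_group_axioms)
    then show ?thesis .
  qed
  show ?thesis
    by (rule const_on_ext_class[OF P.abelian_group_axioms add[OF w] kill v])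
qed

lemma class_tensor_right:
  assumes v: "v \<in> carrier (ext_free R N p)" and w: "w \<in> carrier (ext_free R N q)" "w' \<in> ext_class R N q w"
  shows "ext_class R N (p + q) (tensor p q v w') = ext_class R N (p + q) (tensor p q v w)"
proof -
  let ?P = "ext_power R N (p + q)"
  let ?F = "\<lambda>v w. ext_class R N (p + q) (tensor p q v w)"
  interpret P: abelian_group ?P by (rule ext_power_abelian_group)
  have add: "additive_map (ext_free R N q) ?P (?F w)" if "w \<in> carrier (ext_free R N p)" for w
    by (rule additive_map_comp[OF tensor_additive_right ext_class_additive]) fact
  have add': "additive_map (ext_free R N p) ?P (\<lambda>w. ?F w v)" if "v \<in> carrier (ext_free R N q)" for v
    by (rule additive_map_comp[OF tensor_additive_left ext_class_additive]) fact
  have F: "?F (simple p c ws) (simple q d ws') = tens (c \<otimes>\<^bsub>R\<^esub> d) (ws @ ws')"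
    if "ws \<in> tuples p (carrier N)" "ws' \<in> tuples q (carrier N)" "c \<in> carrier R" "d \<in> carrier R" for c d ws ws'
    using that by (simp add: tensor_simple tens_eq[OF tuples_append])
  have kill: "?F v h = \<zero>\<^bsub>?P\<^esub>" if h: "h \<in> ext_span R N q" for h
  proof -
    have hc: "h \<in> carrier (ext_free R N q)"
      using h ext_span_subset by auto
    have "?F v h = (\<lambda>w. \<zero>\<^bsub>?P\<^esub>) v"
    proof (rule additive_free_eqI[where X = "tuples p (carrier N)" and P = ?P
          and F = "\<lambda>w. ?F w h" and G = "\<lambda>w. \<zero>\<^bsub>?P\<^esub>" and v = v])
      show "additive_map (free_module R (tuples p (carrier N))) ?P (\<lambda>w. ?F w h)"
        using add'[OF hc] by (simp add: ext_free_def)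
      show "additive_map (free_module R (tuples p (carrier N))) ?P (\<lambda>w. \<zero>\<^bsub>?P\<^esub>)"
        by (rule additive_mapI) auto
      show "v \<in> carrier (free_module R (tuples p (carrier N)))"
        using v by (simp add: ext_free_def)
      fix ws' d assume ws': "ws' \<in> tuples p (carrier N)" and d: "d \<in> carrier R"
      have "?F (simple p d ws') h = \<zero>\<^bsub>?P\<^esub>"
      proof (rule additive_kills_ext_span[OF P.abelian_group_axioms add[OF simple_closed[OF ws' d]] _ _ _ h])
        fix c ws i assume *: "c \<in> carrier R" "ws \<in> tuples q (carrier N)"
        have len: "length ws' = p" using ws' by (simp add: tuples_length)
        note app = tuples_append[OF ws' *(2)]
        \<comment> \<open>Slot \<open>i\<close> of the second factor is slot \<open>p + i\<close> of
          the product.\<close>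
        have upd: "ws' @ ws[i := x] = (ws' @ ws)[p + i := x]" for i x
          using len by (simp add: list_update_append)
        note F' = F[OF ws' _ d]
        {
          fix u v assume "i < q" "u \<in> carrier N" "v \<in> carrier N"
          then show "?F (simple p d ws') (simple q c (ws[i := u \<oplus>\<^bsub>N\<^esub> v])) =
            ?F (simple p d ws') (simple q c (ws[i := u])) \<oplus>\<^bsub>?P\<^esub> ?F (simple p d ws') (simple q c (ws[i := v]))"
            using * d by (simp add: F' tuples_update upd tens_slot_add[OF _ app])
        next
          fix a u assume "i < q" "a \<in> carrier R" "u \<in> carrier N"
          then show "?F (simple p d ws') (simple q c (ws[i := a \<odot>\<^bsub>N\<^esub> u])) =
            ?F (simple p d ws') (simple q (c \<otimes>\<^bsub>R\<^esub> a) (ws[i := u]))"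
            using * d by (simp add: F' tuples_update upd tens_slot_smult[OF _ app] N.R.m_ac)
        next
          fix j assume ij: "i < j" "j < q" "ws ! i = ws ! j"
          have "tens (d \<otimes>\<^bsub>R\<^esub> c) (ws' @ ws) = \<zero>\<^bsub>?P\<^esub>"
            by (rule tens_alt[OF _ app, of _ "p + i" "p + j"]) (use ij * d len in \<open>auto simp: nth_append\<close>)
          then show "?F (simple p d ws') (simple q c ws) = \<zero>\<^bsub>?P\<^esub>"
            using * d by (simp add: F')
        }
      qed
      then show "?F (d \<odot>\<^bsub>free_module R (tuples p (carrier N))\<^esub> ebasis p ws') h = \<zero>\<^bsub>?P\<^esub>"
        by (simp add: ext_free_def)
    qed (rule P.abelian_group_axioms)
    then show ?thesis .
  qed
  show ?thesis
    by (rule const_on_ext_class[OF P.abelian_group_axioms add[OF v] kill w])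
qed

lemma wedge_class:
  assumes v: "v \<in> carrier (ext_free R N p)" and w: "w \<in> carrier (ext_free R N q)"
  shows "wedge R N p q (ext_class R N p v) (ext_class R N q w) = ext_class R N (p + q) (tensor p q v w)"
proof -
  have "ext_class R N (p + q) (tensor p q v' w') = ext_class R N (p + q) (tensor p q v w)"
    if "v' \<in> ext_class R N p v" "w' \<in> ext_class R N q w" for v' w'
    using class_tensor_left[OF _ v that(1), of w' q] class_tensor_right[OF v w that(2)] ext_class_subset[OF w that(2)]
    by simp
  then show ?thesis
    using ext_class_self[OF v] ext_class_self[OF w] unfolding wedge_def tensor_def[symmetric] by blast
qed

lemma wedge_additive_left:
  assumes \<beta>: "\<beta> \<in> carrier (ext_power R N q)"
  shows "additive_map (ext_power R N p) (ext_power R N (p + q)) (\<lambda>\<alpha>. wedge R N p q \<alpha> \<beta>)"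
proof -
  obtain w where w: "w \<in> carrier (ext_free R N q)" "\<beta> = ext_class R N q w"
    by (rule ext_power_cases[OF \<beta>])
  interpret E: module R "ext_free R N p" by (rule ext_free_module)
  show ?thesis
  proof (rule additive_mapI)
    fix \<alpha> assume "\<alpha> \<in> carrier (ext_power R N p)"
    then obtain v where v: "v \<in> carrier (ext_free R N p)" "\<alpha> = ext_class R N p v"
      by (rule ext_power_cases)
    show "wedge R N p q \<alpha> \<beta> \<in> carrier (ext_power R N (p + q))"
      using v w by (simp add: wedge_class additive_map_closed[OF ext_class_additive] tensor_closed)
    fix \<alpha>' assume "\<alpha>' \<in> carrier (ext_power R N p)"
    then obtain v' where v': "v' \<in> carrier (ext_free R N p)" "\<alpha>' = ext_class R N p v'"
      by (rule ext_power_cases)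
    show "wedge R N p q (\<alpha> \<oplus>\<^bsub>ext_power R N p\<^esub> \<alpha>') \<beta> =
        wedge R N p q \<alpha> \<beta> \<oplus>\<^bsub>ext_power R N (p + q)\<^esub> wedge R N p q \<alpha>' \<beta>"
      using v v' w
      by (simp add: wedge_class additive_map_add[OF ext_class_additive, symmetric] tensor_closed
          additive_map_add[OF tensor_additive_left] E.a_closed)
  qed
qed

lemma wedge_additive_right:
  assumes \<beta>: "\<beta> \<in> carrier (ext_power R N p)"
  shows "additive_map (ext_power R N q) (ext_power R N (p + q)) (wedge R N p q \<beta>)"
proof -
  obtain w where w: "w \<in> carrier (ext_free R N p)" "\<beta> = ext_class R N p w"
    by (rule ext_power_cases[OF \<beta>])
  interpret E: module R "ext_free R N q" by (rule ext_free_module)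
  show ?thesis
  proof (rule additive_mapI)
    fix \<alpha> assume "\<alpha> \<in> carrier (ext_power R N q)"
    then obtain v where v: "v \<in> carrier (ext_free R N q)" "\<alpha> = ext_class R N q v"
      by (rule ext_power_cases)
    show "wedge R N p q \<beta> \<alpha> \<in> carrier (ext_power R N (p + q))"
      using v w by (simp add: wedge_class additive_map_closed[OF ext_class_additive] tensor_closed)
    fix \<alpha>' assume "\<alpha>' \<in> carrier (ext_power R N q)"
    then obtain v' where v': "v' \<in> carrier (ext_free R N q)" "\<alpha>' = ext_class R N q v'"
      by (rule ext_power_cases)
    show "wedge R N p q \<beta> (\<alpha> \<oplus>\<^bsub>ext_power R N q\<^esub> \<alpha>') =
        wedge R N p q \<beta> \<alpha> \<oplus>\<^bsub>ext_power R N (p + q)\<^esub> wedge R N p q \<beta> \<alpha>'"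
      using v v' w
      by (simp add: wedge_class additive_map_add[OF ext_class_additive, symmetric] tensor_closed
          additive_map_add[OF tensor_additive_right] E.a_closed)
  qed
qed

lemma wedge_tens:
  assumes "ws \<in> tuples p (carrier N)" "ws' \<in> tuples q (carrier N)" "c \<in> carrier R" "d \<in> carrier R"
  shows "wedge R N p q (tens c ws) (tens d ws') = tens (c \<otimes>\<^bsub>R\<^esub> d) (ws @ ws')"
  using assms by (simp add: tens_eq[of _ p] tens_eq[of _ q] tens_eq[OF tuples_append] wedge_class simple_closed tensor_simple)

lemma ext_scalar_eq: "ext_scalar R N a = tens a []"
  by (simp add: ext_scalar_def tens_def)

lemma ext_vector_eq: "w \<in> carrier N \<Longrightarrow> ext_vector R N w = tens \<one>\<^bsub>R\<^esub> [w]"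
proof -
  interpret F: module R "ext_free R N 1" by (rule ext_free_module)
  assume "w \<in> carrier N"
  then show ?thesis
    using F.smult_one[of "ebasis 1 [w]"] by (simp add: ext_vector_def tens_def ebasis_closed tuples_Cons tuples_0)
qed

end

section \<open>Change of the ring of coefficients\<close>

locale base_ring_hom = R: base_ring R + R': base_ring R' for R :: "'a ring" and R' :: "'b ring" +
  fixes \<phi> :: "'a \<Rightarrow> 'b"
  assumes hom: "\<phi> \<in> ring_hom R R'"
begin

lemma hom_additive: "additive_map R R' \<phi>"
  using hom by (intro additive_mapI) (auto simp: ring_hom_def)

text \<open>Each coordinate \<open>y\<close> of the image is an additive extension from the basis,
  namely of the map that keeps only the basis elements sent to \<open>y\<close>. Additivity of
  \<open>free_map\<close> is thereby that of \<open>lin_ext\<close>.\<close>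

lemma free_map_eq:
  assumes v: "v \<in> carrier (free_module R X)"
  shows "free_map R' X R Y \<phi> f v =
    (\<lambda>y\<in>Y. lin_ext R' R X (\<lambda>x c. if f x = y then \<phi> c else \<zero>\<^bsub>R'\<^esub>) v)"
proof -
  have "v x \<in> carrier R" if "x \<in> X" for x
    using v that by (auto simp: R.free_carrier)
  then have "\<phi> (v x) \<in> carrier R'" if "x \<in> X" for x
    using that additive_map_closed[OF hom_additive] by auto
  then show ?thesis
    unfolding free_map_def lin_ext_def
    by (intro restrict_ext R'.add.finprod_mono_neutral_cong_left)
       (use v in \<open>auto simp: R.free_carrier\<close>)
qed

lemma free_map_additive:
  assumes f: "\<And>x. x \<in> X \<Longrightarrow> f x \<in> Y"
  shows "additive_map (free_module R X) (free_module R' Y) (free_map R' X R Y \<phi> f)"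
proof (rule additive_mapI)
  have g: "additive_map R R' (\<lambda>c. if f x = y then \<phi> c else \<zero>\<^bsub>R'\<^esub>)" for x y
    using hom_additive by (auto simp: additive_map_def)
  note ladd = R.lin_ext_additive[OF R'.abelian_group_axioms g, where X = X]
  fix u assume u: "u \<in> carrier (free_module R X)"
  have "finite {y \<in> Y. free_map R' X R Y \<phi> f u y \<noteq> \<zero>\<^bsub>R'\<^esub>}"
  proof (rule finite_subset)
    show "{y \<in> Y. free_map R' X R Y \<phi> f u y \<noteq> \<zero>\<^bsub>R'\<^esub>} \<subseteq> f ` {x \<in> X. u x \<noteq> \<zero>\<^bsub>R\<^esub>}"
    proof clarsimp
      fix y assume y: "y \<in> Y" "free_map R' X R Y \<phi> f u y \<noteq> \<zero>\<^bsub>R'\<^esub>"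
      have "free_map R' X R Y \<phi> f u y = finsum R' (\<lambda>x. \<phi> (u x)) {x \<in> X. u x \<noteq> \<zero>\<^bsub>R\<^esub> \<and> f x = y}"
        using y(1) by (simp add: free_map_def)
      with y(2) have "{x \<in> X. u x \<noteq> \<zero>\<^bsub>R\<^esub> \<and> f x = y} \<noteq> {}"
        by (metis R'.finsum_empty)
      then show "y \<in> f ` {x \<in> X. u x \<noteq> \<zero>\<^bsub>R\<^esub>}" by auto
    qed
    show "finite (f ` {x \<in> X. u x \<noteq> \<zero>\<^bsub>R\<^esub>})"
      using u by (auto simp: R.free_carrier)
  qed
  moreover have "free_map R' X R Y \<phi> f u \<in> Y \<rightarrow>\<^sub>E carrier R'"
    using additive_map_closed[OF ladd u] by (auto simp: free_map_eq[OF u])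
  ultimately show "free_map R' X R Y \<phi> f u \<in> carrier (free_module R' Y)"
    by (simp add: R'.free_carrier)
  fix v assume v: "v \<in> carrier (free_module R X)"
  show "free_map R' X R Y \<phi> f (u \<oplus>\<^bsub>free_module R X\<^esub> v) =
      free_map R' X R Y \<phi> f u \<oplus>\<^bsub>free_module R' Y\<^esub> free_map R' X R Y \<phi> f v"
    using u v by (simp add: free_map_eq R.free_add_closed R'.free_add fun_eq_iff additive_map_add[OF ladd])
qed

lemma free_map_basis:
  assumes f: "\<And>x. x \<in> X \<Longrightarrow> f x \<in> Y" and x: "x \<in> X" and c: "c \<in> carrier R"
  shows "free_map R' X R Y \<phi> f (c \<odot>\<^bsub>free_module R X\<^esub> basis_vec R X x)
       = \<phi> c \<odot>\<^bsub>free_module R' Y\<^esub> basis_vec R' Y (f x)"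
proof -
  have g: "additive_map R R' (\<lambda>c. if f x = y then \<phi> c else \<zero>\<^bsub>R'\<^esub>)" for x y
    using hom_additive by (auto simp: additive_map_def)
  have "c \<odot>\<^bsub>free_module R X\<^esub> basis_vec R X x \<in> carrier (free_module R X)"
    using x c by (simp add: R.free_smult_closed R.basis_vec_carrier)
  moreover have "\<phi> c \<in> carrier R'" using c additive_map_closed[OF hom_additive] by auto
  ultimately show ?thesis
    using x c by (auto simp: free_map_eq R.lin_ext_basis[OF R'.abelian_group_axioms g] R'.smult_basis_vec fun_eq_iff)
qed

end

text \<open>A map of rings changes the coefficients together with the Kaehler module, so the induced
  map of 1-forms is linear only along \<open>\<phi>\<close>.\<close>

locale semilinear_map = A: ext_algebra R N + B: ext_algebra R' N' + base_ring_hom R R' \<phi>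
  for R :: "'a ring" and N :: "('a, 'n) module" and R' :: "'b ring" and N' :: "('b, 'l) module" and \<phi> +
  fixes f :: "'n \<Rightarrow> 'l"
  assumes f_additive: "additive_map N N' f"
    and f_smult: "\<And>c u. c \<in> carrier R \<Longrightarrow> u \<in> carrier N \<Longrightarrow> f (c \<odot>\<^bsub>N\<^esub> u) = \<phi> c \<odot>\<^bsub>N'\<^esub> f u"
begin

definition ext_map :: "nat \<Rightarrow> ('n list \<Rightarrow> 'a) set \<Rightarrow> ('l list \<Rightarrow> 'b) set" where
  "ext_map k \<alpha> = (\<Union>v\<in>\<alpha>. ext_class R' N' k
        (free_map R' (tuples k (carrier N)) R (tuples k (carrier N')) \<phi> (map f) v))"

lemma f_closed: "u \<in> carrier N \<Longrightarrow> f u \<in> carrier N'"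
  using additive_map_closed[OF f_additive] .

lemma \<phi>_closed: "c \<in> carrier R \<Longrightarrow> \<phi> c \<in> carrier R'"
  using additive_map_closed[OF hom_additive] .

lemma class_free_map_additive:
  "additive_map (ext_free R N k) (ext_power R' N' k)
     (\<lambda>v. ext_class R' N' k (free_map R' (tuples k (carrier N)) R (tuples k (carrier N')) \<phi> (map f) v))"
  using additive_map_comp[OF free_map_additive[of "tuples k (carrier N)" "map f" "tuples k (carrier N')"]
      B.ext_class_additive[of k, unfolded ext_free_def]]
  by (simp add: ext_free_def tuples_map f_closed)

lemma class_free_map_simple:
  assumes "c \<in> carrier R" "ws \<in> tuples k (carrier N)"
  shows "ext_class R' N' k (free_map R' (tuples k (carrier N)) R (tuples k (carrier N')) \<phi> (map f) (A.simple k c ws))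
    = B.tens (\<phi> c) (map f ws)"
  using assms
  by (simp add: ext_free_def free_map_basis tuples_map f_closed B.tens_eq[OF tuples_map[where B = "carrier N'"]])

lemma class_free_map_kills:
  assumes "h \<in> ext_span R N k"
  shows "ext_class R' N' k (free_map R' (tuples k (carrier N)) R (tuples k (carrier N')) \<phi> (map f) h)
    = \<zero>\<^bsub>ext_power R' N' k\<^esub>"
proof (rule A.additive_kills_ext_span[OF B.ext_power_abelian_group class_free_map_additive _ _ _ assms])
  fix c ws i assume c: "c \<in> carrier R" and ws: "ws \<in> tuples k (carrier N)"
  have ws': "map f ws \<in> tuples k (carrier N')"
    using ws by (rule tuples_map) (rule f_closed)
  note [simp] = class_free_map_simple[OF _ tuples_update] map_update f_closed \<phi>_closed
  let ?F = "\<lambda>v. ext_class R' N' k (free_map R' (tuples k (carrier N)) R (tuples k (carrier N')) \<phi> (map f) v)"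
  {
    fix u v assume "i < k" "u \<in> carrier N" "v \<in> carrier N"
    then show "?F (A.simple k c (ws[i := u \<oplus>\<^bsub>N\<^esub> v])) =
      ?F (A.simple k c (ws[i := u])) \<oplus>\<^bsub>ext_power R' N' k\<^esub> ?F (A.simple k c (ws[i := v]))"
      using c ws by (simp add: additive_map_add[OF f_additive] B.tens_slot_add[OF _ ws'])
  next
    fix a u assume "i < k" "a \<in> carrier R" "u \<in> carrier N"
    moreover have "\<phi> (c \<otimes>\<^bsub>R\<^esub> a) = \<phi> c \<otimes>\<^bsub>R'\<^esub> \<phi> a" if "a \<in> carrier R" for a
      using hom c that by (simp add: ring_hom_def)
    ultimately show "?F (A.simple k c (ws[i := a \<odot>\<^bsub>N\<^esub> u])) = ?F (A.simple k (c \<otimes>\<^bsub>R\<^esub> a) (ws[i := u]))"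
      using c ws by (simp add: f_smult B.tens_slot_smult[OF _ ws'])
  next
    fix j assume ij: "i < j" "j < k" "ws ! i = ws ! j"
    have "B.tens (\<phi> c) (map f ws) = \<zero>\<^bsub>ext_power R' N' k\<^esub>"
      by (rule B.tens_alt[OF _ ws', of _ i j]) (use ij c ws in \<open>auto simp: tuples_length\<close>)
    then show "?F (A.simple k c ws) = \<zero>\<^bsub>ext_power R' N' k\<^esub>"
      using c ws by (simp add: class_free_map_simple)
  }
qed

lemma ext_map_class:
  assumes v: "v \<in> carrier (ext_free R N k)"
  shows "ext_map k (ext_class R N k v) =
    ext_class R' N' k (free_map R' (tuples k (carrier N)) R (tuples k (carrier N')) \<phi> (map f) v)"
  unfolding ext_map_def
  using A.const_on_ext_class[OF B.ext_power_abelian_group class_free_map_additive class_free_map_kills v]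
    A.ext_class_self[OF v] by blast

lemma ext_map_additive: "additive_map (ext_power R N k) (ext_power R' N' k) (ext_map k)"
proof (rule additive_mapI)
  interpret E: module R "ext_free R N k" by (rule A.ext_free_module)
  fix \<alpha> assume "\<alpha> \<in> carrier (ext_power R N k)"
  then obtain v where v: "v \<in> carrier (ext_free R N k)" "\<alpha> = ext_class R N k v"
    by (rule A.ext_power_cases)
  show "ext_map k \<alpha> \<in> carrier (ext_power R' N' k)"
    using v additive_map_closed[OF class_free_map_additive v(1)] by (simp add: ext_map_class)
  fix \<alpha>' assume "\<alpha>' \<in> carrier (ext_power R N k)"
  then obtain v' where v': "v' \<in> carrier (ext_free R N k)" "\<alpha>' = ext_class R N k v'"
    by (rule A.ext_power_cases)
  show "ext_map k (\<alpha> \<oplus>\<^bsub>ext_power R N k\<^esub> \<alpha>') = ext_map k \<alpha> \<oplus>\<^bsub>ext_power R' N' k\<^esub> ext_map k \<alpha>'"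
    using v v' by (simp add: additive_map_add[OF A.ext_class_additive, symmetric] ext_map_class E.a_closed
        additive_map_add[OF class_free_map_additive])
qed

lemma ext_map_tens:
  "c \<in> carrier R \<Longrightarrow> ws \<in> tuples k (carrier N) \<Longrightarrow> ext_map k (A.tens c ws) = B.tens (\<phi> c) (map f ws)"
  unfolding A.tens_eq[of ws k] by (subst ext_map_class) (simp_all add: A.simple_closed class_free_map_simple)

end

section \<open>Smooth functions in coordinates\<close>

lemma mem_euclid: "x \<in> euclid n \<longleftrightarrow> (\<forall>i\<ge>n. x i = 0)"
  by (simp add: topspace_Euclidean_space)

lemma euclid_upd: "x \<in> euclid n \<Longrightarrow> i < n \<Longrightarrow> x(i := t) \<in> euclid n"
  by (auto simp: mem_euclid)

lemma Euclidean_space_top_of_set: "Euclidean_space n = top_of_set {x. \<forall>i\<ge>n. x i = 0}"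
  by (simp add: Euclidean_space_def euclidean_product_topology)

lemma openin_Euclidean_space_iff:
  "openin (Euclidean_space n) V \<longleftrightarrow> (\<exists>W. open W \<and> V = euclid n \<inter> W)"
  by (auto simp: Euclidean_space_top_of_set openin_open)

lemma openin_euclid_subset: "openin (Euclidean_space n) V \<Longrightarrow> x \<in> V \<Longrightarrow> x \<in> euclid n"
  by (meson openin_subset subsetD)

lemma tendsto_fun_componentwise:
  fixes c :: "'x \<Rightarrow> nat \<Rightarrow> real"
  assumes "\<And>i. ((\<lambda>t. c t i) \<longlongrightarrow> x i) F"
  shows "(c \<longlongrightarrow> x) F"
proof -
  have "limitin (powertop_real UNIV) c x F"
    using assms by (auto simp: limitin_componentwise)
  then show ?thesis
    by (simp add: euclidean_product_topology)
qed

text \<open>Only the first \<open>n\<close> coordinates have to converge, since the remaining ones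
  vanish both at \<open>x\<close> and, eventually, along \<open>c\<close>.\<close>

lemma eventually_in_open:
  assumes V: "openin (Euclidean_space n) V" "x \<in> V"
    and c: "\<And>i. i < n \<Longrightarrow> ((\<lambda>t. c t i) \<longlongrightarrow> x i) F"
    and E: "eventually (\<lambda>t. c t \<in> euclid n) F"
  shows "eventually (\<lambda>t. c t \<in> V) F"
proof -
  obtain W where W: "open W" "V = euclid n \<inter> W"
    using V by (auto simp: openin_Euclidean_space_iff)
  have "(c \<longlongrightarrow> x) F"
  proof (rule tendsto_fun_componentwise)
    fix i show "((\<lambda>t. c t i) \<longlongrightarrow> x i) F"
    proof (cases "i < n")
      case False
      have "eventually (\<lambda>t. x i = c t i) F"
        using E by eventually_elim (use False V W in \<open>auto simp: mem_euclid\<close>)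
      then show ?thesis by (rule tendsto_eventually[OF eventually_mono]) auto
    qed (use c in auto)
  qed
  then have "eventually (\<lambda>t. c t \<in> W) F"
    using W V by (auto simp: tendsto_def)
  with E show ?thesis
    by eventually_elim (use W in auto)
qed

lemma continuous_map_Euclidean_iff:
  assumes "V \<subseteq> euclid n"
  shows "continuous_map (subtopology (Euclidean_space n) V) euclideanreal f \<longleftrightarrow> continuous_on V f"
  using assms by (simp add: Euclidean_space_top_of_set subtopology_subtopology Int_absorb1 Int_absorb2)

lemma eventually_upd_in_open:
  assumes "openin (Euclidean_space n) V" "x \<in> V" "i < n"
  shows "eventually (\<lambda>t. x(i := t) \<in> V) (nhds (x i))"
proof (rule eventually_in_open[OF assms(1,2)])
  show "((\<lambda>t. (x(i := t)) l) \<longlongrightarrow> x l) (nhds (x i))" for l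
    by (cases "l = i") (auto intro: filterlim_ident)
  show "\<forall>\<^sub>F t in nhds (x i). x(i := t) \<in> euclid n"
    using openin_euclid_subset[OF assms(1,2)] assms(3) by (simp add: euclid_upd)
qed

lemma partial_derivI:
  "((\<lambda>t. f (x(i := t))) has_real_derivative D) (at (x i)) \<Longrightarrow> partial_deriv i f x = D"
  unfolding partial_deriv_def by (rule DERIV_imp_deriv)

lemma has_partial_deriv:
  assumes "(\<lambda>t. f (x(i := t))) differentiable (at (x i))"
  shows "((\<lambda>t. f (x(i := t))) has_real_derivative partial_deriv i f x) (at (x i))"
  unfolding partial_deriv_def using assms DERIV_deriv_iff_real_differentiable by blast

lemma partial_deriv_cong:
  assumes V: "openin (Euclidean_space n) V" "x \<in> V" "i < n" and eq: "\<And>y. y \<in> V \<Longrightarrow> f y = g y"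
  shows "partial_deriv i f x = partial_deriv i g x"
  unfolding partial_deriv_def
  by (rule deriv_cong_ev) (use eventually_upd_in_open[OF V] in \<open>auto elim!: eventually_mono intro: eq\<close>)

lemma partial_differentiable_cong:
  fixes f g :: "(nat \<Rightarrow> real) \<Rightarrow> real"
  assumes V: "openin (Euclidean_space n) V" "x \<in> V" "i < n" and eq: "\<And>y. y \<in> V \<Longrightarrow> f y = g y"
  shows "(\<lambda>t. f (x(i := t))) differentiable (at (x i)) \<longleftrightarrow> (\<lambda>t. g (x(i := t))) differentiable (at (x i))"
proof -
  have ev: "eventually (\<lambda>t. f (x(i := t)) = g (x(i := t))) (nhds (x i))"
    using eventually_upd_in_open[OF V] by eventually_elim (rule eq)
  have "((\<lambda>t. f (x(i := t))) has_real_derivative D) (at (x i)) \<longleftrightarrow>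
        ((\<lambda>t. g (x(i := t))) has_real_derivative D) (at (x i))" for D
    by (rule DERIV_cong_ev[OF refl ev refl])
  then show ?thesis by (auto simp: real_differentiable_def)
qed

subsection \<open>The chain rule along a path\<close>

text \<open>Only partial derivatives and their continuity are given, so no total derivative of
  \<open>f\<close> is available beforehand. The induction frees the coordinates of the path one at a
  time: \<open>m\<close> counts those that may move.\<close>

lemma chain_rule_path:
  assumes V: "openin (Euclidean_space n) V" and x: "x \<in> V"
    and diff: "\<And>i y. i < n \<Longrightarrow> y \<in> V \<Longrightarrow> (\<lambda>t. f (y(i := t))) differentiable (at (y i))"
    and cont: "\<And>i. i < n \<Longrightarrow> continuous_on V (partial_deriv i f)"
  shows "m \<le> n \<Longrightarrow> c t0 = x \<Longrightarrow> (\<And>t. c t \<in> euclid n) \<Longrightarrow> (\<And>t i. m \<le> i \<Longrightarrow> c t i = x i) \<Longrightarrow>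
     (\<And>i. i < m \<Longrightarrow> ((\<lambda>t. c t i) has_real_derivative c' i) (at t0)) \<Longrightarrow>
     ((\<lambda>t. f (c t)) has_real_derivative (\<Sum>i<m. partial_deriv i f x * c' i)) (at t0)"
proof (induction m arbitrary: c)
  case 0
  then have "c t = x" for t by (auto simp: fun_eq_iff)
  then show ?case by simp
next
  case (Suc m)
  note c0 = Suc.prems(2) and cE = Suc.prems(3) and cx = Suc.prems(4) and cd = Suc.prems(5)
  have mn: "m < n" using Suc.prems by simp
  define c1 where "c1 t = (c t)(m := x m)" for t
  have IH: "((\<lambda>t. f (c1 t)) has_real_derivative (\<Sum>i<m. partial_deriv i f x * c' i)) (at t0)"
  proof (rule Suc.IH)
    show "c1 t i = x i" if "m \<le> i" for t i
      using that cx[of i t] by (auto simp: c1_def)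
    show "((\<lambda>t. c1 t i) has_real_derivative c' i) (at t0)" if "i < m" for i
      using cd[of i] that by (simp add: c1_def)
  qed (use c0 cE mn in \<open>auto simp: c1_def euclid_upd simp del: fun_upd_apply\<close>)
  \<comment> \<open>Coordinate \<open>m\<close> gets a parameter of its own. With that parameter
    fixed at \<open>x m\<close>, the derivative in \<open>t\<close> is the induction hypothesis; in
    the new parameter it is a partial derivative that is continuous at the point. Together they make
    \<open>f \<circ> h\<close> differentiable, and the given path is its restriction to
    \<open>t \<mapsto> (t, c t m)\<close>.\<close>
  define h where "h = (\<lambda>p::real \<times> real. (c (fst p))(m := snd p))"
  have h0: "h (t0, x m) = x" by (simp add: h_def c0)
  have cl: "((\<lambda>t. c t i) \<longlongrightarrow> x i) (nhds t0)" for i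
  proof (cases "i < Suc m")
    case True
    from DERIV_isCont[OF cd[OF True]] have "((\<lambda>t. c t i) \<longlongrightarrow> c t0 i) (nhds t0)"
      unfolding isCont_def using tendsto_at_iff_tendsto_nhds[of "\<lambda>t. c t i" t0] by blast
    then show ?thesis by (simp add: c0)
  qed (use cx in auto)
  have hl: "((\<lambda>p. h p i) \<longlongrightarrow> x i) (nhds (t0, x m))" for i
  proof -
    have "((\<lambda>p. c (fst p) i) \<longlongrightarrow> x i) (nhds (t0, x m))"
      by (rule filterlim_compose[OF cl]) (auto intro!: tendsto_eq_intros filterlim_ident)
    moreover have "((\<lambda>p::real\<times>real. snd p) \<longlongrightarrow> x m) (nhds (t0, x m))"
      by (auto intro!: tendsto_eq_intros filterlim_ident)
    ultimately show ?thesis by (cases "i = m") (simp_all add: h_def)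
  qed
  have hE: "h p \<in> euclid n" for p
    using cE mn by (simp add: h_def euclid_upd)
  have "eventually (\<lambda>p. h p \<in> V) (nhds (t0, x m))"
    by (rule eventually_in_open[OF V x]) (use hl hE in auto)
  then obtain S where S: "open S" "(t0, x m) \<in> S" "\<And>p. p \<in> S \<Longrightarrow> h p \<in> V"
    by (auto simp: eventually_nhds)
  from open_prod_elim[OF S(1,2)] obtain A B where AB: "open A" "open B" "(t0, x m) \<in> A \<times> B" "A \<times> B \<subseteq> S"
    by blast
  obtain e where e: "e > 0" "ball (x m) e \<subseteq> B"
    using AB(2,3) openE by blast
  define B' where "B' = ball (x m) e"
  have B': "open B'" "convex B'" "x m \<in> B'" "A \<times> B' \<subseteq> S"
    using AB e by (auto simp: B'_def)
  have hV: "h (t, s) \<in> V" if "t \<in> A" "s \<in> B'" for t s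
    using that B'(4) S(3) by auto
  have tot: "((\<lambda>(t, s). f (h (t, s))) has_derivative
      (\<lambda>(dt, ds). (\<Sum>i<m. partial_deriv i f x * c' i) * dt + blinfun_scaleR_left (partial_deriv m f (h (t0, x m))) ds))
      (at (t0, x m) within A \<times> B')"
  proof (rule has_derivative_partialsI)
    show "((\<lambda>t. f (h (t, x m))) has_derivative (\<lambda>dt. (\<Sum>i<m. partial_deriv i f x * c' i) * dt)) (at t0 within A)"
      using IH by (auto simp: h_def c1_def has_field_derivative_def intro: has_derivative_at_withinI)
    fix t s assume ts: "t \<in> A" "s \<in> B'"
    have "((\<lambda>u. f ((h (t, s))(m := u))) has_real_derivative partial_deriv m f (h (t, s))) (at (h (t, s) m))"
      by (rule has_partial_deriv[OF diff[OF mn hV[OF ts]]])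
    then have "((\<lambda>s. f (h (t, s))) has_real_derivative partial_deriv m f (h (t, s))) (at s)"
      by (simp add: h_def)
    then show "((\<lambda>s. f (h (t, s))) has_derivative blinfun_apply (blinfun_scaleR_left (partial_deriv m f (h (t, s))))) (at s within B')"
      by (auto simp: has_field_derivative_def mult.commute[of _ "partial_deriv _ _ _"] intro!: has_derivative_at_withinI
          elim!: has_derivative_eq_rhs)
  next
    have "((\<lambda>p. partial_deriv m f (h p)) \<longlongrightarrow> partial_deriv m f (h (t0, x m))) (at (t0, x m) within A \<times> B')"
    proof -
      have lim: "(h \<longlongrightarrow> x) (at (t0, x m) within A \<times> B')"
        by (rule tendsto_fun_componentwise, rule tendsto_mono[OF _ hl]) (simp add: at_within_def)
      have "(partial_deriv m f \<longlongrightarrow> partial_deriv m f x) (at x within V)"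
        using cont[OF mn] x by (simp add: continuous_on_def)
      moreover have "eventually (\<lambda>p. h p \<in> V) (at (t0, x m) within A \<times> B')"
        unfolding eventually_at_filter by (rule always_eventually) (use hV in auto)
      ultimately show ?thesis
        using continuous_on_tendsto_compose[OF cont[OF mn] lim x] by (simp add: h0)
    qed
    then show "continuous (at (t0, x m) within A \<times> B') (\<lambda>(t, s). blinfun_scaleR_left (partial_deriv m f (h (t, s))))"
      unfolding continuous_within case_prod_unfold
      by (auto intro!: bounded_linear.tendsto[OF bounded_linear_blinfun_scaleR_left])
  qed (use B' in auto)
  moreover have op: "open (A \<times> B')" "(t0, x m) \<in> A \<times> B'"
    using AB B' by (auto intro: open_Times)
  ultimately have tot': "((\<lambda>p. f (h p)) has_derivative
      (\<lambda>(dt, ds). (\<Sum>i<m. partial_deriv i f x * c' i) * dt + ds * partial_deriv m f x)) (at (t0, x m))"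
    unfolding at_within_open[OF op(2,1)] h0 by (simp only: case_prod_unfold prod.collapse blinfun_scaleR_left.rep_eq real_scaleR_def)
  have "((\<lambda>t. (t, c t m)) has_derivative (\<lambda>dt. (dt, c' m * dt))) (at t0)"
    using cd[of m] by (auto intro!: has_derivative_Pair simp: has_field_derivative_def)
  from has_derivative_compose[OF this, of "\<lambda>p. f (h p)", unfolded c0, OF tot']
  have "((\<lambda>t. f (h (t, c t m))) has_derivative
      (\<lambda>dt. (\<Sum>i<m. partial_deriv i f x * c' i) * dt + (c' m * dt) * partial_deriv m f x)) (at t0)"
    by simp
  moreover have "h (t, c t m) = c t" for t by (simp add: h_def)
  ultimately show ?case
    by (auto simp: has_field_derivative_def algebra_simps elim!: has_derivative_eq_rhs)
qed

subsection \<open>Functions of class \<open>C\<^sup>m\<close>\<close>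

text \<open>\<open>smooth_on_open\<close> quantifies over all lists of derivatives at once. With a
  finite order, closure under products and composition is an induction on the order, each
  differentiation lowering it by one.\<close>

fun Ck :: "nat \<Rightarrow> nat \<Rightarrow> (nat \<Rightarrow> real) set \<Rightarrow> ((nat \<Rightarrow> real) \<Rightarrow> real) \<Rightarrow> bool" where
  "Ck 0 n V f \<longleftrightarrow> continuous_on V f"
| "Ck (Suc m) n V f \<longleftrightarrow> continuous_on V f \<and>
     (\<forall>i<n. (\<forall>x\<in>V. (\<lambda>t. f (x(i := t))) differentiable (at (x i))) \<and> Ck m n V (partial_deriv i f))"

lemma Ck_continuous: "Ck m n V f \<Longrightarrow> continuous_on V f"
  by (cases m) auto

lemma Ck_Suc_imp: "Ck (Suc m) n V f \<Longrightarrow> Ck m n V f"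
  by (induction m arbitrary: f) auto

lemma smooth_on_open_iff: "smooth_on_open n V f \<longleftrightarrow> openin (Euclidean_space n) V \<and> (\<forall>m. Ck m n V f)"
proof (cases "openin (Euclidean_space n) V")
  case True
  then have V: "V \<subseteq> euclid n" by (rule openin_subset)
  define Pd where "Pd f \<longleftrightarrow> continuous_on V f \<and> (\<forall>i<n. \<forall>x\<in>V. (\<lambda>t. f (x(i := t))) differentiable (at (x i)))"
    for f :: "(nat \<Rightarrow> real) \<Rightarrow> real"
  have eq: "smooth_on_open n V f \<longleftrightarrow> (\<forall>is. set is \<subseteq> {..<n} \<longrightarrow> Pd (foldr partial_deriv is f))"
    unfolding smooth_on_open_def Pd_def continuous_map_Euclidean_iff[OF V] using True by blast
  have "Ck m n V f" if "\<And>is. set is \<subseteq> {..<n} \<Longrightarrow> Pd (foldr partial_deriv is f)" for m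
    using that
  proof (induction m arbitrary: f)
    case 0
    from 0[of "[]"] show ?case by (simp add: Pd_def)
  next
    case (Suc m)
    have "Ck m n V (partial_deriv i f)" if "i < n" for i
    proof (rule Suc.IH)
      fix "is" assume "set is \<subseteq> {..<n}"
      with Suc.prems[of "is @ [i]"] that show "Pd (foldr partial_deriv is (partial_deriv i f))" by simp
    qed
    with Suc.prems[of "[]"] show ?case by (simp add: Pd_def)
  qed
  moreover have "Pd (foldr partial_deriv is f)" if "\<And>m. Ck m n V f" "set is \<subseteq> {..<n}" for "is"
    using that
  \<comment> \<open>\<open>foldr\<close> applies the last index of the list first, so the list is
    taken apart from its end.\<close>
  proof (induction "is" arbitrary: f rule: rev_induct)
    case Nil
    from Nil(1)[of "Suc 0"] show ?case by (simp add: Pd_def)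
  next
    case (snoc i "is")
    have "Ck m n V (partial_deriv i f)" for m
      using snoc.prems(1)[of "Suc m"] snoc.prems(2) by simp
    with snoc show ?case by simp
  qed
  ultimately show ?thesis using True eq by blast
qed (simp add: smooth_on_open_def)

context
  fixes n V
  assumes V: "openin (Euclidean_space n) V"
begin

lemma Ck_cong_imp: "Ck m n V f \<Longrightarrow> (\<And>x. x \<in> V \<Longrightarrow> f x = g x) \<Longrightarrow> Ck m n V g"
proof (induction m arbitrary: f g)
  case 0
  then show ?case using continuous_on_cong[of V V f g] by simp
next
  case (Suc m)
  have "Ck m n V (partial_deriv i g)" if "i < n" for i
    by (rule Suc.IH[of "partial_deriv i f"]) (use Suc.prems that partial_deriv_cong[OF V _ that, of _ f g] in auto)
  moreover have "(\<lambda>t. g (x(i := t))) differentiable (at (x i))" if "x \<in> V" "i < n" for x i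
    using partial_differentiable_cong[OF V that, of f g] Suc.prems that by auto
  moreover have "continuous_on V g"
    using Suc.prems continuous_on_cong[of V V f g] by simp
  ultimately show ?case by simp
qed

text \<open>Any formula \<open>D\<close> for the partial derivatives on \<open>V\<close> may replace
  \<open>partial_deriv\<close>, because the condition depends only on values on the open set
  \<open>V\<close>.\<close>

lemma Ck_SucI:
  assumes "continuous_on V f"
    and "\<And>i x. i < n \<Longrightarrow> x \<in> V \<Longrightarrow> ((\<lambda>t. f (x(i := t))) has_real_derivative D i x) (at (x i))"
    and "\<And>i. i < n \<Longrightarrow> Ck m n V (D i)"
  shows "Ck (Suc m) n V f"
proof -
  have "Ck m n V (partial_deriv i f)" if "i < n" for i
    by (rule Ck_cong_imp[OF assms(3)[OF that]]) (metis partial_derivI assms(2) that)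
  then show ?thesis
    using assms(1,2) by (auto simp: real_differentiable_def)
qed

lemma Ck_partial:
  "Ck (Suc m) n V f \<Longrightarrow> i < n \<Longrightarrow> x \<in> V \<Longrightarrow> ((\<lambda>t. f (x(i := t))) has_real_derivative partial_deriv i f x) (at (x i))"
  by (auto intro: has_partial_deriv)

lemma Ck_const: "Ck m n V (\<lambda>x. c)"
proof (induction m arbitrary: c)
  case (Suc m)
  show ?case by (rule Ck_SucI[where D = "\<lambda>_ _. 0"]) (auto intro: Suc)
qed auto

lemma Ck_coord: "Ck m n V (\<lambda>x. x j)"
proof (cases m)
  case 0
  then show ?thesis by (auto intro: continuous_on_subset[OF continuous_on_product_coordinates])
next
  case (Suc m)
  have "Ck (Suc m) n V (\<lambda>x. x j)"
  proof (rule Ck_SucI[where D = "\<lambda>i _. if i = j then 1 else 0"])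
    show "continuous_on V (\<lambda>x. x j)"
      by (auto intro: continuous_on_subset[OF continuous_on_product_coordinates])
    fix i and x :: "nat \<Rightarrow> real"
    show "((\<lambda>t. (x(i := t)) j) has_real_derivative (if i = j then 1 else 0)) (at (x i))"
      by (cases "i = j") auto
  qed (rule Ck_const)
  then show ?thesis using Suc by simp
qed

lemma Ck_add: "Ck m n V f \<Longrightarrow> Ck m n V g \<Longrightarrow> Ck m n V (\<lambda>x. f x + g x)"
proof (induction m arbitrary: f g)
  case (Suc m)
  show ?case
    by (rule Ck_SucI[where D = "\<lambda>i x. partial_deriv i f x + partial_deriv i g x"])
       (use Suc in \<open>auto intro!: continuous_on_add DERIV_add has_partial_deriv simp del: fun_upd_apply\<close>)
qed (auto intro: continuous_on_add)

lemma Ck_mult: "Ck m n V f \<Longrightarrow> Ck m n V g \<Longrightarrow> Ck m n V (\<lambda>x. f x * g x)"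
proof (induction m arbitrary: f g)
  case (Suc m)
  show ?case
  proof (rule Ck_SucI[where D = "\<lambda>i x. partial_deriv i f x * g x + partial_deriv i g x * f x"])
    fix i and x :: "nat \<Rightarrow> real"
    assume ix: "i < n" "x \<in> V"
    show "((\<lambda>t. f (x(i := t)) * g (x(i := t))) has_real_derivative
        partial_deriv i f x * g x + partial_deriv i g x * f x) (at (x i))"
      using DERIV_mult[OF Ck_partial[OF Suc.prems(1) ix] Ck_partial[OF Suc.prems(2) ix]]
      by (simp del: fun_upd_apply)
  next
    fix i assume i: "i < n"
    show "Ck m n V (\<lambda>x. partial_deriv i f x * g x + partial_deriv i g x * f x)"
      by (intro Ck_add Suc.IH) (use Suc.prems i Ck_Suc_imp in auto)
  qed (use Suc.prems in \<open>auto intro: continuous_on_mult\<close>)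
qed (auto intro: continuous_on_mult)

lemma Ck_sum: "(\<And>i. i \<in> I \<Longrightarrow> Ck m n V (f i)) \<Longrightarrow> Ck m n V (\<lambda>x. \<Sum>i\<in>I. f i x)"
  by (induction I rule: infinite_finite_induct) (auto intro: Ck_const Ck_add)

lemma Ck_subset:
  assumes "openin (Euclidean_space n) W" "W \<subseteq> V"
  shows "Ck m n V f \<Longrightarrow> Ck m n W f"
  by (induction m arbitrary: f) (use assms in \<open>auto intro: continuous_on_subset\<close>)

lemma composite_partial:
  assumes W: "openin (Euclidean_space p) W" and H: "\<And>x. x \<in> V \<Longrightarrow> (\<lambda>l. if l < p then H l x else 0) \<in> W"
    and g: "Ck (Suc 0) p W g" and x: "x \<in> V" and i: "i < n"
    and dH: "\<And>l. l < p \<Longrightarrow> ((\<lambda>t. H l (x(i := t))) has_real_derivative D l) (at (x i))"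
  shows "((\<lambda>t. g (\<lambda>l. if l < p then H l (x(i := t)) else 0)) has_real_derivative
    (\<Sum>l<p. partial_deriv l g (\<lambda>l. if l < p then H l x else 0) * D l)) (at (x i))"
  by (rule chain_rule_path[OF W H[OF x]])
     (use g dH in \<open>auto simp: mem_euclid simp del: fun_upd_apply\<close>)

text \<open>By the chain rule, a partial derivative of the composite is a sum of products in which
  partial derivatives of \<open>g\<close> are composed with the same \<open>H\<close>. The induction
  is therefore on \<open>g\<close>, with \<open>H\<close> fixed. The value 0 from index
  \<open>p\<close> on places the argument in \<open>\<real>\<^sup>p\<close>.\<close>

lemma Ck_compose:
  assumes W: "openin (Euclidean_space p) W" and HW: "\<And>x. x \<in> V \<Longrightarrow> (\<lambda>l. if l < p then H l x else 0) \<in> W"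
  shows "Ck m p W g \<Longrightarrow> (\<And>l. l < p \<Longrightarrow> Ck m n V (H l)) \<Longrightarrow> Ck m n V (\<lambda>x. g (\<lambda>l. if l < p then H l x else 0))"
proof (induction m arbitrary: g)
  case 0
  have "continuous_on V (\<lambda>x. if l < p then H l x else 0)" for l
    using 0 by (cases "l < p") auto
  then show ?case
    using 0 by (auto intro!: continuous_on_compose2[of W g V] continuous_on_coordinatewise_then_product HW)
next
  case (Suc m)
  have "continuous_on V (\<lambda>x. if l < p then H l x else 0)" for l
    using Suc.prems(2)[of l] by (cases "l < p") auto
  then have c: "continuous_on V (\<lambda>x. g (\<lambda>l. if l < p then H l x else 0))"
    using Suc.prems(1)
    by (auto intro!: continuous_on_compose2[of W g V] continuous_on_coordinatewise_then_product HW)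
  have "continuous_on W (partial_deriv i g)" if "i < p" for i
    using Suc.prems(1) that by (intro Ck_continuous[of m p]) simp
  then have g1: "Ck (Suc 0) p W g" using Suc.prems(1) by simp
  show ?case
  proof (rule Ck_SucI[where D = "\<lambda>i x. \<Sum>l<p. partial_deriv l g (\<lambda>l. if l < p then H l x else 0) * partial_deriv i (H l) x"])
    fix i assume i: "i < n"
    show "Ck m n V (\<lambda>x. \<Sum>l<p. partial_deriv l g (\<lambda>l. if l < p then H l x else 0) * partial_deriv i (H l) x)"
    proof (intro Ck_sum Ck_mult Suc.IH)
      fix l l' assume l: "l \<in> {..<p}"
      show "Ck m p W (partial_deriv l g)" using Suc.prems(1) l by simp
      show "Ck m n V (partial_deriv i (H l))" using Suc.prems(2) l i by simp
      show "l' < p \<Longrightarrow> Ck m n V (H l')" by (rule Ck_Suc_imp) (rule Suc.prems(2))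
    qed
    fix x assume x: "x \<in> V"
    show "((\<lambda>t. g (\<lambda>l. if l < p then H l (x(i := t)) else 0)) has_real_derivative
      (\<Sum>l<p. partial_deriv l g (\<lambda>l. if l < p then H l x else 0) * partial_deriv i (H l) x)) (at (x i))"
      by (rule composite_partial[OF W HW g1 x i])
         (use Suc.prems(2) i x in \<open>auto intro!: has_partial_deriv simp del: fun_upd_apply\<close>)
  qed (rule c)
qed

end

subsection \<open>Symmetry of second derivatives\<close>

text \<open>The second difference of \<open>g\<close> over a square of side \<open>h\<close> equals,
  by the mean value theorem applied twice, \<open>h * h\<close> times a value of \<open>gst\<close>,
  and in the other order \<open>h * h\<close> times a value of \<open>gts\<close>. For small
  \<open>h\<close> both values are close to those at the corner, which excludes different
  limits.\<close>

lemma mixed_derivatives_eq: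
  fixes g gs gt gst gts :: "real \<Rightarrow> real \<Rightarrow> real"
  assumes d: "d > 0"
    and gs: "\<And>s t. \<bar>s - a\<bar> < d \<Longrightarrow> \<bar>t - b\<bar> < d \<Longrightarrow> ((\<lambda>s. g s t) has_real_derivative gs s t) (at s)"
    and gt: "\<And>s t. \<bar>s - a\<bar> < d \<Longrightarrow> \<bar>t - b\<bar> < d \<Longrightarrow> ((\<lambda>t. g s t) has_real_derivative gt s t) (at t)"
    and gst: "\<And>s t. \<bar>s - a\<bar> < d \<Longrightarrow> \<bar>t - b\<bar> < d \<Longrightarrow> ((\<lambda>t. gs s t) has_real_derivative gst s t) (at t)"
    and gts: "\<And>s t. \<bar>s - a\<bar> < d \<Longrightarrow> \<bar>t - b\<bar> < d \<Longrightarrow> ((\<lambda>s. gt s t) has_real_derivative gts s t) (at s)"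
    and cst: "((\<lambda>(s, t). gst s t) \<longlongrightarrow> gst a b) (nhds (a, b))"
    and cts: "((\<lambda>(s, t). gts s t) \<longlongrightarrow> gts a b) (nhds (a, b))"
  shows "gst a b = gts a b"
proof (rule ccontr)
  assume ne: "gst a b \<noteq> gts a b"
  define e where "e = \<bar>gst a b - gts a b\<bar> / 2"
  have e2: "\<bar>gst a b - gts a b\<bar> = 2 * e" by (simp add: e_def)
  have e: "e > 0" using ne by (simp add: e_def)
  have "eventually (\<lambda>p. dist (case p of (s, t) \<Rightarrow> gst s t) (gst a b) < e \<and> dist (case p of (s, t) \<Rightarrow> gts s t) (gts a b) < e) (nhds (a, b))"
    using tendstoD[OF cst e] tendstoD[OF cts e] by eventually_elim auto
  then obtain r where r: "r > 0" "\<And>p. dist p (a, b) < r \<Longrightarrow>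
      dist (case p of (s, t) \<Rightarrow> gst s t) (gst a b) < e \<and> dist (case p of (s, t) \<Rightarrow> gts s t) (gts a b) < e"
    unfolding eventually_nhds_metric by blast
  \<comment> \<open>The first bound keeps the square where the derivatives exist; the second makes
    the sum of the two coordinate distances, which bounds the distance to \<open>(a, b)\<close>,
    less than \<open>r\<close>.\<close>
  define h where "h = min (d / 2) (r / 4)"
  have h: "h > 0" "h < d" "2 * h < r" using d r by (auto simp: h_def)
  have near: "dist (s, t) (a, b) < r" if "a < s" "s < a + h" "b < t" "t < b + h" for s t
  proof -
    have "dist (s, t) (a, b) \<le> \<bar>s - a\<bar> + \<bar>t - b\<bar>"
      by (simp add: dist_Pair_Pair dist_real_def sqrt_sum_squares_le_sum_abs)
    then show ?thesis using that h by linarith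
  qed
  have "\<exists>s>a. s < a + h \<and> (g (a + h) (b + h) - g (a + h) b) - (g a (b + h) - g a b) = (a + h - a) * (gs s (b + h) - gs s b)"
    by (rule MVT2) (use h in \<open>auto intro!: DERIV_diff gs\<close>)
  then obtain s1 where s1: "s1 > a" "s1 < a + h"
    "(g (a + h) (b + h) - g (a + h) b) - (g a (b + h) - g a b) = h * (gs s1 (b + h) - gs s1 b)" by auto
  have "\<exists>t>b. t < b + h \<and> gs s1 (b + h) - gs s1 b = (b + h - b) * gst s1 t"
    by (rule MVT2) (use h s1 in \<open>auto intro!: gst\<close>)
  then obtain t1 where t1: "t1 > b" "t1 < b + h" "gs s1 (b + h) - gs s1 b = h * gst s1 t1" by auto
  have "\<exists>t>b. t < b + h \<and> (g (a + h) (b + h) - g a (b + h)) - (g (a + h) b - g a b) = (b + h - b) * (gt (a + h) t - gt a t)"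
    by (rule MVT2) (use h in \<open>auto intro!: DERIV_diff gt\<close>)
  then obtain t2 where t2: "t2 > b" "t2 < b + h"
    "(g (a + h) (b + h) - g a (b + h)) - (g (a + h) b - g a b) = h * (gt (a + h) t2 - gt a t2)" by auto
  have "\<exists>s>a. s < a + h \<and> gt (a + h) t2 - gt a t2 = (a + h - a) * gts s t2"
    by (rule MVT2) (use h t2 in \<open>auto intro!: gts\<close>)
  then obtain s2 where s2: "s2 > a" "s2 < a + h" "gt (a + h) t2 - gt a t2 = h * gts s2 t2" by auto
  have "h * (h * gst s1 t1) = h * (h * gts s2 t2)"
    using s1(3) t1(3) t2(3) s2(3) by (simp add: algebra_simps)
  then have "gst s1 t1 = gts s2 t2" using h by simp
  moreover have "dist (gst s1 t1) (gst a b) < e" "dist (gts s2 t2) (gts a b) < e"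
    using r(2)[OF near[of s1 t1]] r(2)[OF near[of s2 t2]] s1 t1 s2 t2 by auto
  ultimately show False
    using e2 unfolding dist_real_def by linarith
qed

lemma partial_deriv_commute:
  assumes V: "openin (Euclidean_space n) V" and f: "Ck 2 n V f" and x: "x \<in> V" and ij: "i < n" "j < n"
  shows "partial_deriv i (partial_deriv j f) x = partial_deriv j (partial_deriv i f) x"
proof (cases "i = j")
  case False
  define h where "h = (\<lambda>p::real \<times> real. x(i := fst p, j := snd p))"
  have h0: "h (x i, x j) = x" by (simp add: h_def)
  have hl: "((\<lambda>p. h p l) \<longlongrightarrow> x l) (nhds (x i, x j))" for l
  proof -
    have "((\<lambda>p::real\<times>real. fst p) \<longlongrightarrow> x i) (nhds (x i, x j))" "((\<lambda>p::real\<times>real. snd p) \<longlongrightarrow> x j) (nhds (x i, x j))"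
      by (auto intro!: tendsto_eq_intros filterlim_ident)
    then show ?thesis using False by (cases "l = j"; cases "l = i") (simp_all add: h_def)
  qed
  have hE: "h p \<in> euclid n" for p
    using openin_euclid_subset[OF V x] ij by (simp add: h_def euclid_upd)
  have "eventually (\<lambda>p. h p \<in> V) (nhds (x i, x j))"
    by (rule eventually_in_open[OF V x]) (use hl hE in auto)
  then obtain r where r: "r > 0" "\<And>p. dist p (x i, x j) < r \<Longrightarrow> h p \<in> V"
    unfolding eventually_nhds_metric by blast
  have hV: "h (s, t) \<in> V" if "\<bar>s - x i\<bar> < r / 2" "\<bar>t - x j\<bar> < r / 2" for s t
  proof (rule r(2))
    have "dist (s, t) (x i, x j) \<le> \<bar>s - x i\<bar> + \<bar>t - x j\<bar>"
      by (simp add: dist_Pair_Pair dist_real_def sqrt_sum_squares_le_sum_abs)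
    then show "dist (s, t) (x i, x j) < r" using that by linarith
  qed
  have f2: "Ck (Suc (Suc 0)) n V f" using f by (simp add: numeral_2_eq_2)
  have f1: "Ck (Suc 0) n V f" by (rule Ck_Suc_imp[OF f2])
  have fp: "Ck (Suc 0) n V (partial_deriv l f)" if "l < n" for l using f2 that by simp
  have fpp: "continuous_on V (partial_deriv l (partial_deriv l' f))" if "l < n" "l' < n" for l l'
    using fp[OF that(2)] that by simp
  have Pi: "((\<lambda>s. q (h (s, t))) has_real_derivative partial_deriv i q (h (s, t))) (at s)"
    if "Ck (Suc 0) n V q" "\<bar>s - x i\<bar> < r / 2" "\<bar>t - x j\<bar> < r / 2" for q s t
    using Ck_partial[OF V that(1) ij(1) hV[OF that(2,3)]] False by (simp add: h_def fun_upd_twist)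
  have Pj: "((\<lambda>t. q (h (s, t))) has_real_derivative partial_deriv j q (h (s, t))) (at t)"
    if "Ck (Suc 0) n V q" "\<bar>s - x i\<bar> < r / 2" "\<bar>t - x j\<bar> < r / 2" for q s t
    using Ck_partial[OF V that(1) ij(2) hV[OF that(2,3)]] False by (simp add: h_def)
  have lim: "((\<lambda>(s, t). q (h (s, t))) \<longlongrightarrow> q (h (x i, x j))) (nhds (x i, x j))" if "continuous_on V q" for q
    using continuous_on_tendsto_compose[OF that tendsto_fun_componentwise[OF hl] x] r
    by (auto simp: h0 case_prod_unfold eventually_nhds_metric)
  have "partial_deriv j (partial_deriv i f) (h (x i, x j)) = partial_deriv i (partial_deriv j f) (h (x i, x j))"
    by (rule mixed_derivatives_eq[where d = "r / 2" and g = "\<lambda>s t. f (h (s, t))"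
          and gs = "\<lambda>s t. partial_deriv i f (h (s, t))" and gt = "\<lambda>s t. partial_deriv j f (h (s, t))"
          and gst = "\<lambda>s t. partial_deriv j (partial_deriv i f) (h (s, t))"
          and gts = "\<lambda>s t. partial_deriv i (partial_deriv j f) (h (s, t))"])
       (use r in simp, (rule Pi Pj f1 fp ij lim fpp; assumption?)+)
  then show ?thesis by (simp add: h0)
qed simp

subsection \<open>Smooth functions\<close>

lemma openin_euclid: "openin (Euclidean_space n) (euclid n)"
  by (rule openin_topspace)

lemma smooth_const: "openin (Euclidean_space n) V \<Longrightarrow> smooth_on_open n V (\<lambda>x. c)"
  by (simp add: smooth_on_open_iff Ck_const)

lemma smooth_coord: "openin (Euclidean_space n) V \<Longrightarrow> smooth_on_open n V (\<lambda>x. x i)"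
  by (simp add: smooth_on_open_iff Ck_coord)

lemma smooth_add: "smooth_on_open n V f \<Longrightarrow> smooth_on_open n V g \<Longrightarrow> smooth_on_open n V (\<lambda>x. f x + g x)"
  by (simp add: smooth_on_open_iff Ck_add)

lemma smooth_mult: "smooth_on_open n V f \<Longrightarrow> smooth_on_open n V g \<Longrightarrow> smooth_on_open n V (\<lambda>x. f x * g x)"
  by (simp add: smooth_on_open_iff Ck_mult)

lemma smooth_cong:
  "smooth_on_open n V f \<Longrightarrow> (\<And>x. x \<in> V \<Longrightarrow> f x = g x) \<Longrightarrow> smooth_on_open n V g"
  unfolding smooth_on_open_iff using Ck_cong_imp[of n V _ f g] by blast

lemma smooth_subset:
  "smooth_on_open n V f \<Longrightarrow> openin (Euclidean_space n) W \<Longrightarrow> W \<subseteq> V \<Longrightarrow> smooth_on_open n W f"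
  unfolding smooth_on_open_iff using Ck_subset[of n V W _ f] by blast

lemma smooth_partial: "smooth_on_open n V f \<Longrightarrow> i < n \<Longrightarrow> smooth_on_open n V (partial_deriv i f)"
  unfolding smooth_on_open_iff using Ck.simps(2)[of _ n V f] by blast

lemma smooth_compose:
  assumes V: "openin (Euclidean_space n) V"
    and "smooth_on_open p W g" "\<And>l. l < p \<Longrightarrow> smooth_on_open n V (H l)"
    and "\<And>x. x \<in> V \<Longrightarrow> (\<lambda>l. if l < p then H l x else 0) \<in> W"
  shows "smooth_on_open n V (\<lambda>x. g (\<lambda>l. if l < p then H l x else 0))"
proof -
  have W: "openin (Euclidean_space p) W" "\<And>m. Ck m p W g"
    using assms(2) by (auto simp: smooth_on_open_iff)
  have H: "Ck m n V (H l)" if "l < p" for m l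
    using assms(3)[OF that] by (simp add: smooth_on_open_iff)
  show ?thesis
    unfolding smooth_on_open_iff using V Ck_compose[OF V W(1) assms(4) W(2) H] by blast
qed

lemma smooth_continuous: "smooth_on_open n V f \<Longrightarrow> continuous_on V f"
  unfolding smooth_on_open_iff using Ck.simps(1)[of n V f] by blast

lemma smooth_has_partial:
  assumes "smooth_on_open n V f" "i < n" "x \<in> V"
  shows "((\<lambda>t. f (x(i := t))) has_real_derivative partial_deriv i f x) (at (x i))"
  using assms Ck_partial[of n V 0 f i x] unfolding smooth_on_open_iff by blast

lemma smooth_partial_commute:
  assumes "smooth_on_open n V f" "i < n" "j < n" "x \<in> V"
  shows "partial_deriv i (partial_deriv j f) x = partial_deriv j (partial_deriv i f) x"
  using assms partial_deriv_commute[of n V f x i j] by (auto simp: smooth_on_open_iff)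

lemma smooth_chain_path:
  assumes f: "smooth_on_open n V f" and "c t0 \<in> V" "\<And>t. c t \<in> euclid n"
    and "\<And>i. i < n \<Longrightarrow> ((\<lambda>t. c t i) has_real_derivative c' i) (at t0)"
  shows "((\<lambda>t. f (c t)) has_real_derivative (\<Sum>i<n. partial_deriv i f (c t0) * c' i)) (at t0)"
proof -
  have V: "openin (Euclidean_space n) V" and C1: "Ck 1 n V f"
    using f by (auto simp: smooth_on_open_iff)
  have "c t i = c t0 i" if "n \<le> i" for t i
    using assms(3)[of t] assms(3)[of t0] that by (simp add: mem_euclid)
  note const = this
  have d: "(\<lambda>t. f (y(i := t))) differentiable (at (y i))" "continuous_on V (partial_deriv i f)"
    if "i < n" "y \<in> V" for i y
    using C1 that by simp_all
  show ?thesis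
    by (rule chain_rule_path[OF V assms(2) d(1) d(2)[OF _ assms(2)] order_refl refl assms(3) const assms(4)])
qed

lemma smooth_composite_partial:
  assumes V: "openin (Euclidean_space n) V"
    and g: "smooth_on_open p W g" and H: "\<And>l. l < p \<Longrightarrow> smooth_on_open n V (H l)"
    and HW: "\<And>x. x \<in> V \<Longrightarrow> (\<lambda>l. if l < p then H l x else 0) \<in> W"
    and x: "x \<in> V" "i < n"
  shows "partial_deriv i (\<lambda>x. g (\<lambda>l. if l < p then H l x else 0)) x =
    (\<Sum>l<p. partial_deriv l g (\<lambda>l. if l < p then H l x else 0) * partial_deriv i (H l) x)"
proof (rule partial_derivI)
  have gW: "openin (Euclidean_space p) W" "Ck (Suc 0) p W g"
    using g unfolding smooth_on_open_iff by blast+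
  show "((\<lambda>t. g (\<lambda>l. if l < p then H l (x(i := t)) else 0)) has_real_derivative
    (\<Sum>l<p. partial_deriv l g (\<lambda>l. if l < p then H l x else 0) * partial_deriv i (H l) x)) (at (x i))"
    by (rule composite_partial[OF V gW(1) HW gW(2) x]) (assumption | rule smooth_has_partial[OF H x(2,1)])+
qed

lemma partial_deriv_add:
  assumes "smooth_on_open n V f" "smooth_on_open n V g" "i < n" "x \<in> V"
  shows "partial_deriv i (\<lambda>x. f x + g x) x = partial_deriv i f x + partial_deriv i g x"
  by (rule partial_derivI, rule DERIV_add) (rule smooth_has_partial assms)+

lemma partial_deriv_mult:
  assumes "smooth_on_open n V f" "smooth_on_open n V g" "i < n" "x \<in> V"
  shows "partial_deriv i (\<lambda>x. f x * g x) x = partial_deriv i f x * g x + f x * partial_deriv i g x"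
  using DERIV_mult[OF smooth_has_partial[OF assms(1,3,4)] smooth_has_partial[OF assms(2,3,4)]]
  by (intro partial_derivI) (simp add: mult.commute del: fun_upd_apply)

lemma partial_deriv_const: "partial_deriv i (\<lambda>x. c) x = 0"
  by (rule partial_derivI) simp

lemma partial_deriv_coord: "partial_deriv i (\<lambda>x. x j) x = (if i = j then 1 else 0)"
  by (rule partial_derivI) auto

section \<open>Smooth functions on Euclidean space as labels of operations\<close>

lemma Cinf_smooth: "g \<in> Cinf n \<Longrightarrow> smooth_on_open n (euclid n) g"
  by (simp add: Cinf_def)

lemma CinfI: "smooth_on_open n (euclid n) f \<Longrightarrow> (\<lambda>x\<in>euclid n. f x) \<in> Cinf n"
  unfolding Cinf_def using smooth_cong[of n "euclid n" f "\<lambda>x\<in>euclid n. f x"] by auto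

lemma Cinf_const: "(\<lambda>x\<in>euclid n. c) \<in> Cinf n"
  by (intro CinfI smooth_const openin_euclid)

lemma Cinf_coord: "(\<lambda>x\<in>euclid n. x i) \<in> Cinf n"
  by (intro CinfI smooth_coord openin_euclid)

lemma Cinf_add: "g \<in> Cinf n \<Longrightarrow> h \<in> Cinf n \<Longrightarrow> (\<lambda>x\<in>euclid n. g x + h x) \<in> Cinf n"
  by (intro CinfI smooth_add Cinf_smooth)

lemma Cinf_mult: "g \<in> Cinf n \<Longrightarrow> h \<in> Cinf n \<Longrightarrow> (\<lambda>x\<in>euclid n. g x * h x) \<in> Cinf n"
  by (intro CinfI smooth_mult Cinf_smooth)

lemma Cinf_eqI: "g \<in> Cinf n \<Longrightarrow> h \<in> Cinf n \<Longrightarrow> (\<And>x. x \<in> euclid n \<Longrightarrow> g x = h x) \<Longrightarrow> g = h"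
  unfolding Cinf_def by (auto intro: extensionalityI)

lemma pd_Cinf: "g \<in> Cinf n \<Longrightarrow> i < n \<Longrightarrow> pd n i g \<in> Cinf n"
  unfolding pd_def by (intro CinfI smooth_partial Cinf_smooth)

lemma partial_deriv_restrict:
  "x \<in> euclid n \<Longrightarrow> i < n \<Longrightarrow> partial_deriv i (\<lambda>x\<in>euclid n. f x) x = partial_deriv i f x"
  by (rule partial_deriv_cong[OF openin_euclid]) auto

lemma pd_commute:
  assumes "g \<in> Cinf n" "i < n" "j < n"
  shows "pd n i (pd n j g) = pd n j (pd n i g)"
  unfolding pd_def
  by (rule restrict_ext)
     (use assms in \<open>simp add: partial_deriv_restrict smooth_partial_commute[OF Cinf_smooth]\<close>)

lemma point_euclid: "length xs = n \<Longrightarrow> point xs \<in> euclid n"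
  by (auto simp: point_def mem_euclid)

section \<open>The ring underlying a \<open>C\<^sup>\<infinity>\<close>-ring\<close>

lemma tuples_Nil: "[] \<in> tuples 0 A"
  by (simp add: tuples_def)

locale smooth_ring = cinf_ring C for C :: "'a cring_inf"
begin

text \<open>Compatibility with composition turns a ring operation on values at one tuple into the
  pointwise operation on the smooth functions. The ring axioms are thereby reduced to those of
  real-valued functions.\<close>

lemma op_add:
  assumes "h \<in> Cinf n" "h' \<in> Cinf n" "as \<in> tuples n (carrier C)"
  shows "smooth_op C (\<lambda>x\<in>euclid 2. x 0 + x 1) [smooth_op C h as, smooth_op C h' as] =
    smooth_op C (\<lambda>x\<in>euclid n. h x + h' x) as"
proof -
  have "(\<lambda>x\<in>euclid 2. x 0 + x 1) \<in> Cinf 2"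
    by (intro CinfI smooth_add smooth_coord openin_euclid)
  from op_comp[OF this _ assms(3), of "[h, h']"] assms(1,2)
  have "smooth_op C (\<lambda>x\<in>euclid n. (\<lambda>x\<in>euclid 2. x 0 + x 1) (point [h x, h' x])) as =
    smooth_op C (\<lambda>x\<in>euclid 2. x 0 + x 1) [smooth_op C h as, smooth_op C h' as]"
    by (simp add: tuples_def)
  moreover have "(\<lambda>x\<in>euclid 2. x 0 + x 1) (point [a, b]) = a + b" for a b
    using point_euclid[of "[a, b]" 2] by (simp add: point_def)
  ultimately show ?thesis by simp
qed

lemma op_mult:
  assumes "h \<in> Cinf n" "h' \<in> Cinf n" "as \<in> tuples n (carrier C)"
  shows "smooth_op C (\<lambda>x\<in>euclid 2. x 0 * x 1) [smooth_op C h as, smooth_op C h' as] =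
    smooth_op C (\<lambda>x\<in>euclid n. h x * h' x) as"
proof -
  have "(\<lambda>x\<in>euclid 2. x 0 * x 1) \<in> Cinf 2"
    by (intro CinfI smooth_mult smooth_coord openin_euclid)
  from op_comp[OF this _ assms(3), of "[h, h']"] assms(1,2)
  have "smooth_op C (\<lambda>x\<in>euclid n. (\<lambda>x\<in>euclid 2. x 0 * x 1) (point [h x, h' x])) as =
    smooth_op C (\<lambda>x\<in>euclid 2. x 0 * x 1) [smooth_op C h as, smooth_op C h' as]"
    by (simp add: tuples_def)
  moreover have "(\<lambda>x\<in>euclid 2. x 0 * x 1) (point [a, b]) = a * b" for a b
    using point_euclid[of "[a, b]" 2] by (simp add: point_def)
  ultimately show ?thesis by simp
qed

text \<open>Zero and one are operations of arity 0; composition with an empty list of functions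
  makes them available in every arity.\<close>

lemma op_const:
  assumes "as \<in> tuples n (carrier C)"
  shows "smooth_op C (\<lambda>x\<in>euclid 0. c) [] = smooth_op C (\<lambda>x\<in>euclid n. c) as"
proof -
  have "point [] \<in> euclid 0" by (rule point_euclid) simp
  then have "(\<lambda>x\<in>euclid n. (\<lambda>x\<in>euclid 0. c) (point (map (\<lambda>h. h x) []))) = (\<lambda>x\<in>euclid n. c)"
    by (intro restrict_ext) (simp only: list.map restrict_apply')
  then show ?thesis
    using op_comp[OF Cinf_const tuples_Nil assms, of c] by (simp only: list.map)
qed

abbreviation "UR \<equiv> underlying_ring C"

lemma UR_carrier: "carrier UR = carrier C"
  by (simp add: underlying_ring_def)

lemma UR_add: "h \<in> Cinf n \<Longrightarrow> h' \<in> Cinf n \<Longrightarrow> as \<in> tuples n (carrier C) \<Longrightarrow>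
    smooth_op C h as \<oplus>\<^bsub>UR\<^esub> smooth_op C h' as = smooth_op C (\<lambda>x\<in>euclid n. h x + h' x) as"
  using op_add[of h n h' as] by (simp add: underlying_ring_def del: One_nat_def)

lemma UR_mult: "h \<in> Cinf n \<Longrightarrow> h' \<in> Cinf n \<Longrightarrow> as \<in> tuples n (carrier C) \<Longrightarrow>
    smooth_op C h as \<otimes>\<^bsub>UR\<^esub> smooth_op C h' as = smooth_op C (\<lambda>x\<in>euclid n. h x * h' x) as"
  using op_mult[of h n h' as] by (simp add: underlying_ring_def del: One_nat_def)

lemma UR_zero: "as \<in> tuples n (carrier C) \<Longrightarrow> \<zero>\<^bsub>UR\<^esub> = smooth_op C (\<lambda>x\<in>euclid n. 0) as"
  by (simp add: underlying_ring_def op_const)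

lemma UR_one: "as \<in> tuples n (carrier C) \<Longrightarrow> \<one>\<^bsub>UR\<^esub> = smooth_op C (\<lambda>x\<in>euclid n. 1) as"
  by (simp add: underlying_ring_def op_const)

lemma nth_op: "as \<in> tuples n (carrier C) \<Longrightarrow> i < n \<Longrightarrow> as ! i = smooth_op C (\<lambda>x\<in>euclid n. x i) as"
  by (simp add: op_proj)

text \<open>A ring identity in \<open>a, b, c\<close> is checked on smooth functions of three variables.\<close>

lemma three_elements:
  assumes "a \<in> carrier UR" "b \<in> carrier UR" "c \<in> carrier UR"
  obtains as f g h where "as \<in> tuples 3 (carrier C)" "f \<in> Cinf 3" "g \<in> Cinf 3" "h \<in> Cinf 3"
    "a = smooth_op C f as" "b = smooth_op C g as" "c = smooth_op C h as"
proof
  show as: "[a, b, c] \<in> tuples 3 (carrier C)"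
    using assms by (simp add: tuples_def UR_carrier)
  show "a = smooth_op C (\<lambda>x\<in>euclid 3. x 0) [a, b, c]" "b = smooth_op C (\<lambda>x\<in>euclid 3. x 1) [a, b, c]"
    "c = smooth_op C (\<lambda>x\<in>euclid 3. x 2) [a, b, c]"
    using nth_op[OF as, of 0] nth_op[OF as, of 1] nth_op[OF as, of 2] by simp_all
qed (rule Cinf_coord)+

lemma UR_cring: "cring UR"
proof (rule cringI)
  note [simp] = UR_carrier Cinf_add Cinf_mult Cinf_const
  show "abelian_group UR"
  proof (rule abelian_groupI)
    fix a b c assume "a \<in> carrier UR" "b \<in> carrier UR" "c \<in> carrier UR"
    then obtain as f g h where *: "as \<in> tuples 3 (carrier C)" "f \<in> Cinf 3" "g \<in> Cinf 3" "h \<in> Cinf 3"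
      "a = smooth_op C f as" "b = smooth_op C g as" "c = smooth_op C h as"
      by (rule three_elements)
    then show "a \<oplus>\<^bsub>UR\<^esub> b \<in> carrier UR" "a \<oplus>\<^bsub>UR\<^esub> b = b \<oplus>\<^bsub>UR\<^esub> a"
      "a \<oplus>\<^bsub>UR\<^esub> b \<oplus>\<^bsub>UR\<^esub> c = a \<oplus>\<^bsub>UR\<^esub> (b \<oplus>\<^bsub>UR\<^esub> c)"
      by (simp_all add: UR_add[OF _ _ *(1)] op_closed[OF _ *(1)] add_ac cong: restrict_cong)
  next
    show "\<zero>\<^bsub>UR\<^esub> \<in> carrier UR" using tuples_Nil by (simp add: UR_zero[OF tuples_Nil] op_closed[OF _ tuples_Nil])
    fix a assume a: "a \<in> carrier UR"
    from a a a obtain as f g h where *: "as \<in> tuples 3 (carrier C)" "f \<in> Cinf 3" "a = smooth_op C f as"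
      by (rule three_elements)
    have "\<zero>\<^bsub>UR\<^esub> \<oplus>\<^bsub>UR\<^esub> a = smooth_op C (\<lambda>x\<in>euclid 3. (\<lambda>x\<in>euclid 3. 0) x + f x) as"
      unfolding UR_zero[OF *(1)] *(3) by (rule UR_add[OF Cinf_const *(2,1)])
    also have "(\<lambda>x\<in>euclid 3. (\<lambda>x\<in>euclid 3. 0) x + f x) = f"
      by (rule Cinf_eqI[OF Cinf_add[OF Cinf_const *(2)] *(2)]) simp
    finally show "\<zero>\<^bsub>UR\<^esub> \<oplus>\<^bsub>UR\<^esub> a = a" by (simp add: *(3))
    have "smooth_op C (\<lambda>x\<in>euclid 3. (\<lambda>x\<in>euclid 3. -1) x * f x) as \<oplus>\<^bsub>UR\<^esub> a = \<zero>\<^bsub>UR\<^esub>"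
      unfolding UR_zero[OF *(1)] *(3)
      by (subst UR_add[OF Cinf_mult[OF Cinf_const *(2)] *(2,1)]) (simp cong: restrict_cong)
    moreover have "smooth_op C (\<lambda>x\<in>euclid 3. (\<lambda>x\<in>euclid 3. -1) x * f x) as \<in> carrier UR"
      unfolding UR_carrier by (rule op_closed[OF Cinf_mult[OF Cinf_const *(2)] *(1)])
    ultimately show "\<exists>b\<in>carrier UR. b \<oplus>\<^bsub>UR\<^esub> a = \<zero>\<^bsub>UR\<^esub>" by blast
  qed
  show "comm_monoid UR"
  proof (rule comm_monoidI)
    fix a b c assume "a \<in> carrier UR" "b \<in> carrier UR" "c \<in> carrier UR"
    then obtain as f g h where *: "as \<in> tuples 3 (carrier C)" "f \<in> Cinf 3" "g \<in> Cinf 3" "h \<in> Cinf 3"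
      "a = smooth_op C f as" "b = smooth_op C g as" "c = smooth_op C h as"
      by (rule three_elements)
    then show "a \<otimes>\<^bsub>UR\<^esub> b \<in> carrier UR" "a \<otimes>\<^bsub>UR\<^esub> b = b \<otimes>\<^bsub>UR\<^esub> a"
      "a \<otimes>\<^bsub>UR\<^esub> b \<otimes>\<^bsub>UR\<^esub> c = a \<otimes>\<^bsub>UR\<^esub> (b \<otimes>\<^bsub>UR\<^esub> c)"
      by (simp_all add: UR_mult[OF _ _ *(1)] op_closed[OF _ *(1)] mult_ac cong: restrict_cong)
  next
    show "\<one>\<^bsub>UR\<^esub> \<in> carrier UR" using tuples_Nil by (simp add: UR_one[OF tuples_Nil] op_closed[OF _ tuples_Nil])
    fix a assume a: "a \<in> carrier UR"
    from a a a obtain as f g h where *: "as \<in> tuples 3 (carrier C)" "f \<in> Cinf 3" "a = smooth_op C f as"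
      by (rule three_elements)
    have "\<one>\<^bsub>UR\<^esub> \<otimes>\<^bsub>UR\<^esub> a = smooth_op C (\<lambda>x\<in>euclid 3. (\<lambda>x\<in>euclid 3. 1) x * f x) as"
      unfolding UR_one[OF *(1)] *(3) by (rule UR_mult[OF Cinf_const *(2,1)])
    also have "(\<lambda>x\<in>euclid 3. (\<lambda>x\<in>euclid 3. 1) x * f x) = f"
      by (rule Cinf_eqI[OF Cinf_mult[OF Cinf_const *(2)] *(2)]) simp
    finally show "\<one>\<^bsub>UR\<^esub> \<otimes>\<^bsub>UR\<^esub> a = a" by (simp add: *(3))
  qed
  fix a b c assume "a \<in> carrier UR" "b \<in> carrier UR" "c \<in> carrier UR"
  then obtain as f g h where *: "as \<in> tuples 3 (carrier C)" "f \<in> Cinf 3" "g \<in> Cinf 3" "h \<in> Cinf 3"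
    "a = smooth_op C f as" "b = smooth_op C g as" "c = smooth_op C h as"
    by (rule three_elements)
  then show "(a \<oplus>\<^bsub>UR\<^esub> b) \<otimes>\<^bsub>UR\<^esub> c = a \<otimes>\<^bsub>UR\<^esub> c \<oplus>\<^bsub>UR\<^esub> b \<otimes>\<^bsub>UR\<^esub> c"
    by (simp add: UR_add[OF _ _ *(1)] UR_mult[OF _ _ *(1)] distrib_right cong: restrict_cong)
qed

sublocale UR: base_ring UR
  by (rule base_ring.intro) (rule UR_cring)

end

lemma cinf_hom_closed: "\<phi> \<in> cinf_hom C D \<Longrightarrow> a \<in> carrier C \<Longrightarrow> \<phi> a \<in> carrier D"
  by (auto simp: cinf_hom_def)

lemma cinf_hom_op:
  "\<phi> \<in> cinf_hom C D \<Longrightarrow> g \<in> Cinf m \<Longrightarrow> as \<in> tuples m (carrier C) \<Longrightarrow> \<phi> (smooth_op C g as) = smooth_op D g (map \<phi> as)"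
  by (auto simp: cinf_hom_def)

lemma cinf_hom_ring_hom:
  assumes "\<phi> \<in> cinf_hom C D"
  shows "\<phi> \<in> ring_hom (underlying_ring C) (underlying_ring D)"
proof (rule ring_hom_memI)
  have "(\<lambda>x\<in>euclid 2. x 0 * x 1) \<in> Cinf 2" "(\<lambda>x\<in>euclid 2. x 0 + x 1) \<in> Cinf 2"
    by (intro CinfI smooth_mult smooth_add smooth_coord openin_euclid)+
  moreover fix a b assume "a \<in> carrier (underlying_ring C)" "b \<in> carrier (underlying_ring C)"
  ultimately show "\<phi> (a \<otimes>\<^bsub>underlying_ring C\<^esub> b) = \<phi> a \<otimes>\<^bsub>underlying_ring D\<^esub> \<phi> b"
    "\<phi> (a \<oplus>\<^bsub>underlying_ring C\<^esub> b) = \<phi> a \<oplus>\<^bsub>underlying_ring D\<^esub> \<phi> b"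
    using cinf_hom_op[OF assms, of _ 2 "[a, b]"] by (simp_all add: underlying_ring_def tuples_def)
next
  show "\<phi> \<one>\<^bsub>underlying_ring C\<^esub> = \<one>\<^bsub>underlying_ring D\<^esub>"
    using cinf_hom_op[OF assms Cinf_const, of "[]"] by (simp add: underlying_ring_def tuples_def)
qed (use cinf_hom_closed[OF assms] in \<open>auto simp: underlying_ring_def\<close>)

section \<open>Kaehler differentials\<close>

context smooth_ring
begin

abbreviation "KF \<equiv> kaehler_free C"
abbreviation "\<Omega> \<equiv> kaehler C"
abbreviation "gen_vec \<equiv> basis_vec UR (carrier C)"
abbreviation "kd \<equiv> kaehler_d C"

lemma KF_module: "module UR KF"
  unfolding kaehler_free_def by (rule UR.free_module)

lemma KF_abelian_group: "abelian_group KF"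
  unfolding kaehler_free_def by (rule UR.free_abelian_group)

lemma gen_vec_closed: "a \<in> carrier C \<Longrightarrow> gen_vec a \<in> carrier KF"
  unfolding kaehler_free_def by (rule UR.basis_vec_carrier)

sublocale KF: module UR KF
  by (rule KF_module)

lemma tuples_op_closed: "as \<in> tuples n (carrier C) \<Longrightarrow> i < n \<Longrightarrow> h \<in> Cinf n \<Longrightarrow>
    smooth_op C (pd n i h) as \<in> carrier UR"
  unfolding UR_carrier by (rule op_closed[OF pd_Cinf])

lemma kaehler_rels_carrier: "kaehler_rels C \<subseteq> carrier KF"
proof -
  have "gen_vec (smooth_op C h as) \<ominus>\<^bsub>KF\<^esub> (\<Oplus>\<^bsub>KF\<^esub>i\<in>{..<n}. smooth_op C (pd n i h) as \<odot>\<^bsub>KF\<^esub> gen_vec (as ! i)) \<in> carrier KF"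
    if "h \<in> Cinf n" "as \<in> tuples n (carrier C)" for n h as
    using that
    by (intro KF.M.minus_closed gen_vec_closed KF.M.finsum_closed op_closed)
       (auto intro!: KF.smult_closed tuples_op_closed gen_vec_closed tuples_nth)
  then show ?thesis unfolding kaehler_rels_def Let_def by blast
qed

sublocale KQ: module_quotient UR KF "kaehler_span C"
  by (intro module_quotient.intro module_quotient_axioms.intro KF_module)
     (simp add: kaehler_span_def UR.span_submodule KF_module kaehler_rels_carrier)

lemma kaehler_eq: "\<Omega> = KQ.Q"
  by (simp add: kaehler_def)

lemma kaehler_module: "module UR \<Omega>"
  unfolding kaehler_eq by (rule KQ.Q_module)

sublocale E: ext_algebra UR \<Omega>
  by (rule ext_algebra.intro) (rule kaehler_module)

lemma kaehler_class_additive: "additive_map KF \<Omega> (kaehler_class C)"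
proof -
  have "kaehler_class C = (+>\<^bsub>KF\<^esub>) (kaehler_span C)"
    by (simp add: fun_eq_iff kaehler_class_def)
  then show ?thesis
    using KQ.cls_additive by (simp add: kaehler_eq)
qed

sublocale KC: additive_pair KF \<Omega> "kaehler_class C"
  by (intro additive_pair.intro additive_pair_axioms.intro KF_abelian_group
      kaehler_class_additive E.N.abelian_group_axioms)

lemma kaehler_cases:
  assumes "w \<in> carrier \<Omega>"
  obtains v where "v \<in> carrier KF" "w = kaehler_class C v"
  using assms KQ.Q_carrier by (auto simp: kaehler_eq kaehler_class_def)

lemma kaehler_class_smult:
  "c \<in> carrier C \<Longrightarrow> v \<in> carrier KF \<Longrightarrow> kaehler_class C (c \<odot>\<^bsub>KF\<^esub> v) = c \<odot>\<^bsub>\<Omega>\<^esub> kaehler_class C v"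
  using KQ.cls_smult[of c v] by (simp add: kaehler_eq kaehler_class_def UR_carrier)

lemma kaehler_class_self: "v \<in> carrier KF \<Longrightarrow> v \<in> kaehler_class C v"
  by (simp add: kaehler_class_def KQ.cls_self)

lemma kd_closed: "a \<in> carrier C \<Longrightarrow> kd a \<in> carrier \<Omega>"
  by (simp add: kaehler_d_def gen_vec_closed)

lemma kaehler_class_gen:
  "c \<in> carrier C \<Longrightarrow> a \<in> carrier C \<Longrightarrow> kaehler_class C (c \<odot>\<^bsub>KF\<^esub> gen_vec a) = c \<odot>\<^bsub>\<Omega>\<^esub> kd a"
  by (simp add: kaehler_class_smult gen_vec_closed kaehler_d_def)

lemma kd_op:
  assumes h: "h \<in> Cinf n" and as: "as \<in> tuples n (carrier C)"
  shows "kd (smooth_op C h as) = (\<Oplus>\<^bsub>\<Omega>\<^esub>i\<in>{..<n}. smooth_op C (pd n i h) as \<odot>\<^bsub>\<Omega>\<^esub> kd (as ! i))"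
proof -
  let ?s = "\<Oplus>\<^bsub>KF\<^esub>i\<in>{..<n}. smooth_op C (pd n i h) as \<odot>\<^bsub>KF\<^esub> gen_vec (as ! i)"
  have t: "(\<lambda>i. smooth_op C (pd n i h) as \<odot>\<^bsub>KF\<^esub> gen_vec (as ! i)) \<in> {..<n} \<rightarrow> carrier KF"
    using h as by (auto intro!: KF.smult_closed tuples_op_closed gen_vec_closed tuples_nth)
  have s: "?s \<in> carrier KF" "gen_vec (smooth_op C h as) \<in> carrier KF"
    using t h as by (auto intro!: KF.M.finsum_closed gen_vec_closed op_closed)
  have "gen_vec (smooth_op C h as) \<ominus>\<^bsub>KF\<^esub> ?s \<in> kaehler_rels C"
    unfolding kaehler_rels_def Let_def
    by (rule CollectI, intro exI conjI, rule refl) (rule h as)+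
  then have "gen_vec (smooth_op C h as) \<ominus>\<^bsub>KF\<^esub> ?s \<in> kaehler_span C"
    unfolding kaehler_span_def by (rule subsetD[OF UR.span_incl])
  then have "kaehler_class C (gen_vec (smooth_op C h as)) = kaehler_class C ?s"
    using s by (simp add: kaehler_class_def KQ.cls_eq_iff)
  also have "\<dots> = (\<Oplus>\<^bsub>\<Omega>\<^esub>i\<in>{..<n}. kaehler_class C (smooth_op C (pd n i h) as \<odot>\<^bsub>KF\<^esub> gen_vec (as ! i)))"
    by (rule KC.finsum[OF t])
  also have "\<dots> = (\<Oplus>\<^bsub>\<Omega>\<^esub>i\<in>{..<n}. smooth_op C (pd n i h) as \<odot>\<^bsub>\<Omega>\<^esub> kd (as ! i))"
  proof (rule E.N.M.finsum_cong'[OF refl])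
    fix i assume "i \<in> {..<n}"
    then have i: "i < n" by simp
    have c: "smooth_op C (pd n i h) as \<in> carrier C" using tuples_op_closed[OF as i h] by (simp add: UR_carrier)
    show "kaehler_class C (smooth_op C (pd n i h) as \<odot>\<^bsub>KF\<^esub> gen_vec (as ! i)) = smooth_op C (pd n i h) as \<odot>\<^bsub>\<Omega>\<^esub> kd (as ! i)"
      by (rule kaehler_class_gen[OF c tuples_nth[OF as i]])
  qed (use h as in \<open>auto intro!: E.N.smult_closed tuples_op_closed kd_closed tuples_nth\<close>)
  finally show ?thesis by (simp add: kaehler_d_def)
qed

text \<open>A map on the free module descends to the Kaehler module if it respects every multiple of
  the chain rule. Additivity allows the sum in the relation to be taken out of
  \<open>F\<close>.\<close>

lemma kaehler_additive_kills:
  assumes P: "abelian_group P" and F: "additive_map KF P F"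
    and rel: "\<And>c n h as. c \<in> carrier C \<Longrightarrow> h \<in> Cinf n \<Longrightarrow> as \<in> tuples n (carrier C) \<Longrightarrow>
      F (c \<odot>\<^bsub>KF\<^esub> gen_vec (smooth_op C h as)) =
        (\<Oplus>\<^bsub>P\<^esub>i\<in>{..<n}. F ((c \<otimes>\<^bsub>UR\<^esub> smooth_op C (pd n i h) as) \<odot>\<^bsub>KF\<^esub> gen_vec (as ! i)))"
    and v: "v \<in> kaehler_span C"
  shows "F v = \<zero>\<^bsub>P\<^esub>"
proof -
  interpret P: abelian_group P by fact
  interpret F: additive_pair KF P F
    by (intro additive_pair.intro additive_pair_axioms.intro KF_abelian_group P F)
  show ?thesis
  proof (rule UR.additive_kills_span[OF KF_module P F kaehler_rels_carrier _ v[unfolded kaehler_span_def]])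
    fix c s assume c: "c \<in> carrier UR" and "s \<in> kaehler_rels C"
    then obtain n h as where s: "s = gen_vec (smooth_op C h as) \<ominus>\<^bsub>KF\<^esub>
        (\<Oplus>\<^bsub>KF\<^esub>i\<in>{..<n}. smooth_op C (pd n i h) as \<odot>\<^bsub>KF\<^esub> gen_vec (as ! i))"
      and h: "h \<in> Cinf n" and as: "as \<in> tuples n (carrier C)"
      unfolding kaehler_rels_def Let_def by blast
    have t: "(\<lambda>i. smooth_op C (pd n i h) as \<odot>\<^bsub>KF\<^esub> gen_vec (as ! i)) \<in> {..<n} \<rightarrow> carrier KF"
      using h as by (auto intro!: KF.smult_closed tuples_op_closed gen_vec_closed tuples_nth)
    have t': "(\<lambda>i. c \<odot>\<^bsub>KF\<^esub> (smooth_op C (pd n i h) as \<odot>\<^bsub>KF\<^esub> gen_vec (as ! i))) \<in> {..<n} \<rightarrow> carrier KF"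
      using t c by auto
    have a: "gen_vec (smooth_op C h as) \<in> carrier KF"
      using h as by (intro gen_vec_closed op_closed)
    have "F (c \<odot>\<^bsub>KF\<^esub> (\<Oplus>\<^bsub>KF\<^esub>i\<in>{..<n}. smooth_op C (pd n i h) as \<odot>\<^bsub>KF\<^esub> gen_vec (as ! i))) =
        (\<Oplus>\<^bsub>P\<^esub>i\<in>{..<n}. F (c \<odot>\<^bsub>KF\<^esub> (smooth_op C (pd n i h) as \<odot>\<^bsub>KF\<^esub> gen_vec (as ! i))))"
      using c t F.finsum[OF t'] by (simp add: KF.finsum_smult_ldistr)
    also have "\<dots> = (\<Oplus>\<^bsub>P\<^esub>i\<in>{..<n}. F ((c \<otimes>\<^bsub>UR\<^esub> smooth_op C (pd n i h) as) \<odot>\<^bsub>KF\<^esub> gen_vec (as ! i)))"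
      by (rule P.finsum_cong')
         (use c h as in \<open>auto simp: KF.smult_assoc1 tuples_op_closed gen_vec_closed tuples_nth
           intro!: F.closed KF.smult_closed UR.m_closed\<close>)
    also have "\<dots> = F (c \<odot>\<^bsub>KF\<^esub> gen_vec (smooth_op C h as))"
      using rel[OF _ h as] c by (simp add: UR_carrier)
    finally show "F (c \<odot>\<^bsub>KF\<^esub> s) = \<zero>\<^bsub>P\<^esub>"
      using a c KF.M.finsum_closed[OF t] unfolding s
      by (simp add: a_minus_def[of KF] KF.smult_r_distr KF.smult_r_minus P.r_neg)
  qed
qed

lemma kaehler_const_on_class:
  assumes "abelian_group P" "additive_map KF P F" "\<And>h. h \<in> kaehler_span C \<Longrightarrow> F h = \<zero>\<^bsub>P\<^esub>"
    and "v \<in> carrier KF" "u \<in> kaehler_class C v"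
  shows "F u = F v"
  using KQ.additive_const_on_cls[OF assms(1,2)] assms(3-) by (simp add: kaehler_class_def)

lemma kaehler_generates: "generates UR \<Omega> (kd ` carrier C)"
  unfolding generates_def
proof (intro conjI allI impI ballI)
  show "kd ` carrier C \<subseteq> carrier \<Omega>" using kd_closed by auto
  fix P w assume zero: "P \<zero>\<^bsub>\<Omega>\<^esub>" and w: "w \<in> carrier \<Omega>"
    and step: "\<forall>w\<in>carrier \<Omega>. \<forall>a\<in>carrier UR. \<forall>g\<in>kd ` carrier C. P w \<longrightarrow> P (w \<oplus>\<^bsub>\<Omega>\<^esub> a \<odot>\<^bsub>\<Omega>\<^esub> g)"
  from w obtain v where v: "v \<in> carrier KF" "w = kaehler_class C v" by (rule kaehler_cases)
  from v(1) have "P (kaehler_class C v)"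
    unfolding kaehler_free_def
  proof (induction rule: UR.free_induct)
    case zero
    then show ?case using \<open>P \<zero>\<^bsub>\<Omega>\<^esub>\<close> by (simp flip: kaehler_free_def)
  next
    case (add v c a)
    then show ?case
      using step
      by (simp flip: kaehler_free_def add: UR_carrier gen_vec_closed kaehler_class_gen KF.smult_closed)
  qed
  then show "P w" using v by simp
qed

text \<open>A constant is an operation of arity 0, and the relation for it has an empty sum on the
  right.\<close>

lemma kd_const: "kd (smooth_op C (\<lambda>x\<in>euclid 0. c) []) = \<zero>\<^bsub>\<Omega>\<^esub>"
  using kd_op[OF Cinf_const, of "[]" 0 c] by (simp add: tuples_Nil)

lemma kd_one: "kd \<one>\<^bsub>UR\<^esub> = \<zero>\<^bsub>\<Omega>\<^esub>"
  using kd_const[of 1] by (simp add: underlying_ring_def)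

lemma finsum_two:
  assumes "abelian_group P" "f 0 \<in> carrier P" "f 1 \<in> carrier P"
  shows "finsum P f {..<2::nat} = f 0 \<oplus>\<^bsub>P\<^esub> f 1"
proof -
  interpret P: abelian_group P by fact
  have "{..<2::nat} = {0, 1}" by auto
  then show ?thesis using assms by (simp add: P.finsum_insert)
qed

lemma two_ops:
  assumes "a \<in> carrier C" "b \<in> carrier C"
  shows "smooth_op C (\<lambda>x\<in>euclid 2. x 0) [a, b] = a" "smooth_op C (\<lambda>x\<in>euclid 2. x 1) [a, b] = b"
    "smooth_op C (\<lambda>x\<in>euclid 2. 1) [a, b] = \<one>\<^bsub>UR\<^esub>"
proof -
  have ab: "[a, b] \<in> tuples 2 (carrier C)" using assms by (simp add: tuples_def)
  show "smooth_op C (\<lambda>x\<in>euclid 2. x 0) [a, b] = a" "smooth_op C (\<lambda>x\<in>euclid 2. x 1) [a, b] = b"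
    using op_proj[OF _ ab, of 0] op_proj[OF _ ab, of 1] by simp_all
  show "smooth_op C (\<lambda>x\<in>euclid 2. 1) [a, b] = \<one>\<^bsub>UR\<^esub>"
    by (simp add: UR_one[OF ab])
qed

lemma kd_add:
  assumes "a \<in> carrier C" "b \<in> carrier C"
  shows "kd (a \<oplus>\<^bsub>UR\<^esub> b) = kd a \<oplus>\<^bsub>\<Omega>\<^esub> kd b"
proof -
  have ab: "[a, b] \<in> tuples 2 (carrier C)" using assms by (simp add: tuples_def)
  have add: "(\<lambda>x\<in>euclid 2. x 0 + x 1) \<in> Cinf 2"
    by (intro CinfI smooth_add smooth_coord openin_euclid)
  have "pd 2 i (\<lambda>x\<in>euclid 2. x 0 + x 1) = (\<lambda>x\<in>euclid 2. 1)" if "i < 2" for i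
    unfolding pd_def using that
    by (intro restrict_ext)
       (simp add: partial_deriv_restrict partial_deriv_add[OF smooth_coord[OF openin_euclid[of 2]] smooth_coord[OF openin_euclid[of 2]]]
         partial_deriv_coord less_2_cases_iff, auto)
  then show ?thesis
    using kd_op[OF add ab] assms
    by (simp add: finsum_two[OF E.N.abelian_group_axioms] UR_carrier two_ops kd_closed E.N.smult_closed del: One_nat_def)
       (simp add: underlying_ring_def del: One_nat_def)
qed

text \<open>The Leibniz rule is not among the relations as such; it is the relation for the smooth
  function \<open>x 0 * x 1\<close>, whose partial derivatives are the two coordinates.\<close>

lemma kd_mult:
  assumes "a \<in> carrier C" "b \<in> carrier C"
  shows "kd (a \<otimes>\<^bsub>UR\<^esub> b) = b \<odot>\<^bsub>\<Omega>\<^esub> kd a \<oplus>\<^bsub>\<Omega>\<^esub> a \<odot>\<^bsub>\<Omega>\<^esub> kd b"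
proof -
  have ab: "[a, b] \<in> tuples 2 (carrier C)" using assms by (simp add: tuples_def)
  have mult: "(\<lambda>x\<in>euclid 2. x 0 * x 1) \<in> Cinf 2"
    by (intro CinfI smooth_mult smooth_coord openin_euclid)
  have "pd 2 0 (\<lambda>x\<in>euclid 2. x 0 * x 1) = (\<lambda>x\<in>euclid 2. x 1)" "pd 2 1 (\<lambda>x\<in>euclid 2. x 0 * x 1) = (\<lambda>x\<in>euclid 2. x 0)"
    unfolding pd_def
    by (intro restrict_ext,
        simp add: partial_deriv_restrict partial_deriv_mult[OF smooth_coord[OF openin_euclid[of 2]] smooth_coord[OF openin_euclid[of 2]]]
         partial_deriv_coord del: One_nat_def)+
  then show ?thesis
    using kd_op[OF mult ab] assms
    by (simp add: finsum_two[OF E.N.abelian_group_axioms] UR_carrier two_ops kd_closed E.N.smult_closed del: One_nat_def)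
       (simp add: underlying_ring_def del: One_nat_def)
qed

lemma kd_additive: "additive_map UR \<Omega> kd"
  by (rule additive_mapI) (simp_all add: UR_carrier kd_closed kd_add)

end

section \<open>The exterior derivative\<close>

lemma (in abelian_group) finsum_lessThan_Suc:
  fixes n :: nat
  assumes "f \<in> {..<Suc n} \<rightarrow> carrier G"
  shows "finsum G f {..<Suc n} = f n \<oplus> finsum G f {..<n}"
  unfolding lessThan_Suc by (rule finsum_insert) (use assms in auto)

text \<open>Inductively, the last row and the last column cancel each other. The diagonal is a
  separate hypothesis, because antisymmetry would only give \<open>2 s j j = 0\<close> and the group
  may have 2-torsion.\<close>

lemma (in abelian_group) antisymmetric_double_sum:
  fixes s :: "nat \<Rightarrow> nat \<Rightarrow> 'a"
  assumes s: "\<And>j l. j < n \<Longrightarrow> l < n \<Longrightarrow> s j l \<in> carrier G"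
    and anti: "\<And>j l. j < n \<Longrightarrow> l < n \<Longrightarrow> j \<noteq> l \<Longrightarrow> s j l = \<ominus> s l j"
    and diag: "\<And>j. j < n \<Longrightarrow> s j j = \<zero>"
  shows "finsum G (\<lambda>j. finsum G (s j) {..<n}) {..<n} = \<zero>"
  using assms
proof (induction n)
  case (Suc n)
  have c: "s j l \<in> carrier G" if "j < Suc n" "l < Suc n" for j l using Suc.prems that by blast
  have row: "finsum G (s j) {..<Suc n} = s j n \<oplus> finsum G (s j) {..<n}" if "j < Suc n" for j
    by (rule finsum_lessThan_Suc) (use c that in auto)
  have cl: "finsum G (s j) {..<n} \<in> carrier G" if "j < Suc n" for j
    by (rule finsum_closed) (use c that in auto)
  have cl2: "finsum G (\<lambda>j. s j n) {..<n} \<in> carrier G"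
    by (rule finsum_closed) (use c in auto)
  have IH: "finsum G (\<lambda>j. finsum G (s j) {..<n}) {..<n} = \<zero>"
    by (rule Suc.IH; rule Suc.prems; simp)
  have col: "s n j \<oplus> s j n = \<zero>" if "j < n" for j
  proof -
    have "s n j = \<ominus> s j n" by (rule Suc.prems(2)) (use that in auto)
    moreover have "s j n \<in> carrier G" by (rule c) (use that in auto)
    ultimately show ?thesis by (simp add: l_neg)
  qed
  have "finsum G (s n) {..<n} \<oplus> finsum G (\<lambda>j. s j n) {..<n} = finsum G (\<lambda>j. s n j \<oplus> s j n) {..<n}"
    by (rule finsum_addf[symmetric]) (use c in auto)
  also have "\<dots> = finsum G (\<lambda>j. \<zero>) {..<n}"
    by (rule finsum_cong') (use col in auto)
  finally have cancel: "finsum G (s n) {..<n} \<oplus> finsum G (\<lambda>j. s j n) {..<n} = \<zero>" by simp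
  have "finsum G (\<lambda>j. finsum G (s j) {..<Suc n}) {..<Suc n} =
      finsum G (s n) {..<Suc n} \<oplus> finsum G (\<lambda>j. finsum G (s j) {..<Suc n}) {..<n}"
    by (rule finsum_lessThan_Suc) (use c in \<open>auto intro!: finsum_closed\<close>)
  also have "finsum G (\<lambda>j. finsum G (s j) {..<Suc n}) {..<n} =
      finsum G (\<lambda>j. s j n \<oplus> finsum G (s j) {..<n}) {..<n}"
    by (rule finsum_cong') (use row c cl in auto)
  also have "\<dots> = finsum G (\<lambda>j. s j n) {..<n} \<oplus> finsum G (\<lambda>j. finsum G (s j) {..<n}) {..<n}"
    by (rule finsum_addf) (use c cl in auto)
  also have "\<dots> = finsum G (\<lambda>j. s j n) {..<n}"
    using cl2 by (simp add: IH)
  also have "finsum G (s n) {..<Suc n} = finsum G (s n) {..<n}"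
  proof -
    have "s n n = \<zero>" by (rule Suc.prems(3)) simp
    moreover have "finsum G (s n) {..<n} \<in> carrier G" by (rule cl) simp
    moreover have "finsum G (s n) {..<Suc n} = s n n \<oplus> finsum G (s n) {..<n}" by (rule row) simp
    ultimately show ?thesis by simp
  qed
  finally show ?case using cancel by simp
qed simp

section \<open>The contribution of a single factor to the exterior derivative\<close>

context smooth_ring
begin

abbreviation "Ext k \<equiv> ext_power UR \<Omega> k"

lemma Ext_abelian_group: "abelian_group (Ext k)"
  by (rule E.ext_power_abelian_group)

lemma KF_eqI:
  assumes "abelian_group P" "additive_map KF P F" "additive_map KF P G"
    and "\<And>b s. b \<in> carrier C \<Longrightarrow> s \<in> carrier C \<Longrightarrow> F (s \<odot>\<^bsub>KF\<^esub> gen_vec b) = G (s \<odot>\<^bsub>KF\<^esub> gen_vec b)"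
    and "v \<in> carrier KF"
  shows "F v = G v"
  by (rule UR.additive_free_eqI[of P "carrier C" F G v])
     (use assms in \<open>simp_all add: UR_carrier kaehler_free_def\<close>)

text \<open>Term \<open>i\<close> in the Leibniz expansion of
  \<open>d (c w_1 \<and> ... \<and> w_k)\<close>. For an entry \<open>s db\<close> in slot
  \<open>i\<close> the factor \<open>ds\<close> is moved to the front of the whole product, and the
  sign of this move cancels the sign in the Leibniz rule. It starts as a function of free vectors,
  since \<open>ds\<close> is not determined by the class of \<open>s db\<close>.\<close>

definition slot_sum :: "nat \<Rightarrow> 'a \<Rightarrow> ('a \<Rightarrow> 'a) set list \<Rightarrow> nat \<Rightarrow> ('a \<Rightarrow> 'a) \<Rightarrow> 'a form" where
  "slot_sum k c ws i v =
     lin_ext (Ext (Suc k)) UR (carrier C) (\<lambda>b s. E.tens c (kd s # ws[i := kd b])) v"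

lemma slot_list:
  "ws \<in> tuples k (carrier \<Omega>) \<Longrightarrow> b \<in> carrier C \<Longrightarrow> w \<in> carrier \<Omega> \<Longrightarrow>
    w # ws[i := kd b] \<in> tuples (Suc k) (carrier \<Omega>)"
  by (simp add: tuples_Cons tuples_update kd_closed)

context
  fixes k i :: nat and c and ws
  assumes c: "c \<in> carrier C" and ws: "ws \<in> tuples k (carrier \<Omega>)" and i: "i < k"
begin

lemma slot_gen_additive:
  assumes b: "b \<in> carrier C"
  shows "additive_map UR (Ext (Suc k)) (\<lambda>s. E.tens c (kd s # ws[i := kd b]))"
proof -
  \<comment> \<open>The zero in front is a placeholder: overwriting slot 0 of this list makes the
    rules for a slot available for the leading factor.\<close>
  have "\<zero>\<^bsub>\<Omega>\<^esub> # ws[i := kd b] \<in> tuples (Suc k) (carrier \<Omega>)"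
    by (rule slot_list[OF ws b]) simp
  from additive_map_comp[OF kd_additive E.tens_slot_additive[OF _ this, of c 0]] c
  show ?thesis by (simp add: UR_carrier)
qed

lemma slot_sum_additive: "additive_map KF (Ext (Suc k)) (slot_sum k c ws i)"
proof -
  have "slot_sum k c ws i = lin_ext (Ext (Suc k)) UR (carrier C) (\<lambda>b s. E.tens c (kd s # ws[i := kd b]))"
    by (rule ext) (simp add: slot_sum_def)
  then show ?thesis
    using UR.lin_ext_additive[OF Ext_abelian_group slot_gen_additive] by (simp add: kaehler_free_def)
qed

lemma slot_sum_gen:
  "b \<in> carrier C \<Longrightarrow> s \<in> carrier C \<Longrightarrow> slot_sum k c ws i (s \<odot>\<^bsub>KF\<^esub> gen_vec b) = E.tens c (kd s # ws[i := kd b])"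
  unfolding slot_sum_def kaehler_free_def
  by (rule UR.lin_ext_basis[OF Ext_abelian_group slot_gen_additive]) (simp_all add: UR_carrier)

text \<open>The relations die because second derivatives are symmetric and the wedge is antisymmetric.\<close>

lemma slot_sum_kills:
  assumes v: "v \<in> kaehler_span C"
  shows "slot_sum k c ws i v = \<zero>\<^bsub>Ext (Suc k)\<^esub>"
proof (rule kaehler_additive_kills[OF Ext_abelian_group slot_sum_additive _ v])
  interpret P: abelian_group "Ext (Suc k)" by (rule Ext_abelian_group)
  fix a n h as
  assume a: "a \<in> carrier C" and h: "h \<in> Cinf n" and as: "as \<in> tuples n (carrier C)"
  have asC: "as ! j \<in> carrier C" if "j < n" for j using as that by (rule tuples_nth)
  have hC: "smooth_op C (pd n j h) as \<in> carrier C" if "j < n" for j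
    using tuples_op_closed[OF as that h] by (simp add: UR_carrier)
  have ahC: "a \<otimes>\<^bsub>UR\<^esub> smooth_op C (pd n j h) as \<in> carrier C" if "j < n" for j
    using a hC[OF that] UR.m_closed[of a "smooth_op C (pd n j h) as"] by (simp add: UR_carrier)
  have acC: "c \<otimes>\<^bsub>UR\<^esub> a \<in> carrier C" using a c UR.m_closed[of c a] by (simp add: UR_carrier)
  define H where "H = (\<lambda>j l. smooth_op C (pd n l (pd n j h)) as)"
  have HC: "H j l \<in> carrier C" if "j < n" "l < n" for j l
    unfolding H_def by (rule op_closed[OF pd_Cinf[OF pd_Cinf[OF h that(1)] that(2)] as])
  have Hsym: "H j l = H l j" if "j < n" "l < n" for j l
    unfolding H_def using pd_commute[OF h that] by simp
  have op: "smooth_op C h as \<in> carrier C" using h as by (rule op_closed)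
  let ?L = "\<lambda>w j. w # ws[i := kd (as ! j)]"
  have L: "?L w j \<in> tuples (Suc k) (carrier \<Omega>)" if "j < n" "w \<in> carrier \<Omega>" for w j
    by (rule slot_list[OF ws asC[OF that(1)] that(2)])
  have tc: "E.tens x (?L w j) \<in> carrier (Ext (Suc k))" if "x \<in> carrier C" "j < n" "w \<in> carrier \<Omega>" for x w j
    using E.tens_closed[OF L[OF that(2,3)], of x] that(1) by (simp add: UR_carrier)
  have len: "length ws = k" using ws by (rule tuples_length)

  have "slot_sum k c ws i (a \<odot>\<^bsub>KF\<^esub> gen_vec (smooth_op C h as)) = E.tens c ((kd a # ws)[Suc i := kd (smooth_op C h as)])"
    using slot_sum_gen[OF op a] by simp
  also have "\<dots> = E.tens c ((kd a # ws)[Suc i := (\<Oplus>\<^bsub>\<Omega>\<^esub>j\<in>{..<n}. smooth_op C (pd n j h) as \<odot>\<^bsub>\<Omega>\<^esub> kd (as ! j))])"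
    by (simp only: kd_op[OF h as])
  also have "\<dots> = (\<Oplus>\<^bsub>Ext (Suc k)\<^esub>j\<in>{..<n}. E.tens c ((kd a # ws)[Suc i := smooth_op C (pd n j h) as \<odot>\<^bsub>\<Omega>\<^esub> kd (as ! j)]))"
  proof (rule additive_pair.finsum[OF E.tens_slot_pair])
    show "kd a # ws \<in> tuples (Suc k) (carrier \<Omega>)" using a ws by (simp add: tuples_Cons kd_closed)
    show "(\<lambda>j. smooth_op C (pd n j h) as \<odot>\<^bsub>\<Omega>\<^esub> kd (as ! j)) \<in> {..<n} \<rightarrow> carrier \<Omega>"
      using hC asC by (auto simp: UR_carrier intro!: E.N.smult_closed kd_closed)
  qed (use c i in \<open>simp_all add: UR_carrier\<close>)
  also have "\<dots> = (\<Oplus>\<^bsub>Ext (Suc k)\<^esub>j\<in>{..<n}. E.tens (c \<otimes>\<^bsub>UR\<^esub> smooth_op C (pd n j h) as) (?L (kd a) j))"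
  proof (rule P.finsum_cong'[OF refl])
    have chC: "c \<otimes>\<^bsub>UR\<^esub> smooth_op C (pd n j h) as \<in> carrier C" if "j < n" for j
      using c hC[OF that] UR.m_closed[of c "smooth_op C (pd n j h) as"] by (simp add: UR_carrier)
    then show "(\<lambda>j. E.tens (c \<otimes>\<^bsub>UR\<^esub> smooth_op C (pd n j h) as) (?L (kd a) j)) \<in> {..<n} \<rightarrow> carrier (Ext (Suc k))"
      by (intro Pi_I tc kd_closed a) auto
    fix j assume "j \<in> {..<n}"
    then have j: "j < n" by simp
    show "E.tens c ((kd a # ws)[Suc i := smooth_op C (pd n j h) as \<odot>\<^bsub>\<Omega>\<^esub> kd (as ! j)]) =
        E.tens (c \<otimes>\<^bsub>UR\<^esub> smooth_op C (pd n j h) as) (?L (kd a) j)"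
      using E.tens_slot_smult[of c "kd a # ws" "Suc k" "Suc i" "smooth_op C (pd n j h) as" "kd (as ! j)"]
        c ws i a hC[OF j] asC[OF j] by (simp add: UR_carrier tuples_Cons kd_closed)
  qed
  finally have lhs: "slot_sum k c ws i (a \<odot>\<^bsub>KF\<^esub> gen_vec (smooth_op C h as)) =
    (\<Oplus>\<^bsub>Ext (Suc k)\<^esub>j\<in>{..<n}. E.tens (c \<otimes>\<^bsub>UR\<^esub> smooth_op C (pd n j h) as) (?L (kd a) j))" .

  \<comment> \<open>The terms with second derivatives: entry \<open>(j, l)\<close> carries the
    Hessian coefficient \<open>H j l\<close>, the differential of \<open>as ! l\<close> in front and
    that of \<open>as ! j\<close> in slot \<open>i\<close>. Exchanging \<open>j\<close> and
    \<open>l\<close> is a swap of two factors.\<close>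
  define s where "s = (\<lambda>j l. E.tens ((c \<otimes>\<^bsub>UR\<^esub> a) \<otimes>\<^bsub>UR\<^esub> H j l) (?L (kd (as ! l)) j))"
  have aH: "(c \<otimes>\<^bsub>UR\<^esub> a) \<otimes>\<^bsub>UR\<^esub> H j l \<in> carrier C" if "j < n" "l < n" for j l
    using acC HC[OF that] UR.m_closed[of "c \<otimes>\<^bsub>UR\<^esub> a" "H j l"] by (simp add: UR_carrier)
  have sc: "s j l \<in> carrier (Ext (Suc k))" if "j < n" "l < n" for j l
    unfolding s_def by (rule tc[OF aH[OF that] that(1) kd_closed[OF asC[OF that(2)]]])
  have s0: "(\<Oplus>\<^bsub>Ext (Suc k)\<^esub>j\<in>{..<n}. finsum (Ext (Suc k)) (s j) {..<n}) = \<zero>\<^bsub>Ext (Suc k)\<^esub>"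
  proof (rule P.antisymmetric_double_sum)
    fix j l assume jl: "j < n" "l < n"
    have z: "\<zero>\<^bsub>\<Omega>\<^esub> # ws \<in> tuples (Suc k) (carrier \<Omega>)" using ws by (simp add: tuples_Cons)
    have "E.tens ((c \<otimes>\<^bsub>UR\<^esub> a) \<otimes>\<^bsub>UR\<^esub> H j l) ((\<zero>\<^bsub>\<Omega>\<^esub> # ws)[0 := kd (as ! l), Suc i := kd (as ! j)]) =
      \<ominus>\<^bsub>Ext (Suc k)\<^esub> E.tens ((c \<otimes>\<^bsub>UR\<^esub> a) \<otimes>\<^bsub>UR\<^esub> H j l) ((\<zero>\<^bsub>\<Omega>\<^esub> # ws)[0 := kd (as ! j), Suc i := kd (as ! l)])"
      by (rule E.tens_swap[OF _ z]) (use aH[OF jl] i asC[OF jl(1)] asC[OF jl(2)] in \<open>simp_all add: UR_carrier kd_closed\<close>)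
    then show "s j l = \<ominus>\<^bsub>Ext (Suc k)\<^esub> s l j"
      unfolding s_def Hsym[OF jl(2,1)] by simp
  next
    fix j assume j: "j < n"
    show "s j j = \<zero>\<^bsub>Ext (Suc k)\<^esub>"
      unfolding s_def
      by (rule E.tens_alt[OF _ L[OF j kd_closed[OF asC[OF j]]], of _ 0 "Suc i"])
         (use aH[OF j j] i len in \<open>simp_all add: UR_carrier\<close>)
  qed (rule sc)

  \<comment> \<open>The differential of the coefficient has two parts by the Leibniz rule: the one
    with \<open>kd a\<close> reproduces term \<open>j\<close> of the left-hand side, and the other
    one expands, by the chain rule for \<open>pd n j h\<close>, into row \<open>j\<close> of the
    Hessian terms.\<close>
  have "slot_sum k c ws i ((a \<otimes>\<^bsub>UR\<^esub> smooth_op C (pd n j h) as) \<odot>\<^bsub>KF\<^esub> gen_vec (as ! j)) =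
      E.tens (c \<otimes>\<^bsub>UR\<^esub> smooth_op C (pd n j h) as) (?L (kd a) j) \<oplus>\<^bsub>Ext (Suc k)\<^esub> finsum (Ext (Suc k)) (s j) {..<n}"
    if j: "j < n" for j
  proof -
    have Lz: "?L \<zero>\<^bsub>\<Omega>\<^esub> j \<in> tuples (Suc k) (carrier \<Omega>)" by (rule L[OF j]) simp
    note add0 = E.tens_slot_add[OF _ Lz, of c 0] and smult0 = E.tens_slot_smult[OF _ Lz, of c 0]
    have hj: "smooth_op C (pd n j h) as \<in> carrier UR" "a \<in> carrier UR" "c \<in> carrier UR"
      using hC[OF j] a c by (simp_all add: UR_carrier)
    have kh: "kd (smooth_op C (pd n j h) as) \<in> carrier \<Omega>" "kd a \<in> carrier \<Omega>"
      using hC[OF j] a by (simp_all add: kd_closed)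
    have "slot_sum k c ws i ((a \<otimes>\<^bsub>UR\<^esub> smooth_op C (pd n j h) as) \<odot>\<^bsub>KF\<^esub> gen_vec (as ! j)) =
        E.tens c (?L (kd (a \<otimes>\<^bsub>UR\<^esub> smooth_op C (pd n j h) as)) j)"
      by (rule slot_sum_gen[OF asC[OF j] ahC[OF j]])
    also have "\<dots> = E.tens c (?L (smooth_op C (pd n j h) as \<odot>\<^bsub>\<Omega>\<^esub> kd a \<oplus>\<^bsub>\<Omega>\<^esub> a \<odot>\<^bsub>\<Omega>\<^esub> kd (smooth_op C (pd n j h) as)) j)"
      by (simp only: kd_mult[OF a hC[OF j]])
    also have "\<dots> = E.tens (c \<otimes>\<^bsub>UR\<^esub> smooth_op C (pd n j h) as) (?L (kd a) j) \<oplus>\<^bsub>Ext (Suc k)\<^esub>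
        E.tens (c \<otimes>\<^bsub>UR\<^esub> a) (?L (kd (smooth_op C (pd n j h) as)) j)"
      using add0[of "smooth_op C (pd n j h) as \<odot>\<^bsub>\<Omega>\<^esub> kd a" "a \<odot>\<^bsub>\<Omega>\<^esub> kd (smooth_op C (pd n j h) as)"]
        smult0[of "smooth_op C (pd n j h) as" "kd a"] smult0[of a "kd (smooth_op C (pd n j h) as)"] hj kh
      by (simp add: E.N.smult_closed)
    also have "E.tens (c \<otimes>\<^bsub>UR\<^esub> a) (?L (kd (smooth_op C (pd n j h) as)) j) =
        E.tens (c \<otimes>\<^bsub>UR\<^esub> a) ((?L \<zero>\<^bsub>\<Omega>\<^esub> j)[0 := \<Oplus>\<^bsub>\<Omega>\<^esub>l\<in>{..<n}. H j l \<odot>\<^bsub>\<Omega>\<^esub> kd (as ! l)])"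
      by (simp add: kd_op[OF pd_Cinf[OF h j] as] H_def)
    also have "\<dots> = (\<Oplus>\<^bsub>Ext (Suc k)\<^esub>l\<in>{..<n}. E.tens (c \<otimes>\<^bsub>UR\<^esub> a) ((?L \<zero>\<^bsub>\<Omega>\<^esub> j)[0 := H j l \<odot>\<^bsub>\<Omega>\<^esub> kd (as ! l)]))"
      by (rule additive_pair.finsum[OF E.tens_slot_pair[OF _ Lz]])
         (use acC HC[OF j] asC in \<open>auto simp: UR_carrier intro!: E.N.smult_closed kd_closed\<close>)
    also have "\<dots> = finsum (Ext (Suc k)) (s j) {..<n}"
    proof (rule P.finsum_cong'[OF refl])
      fix l assume "l \<in> {..<n}"
      then have l: "l < n" by simp
      show "E.tens (c \<otimes>\<^bsub>UR\<^esub> a) ((?L \<zero>\<^bsub>\<Omega>\<^esub> j)[0 := H j l \<odot>\<^bsub>\<Omega>\<^esub> kd (as ! l)]) = s j l"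
        using E.tens_slot_smult[OF _ Lz, of "c \<otimes>\<^bsub>UR\<^esub> a" 0 "H j l" "kd (as ! l)"] acC HC[OF j l] asC[OF l]
        by (simp add: UR_carrier kd_closed s_def)
    qed (use sc[OF j] in auto)
    finally show ?thesis .
  qed
  note eq = this
  have cl1: "E.tens (c \<otimes>\<^bsub>UR\<^esub> smooth_op C (pd n j h) as) (?L (kd a) j) \<in> carrier (Ext (Suc k))" if "j < n" for j
  proof -
    have "c \<otimes>\<^bsub>UR\<^esub> smooth_op C (pd n j h) as \<in> carrier C"
      using c hC[OF that] UR.m_closed[of c "smooth_op C (pd n j h) as"] by (simp add: UR_carrier)
    then show ?thesis by (rule tc[OF _ that kd_closed[OF a]])
  qed
  have cl2: "finsum (Ext (Suc k)) (s j) {..<n} \<in> carrier (Ext (Suc k))" if "j < n" for j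
    by (rule P.finsum_closed) (use sc[OF that] in auto)
  have "(\<Oplus>\<^bsub>Ext (Suc k)\<^esub>j\<in>{..<n}. slot_sum k c ws i ((a \<otimes>\<^bsub>UR\<^esub> smooth_op C (pd n j h) as) \<odot>\<^bsub>KF\<^esub> gen_vec (as ! j))) =
    (\<Oplus>\<^bsub>Ext (Suc k)\<^esub>j\<in>{..<n}. E.tens (c \<otimes>\<^bsub>UR\<^esub> smooth_op C (pd n j h) as) (?L (kd a) j) \<oplus>\<^bsub>Ext (Suc k)\<^esub> finsum (Ext (Suc k)) (s j) {..<n})"
    by (rule P.finsum_cong'[OF refl]) (use eq cl1 cl2 in auto)
  also have "\<dots> = (\<Oplus>\<^bsub>Ext (Suc k)\<^esub>j\<in>{..<n}. E.tens (c \<otimes>\<^bsub>UR\<^esub> smooth_op C (pd n j h) as) (?L (kd a) j)) \<oplus>\<^bsub>Ext (Suc k)\<^esub>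
      (\<Oplus>\<^bsub>Ext (Suc k)\<^esub>j\<in>{..<n}. finsum (Ext (Suc k)) (s j) {..<n})"
    by (rule P.finsum_addf) (use cl1 cl2 in auto)
  also have "\<dots> = slot_sum k c ws i (a \<odot>\<^bsub>KF\<^esub> gen_vec (smooth_op C h as))"
    unfolding s0 lhs by (rule P.r_zero, rule P.finsum_closed) (use cl1 in auto)
  finally show "slot_sum k c ws i (a \<odot>\<^bsub>KF\<^esub> gen_vec (smooth_op C h as)) =
    (\<Oplus>\<^bsub>Ext (Suc k)\<^esub>j\<in>{..<n}. slot_sum k c ws i ((a \<otimes>\<^bsub>UR\<^esub> smooth_op C (pd n j h) as) \<odot>\<^bsub>KF\<^esub> gen_vec (as ! j)))" by simp
qed

end

text \<open>An arbitrary representative turns \<open>slot_sum\<close>, a function of free vectors,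
  into a function of the entries of the list. The choice is harmless because \<open>slot_sum\<close>
  vanishes on the relations.\<close>

definition rep :: "('a \<Rightarrow> 'a) set \<Rightarrow> 'a \<Rightarrow> 'a" where
  "rep w = (SOME v. v \<in> carrier KF \<and> w = kaehler_class C v)"

lemma rep:
  assumes "w \<in> carrier \<Omega>"
  shows "rep w \<in> carrier KF" "kaehler_class C (rep w) = w"
proof -
  have "\<exists>v. v \<in> carrier KF \<and> w = kaehler_class C v"
    using assms by (rule kaehler_cases) blast
  from someI_ex[OF this] show "rep w \<in> carrier KF" "kaehler_class C (rep w) = w"
    by (simp_all add: rep_def)
qed

definition slot :: "nat \<Rightarrow> 'a \<Rightarrow> ('a \<Rightarrow> 'a) set list \<Rightarrow> nat \<Rightarrow> 'a form" where
  "slot k c ws i = slot_sum k c ws i (rep (ws ! i))"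

lemma slot_eq:
  assumes c: "c \<in> carrier C" and ws: "ws \<in> tuples k (carrier \<Omega>)" and i: "i < k"
    and v: "v \<in> carrier KF" "kaehler_class C v = ws ! i"
  shows "slot k c ws i = slot_sum k c ws i v"
proof -
  note r = rep[OF tuples_nth[OF ws i]]
  have "rep (ws ! i) \<in> kaehler_class C v"
    using kaehler_class_self[OF r(1)] r(2) v(2) by simp
  then show ?thesis
    unfolding slot_def
    using kaehler_const_on_class[where F = "slot_sum k c ws i", OF Ext_abelian_group slot_sum_additive[OF c ws i]
        slot_sum_kills[OF c ws i] v(1)] by simp
qed

lemma slot_closed:
  assumes "c \<in> carrier C" "ws \<in> tuples k (carrier \<Omega>)" "i < k"
  shows "slot k c ws i \<in> carrier (Ext (Suc k))"
  unfolding slot_def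
  by (rule additive_map_closed[OF slot_sum_additive[OF assms] rep(1)[OF tuples_nth[OF assms(2,3)]]])

lemma slot_additive:
  assumes ws: "ws \<in> tuples k (carrier \<Omega>)" and i: "i < k"
  shows "additive_map UR (Ext (Suc k)) (\<lambda>c. slot k c ws i)"
proof (rule additive_mapI)
  fix c d assume "c \<in> carrier UR" "d \<in> carrier UR"
  then have cd: "c \<in> carrier C" "d \<in> carrier C" "c \<oplus>\<^bsub>UR\<^esub> d \<in> carrier C"
    using UR.a_closed[of c d] by (simp_all add: UR_carrier)
  show "slot k (c \<oplus>\<^bsub>UR\<^esub> d) ws i = slot k c ws i \<oplus>\<^bsub>Ext (Suc k)\<^esub> slot k d ws i"
    unfolding slot_def
  proof (rule KF_eqI[OF Ext_abelian_group slot_sum_additive[OF cd(3) ws i]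
        additive_map_plus[OF Ext_abelian_group slot_sum_additive[OF cd(1) ws i] slot_sum_additive[OF cd(2) ws i]]])
    fix b s assume bs: "b \<in> carrier C" "s \<in> carrier C"
    show "slot_sum k (c \<oplus>\<^bsub>UR\<^esub> d) ws i (s \<odot>\<^bsub>KF\<^esub> gen_vec b) =
        slot_sum k c ws i (s \<odot>\<^bsub>KF\<^esub> gen_vec b) \<oplus>\<^bsub>Ext (Suc k)\<^esub> slot_sum k d ws i (s \<odot>\<^bsub>KF\<^esub> gen_vec b)"
      unfolding slot_sum_gen[OF cd(1) ws i bs] slot_sum_gen[OF cd(2) ws i bs] slot_sum_gen[OF cd(3) ws i bs]
      by (rule additive_map_add[OF E.tens_additive[OF slot_list[OF ws bs(1) kd_closed[OF bs(2)]]]])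
         (use cd in \<open>simp_all add: UR_carrier\<close>)
  qed (rule rep(1)[OF tuples_nth[OF ws i]])
next
  fix c assume "c \<in> carrier UR"
  then show "slot k c ws i \<in> carrier (Ext (Suc k))"
    using slot_closed[OF _ ws i] by (simp add: UR_carrier)
qed

lemma slot_other_add:
  assumes c: "c \<in> carrier C" and ws: "ws \<in> tuples k (carrier \<Omega>)" and ij: "i < k" "j < k" "j \<noteq> i"
    and uv: "u \<in> carrier \<Omega>" "v \<in> carrier \<Omega>"
  shows "slot k c (ws[j := u \<oplus>\<^bsub>\<Omega>\<^esub> v]) i = slot k c (ws[j := u]) i \<oplus>\<^bsub>Ext (Suc k)\<^esub> slot k c (ws[j := v]) i"
proof -
  have upd: "ws[j := x] \<in> tuples k (carrier \<Omega>)" if "x \<in> carrier \<Omega>" for x using ws that by (rule tuples_update)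
  have uv': "u \<oplus>\<^bsub>\<Omega>\<^esub> v \<in> carrier \<Omega>" using uv by simp
  have nth: "ws[j := x] ! i = ws ! i" for x using ij by simp
  show ?thesis
    unfolding slot_def nth
  proof (rule KF_eqI[OF Ext_abelian_group slot_sum_additive[OF c upd[OF uv'] ij(1)]
        additive_map_plus[OF Ext_abelian_group slot_sum_additive[OF c upd[OF uv(1)] ij(1)]
          slot_sum_additive[OF c upd[OF uv(2)] ij(1)]]])
    fix b s assume bs: "b \<in> carrier C" "s \<in> carrier C"
    have L: "kd s # ws[i := kd b] \<in> tuples (Suc k) (carrier \<Omega>)"
      by (rule slot_list[OF ws bs(1) kd_closed[OF bs(2)]])
    have eq: "kd s # ws[j := x, i := kd b] = (kd s # ws[i := kd b])[Suc j := x]" for x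
      using ij by (simp add: list_update_swap)
    show "slot_sum k c (ws[j := u \<oplus>\<^bsub>\<Omega>\<^esub> v]) i (s \<odot>\<^bsub>KF\<^esub> gen_vec b) =
        slot_sum k c (ws[j := u]) i (s \<odot>\<^bsub>KF\<^esub> gen_vec b) \<oplus>\<^bsub>Ext (Suc k)\<^esub> slot_sum k c (ws[j := v]) i (s \<odot>\<^bsub>KF\<^esub> gen_vec b)"
      unfolding slot_sum_gen[OF c upd[OF uv'] ij(1) bs] slot_sum_gen[OF c upd[OF uv(1)] ij(1) bs]
        slot_sum_gen[OF c upd[OF uv(2)] ij(1) bs] eq
      by (rule E.tens_slot_add[OF _ L]) (use c ij uv in \<open>simp_all add: UR_carrier\<close>)
  qed (rule rep(1)[OF tuples_nth[OF ws ij(1)]])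
qed

lemma slot_other_smult:
  assumes c: "c \<in> carrier C" and ws: "ws \<in> tuples k (carrier \<Omega>)" and ij: "i < k" "j < k" "j \<noteq> i"
    and a: "a \<in> carrier C" and u: "u \<in> carrier \<Omega>"
  shows "slot k c (ws[j := a \<odot>\<^bsub>\<Omega>\<^esub> u]) i = slot k (c \<otimes>\<^bsub>UR\<^esub> a) (ws[j := u]) i"
proof -
  have upd: "ws[j := x] \<in> tuples k (carrier \<Omega>)" if "x \<in> carrier \<Omega>" for x using ws that by (rule tuples_update)
  have au: "a \<odot>\<^bsub>\<Omega>\<^esub> u \<in> carrier \<Omega>" using a u by (simp add: UR_carrier)
  have ca: "c \<otimes>\<^bsub>UR\<^esub> a \<in> carrier C" using UR.m_closed[of c a] c a by (simp add: UR_carrier)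
  have nth: "ws[j := x] ! i = ws ! i" for x using ij by simp
  show ?thesis
    unfolding slot_def nth
  proof (rule KF_eqI[OF Ext_abelian_group slot_sum_additive[OF c upd[OF au] ij(1)] slot_sum_additive[OF ca upd[OF u] ij(1)]])
    fix b s assume bs: "b \<in> carrier C" "s \<in> carrier C"
    have L: "kd s # ws[i := kd b] \<in> tuples (Suc k) (carrier \<Omega>)"
      by (rule slot_list[OF ws bs(1) kd_closed[OF bs(2)]])
    have eq: "kd s # ws[j := x, i := kd b] = (kd s # ws[i := kd b])[Suc j := x]" for x
      using ij by (simp add: list_update_swap)
    show "slot_sum k c (ws[j := a \<odot>\<^bsub>\<Omega>\<^esub> u]) i (s \<odot>\<^bsub>KF\<^esub> gen_vec b) =
        slot_sum k (c \<otimes>\<^bsub>UR\<^esub> a) (ws[j := u]) i (s \<odot>\<^bsub>KF\<^esub> gen_vec b)"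
      unfolding slot_sum_gen[OF c upd[OF au] ij(1) bs] slot_sum_gen[OF ca upd[OF u] ij(1) bs] eq
      by (rule E.tens_slot_smult[OF _ L]) (use c a ij u in \<open>simp_all add: UR_carrier\<close>)
  qed (rule rep(1)[OF tuples_nth[OF ws ij(1)]])
qed

lemma slot_sum_overwrite: "slot_sum k c (ws[i := x]) i = slot_sum k c ws i"
  by (rule ext) (simp add: slot_sum_def)

lemma slot_same_add:
  assumes c: "c \<in> carrier C" and ws: "ws \<in> tuples k (carrier \<Omega>)" and i: "i < k"
    and uv: "u \<in> carrier \<Omega>" "v \<in> carrier \<Omega>"
  shows "slot k c (ws[i := u \<oplus>\<^bsub>\<Omega>\<^esub> v]) i = slot k c (ws[i := u]) i \<oplus>\<^bsub>Ext (Suc k)\<^esub> slot k c (ws[i := v]) i"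
proof -
  have nth: "ws[i := x] ! i = x" for x using ws i by (simp add: tuples_length)
  have uv': "u \<oplus>\<^bsub>\<Omega>\<^esub> v \<in> carrier \<Omega>" using uv by simp
  have "slot k c (ws[i := u \<oplus>\<^bsub>\<Omega>\<^esub> v]) i = slot_sum k c (ws[i := u \<oplus>\<^bsub>\<Omega>\<^esub> v]) i (rep u \<oplus>\<^bsub>KF\<^esub> rep v)"
    by (rule slot_eq[OF c tuples_update[OF ws uv'] i]) (use uv in \<open>simp_all add: nth rep\<close>)
  also have "\<dots> = slot k c (ws[i := u]) i \<oplus>\<^bsub>Ext (Suc k)\<^esub> slot k c (ws[i := v]) i"
    unfolding slot_def nth slot_sum_overwrite
    by (rule additive_map_add[OF slot_sum_additive[OF c ws i]]) (use uv in \<open>simp_all add: rep\<close>)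
  finally show ?thesis .
qed

text \<open>A slot term is not linear over the ring: for a representative \<open>s db\<close> of
  \<open>u\<close>, the differential of \<open>a s\<close> contains \<open>s da\<close> besides
  \<open>a ds\<close>. The first part assembles to the extra product with \<open>da\<close> in front
  of \<open>u\<close>.\<close>

lemma slot_same_smult:
  assumes c: "c \<in> carrier C" and ws: "ws \<in> tuples k (carrier \<Omega>)" and i: "i < k"
    and a: "a \<in> carrier C" and u: "u \<in> carrier \<Omega>"
  shows "slot k c (ws[i := a \<odot>\<^bsub>\<Omega>\<^esub> u]) i =
    slot k (c \<otimes>\<^bsub>UR\<^esub> a) (ws[i := u]) i \<oplus>\<^bsub>Ext (Suc k)\<^esub> E.tens c (kd a # ws[i := u])"
proof -
  have nth: "ws[i := x] ! i = x" for x using ws i by (simp add: tuples_length)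
  have ca: "c \<otimes>\<^bsub>UR\<^esub> a \<in> carrier C" using UR.m_closed[of c a] c a by (simp add: UR_carrier)
  have au: "a \<odot>\<^bsub>\<Omega>\<^esub> u \<in> carrier \<Omega>" using a u by (simp add: UR_carrier)
  have aL: "kd a # ws \<in> tuples (Suc k) (carrier \<Omega>)" using ws a by (simp add: tuples_Cons kd_closed)
  have "slot k c (ws[i := a \<odot>\<^bsub>\<Omega>\<^esub> u]) i = slot_sum k c (ws[i := a \<odot>\<^bsub>\<Omega>\<^esub> u]) i (a \<odot>\<^bsub>KF\<^esub> rep u)"
    by (rule slot_eq[OF c tuples_update[OF ws au] i])
       (use a u in \<open>simp_all add: nth rep kaehler_class_smult UR_carrier\<close>)
  also have "\<dots> = slot_sum k c ws i (a \<odot>\<^bsub>KF\<^esub> rep u)"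
    by (simp only: slot_sum_overwrite)
  also have "\<dots> = slot_sum k (c \<otimes>\<^bsub>UR\<^esub> a) ws i (rep u) \<oplus>\<^bsub>Ext (Suc k)\<^esub> E.tens c ((kd a # ws)[Suc i := kaehler_class C (rep u)])"
  proof (rule KF_eqI[where v = "rep u" and F = "\<lambda>v. slot_sum k c ws i (a \<odot>\<^bsub>KF\<^esub> v)" and
        G = "\<lambda>v. slot_sum k (c \<otimes>\<^bsub>UR\<^esub> a) ws i v \<oplus>\<^bsub>Ext (Suc k)\<^esub> E.tens c ((kd a # ws)[Suc i := kaehler_class C v])"])
    have "additive_map KF KF (\<lambda>v. a \<odot>\<^bsub>KF\<^esub> v)"
      by (rule additive_mapI) (use a in \<open>simp_all add: UR_carrier KF.smult_r_distr\<close>)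
    then show "additive_map KF (Ext (Suc k)) (\<lambda>v. slot_sum k c ws i (a \<odot>\<^bsub>KF\<^esub> v))"
      by (rule additive_map_comp[OF _ slot_sum_additive[OF c ws i]])
    have "additive_map \<Omega> (Ext (Suc k)) (\<lambda>u. E.tens c ((kd a # ws)[Suc i := u]))"
      by (rule E.tens_slot_additive[OF _ aL]) (use c i in \<open>simp_all add: UR_carrier\<close>)
    then show "additive_map KF (Ext (Suc k)) (\<lambda>v. slot_sum k (c \<otimes>\<^bsub>UR\<^esub> a) ws i v \<oplus>\<^bsub>Ext (Suc k)\<^esub> E.tens c ((kd a # ws)[Suc i := kaehler_class C v]))"
      by (intro additive_map_plus[OF Ext_abelian_group slot_sum_additive[OF ca ws i]] additive_map_comp[OF kaehler_class_additive])
    fix b s assume bs: "b \<in> carrier C" "s \<in> carrier C"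
    have as: "a \<otimes>\<^bsub>UR\<^esub> s \<in> carrier C" using UR.m_closed[of a s] a bs by (simp add: UR_carrier)
    have Lz: "\<zero>\<^bsub>\<Omega>\<^esub> # ws[i := kd b] \<in> tuples (Suc k) (carrier \<Omega>)"
      by (rule slot_list[OF ws bs(1)]) simp
    have UR': "a \<in> carrier UR" "s \<in> carrier UR" "c \<in> carrier UR" using a c bs by (simp_all add: UR_carrier)
    have kK: "kd a \<in> carrier \<Omega>" "kd s \<in> carrier \<Omega>" "kd b \<in> carrier \<Omega>" using a bs by (simp_all add: kd_closed)
    have "slot_sum k c ws i (a \<odot>\<^bsub>KF\<^esub> (s \<odot>\<^bsub>KF\<^esub> gen_vec b)) = slot_sum k c ws i ((a \<otimes>\<^bsub>UR\<^esub> s) \<odot>\<^bsub>KF\<^esub> gen_vec b)"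
      using UR' bs(1) by (simp add: KF.smult_assoc1 gen_vec_closed)
    also have "\<dots> = E.tens c ((\<zero>\<^bsub>\<Omega>\<^esub> # ws[i := kd b])[0 := a \<odot>\<^bsub>\<Omega>\<^esub> kd s \<oplus>\<^bsub>\<Omega>\<^esub> s \<odot>\<^bsub>\<Omega>\<^esub> kd a])"
    proof -
      have "kd (a \<otimes>\<^bsub>UR\<^esub> s) = a \<odot>\<^bsub>\<Omega>\<^esub> kd s \<oplus>\<^bsub>\<Omega>\<^esub> s \<odot>\<^bsub>\<Omega>\<^esub> kd a"
        unfolding kd_mult[OF a bs(2)] using UR' kK by (intro E.N.M.a_comm E.N.smult_closed)
      then show ?thesis unfolding slot_sum_gen[OF c ws i bs(1) as] by simp
    qed
    also have "\<dots> = E.tens c ((\<zero>\<^bsub>\<Omega>\<^esub> # ws[i := kd b])[0 := a \<odot>\<^bsub>\<Omega>\<^esub> kd s]) \<oplus>\<^bsub>Ext (Suc k)\<^esub>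
        E.tens c ((\<zero>\<^bsub>\<Omega>\<^esub> # ws[i := kd b])[0 := s \<odot>\<^bsub>\<Omega>\<^esub> kd a])"
      by (rule E.tens_slot_add[OF UR'(3) Lz]) (use UR' kK in \<open>simp_all\<close>)
    also have "E.tens c ((\<zero>\<^bsub>\<Omega>\<^esub> # ws[i := kd b])[0 := a \<odot>\<^bsub>\<Omega>\<^esub> kd s]) = slot_sum k (c \<otimes>\<^bsub>UR\<^esub> a) ws i (s \<odot>\<^bsub>KF\<^esub> gen_vec b)"
      unfolding slot_sum_gen[OF ca ws i bs] using E.tens_slot_smult[OF UR'(3) Lz, of 0 a "kd s"] UR' kK by simp
    also have "E.tens c ((\<zero>\<^bsub>\<Omega>\<^esub> # ws[i := kd b])[0 := s \<odot>\<^bsub>\<Omega>\<^esub> kd a]) = E.tens (c \<otimes>\<^bsub>UR\<^esub> s) (kd a # ws[i := kd b])"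
      using E.tens_slot_smult[OF UR'(3) Lz, of 0 s "kd a"] UR' kK by simp
    also have "\<dots> = E.tens c ((kd a # ws)[Suc i := kaehler_class C (s \<odot>\<^bsub>KF\<^esub> gen_vec b)])"
      unfolding kaehler_class_gen[OF bs(2,1)]
      using E.tens_slot_smult[OF UR'(3) aL, of "Suc i" s "kd b"] UR' kK i by simp
    finally show "slot_sum k c ws i (a \<odot>\<^bsub>KF\<^esub> (s \<odot>\<^bsub>KF\<^esub> gen_vec b)) =
      slot_sum k (c \<otimes>\<^bsub>UR\<^esub> a) ws i (s \<odot>\<^bsub>KF\<^esub> gen_vec b) \<oplus>\<^bsub>Ext (Suc k)\<^esub>
        E.tens c ((kd a # ws)[Suc i := kaehler_class C (s \<odot>\<^bsub>KF\<^esub> gen_vec b)])" .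
  qed (rule Ext_abelian_group, rule rep(1)[OF u])
  finally show ?thesis
    unfolding slot_def nth slot_sum_overwrite using u by (simp add: rep)
qed

end

lemma additive_map_uminus:
  assumes "abelian_group P" "additive_map N P F"
  shows "additive_map N P (\<lambda>x. \<ominus>\<^bsub>P\<^esub> F x)"
proof -
  interpret abelian_group P by fact
  show ?thesis
    by (rule additive_mapI)
       (use assms in \<open>simp_all add: additive_map_closed[OF assms(2)] additive_map_add[OF assms(2)] minus_add\<close>)
qed

section \<open>Existence of the exterior derivative\<close>

context smooth_ring
begin

text \<open>The value that the Leibniz rule forces on \<open>c w_1 \<and> ... \<and> w_k\<close>.
  Neither summand alone is compatible with moving a scalar \<open>a\<close> from a factor into the
  coefficient; the extra term of the slot sum, with \<open>c da\<close> in front, is the part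
  \<open>c da\<close> of \<open>d (c a)\<close>.\<close>

definition dG :: "nat \<Rightarrow> 'a \<Rightarrow> ('a \<Rightarrow> 'a) set list \<Rightarrow> 'a form" where
  "dG k c ws = E.tens \<one>\<^bsub>UR\<^esub> (kd c # ws) \<oplus>\<^bsub>Ext (Suc k)\<^esub> finsum (Ext (Suc k)) (slot k c ws) {..<k}"

lemma Cons_slot:
  assumes "ws \<in> tuples k (carrier \<Omega>)"
  shows "additive_map UR (Ext (Suc k)) (\<lambda>c. E.tens \<one>\<^bsub>UR\<^esub> (kd c # ws))"
proof -
  have "\<zero>\<^bsub>\<Omega>\<^esub> # ws \<in> tuples (Suc k) (carrier \<Omega>)" using assms by (simp add: tuples_Cons)
  from additive_map_comp[OF kd_additive E.tens_slot_additive[OF _ this, of "\<one>\<^bsub>UR\<^esub>" 0]] show ?thesis by simp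
qed

lemma dG_additive:
  assumes ws: "ws \<in> tuples k (carrier \<Omega>)"
  shows "additive_map UR (Ext (Suc k)) (\<lambda>c. dG k c ws)"
  unfolding dG_def
  by (intro additive_map_plus[OF Ext_abelian_group Cons_slot[OF ws]] additive_map_finsum[OF Ext_abelian_group] slot_additive[OF ws])
     simp

lemma slot_Pi:
  assumes "c \<in> carrier C" "ws \<in> tuples k (carrier \<Omega>)"
  shows "slot k c ws \<in> {..<k} \<rightarrow> carrier (Ext (Suc k))"
  using slot_closed[OF assms] by auto

lemma dG_slot_add:
  assumes c: "c \<in> carrier C" and ws: "ws \<in> tuples k (carrier \<Omega>)" and i: "i < k"
    and uv: "u \<in> carrier \<Omega>" "v \<in> carrier \<Omega>"
  shows "dG k c (ws[i := u \<oplus>\<^bsub>\<Omega>\<^esub> v]) = dG k c (ws[i := u]) \<oplus>\<^bsub>Ext (Suc k)\<^esub> dG k c (ws[i := v])"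
proof -
  interpret P: abelian_group "Ext (Suc k)" by (rule Ext_abelian_group)
  have upd: "ws[i := x] \<in> tuples k (carrier \<Omega>)" if "x \<in> carrier \<Omega>" for x using ws that by (rule tuples_update)
  have cw: "kd c # ws \<in> tuples (Suc k) (carrier \<Omega>)" using c ws by (simp add: tuples_Cons kd_closed)
  have "slot k c (ws[i := u \<oplus>\<^bsub>\<Omega>\<^esub> v]) j = slot k c (ws[i := u]) j \<oplus>\<^bsub>Ext (Suc k)\<^esub> slot k c (ws[i := v]) j" if "j < k" for j
    using slot_same_add[OF c ws i uv] slot_other_add[OF c ws that i _ uv] by (cases "j = i") auto
  then have "finsum (Ext (Suc k)) (slot k c (ws[i := u \<oplus>\<^bsub>\<Omega>\<^esub> v])) {..<k} =
      finsum (Ext (Suc k)) (\<lambda>j. slot k c (ws[i := u]) j \<oplus>\<^bsub>Ext (Suc k)\<^esub> slot k c (ws[i := v]) j) {..<k}"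
    by (intro P.finsum_cong'[OF refl] Pi_I P.a_closed) (use slot_closed[OF c upd] uv in auto)
  also have "\<dots> = finsum (Ext (Suc k)) (slot k c (ws[i := u])) {..<k} \<oplus>\<^bsub>Ext (Suc k)\<^esub> finsum (Ext (Suc k)) (slot k c (ws[i := v])) {..<k}"
    by (rule P.finsum_addf[OF slot_Pi[OF c upd[OF uv(1)]] slot_Pi[OF c upd[OF uv(2)]]])
  finally have s: "finsum (Ext (Suc k)) (slot k c (ws[i := u \<oplus>\<^bsub>\<Omega>\<^esub> v])) {..<k} =
    finsum (Ext (Suc k)) (slot k c (ws[i := u])) {..<k} \<oplus>\<^bsub>Ext (Suc k)\<^esub> finsum (Ext (Suc k)) (slot k c (ws[i := v])) {..<k}" .
  have t: "E.tens \<one>\<^bsub>UR\<^esub> (kd c # ws[i := u \<oplus>\<^bsub>\<Omega>\<^esub> v]) =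
      E.tens \<one>\<^bsub>UR\<^esub> (kd c # ws[i := u]) \<oplus>\<^bsub>Ext (Suc k)\<^esub> E.tens \<one>\<^bsub>UR\<^esub> (kd c # ws[i := v])"
    using E.tens_slot_add[OF UR.one_closed cw, of "Suc i" u v] i uv by simp
  have cl: "E.tens \<one>\<^bsub>UR\<^esub> (kd c # ws[i := x]) \<in> carrier (Ext (Suc k))"
      "finsum (Ext (Suc k)) (slot k c (ws[i := x])) {..<k} \<in> carrier (Ext (Suc k))" if "x \<in> carrier \<Omega>" for x
    using additive_map_closed[OF Cons_slot[OF upd[OF that]], of c] c P.finsum_closed[OF slot_Pi[OF c upd[OF that]]]
    by (simp_all add: UR_carrier)
  show ?thesis
    unfolding dG_def s t using cl[OF uv(1)] cl[OF uv(2)] by (simp add: P.a_ac)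
qed

lemma dG_slot_smult:
  assumes c: "c \<in> carrier C" and ws: "ws \<in> tuples k (carrier \<Omega>)" and i: "i < k"
    and a: "a \<in> carrier C" and u: "u \<in> carrier \<Omega>"
  shows "dG k c (ws[i := a \<odot>\<^bsub>\<Omega>\<^esub> u]) = dG k (c \<otimes>\<^bsub>UR\<^esub> a) (ws[i := u])"
proof -
  interpret P: abelian_group "Ext (Suc k)" by (rule Ext_abelian_group)
  have R: "a \<in> carrier UR" "c \<in> carrier UR" using a c by (simp_all add: UR_carrier)
  have ca: "c \<otimes>\<^bsub>UR\<^esub> a \<in> carrier C" using UR.m_closed[OF R(2,1)] by (simp add: UR_carrier)
  have upd: "ws[i := u] \<in> tuples k (carrier \<Omega>)" using ws u by (rule tuples_update)
  have cw: "kd x # ws \<in> tuples (Suc k) (carrier \<Omega>)" "kd x # ws[i := u] \<in> tuples (Suc k) (carrier \<Omega>)"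
    if "x \<in> carrier C" for x using that ws upd by (simp_all add: tuples_Cons kd_closed)
  let ?t = "E.tens c (kd a # ws[i := u])" and ?t' = "E.tens a (kd c # ws[i := u])"
  have t: "?t \<in> carrier (Ext (Suc k))" "?t' \<in> carrier (Ext (Suc k))"
    by (rule E.tens_closed[OF cw(2)[OF a] R(2)], rule E.tens_closed[OF cw(2)[OF c] R(1)])
  let ?e = "\<lambda>j. if i = j then ?t else \<zero>\<^bsub>Ext (Suc k)\<^esub>"
  have "slot k c (ws[i := a \<odot>\<^bsub>\<Omega>\<^esub> u]) j = slot k (c \<otimes>\<^bsub>UR\<^esub> a) (ws[i := u]) j \<oplus>\<^bsub>Ext (Suc k)\<^esub> ?e j" if "j < k" for j
    using slot_same_smult[OF c ws i a u] slot_other_smult[OF c ws that i _ a u] slot_closed[OF ca upd that]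
    by (cases "j = i") auto
  then have "finsum (Ext (Suc k)) (slot k c (ws[i := a \<odot>\<^bsub>\<Omega>\<^esub> u])) {..<k} =
      finsum (Ext (Suc k)) (\<lambda>j. slot k (c \<otimes>\<^bsub>UR\<^esub> a) (ws[i := u]) j \<oplus>\<^bsub>Ext (Suc k)\<^esub> ?e j) {..<k}"
    by (intro P.finsum_cong'[OF refl] Pi_I P.a_closed) (use slot_closed[OF ca upd] t in auto)
  also have "\<dots> = finsum (Ext (Suc k)) (slot k (c \<otimes>\<^bsub>UR\<^esub> a) (ws[i := u])) {..<k} \<oplus>\<^bsub>Ext (Suc k)\<^esub> finsum (Ext (Suc k)) ?e {..<k}"
    by (rule P.finsum_addf[OF slot_Pi[OF ca upd]]) (use t in auto)
  also have "finsum (Ext (Suc k)) ?e {..<k} = ?t"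
    using P.finsum_singleton[of i "{..<k}" "\<lambda>_. ?t"] i t by simp
  finally have s: "finsum (Ext (Suc k)) (slot k c (ws[i := a \<odot>\<^bsub>\<Omega>\<^esub> u])) {..<k} =
    finsum (Ext (Suc k)) (slot k (c \<otimes>\<^bsub>UR\<^esub> a) (ws[i := u])) {..<k} \<oplus>\<^bsub>Ext (Suc k)\<^esub> ?t" .
  have l: "E.tens \<one>\<^bsub>UR\<^esub> (kd c # ws[i := a \<odot>\<^bsub>\<Omega>\<^esub> u]) = ?t'"
    using E.tens_slot_smult[OF UR.one_closed cw(1)[OF c], of "Suc i" a u] i u R by simp
  have Lz: "\<zero>\<^bsub>\<Omega>\<^esub> # ws[i := u] \<in> tuples (Suc k) (carrier \<Omega>)" using upd by (simp add: tuples_Cons)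
  have "E.tens \<one>\<^bsub>UR\<^esub> (kd (c \<otimes>\<^bsub>UR\<^esub> a) # ws[i := u]) =
      E.tens \<one>\<^bsub>UR\<^esub> ((\<zero>\<^bsub>\<Omega>\<^esub> # ws[i := u])[0 := a \<odot>\<^bsub>\<Omega>\<^esub> kd c \<oplus>\<^bsub>\<Omega>\<^esub> c \<odot>\<^bsub>\<Omega>\<^esub> kd a])"
    by (simp add: kd_mult[OF c a])
  also have "\<dots> = E.tens \<one>\<^bsub>UR\<^esub> ((\<zero>\<^bsub>\<Omega>\<^esub> # ws[i := u])[0 := a \<odot>\<^bsub>\<Omega>\<^esub> kd c]) \<oplus>\<^bsub>Ext (Suc k)\<^esub>
      E.tens \<one>\<^bsub>UR\<^esub> ((\<zero>\<^bsub>\<Omega>\<^esub> # ws[i := u])[0 := c \<odot>\<^bsub>\<Omega>\<^esub> kd a])"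
    by (rule E.tens_slot_add[OF UR.one_closed Lz]) (use R a c in \<open>simp_all add: kd_closed\<close>)
  also have "E.tens \<one>\<^bsub>UR\<^esub> ((\<zero>\<^bsub>\<Omega>\<^esub> # ws[i := u])[0 := a \<odot>\<^bsub>\<Omega>\<^esub> kd c]) = ?t'"
    using E.tens_slot_smult[OF UR.one_closed Lz, of 0 a "kd c"] R c by (simp add: kd_closed)
  also have "E.tens \<one>\<^bsub>UR\<^esub> ((\<zero>\<^bsub>\<Omega>\<^esub> # ws[i := u])[0 := c \<odot>\<^bsub>\<Omega>\<^esub> kd a]) = ?t"
    using E.tens_slot_smult[OF UR.one_closed Lz, of 0 c "kd a"] R a by (simp add: kd_closed)
  finally have r: "E.tens \<one>\<^bsub>UR\<^esub> (kd (c \<otimes>\<^bsub>UR\<^esub> a) # ws[i := u]) = ?t' \<oplus>\<^bsub>Ext (Suc k)\<^esub> ?t" .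
  show ?thesis
    unfolding dG_def s l r using t P.finsum_closed[OF slot_Pi[OF ca upd]] by (simp add: P.a_ac)
qed

text \<open>If the entries \<open>i\<close> and \<open>j\<close> agree, every term that
  differentiates another slot still has a repeated entry. The terms of the slots \<open>i\<close>
  and \<open>j\<close> are each other's negatives, as they differ by the exchange of these two
  slots.\<close>

lemma dG_alt:
  assumes c: "c \<in> carrier C" and ws: "ws \<in> tuples k (carrier \<Omega>)" and ij: "i < j" "j < k" "ws ! i = ws ! j"
  shows "dG k c ws = \<zero>\<^bsub>Ext (Suc k)\<^esub>"
proof -
  interpret P: abelian_group "Ext (Suc k)" by (rule Ext_abelian_group)
  have R: "c \<in> carrier UR" using c by (simp add: UR_carrier)
  have i: "i < k" using ij by simp
  have len: "length ws = k" using ws by (rule tuples_length)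
  have w: "ws ! i \<in> carrier \<Omega>" by (rule tuples_nth[OF ws i])
  have t: "E.tens \<one>\<^bsub>UR\<^esub> (kd c # ws) = \<zero>\<^bsub>Ext (Suc k)\<^esub>"
    by (rule E.tens_alt[OF UR.one_closed, of _ _ "Suc i" "Suc j"])
       (use c ws ij in \<open>simp_all add: tuples_Cons kd_closed\<close>)
  have zero_map: "additive_map KF (Ext (Suc k)) (\<lambda>v. \<zero>\<^bsub>Ext (Suc k)\<^esub>)"
    by (rule additive_mapI) auto
  have other: "slot k c ws l = \<zero>\<^bsub>Ext (Suc k)\<^esub>" if l: "l < k" "l \<noteq> i" "l \<noteq> j" for l
    unfolding slot_def
  proof (rule KF_eqI[OF Ext_abelian_group slot_sum_additive[OF c ws l(1)] zero_map])
    fix b s assume bs: "b \<in> carrier C" "s \<in> carrier C"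
    show "slot_sum k c ws l (s \<odot>\<^bsub>KF\<^esub> gen_vec b) = \<zero>\<^bsub>Ext (Suc k)\<^esub>"
      unfolding slot_sum_gen[OF c ws l(1) bs]
      by (rule E.tens_alt[OF R slot_list[OF ws bs(1) kd_closed[OF bs(2)]], of "Suc i" "Suc j"])
         (use ij l in simp_all)
  qed (rule rep(1)[OF tuples_nth[OF ws l(1)]])
  have pair: "slot_sum k c ws i v \<oplus>\<^bsub>Ext (Suc k)\<^esub> slot_sum k c ws j v = \<zero>\<^bsub>Ext (Suc k)\<^esub>" if "v \<in> carrier KF" for v
  proof (rule KF_eqI[OF Ext_abelian_group additive_map_plus[OF Ext_abelian_group slot_sum_additive[OF c ws i]
          slot_sum_additive[OF c ws ij(2)]] zero_map _ that])
    fix b s assume bs: "b \<in> carrier C" "s \<in> carrier C"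
    have sL: "kd s # ws \<in> tuples (Suc k) (carrier \<Omega>)" using ws bs by (simp add: tuples_Cons kd_closed)
    have a1: "kd s # ws[i := kd b] = (kd s # ws)[Suc i := kd b, Suc j := ws ! i]"
      using ij by (simp add: list_update_swap[of i j])
    have a2: "kd s # ws[j := kd b] = (kd s # ws)[Suc i := ws ! i, Suc j := kd b]" by simp
    have sw: "E.tens c (kd s # ws[i := kd b]) = \<ominus>\<^bsub>Ext (Suc k)\<^esub> E.tens c (kd s # ws[j := kd b])"
      unfolding a1 a2 by (rule E.tens_swap[OF R sL]) (use ij w bs in \<open>simp_all add: kd_closed\<close>)
    show "slot_sum k c ws i (s \<odot>\<^bsub>KF\<^esub> gen_vec b) \<oplus>\<^bsub>Ext (Suc k)\<^esub> slot_sum k c ws j (s \<odot>\<^bsub>KF\<^esub> gen_vec b) = \<zero>\<^bsub>Ext (Suc k)\<^esub>"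
      unfolding slot_sum_gen[OF c ws i bs] slot_sum_gen[OF c ws ij(2) bs] sw
      by (rule P.l_neg, rule E.tens_closed[OF slot_list[OF ws bs(1) kd_closed[OF bs(2)]] R])
  qed
  have "finsum (Ext (Suc k)) (slot k c ws) {..<k} = finsum (Ext (Suc k)) (slot k c ws) {i, j}"
    by (rule P.add.finprod_mono_neutral_cong_right) (use ij other slot_closed[OF c ws] in auto)
  also have "\<dots> = slot k c ws i \<oplus>\<^bsub>Ext (Suc k)\<^esub> slot k c ws j"
    using ij slot_closed[OF c ws] by (simp add: P.finsum_insert)
  also have "\<dots> = \<zero>\<^bsub>Ext (Suc k)\<^esub>"
    unfolding slot_def ij(3)[symmetric] by (rule pair[OF rep(1)[OF w]])
  finally show ?thesis by (simp add: dG_def t)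
qed

definition dlin :: "nat \<Rightarrow> (('a \<Rightarrow> 'a) set list \<Rightarrow> 'a) \<Rightarrow> 'a form" where
  "dlin k v = lin_ext (Ext (Suc k)) UR (tuples k (carrier \<Omega>)) (\<lambda>ws c. dG k c ws) v"

lemma dlin_additive: "additive_map (ext_free UR \<Omega> k) (Ext (Suc k)) (dlin k)"
proof -
  have "dlin k = lin_ext (Ext (Suc k)) UR (tuples k (carrier \<Omega>)) (\<lambda>ws c. dG k c ws)"
    by (rule ext) (simp add: dlin_def)
  then show ?thesis
    using UR.lin_ext_additive[OF Ext_abelian_group dG_additive] by (simp add: ext_free_def)
qed

lemma dlin_simple:
  assumes "c \<in> carrier UR" "ws \<in> tuples k (carrier \<Omega>)"
  shows "dlin k (E.simple k c ws) = dG k c ws"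
  unfolding dlin_def ext_free_def
  by (rule UR.lin_ext_basis[OF Ext_abelian_group dG_additive]) (use assms in simp_all)

lemma dlin_kills:
  assumes "v \<in> ext_span UR \<Omega> k"
  shows "dlin k v = \<zero>\<^bsub>Ext (Suc k)\<^esub>"
  by (rule E.additive_kills_ext_span[OF Ext_abelian_group dlin_additive _ _ _ assms])
     (simp_all add: dlin_simple tuples_update dG_slot_add dG_slot_smult dG_alt UR.m_closed UR_carrier[symmetric])

text \<open>Restricted to the carrier because \<open>is_exterior_derivative\<close> asks for
  extensional maps; without this the definite description would not be met by this function.\<close>

definition dmap :: "nat \<Rightarrow> 'a form \<Rightarrow> 'a form" where
  "dmap k = (\<lambda>\<alpha>\<in>carrier (Ext k). dlin k (SOME v. v \<in> carrier (ext_free UR \<Omega> k) \<and> \<alpha> = ext_class UR \<Omega> k v))"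

lemma dmap_class:
  assumes v: "v \<in> carrier (ext_free UR \<Omega> k)"
  shows "dmap k (ext_class UR \<Omega> k v) = dlin k v"
proof -
  define u where "u = (SOME u. u \<in> carrier (ext_free UR \<Omega> k) \<and> ext_class UR \<Omega> k v = ext_class UR \<Omega> k u)"
  have "\<exists>u. u \<in> carrier (ext_free UR \<Omega> k) \<and> ext_class UR \<Omega> k v = ext_class UR \<Omega> k u" using v by blast
  from someI_ex[OF this] have u: "u \<in> carrier (ext_free UR \<Omega> k)" "ext_class UR \<Omega> k v = ext_class UR \<Omega> k u"
    by (simp_all add: u_def)
  have uv: "u \<in> ext_class UR \<Omega> k v" using E.ext_class_self[OF u(1)] u(2) by simp
  have "dmap k (ext_class UR \<Omega> k v) = dlin k u"
    using additive_map_closed[OF E.ext_class_additive v] by (simp add: dmap_def u_def)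
  also have "\<dots> = dlin k v"
    by (rule E.const_on_ext_class[where F = "dlin k", OF Ext_abelian_group dlin_additive dlin_kills v uv])
  finally show ?thesis .
qed

lemma dmap_additive: "additive_map (Ext k) (Ext (Suc k)) (dmap k)"
proof (rule additive_mapI)
  interpret F: module UR "ext_free UR \<Omega> k" by (rule E.ext_free_module)
  fix \<alpha> assume "\<alpha> \<in> carrier (Ext k)"
  then obtain v where v: "v \<in> carrier (ext_free UR \<Omega> k)" "\<alpha> = ext_class UR \<Omega> k v" by (rule E.ext_power_cases)
  show "dmap k \<alpha> \<in> carrier (Ext (Suc k))"
    unfolding v(2) dmap_class[OF v(1)] by (rule additive_map_closed[OF dlin_additive v(1)])
  fix \<beta> assume "\<beta> \<in> carrier (Ext k)"
  then obtain w where w: "w \<in> carrier (ext_free UR \<Omega> k)" "\<beta> = ext_class UR \<Omega> k w" by (rule E.ext_power_cases)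
  show "dmap k (\<alpha> \<oplus>\<^bsub>Ext k\<^esub> \<beta>) = dmap k \<alpha> \<oplus>\<^bsub>Ext (Suc k)\<^esub> dmap k \<beta>"
    unfolding v(2) w(2) additive_map_add[OF E.ext_class_additive v(1) w(1), symmetric]
      dmap_class[OF v(1)] dmap_class[OF w(1)] dmap_class[OF F.M.a_closed[OF v(1) w(1)]]
    by (rule additive_map_add[OF dlin_additive v(1) w(1)])
qed

text \<open>The form \<open>a db_1 \<and> ... \<and> db_k\<close>. These forms generate additively,
  so every identity between additive maps of forms is checked on them, where differential, product
  and functoriality are explicit.\<close>

definition gen :: "'a \<Rightarrow> 'a list \<Rightarrow> 'a form" where
  "gen a bs = E.tens a (map kd bs)"

lemma map_kd: "bs \<in> tuples k (carrier C) \<Longrightarrow> map kd bs \<in> tuples k (carrier \<Omega>)"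
  by (erule tuples_map) (rule kd_closed)

lemma gen_closed: "a \<in> carrier C \<Longrightarrow> bs \<in> tuples k (carrier C) \<Longrightarrow> gen a bs \<in> carrier (Ext k)"
  unfolding gen_def by (rule E.tens_closed[OF map_kd]) (simp_all add: UR_carrier)

lemma gen_induct [consumes 1, case_names zero gen add]:
  assumes "\<alpha> \<in> carrier (Ext k)"
    and "Q \<zero>\<^bsub>Ext k\<^esub>"
    and "\<And>a bs. a \<in> carrier C \<Longrightarrow> bs \<in> tuples k (carrier C) \<Longrightarrow> Q (gen a bs)"
    and "\<And>\<alpha> \<beta>. \<alpha> \<in> carrier (Ext k) \<Longrightarrow> \<beta> \<in> carrier (Ext k) \<Longrightarrow> Q \<alpha> \<Longrightarrow> Q \<beta> \<Longrightarrow> Q (\<alpha> \<oplus>\<^bsub>Ext k\<^esub> \<beta>)"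
  shows "Q \<alpha>"
proof (rule E.ext_induct[OF kaehler_generates assms(1,2) _ assms(4)])
  fix c ws assume c: "c \<in> carrier UR" and ws: "ws \<in> tuples k (kd ` carrier C)"
  then have "ws \<in> lists (kd ` carrier C)" by (auto simp: tuples_def)
  then obtain bs where "ws = map kd bs" "bs \<in> lists (carrier C)"
    unfolding lists_image by blast
  with ws have "bs \<in> tuples k (carrier C)" "ws = map kd bs" by (auto simp: tuples_def)
  then show "Q (E.tens c ws)" using assms(3)[of c bs] c by (simp add: gen_def UR_carrier)
qed

lemma gen_eqI:
  assumes P: "abelian_group P" and A: "additive_map (Ext k) P A" and B: "additive_map (Ext k) P B"
    and eq: "\<And>a bs. a \<in> carrier C \<Longrightarrow> bs \<in> tuples k (carrier C) \<Longrightarrow> A (gen a bs) = B (gen a bs)"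
    and \<alpha>: "\<alpha> \<in> carrier (Ext k)"
  shows "A \<alpha> = B \<alpha>"
proof -
  interpret A: additive_pair "Ext k" P A
    by (intro additive_pair.intro additive_pair_axioms.intro Ext_abelian_group P A)
  interpret B: additive_pair "Ext k" P B
    by (intro additive_pair.intro additive_pair_axioms.intro Ext_abelian_group P B)
  from \<alpha> show ?thesis
    by (induction rule: gen_induct) (simp_all add: eq)
qed

text \<open>Each entry \<open>db_i\<close> has a representative with coefficient 1. Since
  \<open>d1 = 0\<close>, all slot terms vanish and only the differential of the coefficient
  remains.\<close>

lemma dmap_gen:
  assumes a: "a \<in> carrier C" and bs: "bs \<in> tuples k (carrier C)"
  shows "dmap k (gen a bs) = gen \<one>\<^bsub>UR\<^esub> (a # bs)"
proof -
  interpret P: abelian_group "Ext (Suc k)" by (rule Ext_abelian_group)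
  have R: "a \<in> carrier UR" using a by (simp add: UR_carrier)
  note ws = map_kd[OF bs]
  have one: "\<one>\<^bsub>UR\<^esub> \<in> carrier C" using UR.one_closed by (simp add: UR_carrier)
  have "slot k a (map kd bs) i = \<zero>\<^bsub>Ext (Suc k)\<^esub>" if i: "i < k" for i
  proof -
    have b: "bs ! i \<in> carrier C" by (rule tuples_nth[OF bs i])
    have "kaehler_class C (\<one>\<^bsub>UR\<^esub> \<odot>\<^bsub>KF\<^esub> gen_vec (bs ! i)) = map kd bs ! i"
      unfolding kaehler_class_gen[OF one b] using b i bs by (simp add: tuples_length kd_closed)
    then have "slot k a (map kd bs) i = slot_sum k a (map kd bs) i (\<one>\<^bsub>UR\<^esub> \<odot>\<^bsub>KF\<^esub> gen_vec (bs ! i))"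
      by (intro slot_eq[OF a ws i]) (use b in \<open>simp_all add: gen_vec_closed\<close>)
    also have "\<dots> = E.tens a ((\<zero>\<^bsub>\<Omega>\<^esub> # (map kd bs)[i := kd (bs ! i)])[0 := \<zero>\<^bsub>\<Omega>\<^esub>])"
      by (simp add: slot_sum_gen[OF a ws i b one] kd_one)
    also have "\<dots> = \<zero>\<^bsub>Ext (Suc k)\<^esub>"
      by (rule E.tens_slot_zero[OF R slot_list[OF ws b E.N.M.zero_closed]]) simp
    finally show ?thesis .
  qed
  then have "finsum (Ext (Suc k)) (slot k a (map kd bs)) {..<k} = \<zero>\<^bsub>Ext (Suc k)\<^esub>"
    by (intro P.add.finprod_one_eqI) auto
  moreover have "E.tens \<one>\<^bsub>UR\<^esub> (kd a # map kd bs) \<in> carrier (Ext (Suc k))"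
    by (rule E.tens_closed) (use ws a in \<open>simp_all add: tuples_Cons kd_closed\<close>)
  ultimately show ?thesis
    unfolding gen_def E.tens_eq[OF ws] dmap_class[OF E.simple_closed[OF ws R]] dlin_simple[OF R ws]
    by (simp add: dG_def)
qed

lemma wedge_gen:
  assumes "a \<in> carrier C" "b \<in> carrier C" "as \<in> tuples p (carrier C)" "bs \<in> tuples q (carrier C)"
  shows "wedge UR \<Omega> p q (gen a as) (gen b bs) = gen (a \<otimes>\<^bsub>UR\<^esub> b) (as @ bs)"
  unfolding gen_def using E.wedge_tens[OF map_kd[OF assms(3)] map_kd[OF assms(4)], of a b] assms
  by (simp add: UR_carrier)

lemma gen_leibniz:
  assumes a: "a \<in> carrier C" and b: "b \<in> carrier C" and bs: "bs \<in> tuples k (carrier C)"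
  shows "gen \<one>\<^bsub>UR\<^esub> ((a \<otimes>\<^bsub>UR\<^esub> b) # bs) = gen b (a # bs) \<oplus>\<^bsub>Ext (Suc k)\<^esub> gen a (b # bs)"
proof -
  have R: "a \<in> carrier UR" "b \<in> carrier UR" using a b by (simp_all add: UR_carrier)
  note ws = map_kd[OF bs]
  have Lz: "\<zero>\<^bsub>\<Omega>\<^esub> # map kd bs \<in> tuples (Suc k) (carrier \<Omega>)" using ws by (simp add: tuples_Cons)
  have "gen \<one>\<^bsub>UR\<^esub> ((a \<otimes>\<^bsub>UR\<^esub> b) # bs) =
      E.tens \<one>\<^bsub>UR\<^esub> ((\<zero>\<^bsub>\<Omega>\<^esub> # map kd bs)[0 := b \<odot>\<^bsub>\<Omega>\<^esub> kd a \<oplus>\<^bsub>\<Omega>\<^esub> a \<odot>\<^bsub>\<Omega>\<^esub> kd b])"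
    by (simp add: kd_mult[OF a b] gen_def)
  also have "\<dots> = E.tens \<one>\<^bsub>UR\<^esub> ((\<zero>\<^bsub>\<Omega>\<^esub> # map kd bs)[0 := b \<odot>\<^bsub>\<Omega>\<^esub> kd a]) \<oplus>\<^bsub>Ext (Suc k)\<^esub>
      E.tens \<one>\<^bsub>UR\<^esub> ((\<zero>\<^bsub>\<Omega>\<^esub> # map kd bs)[0 := a \<odot>\<^bsub>\<Omega>\<^esub> kd b])"
    by (rule E.tens_slot_add[OF UR.one_closed Lz]) (use R a b in \<open>simp_all add: kd_closed\<close>)
  also have "E.tens \<one>\<^bsub>UR\<^esub> ((\<zero>\<^bsub>\<Omega>\<^esub> # map kd bs)[0 := b \<odot>\<^bsub>\<Omega>\<^esub> kd a]) = gen b (a # bs)"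
    using E.tens_slot_smult[OF UR.one_closed Lz, of 0 b "kd a"] R a by (simp add: kd_closed gen_def)
  also have "E.tens \<one>\<^bsub>UR\<^esub> ((\<zero>\<^bsub>\<Omega>\<^esub> # map kd bs)[0 := a \<odot>\<^bsub>\<Omega>\<^esub> kd b]) = gen a (b # bs)"
    using E.tens_slot_smult[OF UR.one_closed Lz, of 0 a "kd b"] R b by (simp add: kd_closed gen_def)
  finally show ?thesis .
qed

lemma gen_move:
  assumes "a \<in> carrier C" "b \<in> carrier C" "as \<in> tuples p (carrier C)" "bs \<in> tuples q (carrier C)"
  shows "gen a (as @ b # bs) = (if even p then gen a (b # as @ bs) else \<ominus>\<^bsub>Ext (Suc (p + q))\<^esub> gen a (b # as @ bs))"
  unfolding gen_def using E.tens_move[OF _ kd_closed[OF assms(2)] map_kd[OF assms(3)] map_kd[OF assms(4)], of a] assms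
  by (simp add: UR_carrier)

lemma \<Lambda>\<Omega>_eq: "\<Lambda>\<Omega> C k = Ext k"
  by (simp add: \<Lambda>\<Omega>_def)

text \<open>Both sides are additive in each factor, so generators suffice. There the ordinary
  Leibniz rule for the product of the coefficients gives two terms, and the sign is that of moving
  the differential of the second coefficient to the front past \<open>p\<close> factors.\<close>

lemma dmap_leibniz:
  assumes \<alpha>: "\<alpha> \<in> carrier (Ext p)" and \<beta>: "\<beta> \<in> carrier (Ext q)"
  shows "dmap (p + q) (wedge UR \<Omega> p q \<alpha> \<beta>) =
    (if even p
     then wedge UR \<Omega> (Suc p) q (dmap p \<alpha>) \<beta> \<oplus>\<^bsub>Ext (Suc (p + q))\<^esub> wedge UR \<Omega> p (Suc q) \<alpha> (dmap q \<beta>)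
     else wedge UR \<Omega> (Suc p) q (dmap p \<alpha>) \<beta> \<ominus>\<^bsub>Ext (Suc (p + q))\<^esub> wedge UR \<Omega> p (Suc q) \<alpha> (dmap q \<beta>))"
proof -
  let ?P = "Ext (Suc (p + q))"
  interpret P: abelian_group ?P by (rule Ext_abelian_group)
  let ?L = "\<lambda>\<alpha> \<beta>. dmap (p + q) (wedge UR \<Omega> p q \<alpha> \<beta>)"
  let ?A = "\<lambda>\<alpha> \<beta>. wedge UR \<Omega> (Suc p) q (dmap p \<alpha>) \<beta>"
  let ?B = "\<lambda>\<alpha> \<beta>. wedge UR \<Omega> p (Suc q) \<alpha> (dmap q \<beta>)"
  let ?B' = "\<lambda>\<alpha> \<beta>. if even p then ?B \<alpha> \<beta> else \<ominus>\<^bsub>?P\<^esub> ?B \<alpha> \<beta>"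
  have sign: "additive_map N ?P (\<lambda>x. if even p then F x else \<ominus>\<^bsub>?P\<^esub> F x)" if "additive_map N ?P F"
    for N :: "('a, 'a form) module" and F
    using that additive_map_uminus[OF Ext_abelian_group that] by (cases "even p") auto
  have L1: "additive_map (Ext p) ?P (\<lambda>\<alpha>. ?L \<alpha> \<beta>)" if "\<beta> \<in> carrier (Ext q)" for \<beta>
    by (rule additive_map_comp[OF E.wedge_additive_left[OF that] dmap_additive])
  have L2: "additive_map (Ext q) ?P (\<lambda>\<beta>. ?L \<alpha> \<beta>)" if "\<alpha> \<in> carrier (Ext p)" for \<alpha>
    by (rule additive_map_comp[OF E.wedge_additive_right[OF that] dmap_additive])
  have dc: "dmap k \<gamma> \<in> carrier (Ext (Suc k))" if "\<gamma> \<in> carrier (Ext k)" for k \<gamma>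
    by (rule additive_map_closed[OF dmap_additive that])
  have A1: "additive_map (Ext p) ?P (\<lambda>\<alpha>. ?A \<alpha> \<beta>)" if "\<beta> \<in> carrier (Ext q)" for \<beta>
    using additive_map_comp[OF dmap_additive E.wedge_additive_left[OF that, of "Suc p"]] by simp
  have A2: "additive_map (Ext q) ?P (\<lambda>\<beta>. ?A \<alpha> \<beta>)" if "\<alpha> \<in> carrier (Ext p)" for \<alpha>
    using E.wedge_additive_right[OF dc[OF that], of q] by simp
  have B1: "additive_map (Ext p) ?P (\<lambda>\<alpha>. ?B' \<alpha> \<beta>)" if "\<beta> \<in> carrier (Ext q)" for \<beta>
    by (rule sign) (use E.wedge_additive_left[OF dc[OF that], of p] in simp)
  have B2: "additive_map (Ext q) ?P (\<lambda>\<beta>. ?B' \<alpha> \<beta>)" if "\<alpha> \<in> carrier (Ext p)" for \<alpha>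
    by (rule sign) (use additive_map_comp[OF dmap_additive E.wedge_additive_right[OF that, of "Suc q"]] in simp)
  have "?L \<alpha> \<beta> = ?A \<alpha> \<beta> \<oplus>\<^bsub>?P\<^esub> ?B' \<alpha> \<beta>"
  proof (rule gen_eqI[where A = "\<lambda>\<alpha>. ?L \<alpha> \<beta>" and B = "\<lambda>\<alpha>. ?A \<alpha> \<beta> \<oplus>\<^bsub>?P\<^esub> ?B' \<alpha> \<beta>",
        OF Ext_abelian_group L1[OF \<beta>] additive_map_plus[OF Ext_abelian_group A1[OF \<beta>] B1[OF \<beta>]] _ \<alpha>])
    fix a as assume a: "a \<in> carrier C" and as: "as \<in> tuples p (carrier C)"
    let ?\<alpha> = "gen a as"
    have \<alpha>': "?\<alpha> \<in> carrier (Ext p)" by (rule gen_closed[OF a as])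
    show "?L ?\<alpha> \<beta> = ?A ?\<alpha> \<beta> \<oplus>\<^bsub>?P\<^esub> ?B' ?\<alpha> \<beta>"
    proof (rule gen_eqI[where A = "\<lambda>\<beta>. ?L ?\<alpha> \<beta>" and B = "\<lambda>\<beta>. ?A ?\<alpha> \<beta> \<oplus>\<^bsub>?P\<^esub> ?B' ?\<alpha> \<beta>",
          OF Ext_abelian_group L2[OF \<alpha>'] additive_map_plus[OF Ext_abelian_group A2[OF \<alpha>'] B2[OF \<alpha>']] _ \<beta>])
      fix b bs assume b: "b \<in> carrier C" and bs: "bs \<in> tuples q (carrier C)"
      have R: "a \<in> carrier UR" "b \<in> carrier UR" using a b by (simp_all add: UR_carrier)
      have ab: "a \<otimes>\<^bsub>UR\<^esub> b \<in> carrier C" using UR.m_closed[OF R] by (simp add: UR_carrier)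
      have one: "\<one>\<^bsub>UR\<^esub> \<in> carrier C" using UR.one_closed by (simp add: UR_carrier)
      have abs: "as @ bs \<in> tuples (p + q) (carrier C)" by (rule tuples_append[OF as bs])
      have l: "?L ?\<alpha> (gen b bs) = gen b (a # as @ bs) \<oplus>\<^bsub>?P\<^esub> gen a (b # as @ bs)"
        unfolding wedge_gen[OF a b as bs] dmap_gen[OF ab abs] by (rule gen_leibniz[OF a b abs])
      have aas: "a # as \<in> tuples (Suc p) (carrier C)" "b # bs \<in> tuples (Suc q) (carrier C)"
        using a as b bs by (simp_all add: tuples_Cons)
      have r1: "?A ?\<alpha> (gen b bs) = gen b (a # as @ bs)"
        unfolding dmap_gen[OF a as] wedge_gen[OF one b aas(1) bs] using R by simp
      have r2: "?B ?\<alpha> (gen b bs) = gen a (as @ b # bs)"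
        unfolding dmap_gen[OF b bs] wedge_gen[OF a one as aas(2)] using R by simp
      have "gen a (b # as @ bs) \<in> carrier ?P"
        by (rule gen_closed) (use a b abs in \<open>simp_all add: tuples_Cons\<close>)
      then have r2': "?B' ?\<alpha> (gen b bs) = gen a (b # as @ bs)"
        unfolding r2 gen_move[OF a b as bs] by (simp add: P.minus_minus)
      show "?L ?\<alpha> (gen b bs) = ?A ?\<alpha> (gen b bs) \<oplus>\<^bsub>?P\<^esub> ?B' ?\<alpha> (gen b bs)"
        unfolding l r1 r2' ..
    qed
  qed
  then show ?thesis by (simp add: a_minus_def)
qed

lemma dmap_exterior_derivative: "is_exterior_derivative C dmap"
  unfolding is_exterior_derivative_def Let_def \<Lambda>\<Omega>_eq
proof (intro conjI allI ballI)
  fix k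
  show "dmap k \<in> carrier (Ext k) \<rightarrow>\<^sub>E carrier (Ext (Suc k))"
    using additive_map_closed[OF dmap_additive[of k]] by (auto simp: dmap_def)
  fix \<alpha> assume \<alpha>: "\<alpha> \<in> carrier (Ext k)"
  show "dmap k (\<alpha> \<oplus>\<^bsub>Ext k\<^esub> \<beta>) = dmap k \<alpha> \<oplus>\<^bsub>Ext (Suc k)\<^esub> dmap k \<beta>" if "\<beta> \<in> carrier (Ext k)" for \<beta>
    by (rule additive_map_add[OF dmap_additive \<alpha> that])
  interpret P: abelian_group "Ext (Suc (Suc k))" by (rule Ext_abelian_group)
  have z: "additive_map (Ext k) (Ext (Suc (Suc k))) (\<lambda>_. \<zero>\<^bsub>Ext (Suc (Suc k))\<^esub>)"
    by (rule additive_mapI) auto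
  show "dmap (Suc k) (dmap k \<alpha>) = \<zero>\<^bsub>Ext (Suc (Suc k))\<^esub>"
  proof (rule gen_eqI[OF Ext_abelian_group additive_map_comp[OF dmap_additive dmap_additive] z _ \<alpha>])
    fix a bs assume a: "a \<in> carrier C" and bs: "bs \<in> tuples k (carrier C)"
    have one: "\<one>\<^bsub>UR\<^esub> \<in> carrier C" using UR.one_closed by (simp add: UR_carrier)
    have abs: "a # bs \<in> tuples (Suc k) (carrier C)" using a bs by (simp add: tuples_Cons)
    have Lz: "\<zero>\<^bsub>\<Omega>\<^esub> # map kd (a # bs) \<in> tuples (Suc (Suc k)) (carrier \<Omega>)"
      using map_kd[OF abs] by (simp add: tuples_Cons)
    have "dmap (Suc k) (dmap k (gen a bs)) = E.tens \<one>\<^bsub>UR\<^esub> ((\<zero>\<^bsub>\<Omega>\<^esub> # map kd (a # bs))[0 := \<zero>\<^bsub>\<Omega>\<^esub>])"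
      unfolding dmap_gen[OF a bs] dmap_gen[OF one abs] by (simp add: gen_def kd_one)
    also have "\<dots> = \<zero>\<^bsub>Ext (Suc (Suc k))\<^esub>"
      by (rule E.tens_slot_zero[OF UR.one_closed Lz]) simp
    finally show "dmap (Suc k) (dmap k (gen a bs)) = \<zero>\<^bsub>Ext (Suc (Suc k))\<^esub>" .
  qed
next
  fix p q \<alpha> \<beta> assume "\<alpha> \<in> carrier (Ext p)" "\<beta> \<in> carrier (Ext q)"
  then show "dmap (p + q) (wedge UR \<Omega> p q \<alpha> \<beta>) =
    (if even p
     then wedge UR \<Omega> (Suc p) q (dmap p \<alpha>) \<beta> \<oplus>\<^bsub>Ext (Suc (p + q))\<^esub> wedge UR \<Omega> p (Suc q) \<alpha> (dmap q \<beta>)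
     else wedge UR \<Omega> (Suc p) q (dmap p \<alpha>) \<beta> \<ominus>\<^bsub>Ext (Suc (p + q))\<^esub> wedge UR \<Omega> p (Suc q) \<alpha> (dmap q \<beta>))"
    by (rule dmap_leibniz)
next
  fix a assume a: "a \<in> carrier C"
  show "dmap 0 (ext_scalar UR \<Omega> a) = ext_vector UR \<Omega> (kd a)"
    using dmap_gen[OF a tuples_Nil] a by (simp add: E.ext_scalar_eq E.ext_vector_eq kd_closed gen_def)
qed

section \<open>Uniqueness of the exterior derivative\<close>

lemma exterior_derivative_gen:
  assumes D: "is_exterior_derivative C D" and a: "a \<in> carrier C" and bs: "bs \<in> tuples k (carrier C)"
  shows "D k (gen a bs) = gen \<one>\<^bsub>UR\<^esub> (a # bs)"
proof -
  have add: "additive_map (Ext k) (Ext (Suc k)) (D k)" for k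
    by (rule additive_mapI) (use D in \<open>auto simp: is_exterior_derivative_def Let_def \<Lambda>\<Omega>_eq\<close>)
  have leib: "D (p + q) (wedge UR \<Omega> p q \<alpha> \<beta>) =
    (if even p
     then wedge UR \<Omega> (Suc p) q (D p \<alpha>) \<beta> \<oplus>\<^bsub>Ext (Suc (p + q))\<^esub> wedge UR \<Omega> p (Suc q) \<alpha> (D q \<beta>)
     else wedge UR \<Omega> (Suc p) q (D p \<alpha>) \<beta> \<ominus>\<^bsub>Ext (Suc (p + q))\<^esub> wedge UR \<Omega> p (Suc q) \<alpha> (D q \<beta>))"
    if "\<alpha> \<in> carrier (Ext p)" "\<beta> \<in> carrier (Ext q)" for p q \<alpha> \<beta>
    using D that unfolding is_exterior_derivative_def Let_def \<Lambda>\<Omega>_eq by blast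
  have D0: "D 0 (gen a []) = gen \<one>\<^bsub>UR\<^esub> [a]" if "a \<in> carrier C" for a
    using D that unfolding is_exterior_derivative_def Let_def
    by (simp add: E.ext_scalar_eq E.ext_vector_eq kd_closed gen_def)
  have DD: "D (Suc k) (D k \<alpha>) = \<zero>\<^bsub>Ext (Suc (Suc k))\<^esub>" if "\<alpha> \<in> carrier (Ext k)" for k \<alpha>
    using D that unfolding is_exterior_derivative_def Let_def \<Lambda>\<Omega>_eq by blast
  have one: "\<one>\<^bsub>UR\<^esub> \<in> carrier C" using UR.one_closed by (simp add: UR_carrier)
  have single: "[x] \<in> tuples (Suc 0) (carrier C)" if "x \<in> carrier C" for x
    using that by (simp add: tuples_def)
  have wedge0: "wedge UR \<Omega> p q \<zero>\<^bsub>Ext p\<^esub> \<beta> = \<zero>\<^bsub>Ext (p + q)\<^esub>" if "\<beta> \<in> carrier (Ext q)" for p q \<beta>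
    using additive_pair.zero[OF additive_pair.intro[OF Ext_abelian_group Ext_abelian_group
          additive_pair_axioms.intro[OF E.wedge_additive_left[OF that, of p]]]] .
  have wedge0': "wedge UR \<Omega> p q \<alpha> \<zero>\<^bsub>Ext q\<^esub> = \<zero>\<^bsub>Ext (p + q)\<^esub>" if "\<alpha> \<in> carrier (Ext p)" for p q \<alpha>
    using additive_pair.zero[OF additive_pair.intro[OF Ext_abelian_group Ext_abelian_group
          additive_pair_axioms.intro[OF E.wedge_additive_right[OF that, of q]]]] .
  \<comment> \<open>Products of the differentials of ring elements are closed: each factor is
    \<open>D 0\<close> of a form of degree 0, so it is killed by the square-zero law, and the
    Leibniz rule extends this to products. The empty product is the unit, whose differential is
    zero.\<close>
  have closed: "D k (gen \<one>\<^bsub>UR\<^esub> bs) = \<zero>\<^bsub>Ext (Suc k)\<^esub>" if "bs \<in> tuples k (carrier C)" for k bs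
    using that
  proof (induction bs arbitrary: k)
    case Nil
    then have k: "k = 0" by (simp add: tuples_def)
    have "gen \<one>\<^bsub>UR\<^esub> [\<one>\<^bsub>UR\<^esub>] = E.tens \<one>\<^bsub>UR\<^esub> ([\<zero>\<^bsub>\<Omega>\<^esub>][0 := \<zero>\<^bsub>\<Omega>\<^esub>])" by (simp add: gen_def kd_one)
    also have "\<dots> = \<zero>\<^bsub>Ext (Suc 0)\<^esub>"
      by (rule E.tens_slot_zero[OF UR.one_closed]) (simp_all add: tuples_def)
    finally show ?case using D0[OF one] k by simp
  next
    case (Cons b bs)
    then obtain k' where k: "k = Suc k'" "b \<in> carrier C" "bs \<in> tuples k' (carrier C)"
      by (cases k) (auto simp: tuples_def)
    interpret P: abelian_group "Ext (Suc k)" by (rule Ext_abelian_group)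
    have g: "gen \<one>\<^bsub>UR\<^esub> [b] \<in> carrier (Ext (Suc 0))" "gen \<one>\<^bsub>UR\<^esub> bs \<in> carrier (Ext k')"
      by (rule gen_closed[OF one single[OF k(2)]], rule gen_closed[OF one k(3)])
    have "gen \<one>\<^bsub>UR\<^esub> (b # bs) = wedge UR \<Omega> (Suc 0) k' (gen \<one>\<^bsub>UR\<^esub> [b]) (gen \<one>\<^bsub>UR\<^esub> bs)"
      using wedge_gen[OF one one single[OF k(2)] k(3)] by simp
    then have "D k (gen \<one>\<^bsub>UR\<^esub> (b # bs)) = D (Suc 0 + k') (wedge UR \<Omega> (Suc 0) k' (gen \<one>\<^bsub>UR\<^esub> [b]) (gen \<one>\<^bsub>UR\<^esub> bs))"
      by (simp add: k(1))
    also have "\<dots> = wedge UR \<Omega> (Suc (Suc 0)) k' (D (Suc 0) (gen \<one>\<^bsub>UR\<^esub> [b])) (gen \<one>\<^bsub>UR\<^esub> bs)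
        \<ominus>\<^bsub>Ext (Suc (Suc 0 + k'))\<^esub> wedge UR \<Omega> (Suc 0) (Suc k') (gen \<one>\<^bsub>UR\<^esub> [b]) (D k' (gen \<one>\<^bsub>UR\<^esub> bs))"
      unfolding leib[OF g] by simp
    also have "D (Suc 0) (gen \<one>\<^bsub>UR\<^esub> [b]) = \<zero>\<^bsub>Ext (Suc (Suc 0))\<^esub>"
      using DD[OF gen_closed[OF k(2) tuples_Nil]] D0[OF k(2)] by simp
    also have "wedge UR \<Omega> (Suc (Suc 0)) k' \<zero>\<^bsub>Ext (Suc (Suc 0))\<^esub> (gen \<one>\<^bsub>UR\<^esub> bs) = \<zero>\<^bsub>Ext (Suc k)\<^esub>"
      using wedge0[OF g(2), of "Suc (Suc 0)"] k(1) by simp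
    also have "D k' (gen \<one>\<^bsub>UR\<^esub> bs) = \<zero>\<^bsub>Ext (Suc k')\<^esub>" by (rule Cons.IH[OF k(3)])
    also have "wedge UR \<Omega> (Suc 0) (Suc k') (gen \<one>\<^bsub>UR\<^esub> [b]) \<zero>\<^bsub>Ext (Suc k')\<^esub> = \<zero>\<^bsub>Ext (Suc k)\<^esub>"
      using wedge0'[OF g(1), of "Suc k'"] k(1) by simp
    finally show ?case using k(1) P.a_minus_zero[OF P.zero_closed] by simp
  qed
  interpret P: abelian_group "Ext (Suc k)" by (rule Ext_abelian_group)
  have R: "a \<in> carrier UR" using a by (simp add: UR_carrier)
  have g: "gen a [] \<in> carrier (Ext 0)" "gen \<one>\<^bsub>UR\<^esub> bs \<in> carrier (Ext k)"
    by (rule gen_closed[OF a tuples_Nil], rule gen_closed[OF one bs])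
  \<comment> \<open>With the coefficient split off as a factor of degree 0 and the other factor
    closed, the Leibniz rule leaves one term, without sign.\<close>
  have "gen a bs = wedge UR \<Omega> 0 k (gen a []) (gen \<one>\<^bsub>UR\<^esub> bs)"
    using wedge_gen[OF a one tuples_Nil bs] R by simp
  then have "D k (gen a bs) = D (0 + k) (wedge UR \<Omega> 0 k (gen a []) (gen \<one>\<^bsub>UR\<^esub> bs))" by simp
  also have "\<dots> = wedge UR \<Omega> (Suc 0) k (gen \<one>\<^bsub>UR\<^esub> [a]) (gen \<one>\<^bsub>UR\<^esub> bs) \<oplus>\<^bsub>Ext (Suc k)\<^esub>
      wedge UR \<Omega> 0 (Suc k) (gen a []) \<zero>\<^bsub>Ext (Suc k)\<^esub>"
    unfolding leib[OF g] D0[OF a] closed[OF bs] by simp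
  also have "wedge UR \<Omega> 0 (Suc k) (gen a []) \<zero>\<^bsub>Ext (Suc k)\<^esub> = \<zero>\<^bsub>Ext (Suc k)\<^esub>"
    using wedge0'[OF g(1), of "Suc k"] by simp
  also have "wedge UR \<Omega> (Suc 0) k (gen \<one>\<^bsub>UR\<^esub> [a]) (gen \<one>\<^bsub>UR\<^esub> bs) = gen \<one>\<^bsub>UR\<^esub> (a # bs)"
    using wedge_gen[OF one one single[OF a] bs] by simp
  finally show ?thesis
    using gen_closed[OF one, of "a # bs" "Suc k"] a bs by (simp add: tuples_Cons)
qed

lemma ext_deriv_eq: "ext_deriv C = dmap"
  unfolding ext_deriv_def
proof (rule the_equality[where P = "is_exterior_derivative C", OF dmap_exterior_derivative])
  fix D assume D: "is_exterior_derivative C D"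
  have add: "additive_map (Ext k) (Ext (Suc k)) (D k)" for k
    by (rule additive_mapI) (use D in \<open>auto simp: is_exterior_derivative_def Let_def \<Lambda>\<Omega>_eq\<close>)
  show "D = dmap"
  proof (intro ext)
    fix k \<alpha>
    show "D k \<alpha> = dmap k \<alpha>"
    proof (cases "\<alpha> \<in> carrier (Ext k)")
      case True
      show ?thesis
        by (rule gen_eqI[OF Ext_abelian_group add dmap_additive _ True])
           (simp add: exterior_derivative_gen[OF D] dmap_gen)
    next
      case False
      have "D k \<in> carrier (Ext k) \<rightarrow>\<^sub>E carrier (Ext (Suc k))"
        using D unfolding is_exterior_derivative_def Let_def \<Lambda>\<Omega>_eq by blast
      then have "D k \<alpha> = undefined" using False by (rule PiE_arb)
      then show ?thesis using False by (simp add: dmap_def)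
    qed
  qed
qed

end

section \<open>Functoriality of algebraic forms\<close>

locale smooth_ring_hom = C: smooth_ring C + D: smooth_ring D
  for C :: "'a cring_inf" and D :: "'b cring_inf" +
  fixes \<phi>
  assumes smooth_hom: "\<phi> \<in> cinf_hom C D"
begin

sublocale base_ring_hom "underlying_ring C" "underlying_ring D" \<phi>
  by (intro base_ring_hom.intro base_ring_hom_axioms.intro C.UR.base_ring_axioms D.UR.base_ring_axioms
      cinf_hom_ring_hom[OF smooth_hom])

lemma \<phi>_closed: "a \<in> carrier C \<Longrightarrow> \<phi> a \<in> carrier D"
  by (rule cinf_hom_closed[OF smooth_hom])

definition kmap :: "('a \<Rightarrow> 'a) \<Rightarrow> ('b \<Rightarrow> 'b) set" where
  "kmap v = kaehler_class D (free_map (underlying_ring D) (carrier C) (underlying_ring C) (carrier D) \<phi> \<phi> v)"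

lemma kmap_additive: "additive_map (kaehler_free C) (kaehler D) kmap"
proof -
  have "additive_map (kaehler_free C) (kaehler_free D)
      (free_map (underlying_ring D) (carrier C) (underlying_ring C) (carrier D) \<phi> \<phi>)"
    unfolding kaehler_free_def by (rule free_map_additive) (rule \<phi>_closed)
  moreover have "kmap = (\<lambda>v. kaehler_class D
      (free_map (underlying_ring D) (carrier C) (underlying_ring C) (carrier D) \<phi> \<phi> v))"
    by (rule ext) (simp add: kmap_def)
  ultimately show ?thesis
    using additive_map_comp[OF _ D.kaehler_class_additive] by simp
qed

lemma kmap_gen:
  assumes "b \<in> carrier C" "c \<in> carrier C"
  shows "kmap (c \<odot>\<^bsub>kaehler_free C\<^esub> C.gen_vec b) = \<phi> c \<odot>\<^bsub>kaehler D\<^esub> kaehler_d D (\<phi> b)"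
proof -
  have "free_map (underlying_ring D) (carrier C) (underlying_ring C) (carrier D) \<phi> \<phi> (c \<odot>\<^bsub>kaehler_free C\<^esub> C.gen_vec b) =
      \<phi> c \<odot>\<^bsub>kaehler_free D\<^esub> D.gen_vec (\<phi> b)"
    unfolding kaehler_free_def
    by (rule free_map_basis) (use assms \<phi>_closed in \<open>simp_all add: C.UR_carrier\<close>)
  then show ?thesis
    using D.kaehler_class_gen[OF \<phi>_closed[OF assms(2)] \<phi>_closed[OF assms(1)]] by (simp add: kmap_def)
qed

text \<open>A map of \<open>C\<^sup>\<infinity>\<close>-rings commutes with all operations, so it
  carries the relation for \<open>h\<close> at a tuple to the relation for the same \<open>h\<close>
  at the image tuple.\<close>

lemma kmap_kills:
  assumes v: "v \<in> kaehler_span C"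
  shows "kmap v = \<zero>\<^bsub>kaehler D\<^esub>"
proof (rule C.kaehler_additive_kills[OF D.E.N.abelian_group_axioms kmap_additive _ v])
  fix c n h as assume c: "c \<in> carrier C" and h: "h \<in> Cinf n" and as: "as \<in> tuples n (carrier C)"
  have as': "map \<phi> as \<in> tuples n (carrier D)" by (rule tuples_map[OF as \<phi>_closed])
  have asC: "as ! i \<in> carrier C" "\<phi> (as ! i) = map \<phi> as ! i" if "i < n" for i
    using tuples_nth[OF as that] that as by (simp_all add: tuples_length)
  have hC: "smooth_op C (pd n i h) as \<in> carrier C" if "i < n" for i
    using C.tuples_op_closed[OF as that h] by (simp add: C.UR_carrier)
  have hD: "smooth_op D (pd n i h) (map \<phi> as) \<in> carrier (underlying_ring D)" if "i < n" for i
    using D.tuples_op_closed[OF as' that h] .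
  have kD: "kaehler_d D (map \<phi> as ! i) \<in> carrier (kaehler D)" if "i < n" for i
    by (rule D.kd_closed[OF tuples_nth[OF as' that]])
  have \<phi>c: "\<phi> c \<in> carrier (underlying_ring D)" using \<phi>_closed[OF c] by (simp add: D.UR_carrier)
  have "kmap (c \<odot>\<^bsub>kaehler_free C\<^esub> C.gen_vec (smooth_op C h as)) =
      \<phi> c \<odot>\<^bsub>kaehler D\<^esub> kaehler_d D (smooth_op D h (map \<phi> as))"
    using kmap_gen[OF C.op_closed[OF h as] c] cinf_hom_op[OF smooth_hom h as] by simp
  also have "\<dots> = \<phi> c \<odot>\<^bsub>kaehler D\<^esub> (\<Oplus>\<^bsub>kaehler D\<^esub>i\<in>{..<n}. smooth_op D (pd n i h) (map \<phi> as) \<odot>\<^bsub>kaehler D\<^esub> kaehler_d D (map \<phi> as ! i))"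
    by (simp only: D.kd_op[OF h as'])
  also have "\<dots> = (\<Oplus>\<^bsub>kaehler D\<^esub>i\<in>{..<n}. \<phi> c \<odot>\<^bsub>kaehler D\<^esub> (smooth_op D (pd n i h) (map \<phi> as) \<odot>\<^bsub>kaehler D\<^esub> kaehler_d D (map \<phi> as ! i)))"
    by (rule D.E.N.finsum_smult_ldistr) (use \<phi>c hD kD in auto)
  also have "\<dots> = (\<Oplus>\<^bsub>kaehler D\<^esub>i\<in>{..<n}. kmap ((c \<otimes>\<^bsub>underlying_ring C\<^esub> smooth_op C (pd n i h) as) \<odot>\<^bsub>kaehler_free C\<^esub> C.gen_vec (as ! i)))"
  proof (rule D.E.N.M.finsum_cong'[OF refl])
    have cl: "c \<otimes>\<^bsub>underlying_ring C\<^esub> smooth_op C (pd n i h) as \<in> carrier C" if "i < n" for i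
      using C.UR.m_closed[of c "smooth_op C (pd n i h) as"] c hC[OF that] by (simp add: C.UR_carrier)
    have gv: "C.gen_vec (as ! i) \<in> carrier (kaehler_free C)" if "i < n" for i
      by (rule C.gen_vec_closed[OF asC(1)[OF that]])
    show "(\<lambda>i. kmap ((c \<otimes>\<^bsub>underlying_ring C\<^esub> smooth_op C (pd n i h) as) \<odot>\<^bsub>kaehler_free C\<^esub> C.gen_vec (as ! i))) \<in> {..<n} \<rightarrow> carrier (kaehler D)"
      by (intro Pi_I additive_map_closed[OF kmap_additive] C.KF.smult_closed) (simp_all add: cl gv C.UR_carrier)
    fix i assume "i \<in> {..<n}"
    then have i: "i < n" by simp
    have "\<phi> (c \<otimes>\<^bsub>underlying_ring C\<^esub> smooth_op C (pd n i h) as) = \<phi> c \<otimes>\<^bsub>underlying_ring D\<^esub> smooth_op D (pd n i h) (map \<phi> as)"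
      using cinf_hom_ring_hom[OF smooth_hom] c hC[OF i] cinf_hom_op[OF smooth_hom pd_Cinf[OF h i] as]
      by (simp add: ring_hom_def C.UR_carrier)
    then show "\<phi> c \<odot>\<^bsub>kaehler D\<^esub> (smooth_op D (pd n i h) (map \<phi> as) \<odot>\<^bsub>kaehler D\<^esub> kaehler_d D (map \<phi> as ! i)) =
      kmap ((c \<otimes>\<^bsub>underlying_ring C\<^esub> smooth_op C (pd n i h) as) \<odot>\<^bsub>kaehler_free C\<^esub> C.gen_vec (as ! i))"
      using D.E.N.smult_assoc1[OF \<phi>c hD[OF i] kD[OF i]] by (simp add: kmap_gen[OF asC(1)[OF i] cl[OF i]] asC(2)[OF i])
  qed
  finally show "kmap (c \<odot>\<^bsub>kaehler_free C\<^esub> C.gen_vec (smooth_op C h as)) =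
    (\<Oplus>\<^bsub>kaehler D\<^esub>i\<in>{..<n}. kmap ((c \<otimes>\<^bsub>underlying_ring C\<^esub> smooth_op C (pd n i h) as) \<odot>\<^bsub>kaehler_free C\<^esub> C.gen_vec (as ! i)))" .
qed

lemma kaehler_map_class:
  assumes v: "v \<in> carrier (kaehler_free C)"
  shows "kaehler_map C D \<phi> (kaehler_class C v) = kmap v"
  unfolding kaehler_map_def kmap_def[symmetric]
  using C.kaehler_const_on_class[where F = kmap, OF D.E.N.abelian_group_axioms kmap_additive kmap_kills v]
    C.kaehler_class_self[OF v] by blast

lemma kaehler_map_additive: "additive_map (kaehler C) (kaehler D) (kaehler_map C D \<phi>)"
proof (rule additive_mapI)
  fix u assume "u \<in> carrier (kaehler C)"
  then obtain v where v: "v \<in> carrier (kaehler_free C)" "u = kaehler_class C v" by (rule C.kaehler_cases)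
  show "kaehler_map C D \<phi> u \<in> carrier (kaehler D)"
    unfolding v(2) kaehler_map_class[OF v(1)] by (rule additive_map_closed[OF kmap_additive v(1)])
  fix u' assume "u' \<in> carrier (kaehler C)"
  then obtain v' where v': "v' \<in> carrier (kaehler_free C)" "u' = kaehler_class C v'" by (rule C.kaehler_cases)
  show "kaehler_map C D \<phi> (u \<oplus>\<^bsub>kaehler C\<^esub> u') = kaehler_map C D \<phi> u \<oplus>\<^bsub>kaehler D\<^esub> kaehler_map C D \<phi> u'"
    unfolding v(2) v'(2) C.KC.add[OF v(1) v'(1), symmetric]
      kaehler_map_class[OF v(1)] kaehler_map_class[OF v'(1)] kaehler_map_class[OF C.KF.M.a_closed[OF v(1) v'(1)]]
    by (rule additive_map_add[OF kmap_additive v(1) v'(1)])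
qed

lemma kaehler_map_smult:
  assumes c: "c \<in> carrier (underlying_ring C)" and u: "u \<in> carrier (kaehler C)"
  shows "kaehler_map C D \<phi> (c \<odot>\<^bsub>kaehler C\<^esub> u) = \<phi> c \<odot>\<^bsub>kaehler D\<^esub> kaehler_map C D \<phi> u"
proof -
  have c': "c \<in> carrier C" using c by (simp add: C.UR_carrier)
  have \<phi>c: "\<phi> c \<in> carrier (underlying_ring D)" using \<phi>_closed[OF c'] by (simp add: D.UR_carrier)
  obtain v where v: "v \<in> carrier (kaehler_free C)" "u = kaehler_class C v" by (rule C.kaehler_cases[OF u])
  have "kmap (c \<odot>\<^bsub>kaehler_free C\<^esub> v) = \<phi> c \<odot>\<^bsub>kaehler D\<^esub> kmap v"
  proof (rule C.KF_eqI[where F = "\<lambda>v. kmap (c \<odot>\<^bsub>kaehler_free C\<^esub> v)" and G = "\<lambda>v. \<phi> c \<odot>\<^bsub>kaehler D\<^esub> kmap v",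
        OF D.E.N.abelian_group_axioms _ _ _ v(1)])
    have "additive_map (kaehler_free C) (kaehler_free C) (\<lambda>v. c \<odot>\<^bsub>kaehler_free C\<^esub> v)"
      by (rule additive_mapI) (use c in \<open>simp_all add: C.KF.smult_r_distr\<close>)
    then show "additive_map (kaehler_free C) (kaehler D) (\<lambda>v. kmap (c \<odot>\<^bsub>kaehler_free C\<^esub> v))"
      by (rule additive_map_comp[OF _ kmap_additive])
    have "additive_map (kaehler D) (kaehler D) (\<lambda>v. \<phi> c \<odot>\<^bsub>kaehler D\<^esub> v)"
      by (rule additive_mapI) (use \<phi>c in \<open>simp_all add: D.E.N.smult_r_distr\<close>)
    then show "additive_map (kaehler_free C) (kaehler D) (\<lambda>v. \<phi> c \<odot>\<^bsub>kaehler D\<^esub> kmap v)"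
      by (rule additive_map_comp[OF kmap_additive])
    fix b s assume bs: "b \<in> carrier C" "s \<in> carrier C"
    have s': "s \<in> carrier (underlying_ring C)" using bs by (simp add: C.UR_carrier)
    have cs: "c \<otimes>\<^bsub>underlying_ring C\<^esub> s \<in> carrier C" using C.UR.m_closed[OF c s'] by (simp add: C.UR_carrier)
    have \<phi>s: "\<phi> s \<in> carrier (underlying_ring D)" using \<phi>_closed[OF bs(2)] by (simp add: D.UR_carrier)
    have "\<phi> (c \<otimes>\<^bsub>underlying_ring C\<^esub> s) = \<phi> c \<otimes>\<^bsub>underlying_ring D\<^esub> \<phi> s"
      using cinf_hom_ring_hom[OF smooth_hom] c s' by (simp add: ring_hom_def)
    then show "kmap (c \<odot>\<^bsub>kaehler_free C\<^esub> (s \<odot>\<^bsub>kaehler_free C\<^esub> C.gen_vec b)) =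
        \<phi> c \<odot>\<^bsub>kaehler D\<^esub> kmap (s \<odot>\<^bsub>kaehler_free C\<^esub> C.gen_vec b)"
      using C.KF.smult_assoc1[OF c s' C.gen_vec_closed[OF bs(1)], symmetric] kmap_gen[OF bs(1) cs] kmap_gen[OF bs]
        D.E.N.smult_assoc1[OF \<phi>c \<phi>s D.kd_closed[OF \<phi>_closed[OF bs(1)]]] by simp
  qed
  then show ?thesis
    unfolding v(2) C.kaehler_class_smult[OF c' v(1), symmetric]
      kaehler_map_class[OF v(1)] kaehler_map_class[OF C.KF.smult_closed[OF c v(1)]] .
qed

sublocale SM: semilinear_map "underlying_ring C" "kaehler C" "underlying_ring D" "kaehler D" \<phi> "kaehler_map C D \<phi>"
  by (intro semilinear_map.intro semilinear_map_axioms.intro C.E.ext_algebra_axioms D.E.ext_algebra_axioms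
      base_ring_hom_axioms kaehler_map_additive kaehler_map_smult)

lemma \<Lambda>\<Omega>_map_eq: "\<Lambda>\<Omega>_map C D \<phi> k = SM.ext_map k"
  by (rule ext) (simp add: \<Lambda>\<Omega>_map_def SM.ext_map_def)

lemma \<Lambda>\<Omega>_map_additive: "additive_map (\<Lambda>\<Omega> C k) (\<Lambda>\<Omega> D k) (\<Lambda>\<Omega>_map C D \<phi> k)"
  unfolding \<Lambda>\<Omega>_map_eq C.\<Lambda>\<Omega>_eq D.\<Lambda>\<Omega>_eq by (rule SM.ext_map_additive)

lemma kaehler_map_d: "b \<in> carrier C \<Longrightarrow> kaehler_map C D \<phi> (kaehler_d C b) = kaehler_d D (\<phi> b)"
proof -
  assume b: "b \<in> carrier C"
  have one: "\<one>\<^bsub>underlying_ring C\<^esub> \<in> carrier C" using C.UR.one_closed by (simp add: C.UR_carrier)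
  have "\<phi> \<one>\<^bsub>underlying_ring C\<^esub> = \<one>\<^bsub>underlying_ring D\<^esub>"
    using cinf_hom_ring_hom[OF smooth_hom] by (simp add: ring_hom_def)
  moreover have "kmap (C.gen_vec b) = kmap (\<one>\<^bsub>underlying_ring C\<^esub> \<odot>\<^bsub>kaehler_free C\<^esub> C.gen_vec b)"
    using C.KF.smult_one[OF C.gen_vec_closed[OF b]] by simp
  ultimately show ?thesis
    unfolding kaehler_d_def[of C] kaehler_map_class[OF C.gen_vec_closed[OF b]]
    using kmap_gen[OF b one] D.kd_closed[OF \<phi>_closed[OF b]] by simp
qed

lemma \<Lambda>\<Omega>_map_gen:
  assumes a: "a \<in> carrier C" and bs: "bs \<in> tuples k (carrier C)"
  shows "\<Lambda>\<Omega>_map C D \<phi> k (C.gen a bs) = D.gen (\<phi> a) (map \<phi> bs)"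
proof -
  have "map (kaehler_map C D \<phi>) (map (kaehler_d C) bs) = map (kaehler_d D) (map \<phi> bs)"
    using bs by (auto simp: tuples_def kaehler_map_d)
  then show ?thesis
    unfolding C.gen_def D.gen_def \<Lambda>\<Omega>_map_eq
    using SM.ext_map_tens[OF _ C.map_kd[OF bs], of a] a by (simp add: C.UR_carrier del: map_map)
qed

end

section \<open>Determinants of real arrays\<close>

text \<open>The alternating sum that occurs in \<open>eval_form\<close>. Only entries with indices
  below \<open>k\<close> are read, so rows and columns can be changed as functions, without matrix
  dimensions.\<close>

definition dt :: "nat \<Rightarrow> (nat \<Rightarrow> nat \<Rightarrow> real) \<Rightarrow> real" where
  "dt k A = (\<Sum>p | p permutes {..<k}. of_int (sign p) * (\<Prod>i<k. A i (p i)))"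

lemma permutes_lessThan: "p permutes {..<k::nat} \<Longrightarrow> i < k \<Longrightarrow> p i < k"
  using permutes_in_image[of p "{..<k}" i] by simp

lemma dt_cong: "(\<And>i j. i < k \<Longrightarrow> j < k \<Longrightarrow> A i j = B i j) \<Longrightarrow> dt k A = dt k B"
  unfolding dt_def by (intro sum.cong prod.cong arg_cong2[where f = "(*)"] refl) (auto dest: permutes_lessThan)

lemma dt_eq_det: "dt k A = Determinant.det (Matrix.mat k k (\<lambda>(i, j). A i j))"
proof -

  have "Determinant.det (Matrix.mat k k (\<lambda>(i, j). A i j)) =
      (\<Sum>p | p permutes {0..<k}. of_int (sign p) * (\<Prod>i = 0..<k. Matrix.mat k k (\<lambda>(i, j). A i j) $$ (i, p i)))"
    by (rule Determinant.det_def') simp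
  also have "\<dots> = dt k A"
    unfolding dt_def lessThan_atLeast0
    by (intro sum.cong prod.cong arg_cong2[where f = "(*)"] refl)
       (auto dest: permutes_in_image)
  finally show ?thesis by simp
qed

lemma dt_split_row:
  assumes "i < k"
  shows "dt k (A(i := r)) = (\<Sum>p | p permutes {..<k}. of_int (sign p) * (r (p i) * (\<Prod>l\<in>{..<k} - {i}. A l (p l))))"
  unfolding dt_def
proof (intro sum.cong refl arg_cong2[where f = "(*)"])
  fix p
  have "(\<Prod>l<k. (A(i := r)) l (p l)) = (A(i := r)) i (p i) * (\<Prod>l\<in>{..<k} - {i}. (A(i := r)) l (p l))"
    by (rule prod.remove) (use assms in auto)
  then show "(\<Prod>l<k. (A(i := r)) l (p l)) = r (p i) * (\<Prod>l\<in>{..<k} - {i}. A l (p l))" by simp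
qed

lemma dt_row_add:
  "i < k \<Longrightarrow> dt k (A(i := \<lambda>j. u j + v j)) = dt k (A(i := u)) + dt k (A(i := v))"
  by (simp add: dt_split_row algebra_simps sum.distrib)

lemma dt_row_smult: "i < k \<Longrightarrow> dt k (A(i := \<lambda>j. c * u j)) = c * dt k (A(i := u))"
  by (simp add: dt_split_row sum_distrib_left mult_ac)

lemma dt_alt:
  assumes "i < k" "j < k" "i \<noteq> j" "A i = A j"
  shows "dt k A = 0"
  unfolding dt_eq_det
  by (rule Determinant.det_identical_rows[of _ k i j]) (use assms in \<open>auto simp: Matrix.row_def\<close>)

text \<open>The increasing enumeration of the indices other than \<open>j\<close>. Composing columns
  with it deletes column \<open>j\<close>; composing vector fields with it omits field
  \<open>j\<close>.\<close>

definition skip :: "nat \<Rightarrow> nat \<Rightarrow> nat" where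
  "skip j l = (if l < j then l else Suc l)"

text \<open>Laplace expansion along the first row. It relates the determinant of the differentials
  on all fields to the coefficient differentiated along one field times a determinant on the
  others.\<close>

lemma dt_first_row:
  "dt (Suc m) (\<lambda>i. case i of 0 \<Rightarrow> c | Suc i \<Rightarrow> B i) = (\<Sum>j<Suc m. (-1) ^ j * c j * dt m (\<lambda>i l. B i (skip j l)))"
proof -
  let ?A = "Matrix.mat (Suc m) (Suc m) (\<lambda>(i, j). (case i of 0 \<Rightarrow> c | Suc i \<Rightarrow> B i) j)"
  have "Determinant.det ?A = (\<Sum>j<Suc m. ?A $$ (0, j) * cofactor ?A 0 j)"
    by (rule Determinant.laplace_expansion_row) auto
  also have "\<dots> = (\<Sum>j<Suc m. (-1) ^ j * c j * dt m (\<lambda>i l. B i (skip j l)))"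
  proof (rule sum.cong[OF refl])
    fix j assume j: "j \<in> {..<Suc m}"
    have "mat_delete ?A 0 j = Matrix.mat m m (\<lambda>(i, l). B i (skip j l))"
      using j by (intro eq_matI) (auto simp: mat_delete_def skip_def)
    then show "?A $$ (0, j) * cofactor ?A 0 j = (-1) ^ j * c j * dt m (\<lambda>i l. B i (skip j l))"
      using j by (simp add: cofactor_def dt_eq_det)
  qed
  finally show ?thesis by (simp add: dt_eq_det)
qed

text \<open>Subtracting the first column from the others.\<close>

lemma dt_differences:
  "dt m (\<lambda>i l. B i (Suc l) - B i 0) = (\<Sum>j<Suc m. (-1) ^ j * dt m (\<lambda>i l. B i (skip j l)))"
proof -
  \<comment> \<open>\<open>B\<close> is bordered by a row of ones. Laplace expansion along that row
    gives the alternating sum of minors; column subtraction turns the row into a unit vector and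
    leaves the determinant of the differences.\<close>
  define a where "a = (\<lambda>i j::nat. (case i of 0 \<Rightarrow> (\<lambda>_. 1) | Suc i \<Rightarrow> B i) j)"
  let ?A = "Matrix.mat (Suc m) (Suc m) (\<lambda>(i, j). a i j)"
  \<comment> \<open>Right multiplication by this unitriangular matrix subtracts column 0 from every
    other column.\<close>
  let ?P = "Matrix.mat (Suc m) (Suc m) (\<lambda>(i, j). if i = j then 1 else if i = 0 then -1 else 0 :: real)"
  have P: "?P \<in> carrier_mat (Suc m) (Suc m)" and A: "?A \<in> carrier_mat (Suc m) (Suc m)" by auto
  have "Determinant.det ?P = prod_list (diag_mat ?P)"
    by (rule Determinant.det_upper_triangular[OF _ P]) auto
  also have "diag_mat ?P = replicate (Suc m) 1"
    by (intro nth_equalityI) (auto simp: diag_mat_def simp del: upt_Suc replicate_Suc)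
  finally have detP: "Determinant.det ?P = 1" by simp
  define b where "b = (\<lambda>i l::nat. if l = 0 then a i 0 else a i l - a i 0)"
  have "?A * ?P = Matrix.mat (Suc m) (Suc m) (\<lambda>(i, j). b i j)"
  proof (intro eq_matI)
    fix i l assume il: "i < dim_row (Matrix.mat (Suc m) (Suc m) (\<lambda>(i, j). b i j))"
      "l < dim_col (Matrix.mat (Suc m) (Suc m) (\<lambda>(i, j). b i j))"
    have "(?A * ?P) $$ (i, l) = (\<Sum>r<Suc m. a i r * (if r = l then 1 else if r = 0 then -1 else 0))"
      using il by (simp add: scalar_prod_def lessThan_atLeast0 del: sum.op_ivl_Suc)
    also have "\<dots> = (\<Sum>r<Suc m. (if r = l then a i l else 0) + (if r = 0 then (if l = 0 then 0 else - a i 0) else 0))"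
      by (intro sum.cong) auto
    also have "\<dots> = b i l"
      using il unfolding sum.distrib by (simp add: b_def sum.delta' del: sum.lessThan_Suc)
    finally show "(?A * ?P) $$ (i, l) = Matrix.mat (Suc m) (Suc m) (\<lambda>(i, j). b i j) $$ (i, l)"
      using il by simp
  qed auto
  then have eq: "Determinant.det ?A = dt (Suc m) b"
    using Determinant.det_mult[OF A P] detP by (simp add: dt_eq_det)
  have "dt (Suc m) b = dt (Suc m) (\<lambda>i. case i of 0 \<Rightarrow> (\<lambda>l. if l = 0 then 1 else 0) | Suc i \<Rightarrow> b (Suc i))"
    by (rule dt_cong) (auto simp: b_def a_def split: nat.splits)
  also have "\<dots> = dt m (\<lambda>i l. b (Suc i) (skip 0 l))"
    unfolding dt_first_row by (subst sum.remove[of _ 0]) auto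
  also have "\<dots> = dt m (\<lambda>i l. B i (Suc l) - B i 0)"
    by (simp add: b_def a_def skip_def)
  finally have "dt (Suc m) a = dt m (\<lambda>i l. B i (Suc l) - B i 0)"
    using eq by (simp add: dt_eq_det)
  moreover have "dt (Suc m) a = (\<Sum>j<Suc m. (-1) ^ j * 1 * dt m (\<lambda>i l. B i (skip j l)))"
  proof -
    have "a = (\<lambda>i. case i of 0 \<Rightarrow> (\<lambda>_. 1) | Suc i \<Rightarrow> B i)" by (simp add: a_def fun_eq_iff)
    then show ?thesis using dt_first_row[of m "\<lambda>_. 1" B] by simp
  qed
  ultimately show ?thesis by simp
qed

text \<open>In coordinates, this is \<open>d (dg\<^sub>1 \<and> \<dots> \<and> dg\<^sub>m) = 0\<close>.\<close>

lemma dt_symmetric_zero: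
  assumes i0: "i0 < m" and sym: "\<And>j l. j < Suc m \<Longrightarrow> l < Suc m \<Longrightarrow> H j l = H l j"
  shows "(\<Sum>j<Suc m. (-1) ^ j * dt m (\<lambda>i l. (if i = i0 then H j else G i) (skip j l))) = 0"
proof -
  let ?P = "{p. p permutes {..<Suc m}}"
  define B where "B = (\<lambda>j i. if i = i0 then H j else G i)"
  \<comment> \<open>Summand \<open>j\<close> is a determinant of size \<open>Suc m\<close> whose
    first row is the unit vector at \<open>j\<close>, so only permutations with
    \<open>q 0 = j\<close> survive. Summing over \<open>j\<close> therefore gives one sum over all
    permutations, with weight \<open>w\<close>.\<close>
  define w where "w = (\<lambda>q. H (q 0) (q (Suc i0)) * (\<Prod>i\<in>{..<m} - {i0}. G i (q (Suc i))) :: real)"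
  have "(-1) ^ j * dt m (\<lambda>i l. B j i (skip j l)) =
      (\<Sum>q\<in>?P. of_int (sign q) * (if q 0 = j then w q else 0))" if j: "j < Suc m" for j
  proof -
    have "(-1) ^ j * dt m (\<lambda>i l. B j i (skip j l)) =
        dt (Suc m) (\<lambda>i. case i of 0 \<Rightarrow> (\<lambda>l. if l = j then 1 else 0) | Suc i \<Rightarrow> B j i)"
      unfolding dt_first_row using j by (subst sum.remove[of _ j]) auto
    also have "\<dots> = (\<Sum>q\<in>?P. of_int (sign q) * (if q 0 = j then w q else 0))"
      unfolding dt_def
    proof (intro sum.cong refl arg_cong2[where f = "(*)"])
      fix q
      have "(\<Prod>i<m. B j i (q (Suc i))) = H j (q (Suc i0)) * (\<Prod>i\<in>{..<m} - {i0}. G i (q (Suc i)))"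
        using i0 by (subst prod.remove[of _ i0]) (auto simp: B_def intro!: prod.cong)
      then show "(\<Prod>i<Suc m. (case i of 0 \<Rightarrow> (\<lambda>l. if l = j then 1 else 0) | Suc i \<Rightarrow> B j i) (q i)) = (if q 0 = j then w q else 0)"
        unfolding prod.lessThan_Suc_shift by (auto simp: w_def)
    qed
    finally show ?thesis .
  qed
  then have "(\<Sum>j<Suc m. (-1) ^ j * dt m (\<lambda>i l. B j i (skip j l))) =
      (\<Sum>j<Suc m. \<Sum>q\<in>?P. of_int (sign q) * (if q 0 = j then w q else 0))"
    by (intro sum.cong) auto
  also have "\<dots> = (\<Sum>q\<in>?P. \<Sum>j<Suc m. of_int (sign q) * (if q 0 = j then w q else 0))"
    by (rule sum.swap)
  also have "\<dots> = (\<Sum>q\<in>?P. of_int (sign q) * w q)"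
  proof (intro sum.cong refl)
    fix q assume "q \<in> ?P"
    then have "q 0 < Suc m" using permutes_lessThan[of q "Suc m" 0] by simp
    then show "(\<Sum>j<Suc m. of_int (sign q) * (if q 0 = j then w q else 0)) = of_int (sign q) * w q"
      by (simp add: sum_distrib_left[symmetric] sum.delta del: sum.lessThan_Suc)
  qed
  finally have S: "(\<Sum>j<Suc m. (-1) ^ j * dt m (\<lambda>i l. B j i (skip j l))) = (\<Sum>q\<in>?P. of_int (sign q) * w q)" .
  \<comment> \<open>Composition with this transposition exchanges the two arguments of the symmetric
    \<open>H\<close>. It preserves \<open>w\<close> and reverses the sign, so the sum equals its own
    negative.\<close>
  let ?t = "Transposition.transpose 0 (Suc i0)"
  have t: "?t permutes {..<Suc m}" by (rule permutes_swap_id) (use i0 in auto)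
  have "(\<Sum>q\<in>?P. of_int (sign q) * w q) = (\<Sum>q\<in>?P. of_int (sign (q \<circ> ?t)) * w (q \<circ> ?t))"
    by (rule sum_permutations_compose_right[OF t])
  also have "\<dots> = (\<Sum>q\<in>?P. - (of_int (sign q) * w q))"
  proof (intro sum.cong refl)
    fix q assume "q \<in> ?P"
    then have q: "q permutes {..<Suc m}" by simp
    have "sign (q \<circ> ?t) = sign q * sign ?t"
      by (rule sign_compose) (use q t in \<open>auto intro: permutation_permutes[THEN iffD2] simp: permutation_swap_id\<close>)
    then have s: "sign (q \<circ> ?t) = - sign q" by (simp add: sign_swap_id)
    have "w (q \<circ> ?t) = w q"
    proof -
      have "(\<Prod>i\<in>{..<m} - {i0}. G i ((q \<circ> ?t) (Suc i))) = (\<Prod>i\<in>{..<m} - {i0}. G i (q (Suc i)))"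
        by (intro prod.cong refl) (auto simp: Transposition.transpose_def)
      moreover have "H (q (Suc i0)) (q 0) = H (q 0) (q (Suc i0))"
        by (rule sym) (use permutes_lessThan[OF q] i0 in auto)
      ultimately show ?thesis by (simp add: w_def)
    qed
    with s show "of_int (sign (q \<circ> ?t)) * w (q \<circ> ?t) = - (of_int (sign q) * w q)" by simp
  qed
  also have "\<dots> = - (\<Sum>q\<in>?P. of_int (sign q) * w q)" by (rule sum_negf)
  finally have "(\<Sum>q\<in>?P. of_int (sign q) * w q) = 0" by simp
  with S show ?thesis by (simp only: B_def)
qed

section \<open>Smooth functions on the simplex\<close>

lemma standard_simplex_euclid: "x \<in> standard_simplex n \<Longrightarrow> x \<in> euclid (Suc n)"
  by (simp add: standard_simplex_def mem_euclid Suc_le_eq)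

lemma openin_simplex_iff:
  "openin (space_top (simplex_space n)) U \<longleftrightarrow> (\<exists>W. open W \<and> U = standard_simplex n \<inter> W)"
proof -
  have "space_top (simplex_space n) = top_of_set (standard_simplex n)"
  proof -
    have "{x. \<forall>i\<ge>Suc n. x i = 0} \<inter> standard_simplex n = standard_simplex n"
      using standard_simplex_euclid[unfolded mem_euclid] by blast
    then show ?thesis
      by (simp only: simplex_space_def cinf_space.simps Euclidean_space_top_of_set subtopology_subtopology)
  qed
  then show ?thesis by (auto simp: openin_open)
qed

lemma topspace_simplex: "topspace (space_top (simplex_space n)) = standard_simplex n"
  using standard_simplex_euclid by (auto simp: simplex_space_def)

lemma local_extensionE:
  assumes "local_extension N U f x F"
  obtains V where "openin (Euclidean_space N) V" "x \<in> V" "smooth_on_open N V F" "\<And>y. y \<in> U \<Longrightarrow> y \<in> V \<Longrightarrow> F y = f y"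
proof -
  obtain V where V: "x \<in> V" "smooth_on_open N V F" "\<forall>y\<in>U \<inter> V. F y = f y"
    using assms unfolding local_extension_def by blast
  moreover have "openin (Euclidean_space N) V" using V(2) unfolding smooth_on_open_def by blast
  ultimately show ?thesis using that by blast
qed

lemma local_extensionI:
  "x \<in> V \<Longrightarrow> smooth_on_open N V F \<Longrightarrow> (\<And>y. y \<in> U \<Longrightarrow> y \<in> V \<Longrightarrow> F y = f y) \<Longrightarrow> local_extension N U f x F"
  unfolding local_extension_def by blast

lemma smooth_functionsD: "f \<in> smooth_functions N U \<Longrightarrow> x \<in> U \<Longrightarrow> \<exists>F. local_extension N U f x F"
  by (simp add: smooth_functions_def)

lemma smooth_functionsI:
  "f \<in> extensional U \<Longrightarrow> (\<And>x. x \<in> U \<Longrightarrow> \<exists>F. local_extension N U f x F) \<Longrightarrow> f \<in> smooth_functions N U"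
  by (simp add: smooth_functions_def)

lemma common_neighbourhood:
  assumes fs: "fs \<in> tuples m (smooth_functions N U)" and x: "x \<in> U" "x \<in> euclid N"
  obtains V F where "openin (Euclidean_space N) V" "x \<in> V" "\<And>l. l < m \<Longrightarrow> smooth_on_open N V (F l)"
    "\<And>l y. l < m \<Longrightarrow> y \<in> U \<Longrightarrow> y \<in> V \<Longrightarrow> F l y = (fs ! l) y"
proof -
  have "\<exists>F V. openin (Euclidean_space N) V \<and> x \<in> V \<and> smooth_on_open N V F \<and> (\<forall>y\<in>U \<inter> V. F y = (fs ! l) y)" if l: "l < m" for l
  proof -
    obtain F where F: "local_extension N U (fs ! l) x F"
      using smooth_functionsD[OF tuples_nth[OF fs l] x(1)] by blast
    obtain V where "openin (Euclidean_space N) V" "x \<in> V" "smooth_on_open N V F" "\<And>y. y \<in> U \<Longrightarrow> y \<in> V \<Longrightarrow> F y = (fs ! l) y"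
      using local_extensionE[OF F] by blast
    then show ?thesis by blast
  qed
  then have "\<forall>l. \<exists>FV. l < m \<longrightarrow> openin (Euclidean_space N) (snd FV) \<and> x \<in> snd FV \<and> smooth_on_open N (snd FV) (fst FV)
      \<and> (\<forall>y\<in>U \<inter> snd FV. fst FV y = (fs ! l) y)" by (metis fst_conv snd_conv)
  from choice[OF this] obtain FV where FV: "\<And>l. l < m \<Longrightarrow> openin (Euclidean_space N) (snd (FV l)) \<and> x \<in> snd (FV l) \<and>
      smooth_on_open N (snd (FV l)) (fst (FV l)) \<and> (\<forall>y\<in>U \<inter> snd (FV l). fst (FV l) y = (fs ! l) y)"
    by blast
  \<comment> \<open>The factor \<open>euclid N\<close> makes this an open set of the space also when
    there are no functions and the intersection is over an empty family.\<close>
  define V where "V = euclid N \<inter> (\<Inter>l\<in>{..<m}. snd (FV l))"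
  have V: "openin (Euclidean_space N) V"
  proof (cases "m = 0")
    case True
    then show ?thesis by (simp add: V_def openin_euclid)
  next
    case False
    then show ?thesis
      unfolding V_def using FV by (intro openin_Int openin_euclid openin_INT2) auto
  qed
  have sub: "V \<subseteq> snd (FV l)" if "l < m" for l using that by (auto simp: V_def)
  show thesis
  proof (rule that[OF V])
    show "x \<in> V" using x FV by (auto simp: V_def)
    show "smooth_on_open N V (fst (FV l))" if "l < m" for l
      using smooth_subset[OF _ V sub[OF that]] FV[OF that] by blast
    show "fst (FV l) y = (fs ! l) y" if "l < m" "y \<in> U" "y \<in> V" for l y
      using FV[OF that(1)] sub[OF that(1)] that by blast
  qed
qed

lemma composite_extension:
  assumes g: "g \<in> Cinf m" and V: "openin (Euclidean_space N) V" and F: "\<And>l. l < m \<Longrightarrow> smooth_on_open N V (F l)"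
  shows "smooth_on_open N V (\<lambda>y. g (\<lambda>l. if l < m then F l y else 0))"
  by (rule smooth_compose[OF V Cinf_smooth[OF g] F]) (auto simp: mem_euclid)

locale simplex_open =
  fixes n :: nat and U
  assumes openU: "openin (space_top (simplex_space n)) U"
begin

abbreviation "S \<equiv> simplex_sec n U"

lemma U_simplex: "x \<in> U \<Longrightarrow> x \<in> standard_simplex n"
  using openU by (auto simp: openin_simplex_iff)

lemma U_euclid: "x \<in> U \<Longrightarrow> x \<in> euclid (Suc n)"
  by (intro standard_simplex_euclid U_simplex)

lemma S_carrier: "carrier S = smooth_functions (Suc n) U"
  by (simp add: simplex_sec_def)

lemma S_op: "smooth_op S g fs = (\<lambda>x\<in>U. g (point (map (\<lambda>f. f x) fs)))"
  by (simp add: simplex_sec_def)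

lemma op_local_extension:
  assumes g: "g \<in> Cinf m" and fs: "fs \<in> tuples m (carrier S)" and x: "x \<in> V"
    and V: "openin (Euclidean_space (Suc n)) V" and F: "\<And>l. l < m \<Longrightarrow> smooth_on_open (Suc n) V (F l)"
    and FU: "\<And>l y. l < m \<Longrightarrow> y \<in> U \<Longrightarrow> y \<in> V \<Longrightarrow> F l y = (fs ! l) y"
  shows "local_extension (Suc n) U (smooth_op S g fs) x (\<lambda>y. g (\<lambda>l. if l < m then F l y else 0))"
proof (rule local_extensionI[OF x composite_extension[OF g V F]])
  fix y assume y: "y \<in> U" "y \<in> V"
  have "point (map (\<lambda>f. f y) fs) = (\<lambda>l. if l < m then F l y else 0)"
    using FU[OF _ y] fs by (auto simp: point_def fun_eq_iff tuples_length)
  then show "g (\<lambda>l. if l < m then F l y else 0) = smooth_op S g fs y"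
    using y by (simp add: S_op)
qed

sublocale smooth_ring S
proof
  have "(\<lambda>x\<in>U. 0) \<in> smooth_functions (Suc n) U"
  proof (rule smooth_functionsI)
    fix x assume x: "x \<in> U"
    have "local_extension (Suc n) U (\<lambda>x\<in>U. 0) x (\<lambda>_. 0)"
      by (rule local_extensionI[OF U_euclid[OF x] smooth_const[OF openin_euclid]]) simp
    then show "\<exists>F. local_extension (Suc n) U (\<lambda>x\<in>U. 0) x F" by blast
  qed simp
  then show "carrier S \<noteq> {}" by (auto simp: S_carrier)
next
  fix m g fs assume g: "g \<in> Cinf m" and fs: "fs \<in> tuples m (carrier S)"
  show "smooth_op S g fs \<in> carrier S"
    unfolding S_carrier
  proof (rule smooth_functionsI)
    show "smooth_op S g fs \<in> extensional U" by (simp add: S_op)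
    fix x assume x: "x \<in> U"
    obtain V F where V: "openin (Euclidean_space (Suc n)) V" "x \<in> V" "\<And>l. l < m \<Longrightarrow> smooth_on_open (Suc n) V (F l)"
      "\<And>l y. l < m \<Longrightarrow> y \<in> U \<Longrightarrow> y \<in> V \<Longrightarrow> F l y = (fs ! l) y"
      using common_neighbourhood[OF fs[unfolded S_carrier] x U_euclid[OF x]] by blast
    from op_local_extension[OF g fs V(2,1,3,4)]
    show "\<exists>F. local_extension (Suc n) U (smooth_op S g fs) x F" by blast
  qed
next
  fix m i fs assume i: "i < m" and fs: "fs \<in> tuples m (carrier S)"
  have "fs ! i \<in> extensional U"
    using tuples_nth[OF fs i] by (auto simp: S_carrier smooth_functions_def)
  moreover have "point (map (\<lambda>f. f x) fs) \<in> euclid m" for x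
    by (rule point_euclid) (use fs in \<open>simp add: tuples_length\<close>)
  ultimately show "smooth_op S (\<lambda>x\<in>euclid m. x i) fs = fs ! i"
    using i fs by (auto simp: S_op fun_eq_iff point_def tuples_length extensional_def)
next
  fix m k g hs fs
  assume g: "g \<in> Cinf m" and hs: "hs \<in> tuples m (Cinf k)" and fs: "fs \<in> tuples k (carrier S)"
  have "point (map (\<lambda>f. f x) fs) \<in> euclid k" for x
    by (rule point_euclid) (use fs in \<open>simp add: tuples_length\<close>)
  then show "smooth_op S (\<lambda>x\<in>euclid k. g (point (map (\<lambda>h. h x) hs))) fs = smooth_op S g (map (\<lambda>h. smooth_op S h fs) hs)"
    by (auto simp: S_op fun_eq_iff comp_def intro!: arg_cong[where f = g] arg_cong[where f = point])
qed

lemma ring_mult: "x \<in> U \<Longrightarrow> (f \<otimes>\<^bsub>UR\<^esub> g) x = f x * g x"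
  using point_euclid[of "[f x, g x]" 2] by (simp add: underlying_ring_def S_op point_def)

lemma ring_add: "x \<in> U \<Longrightarrow> (f \<oplus>\<^bsub>UR\<^esub> g) x = f x + g x"
  using point_euclid[of "[f x, g x]" 2] by (simp add: underlying_ring_def S_op point_def)

lemma ring_one: "x \<in> U \<Longrightarrow> \<one>\<^bsub>UR\<^esub> x = 1"
  using point_euclid[of "[]" 0] by (simp add: underlying_ring_def S_op)

subsection \<open>The differential on tangent vectors\<close>

definition tangent :: "(nat \<Rightarrow> real) \<Rightarrow> bool" where
  "tangent v \<longleftrightarrow> (\<Sum>i\<le>n. v i) = 0"

text \<open>At a boundary point two extensions need not agree on a neighbourhood in the ambient
  space. They do agree on the segments from \<open>x\<close> to the vertices, which stay in the
  simplex, so the right-hand derivative of the difference along each of them is zero. These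
  directions span the tangent vectors.\<close>

lemma extension_unique:
  assumes x: "x \<in> U" and F: "local_extension (Suc n) U f x F" and G: "local_extension (Suc n) U f x G"
    and v: "tangent v"
  shows "(\<Sum>i\<le>n. partial_deriv i F x * v i) = (\<Sum>i\<le>n. partial_deriv i G x * v i)"
proof -
  obtain V1 where V1: "openin (Euclidean_space (Suc n)) V1" "x \<in> V1" "smooth_on_open (Suc n) V1 F"
    "\<And>y. y \<in> U \<Longrightarrow> y \<in> V1 \<Longrightarrow> F y = f y" using local_extensionE[OF F] by blast
  obtain V2 where V2: "openin (Euclidean_space (Suc n)) V2" "x \<in> V2" "smooth_on_open (Suc n) V2 G"
    "\<And>y. y \<in> U \<Longrightarrow> y \<in> V2 \<Longrightarrow> G y = f y" using local_extensionE[OF G] by blast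
  obtain W where W: "open W" "U = standard_simplex n \<inter> W"
    using openU by (auto simp: openin_simplex_iff)
  define d where "d = (\<lambda>i. partial_deriv i F x - partial_deriv i G x)"
  have edge: "(\<Sum>i\<le>n. d i * ((if i = j then 1 else 0) - x i)) = 0" if j: "j \<le> n" for j
  proof -
    define e where "e = (\<lambda>i::nat. if i = j then 1 else 0 :: real)"
    define c where "c = (\<lambda>t i. (1 - t) * x i + t * e i)"
    have xE: "x i = 0" if "n < i" for i using U_euclid[OF x] that by (simp add: mem_euclid)
    have cE: "c t \<in> euclid (Suc n)" for t
      using j xE by (auto simp: mem_euclid c_def e_def)
    have c0: "c 0 = x" by (simp add: c_def)
    have cd: "((\<lambda>t. c t i) has_real_derivative (e i - x i)) (at 0)" for i
      unfolding c_def by (auto intro!: derivative_eq_intros)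
    have cS: "c t \<in> standard_simplex n" if "0 \<le> t" "t \<le> 1" for t
      unfolding c_def
      by (rule convex_standard_simplex[OF U_simplex[OF x] _ that]) (use j in \<open>simp add: e_def\<close>)
    have lim: "((\<lambda>t. c t i) \<longlongrightarrow> x i) (at_right 0)" for i
      using DERIV_isCont[OF cd[of i]] c0 unfolding isCont_def
      by (auto intro: tendsto_mono[OF at_le])
    have ev1: "eventually (\<lambda>t. c t \<in> V1) (at_right 0)" and ev2: "eventually (\<lambda>t. c t \<in> V2) (at_right 0)"
      by (rule eventually_in_open[OF V1(1,2)], use lim cE in auto,
          rule eventually_in_open[OF V2(1,2)], use lim cE in auto)
    have ev3: "eventually (\<lambda>t. c t \<in> W) (at_right 0)"
      using tendsto_fun_componentwise[OF lim] W x by (auto simp: tendsto_def)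
    have ev4: "eventually (\<lambda>t. 0 \<le> t \<and> t \<le> 1) (at_right (0::real))"
      by (intro eventually_conj) (auto simp: eventually_at_right[of 0 1] intro!: exI[of _ 1])
    have eq: "eventually (\<lambda>t. (F (c t) - G (c t)) / t = 0) (at_right 0)"
      using ev1 ev2 ev3 ev4 by eventually_elim (use cS V1(4) V2(4) W in auto)
    have xV: "c 0 \<in> V1" "c 0 \<in> V2" using V1 V2 c0 by auto
    have "((\<lambda>t. F (c t) - G (c t)) has_real_derivative
        (\<Sum>i<Suc n. partial_deriv i F (c 0) * (e i - x i)) - (\<Sum>i<Suc n. partial_deriv i G (c 0) * (e i - x i))) (at 0)"
      by (intro DERIV_diff smooth_chain_path[OF V1(3) xV(1) cE cd] smooth_chain_path[OF V2(3) xV(2) cE cd])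
    moreover have "(\<Sum>i<Suc n. partial_deriv i F (c 0) * (e i - x i)) - (\<Sum>i<Suc n. partial_deriv i G (c 0) * (e i - x i))
        = (\<Sum>i\<le>n. d i * (e i - x i))"
      unfolding c0 lessThan_Suc_atMost d_def by (simp only: left_diff_distrib sum_subtractf)
    ultimately have D: "((\<lambda>t. F (c t) - G (c t)) has_real_derivative (\<Sum>i\<le>n. d i * (e i - x i))) (at 0)"
      by (simp only:)
    have "F (c 0) = G (c 0)" using V1(2,4) V2(2,4) x c0 by simp
    with D have "((\<lambda>t. (F (c t) - G (c t)) / t) \<longlongrightarrow> (\<Sum>i\<le>n. d i * (e i - x i))) (at 0)"
      unfolding has_field_derivative_iff by simp
    then have "((\<lambda>t. (F (c t) - G (c t)) / t) \<longlongrightarrow> (\<Sum>i\<le>n. d i * (e i - x i))) (at_right 0)"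
      by (rule tendsto_mono[OF at_le, rotated]) simp
    moreover have "((\<lambda>t. (F (c t) - G (c t)) / t) \<longlongrightarrow> 0) (at_right 0)"
      by (rule tendsto_eventually[OF eq])
    ultimately have "(\<Sum>i\<le>n. d i * (e i - x i)) = 0"
      by (rule tendsto_unique[OF trivial_limit_at_right_real])
    then show ?thesis by (simp add: e_def)
  qed
  \<comment> \<open>The derivative towards vertex \<open>j\<close> vanishes, so all components of
    \<open>d\<close> equal one number, and the pairing with a vector of coordinate sum 0 is
    zero.\<close>
  have dj: "d j = (\<Sum>i\<le>n. d i * x i)" if "j \<le> n" for j
  proof -
    have "(\<Sum>i\<le>n. d i * (if i = j then 1 else 0)) = d j" using that by (simp add: if_distrib cong: if_cong)
    then show ?thesis using edge[OF that] by (simp add: algebra_simps sum_subtractf)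
  qed
  have "(\<Sum>i\<le>n. d i * v i) = (\<Sum>i\<le>n. (\<Sum>i\<le>n. d i * x i) * v i)"
    by (intro sum.cong refl) (simp add: dj[symmetric])
  also have "\<dots> = 0" using v by (simp add: tangent_def sum_distrib_left[symmetric])
  finally show ?thesis by (simp add: d_def algebra_simps sum_subtractf)
qed

lemma differential_eq:
  assumes "x \<in> U" "local_extension (Suc n) U f x F" "tangent v"
  shows "differential n U f x v = (\<Sum>i\<le>n. partial_deriv i F x * v i)"
  unfolding differential_def
  by (rule the_equality) (use assms extension_unique[OF assms(1) _ assms(2,3)] in blast)+

text \<open>The chain rule, in exactly the form of the Kaehler relation for \<open>h\<close>. This
  is what lets evaluation on tangent vectors descend from the free module.\<close>

lemma differential_op:
  assumes h: "h \<in> Cinf m" and fs: "fs \<in> tuples m (carrier S)" and x: "x \<in> U" and v: "tangent v"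
  shows "differential n U (smooth_op S h fs) x v =
    (\<Sum>l<m. smooth_op S (pd m l h) fs x * differential n U (fs ! l) x v)"
proof -
  obtain V F where V: "openin (Euclidean_space (Suc n)) V" "x \<in> V" "\<And>l. l < m \<Longrightarrow> smooth_on_open (Suc n) V (F l)"
    "\<And>l y. l < m \<Longrightarrow> y \<in> U \<Longrightarrow> y \<in> V \<Longrightarrow> F l y = (fs ! l) y"
    using common_neighbourhood[OF fs[unfolded S_carrier] x U_euclid[OF x]] by blast
  let ?H = "\<lambda>y l. if l < m then F l y else 0"
  have pt: "point (map (\<lambda>f. f x) fs) = ?H x"
    using V(4)[OF _ x V(2)] fs by (auto simp: point_def fun_eq_iff tuples_length)
  have ptE: "?H x \<in> euclid m" by (auto simp: mem_euclid)
  have "differential n U (smooth_op S h fs) x v = (\<Sum>i\<le>n. partial_deriv i (\<lambda>y. h (?H y)) x * v i)"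
    by (rule differential_eq[OF x op_local_extension[OF h fs V(2,1,3,4)] v])
  also have "\<dots> = (\<Sum>i\<le>n. \<Sum>l<m. partial_deriv l h (?H x) * (partial_deriv i (F l) x * v i))"
  proof (intro sum.cong refl)
    fix i assume "i \<in> {..n}"
    then have "partial_deriv i (\<lambda>y. h (?H y)) x = (\<Sum>l<m. partial_deriv l h (?H x) * partial_deriv i (F l) x)"
      by (intro smooth_composite_partial[OF V(1) Cinf_smooth[OF h] V(3)] V(2)) (auto simp: mem_euclid)
    then show "partial_deriv i (\<lambda>y. h (?H y)) x * v i = (\<Sum>l<m. partial_deriv l h (?H x) * (partial_deriv i (F l) x * v i))"
      by (simp add: sum_distrib_right mult.assoc)
  qed
  also have "\<dots> = (\<Sum>l<m. partial_deriv l h (?H x) * (\<Sum>i\<le>n. partial_deriv i (F l) x * v i))"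
    by (subst sum.swap) (simp add: sum_distrib_left)
  also have "\<dots> = (\<Sum>l<m. smooth_op S (pd m l h) fs x * differential n U (fs ! l) x v)"
  proof (intro sum.cong refl)
    fix l assume "l \<in> {..<m}"
    then have l: "l < m" by simp
    have "differential n U (fs ! l) x v = (\<Sum>i\<le>n. partial_deriv i (F l) x * v i)"
      by (rule differential_eq[OF x local_extensionI[OF V(2) V(3)[OF l] V(4)[OF l]] v])
    moreover have "smooth_op S (pd m l h) fs x = partial_deriv l h (?H x)"
      using x ptE by (simp add: S_op pd_def pt)
    ultimately show "partial_deriv l h (?H x) * (\<Sum>i\<le>n. partial_deriv i (F l) x * v i) =
        smooth_op S (pd m l h) fs x * differential n U (fs ! l) x v" by simp
  qed
  finally show ?thesis .
qed

end

section \<open>Evaluation of algebraic forms on the simplex\<close>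

text \<open>The real numbers as a record, so that evaluation at a point is an additive map into an
  abelian group of the same kind as the other targets.\<close>

definition real_group :: "real ring" where
  "real_group = \<lparr>carrier = UNIV, monoid.mult = (*), one = 1, ring.zero = 0, ring.add = (+)\<rparr>"

lemma real_group_simps [simp]:
  "carrier real_group = UNIV" "\<zero>\<^bsub>real_group\<^esub> = 0" "a \<oplus>\<^bsub>real_group\<^esub> b = a + b"
  by (simp_all add: real_group_def)

lemma real_group: "abelian_group real_group"
proof (rule abelian_groupI)
  fix x :: real
  show "\<exists>y\<in>carrier real_group. y \<oplus>\<^bsub>real_group\<^esub> x = \<zero>\<^bsub>real_group\<^esub>"
    by (rule bexI[of _ "- x"]) simp_all
qed auto

lemma finsum_real_group: "finsum real_group f A = sum f A"
proof -
  interpret abelian_group real_group by (rule real_group)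
  show ?thesis
  proof (induction A rule: infinite_finite_induct)
    case (infinite A)
    then show ?case using finsum_infinite[of A f] by simp
  next
    case empty
    then show ?case using finsum_empty[of f] by simp
  next
    case (insert a A)
    then show ?case using finsum_insert[of A a f] by simp
  qed
qed

lemma additive_map_real: "additive_map N real_group F \<longleftrightarrow> (\<forall>u\<in>carrier N. \<forall>v\<in>carrier N. F (u \<oplus>\<^bsub>N\<^esub> v) = F u + F v)"
  by (simp add: additive_map_def)

lemma the_elem_image: "a \<in> A \<Longrightarrow> (\<And>b. b \<in> A \<Longrightarrow> f b = f a) \<Longrightarrow> the_elem (f ` A) = f a"
  by (rule the_elem_image_unique) blast+

context simplex_open
begin

section \<open>Evaluation of 1-forms\<close>

definition eval1 :: "(nat \<Rightarrow> real) \<Rightarrow> (nat \<Rightarrow> real) \<Rightarrow> (((nat \<Rightarrow> real) \<Rightarrow> real) \<Rightarrow> (nat \<Rightarrow> real) \<Rightarrow> real) \<Rightarrow> real" where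
  "eval1 x t = lin_ext real_group UR (carrier S) (\<lambda>f c. c x * differential n U f x t)"

lemma coeff_additive: "x \<in> U \<Longrightarrow> additive_map UR real_group (\<lambda>c. c x * r)"
  unfolding additive_map_real using ring_add by (simp add: algebra_simps)

context
  fixes x t
  assumes x: "x \<in> U" and t: "tangent t"
begin

lemma eval1_additive: "additive_map KF real_group (eval1 x t)"
  unfolding eval1_def kaehler_free_def
  by (rule UR.lin_ext_additive[OF real_group coeff_additive[OF x]])

lemma eval1_gen: "f \<in> carrier S \<Longrightarrow> c \<in> carrier S \<Longrightarrow> eval1 x t (c \<odot>\<^bsub>KF\<^esub> gen_vec f) = c x * differential n U f x t"
  unfolding eval1_def kaehler_free_def
  by (rule UR.lin_ext_basis[OF real_group coeff_additive[OF x]]) (simp_all add: UR_carrier)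

lemma eval1_kills:
  assumes v: "v \<in> kaehler_span S"
  shows "eval1 x t v = 0"
proof -
  have "eval1 x t v = \<zero>\<^bsub>real_group\<^esub>"
  proof (rule kaehler_additive_kills[OF real_group eval1_additive _ v])
    fix c m h fs assume c: "c \<in> carrier S" and h: "h \<in> Cinf m" and fs: "fs \<in> tuples m (carrier S)"
    have cl: "c \<otimes>\<^bsub>UR\<^esub> smooth_op S (pd m i h) fs \<in> carrier S" if "i < m" for i
      using UR.m_closed[OF _ tuples_op_closed[OF fs that h], of c] c by (simp add: UR_carrier)
    have "eval1 x t (c \<odot>\<^bsub>KF\<^esub> gen_vec (smooth_op S h fs)) =
        (\<Sum>i<m. c x * (smooth_op S (pd m i h) fs x * differential n U (fs ! i) x t))"
      unfolding eval1_gen[OF op_closed[OF h fs] c] differential_op[OF h fs x t] by (rule sum_distrib_left)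
    also have "\<dots> = (\<Sum>i<m. eval1 x t ((c \<otimes>\<^bsub>UR\<^esub> smooth_op S (pd m i h) fs) \<odot>\<^bsub>KF\<^esub> gen_vec (fs ! i)))"
    proof (intro sum.cong refl)
      fix i assume "i \<in> {..<m}"
      then have i: "i < m" by simp
      show "c x * (smooth_op S (pd m i h) fs x * differential n U (fs ! i) x t) =
          eval1 x t ((c \<otimes>\<^bsub>UR\<^esub> smooth_op S (pd m i h) fs) \<odot>\<^bsub>KF\<^esub> gen_vec (fs ! i))"
        unfolding eval1_gen[OF tuples_nth[OF fs i] cl[OF i]] ring_mult[OF x] by simp
    qed
    finally show "eval1 x t (c \<odot>\<^bsub>KF\<^esub> gen_vec (smooth_op S h fs)) =
      (\<Oplus>\<^bsub>real_group\<^esub>i\<in>{..<m}. eval1 x t ((c \<otimes>\<^bsub>UR\<^esub> smooth_op S (pd m i h) fs) \<odot>\<^bsub>KF\<^esub> gen_vec (fs ! i)))"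
      by (simp only: finsum_real_group)
  qed
  then show ?thesis by simp
qed

lemma eval_1form_class:
  assumes v: "v \<in> carrier KF"
  shows "eval_1form n U (kaehler_class S v) x t = eval1 x t v"
proof -
  have "(\<lambda>c. \<Sum>f | f \<in> carrier UR \<and> c f \<noteq> \<zero>\<^bsub>UR\<^esub>. c f x * differential n U f x t) = eval1 x t"
    by (rule ext) (simp add: eval1_def lin_ext_def finsum_real_group UR_carrier)
  moreover have "the_elem (eval1 x t ` kaehler_class S v) = eval1 x t v"
    by (rule the_elem_image[OF kaehler_class_self[OF v]])
       (rule kaehler_const_on_class[where F = "eval1 x t", OF real_group eval1_additive _ v],
         simp_all add: eval1_kills)
  ultimately show ?thesis unfolding eval_1form_def Let_def by (simp only:)
qed

lemma eval_1form_add: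
  assumes "u \<in> carrier \<Omega>" "w \<in> carrier \<Omega>"
  shows "eval_1form n U (u \<oplus>\<^bsub>\<Omega>\<^esub> w) x t = eval_1form n U u x t + eval_1form n U w x t"
proof -
  obtain v where v: "v \<in> carrier KF" "u = kaehler_class S v" by (rule kaehler_cases[OF assms(1)])
  obtain v' where v': "v' \<in> carrier KF" "w = kaehler_class S v'" by (rule kaehler_cases[OF assms(2)])
  show ?thesis
    unfolding v(2) v'(2) KC.add[OF v(1) v'(1), symmetric] eval_1form_class[OF v(1)] eval_1form_class[OF v'(1)]
      eval_1form_class[OF KF.M.a_closed[OF v(1) v'(1)]]
    using additive_map_add[OF eval1_additive v(1) v'(1)] by simp
qed

lemma eval_1form_smult:
  assumes c: "c \<in> carrier S" and u: "u \<in> carrier \<Omega>"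
  shows "eval_1form n U (c \<odot>\<^bsub>\<Omega>\<^esub> u) x t = c x * eval_1form n U u x t"
proof -
  have R: "c \<in> carrier UR" using c by (simp add: UR_carrier)
  obtain v where v: "v \<in> carrier KF" "u = kaehler_class S v" by (rule kaehler_cases[OF u])
  have "eval1 x t (c \<odot>\<^bsub>KF\<^esub> v) = c x * eval1 x t v"
  proof (rule KF_eqI[where F = "\<lambda>v. eval1 x t (c \<odot>\<^bsub>KF\<^esub> v)" and G = "\<lambda>v. c x * eval1 x t v", OF real_group _ _ _ v(1)])
    show "additive_map KF real_group (\<lambda>v. eval1 x t (c \<odot>\<^bsub>KF\<^esub> v))"
      unfolding additive_map_real
    proof (intro ballI)
      fix u v assume uv: "u \<in> carrier KF" "v \<in> carrier KF"
      show "eval1 x t (c \<odot>\<^bsub>KF\<^esub> (u \<oplus>\<^bsub>KF\<^esub> v)) = eval1 x t (c \<odot>\<^bsub>KF\<^esub> u) + eval1 x t (c \<odot>\<^bsub>KF\<^esub> v)"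
        unfolding KF.smult_r_distr[OF R uv]
        using additive_map_add[OF eval1_additive KF.smult_closed[OF R uv(1)] KF.smult_closed[OF R uv(2)]] by simp
    qed
    show "additive_map KF real_group (\<lambda>v. c x * eval1 x t v)"
      using eval1_additive unfolding additive_map_real by (simp add: distrib_left)
    fix b s assume bs: "b \<in> carrier S" "s \<in> carrier S"
    then have s: "s \<in> carrier UR" by (simp add: UR_carrier)
    have cs: "c \<otimes>\<^bsub>UR\<^esub> s \<in> carrier S" using UR.m_closed[OF R s] by (simp add: UR_carrier)
    show "eval1 x t (c \<odot>\<^bsub>KF\<^esub> (s \<odot>\<^bsub>KF\<^esub> gen_vec b)) = c x * eval1 x t (s \<odot>\<^bsub>KF\<^esub> gen_vec b)"
      unfolding KF.smult_assoc1[OF R s gen_vec_closed[OF bs(1)], symmetric] eval1_gen[OF bs(1) cs] eval1_gen[OF bs]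
        ring_mult[OF x] by simp
  qed
  then show ?thesis
    unfolding v(2) kaehler_class_smult[OF c v(1), symmetric] eval_1form_class[OF v(1)]
      eval_1form_class[OF KF.smult_closed[OF R v(1)]] .
qed

lemma eval_1form_d:
  assumes f: "f \<in> carrier S"
  shows "eval_1form n U (kd f) x t = differential n U f x t"
proof -
  have one: "\<one>\<^bsub>UR\<^esub> \<in> carrier S" using UR.one_closed by (simp add: UR_carrier)
  have "eval_1form n U (kd f) x t = eval1 x t (gen_vec f)"
    unfolding kaehler_d_def by (rule eval_1form_class[OF gen_vec_closed[OF f]])
  also have "\<dots> = eval1 x t (\<one>\<^bsub>UR\<^esub> \<odot>\<^bsub>KF\<^esub> gen_vec f)"
    by (simp only: KF.smult_one[OF gen_vec_closed[OF f]])
  also have "\<dots> = differential n U f x t"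
    unfolding eval1_gen[OF f one] ring_one[OF x] by simp
  finally show ?thesis .
qed

end

section \<open>Evaluation of forms of higher degree\<close>

definition evalk :: "nat \<Rightarrow> (nat \<Rightarrow> real) \<Rightarrow> (nat \<Rightarrow> real) list \<Rightarrow>
    ((((nat \<Rightarrow> real) \<Rightarrow> real) \<Rightarrow> (nat \<Rightarrow> real) \<Rightarrow> real) set list \<Rightarrow> (nat \<Rightarrow> real) \<Rightarrow> real) \<Rightarrow> real" where
  "evalk k x ts = lin_ext real_group UR (tuples k (carrier \<Omega>))
     (\<lambda>ws c. c x * dt k (\<lambda>i j. eval_1form n U (ws ! i) x (ts ! j)))"

context
  fixes k x ts
  assumes x: "x \<in> U" and ts: "\<And>j. j < k \<Longrightarrow> tangent (ts ! j)"
begin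

lemma evalk_additive: "additive_map (ext_free UR \<Omega> k) real_group (evalk k x ts)"
  unfolding evalk_def ext_free_def
  by (rule UR.lin_ext_additive[OF real_group coeff_additive[OF x]])

lemma evalk_simple:
  assumes "c \<in> carrier UR" "ws \<in> tuples k (carrier \<Omega>)"
  shows "evalk k x ts (E.simple k c ws) = c x * dt k (\<lambda>i j. eval_1form n U (ws ! i) x (ts ! j))"
  unfolding evalk_def ext_free_def
  by (rule UR.lin_ext_basis[OF real_group coeff_additive[OF x]]) (use assms in simp_all)

lemma dt_update:
  assumes "length ws = k"
  shows "dt k (\<lambda>i j. eval_1form n U (ws[l := u] ! i) x (ts ! j)) =
    dt k ((\<lambda>i j. eval_1form n U (ws ! i) x (ts ! j))(l := \<lambda>j. eval_1form n U u x (ts ! j)))"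
  by (rule dt_cong) (use assms in \<open>auto simp: nth_list_update\<close>)

text \<open>The relations of the exterior power become properties of the determinant as a function
  of its rows: additivity, homogeneity, and vanishing when two rows agree.\<close>

lemma evalk_kills:
  assumes v: "v \<in> ext_span UR \<Omega> k"
  shows "evalk k x ts v = 0"
proof -
  have "evalk k x ts v = \<zero>\<^bsub>real_group\<^esub>"
  proof (rule E.additive_kills_ext_span[OF real_group evalk_additive _ _ _ v])
    fix c ws i assume c: "c \<in> carrier UR" and ws: "ws \<in> tuples k (carrier \<Omega>)"
    have len: "length ws = k" using ws by (rule tuples_length)
    let ?A = "\<lambda>i j. eval_1form n U (ws ! i) x (ts ! j)"
    {
      fix u v assume i: "i < k" and uv: "u \<in> carrier \<Omega>" "v \<in> carrier \<Omega>"
      have w: "ws[i := u \<oplus>\<^bsub>\<Omega>\<^esub> v] \<in> tuples k (carrier \<Omega>)" "ws[i := u] \<in> tuples k (carrier \<Omega>)" "ws[i := v] \<in> tuples k (carrier \<Omega>)"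
        using ws uv by (simp_all add: tuples_update)
      have "dt k (?A(i := \<lambda>j. eval_1form n U (u \<oplus>\<^bsub>\<Omega>\<^esub> v) x (ts ! j))) =
          dt k (?A(i := \<lambda>j. eval_1form n U u x (ts ! j) + eval_1form n U v x (ts ! j)))"
        by (rule dt_cong) (use eval_1form_add[OF x ts uv] in auto)
      also have "\<dots> = dt k (?A(i := \<lambda>j. eval_1form n U u x (ts ! j))) + dt k (?A(i := \<lambda>j. eval_1form n U v x (ts ! j)))"
        by (rule dt_row_add[OF i])
      finally show "evalk k x ts (E.simple k c (ws[i := u \<oplus>\<^bsub>\<Omega>\<^esub> v])) =
        evalk k x ts (E.simple k c (ws[i := u])) \<oplus>\<^bsub>real_group\<^esub> evalk k x ts (E.simple k c (ws[i := v]))"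
        unfolding evalk_simple[OF c w(1)] evalk_simple[OF c w(2)] evalk_simple[OF c w(3)] dt_update[OF len]
        by (simp add: distrib_left)
    next
      fix a u assume i: "i < k" and a: "a \<in> carrier UR" and u: "u \<in> carrier \<Omega>"
      have w: "ws[i := a \<odot>\<^bsub>\<Omega>\<^esub> u] \<in> tuples k (carrier \<Omega>)" "ws[i := u] \<in> tuples k (carrier \<Omega>)"
        using ws u a by (simp_all add: tuples_update)
      have a': "a \<in> carrier S" using a by (simp add: UR_carrier)
      have "dt k (?A(i := \<lambda>j. eval_1form n U (a \<odot>\<^bsub>\<Omega>\<^esub> u) x (ts ! j))) =
          dt k (?A(i := \<lambda>j. a x * eval_1form n U u x (ts ! j)))"
        by (rule dt_cong) (use eval_1form_smult[OF x ts a' u] in auto)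
      also have "\<dots> = a x * dt k (?A(i := \<lambda>j. eval_1form n U u x (ts ! j)))"
        by (rule dt_row_smult[OF i])
      finally show "evalk k x ts (E.simple k c (ws[i := a \<odot>\<^bsub>\<Omega>\<^esub> u])) =
        evalk k x ts (E.simple k (c \<otimes>\<^bsub>UR\<^esub> a) (ws[i := u]))"
        unfolding evalk_simple[OF c w(1)] evalk_simple[OF UR.m_closed[OF c a] w(2)] dt_update[OF len] ring_mult[OF x]
        by simp
    next
      fix j assume ij: "i < j" "j < k" "ws ! i = ws ! j"
      have "dt k ?A = 0" by (rule dt_alt[of i k j]) (use ij in auto)
      then show "evalk k x ts (E.simple k c ws) = \<zero>\<^bsub>real_group\<^esub>"
        unfolding evalk_simple[OF c ws] by simp
    }
  qed
  then show ?thesis by simp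
qed

lemma eval_form_class:
  assumes v: "v \<in> carrier (ext_free UR \<Omega> k)"
  shows "eval_form n k U (ext_class UR \<Omega> k v) x ts = evalk k x ts v"
proof -
  have "(\<lambda>c. \<Sum>ws | ws \<in> tuples k (carrier \<Omega>) \<and> c ws \<noteq> \<zero>\<^bsub>UR\<^esub>.
            c ws x * (\<Sum>p | p permutes {..<k}. of_int (sign p) * (\<Prod>i<k. eval_1form n U (ws ! i) x (ts ! p i)))) = evalk k x ts"
    by (rule ext) (simp add: evalk_def lin_ext_def finsum_real_group dt_def)
  moreover have "the_elem (evalk k x ts ` ext_class UR \<Omega> k v) = evalk k x ts v"
    by (rule the_elem_image[OF E.ext_class_self[OF v]])
       (rule E.const_on_ext_class[where F = "evalk k x ts", OF real_group evalk_additive _ v],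
         simp_all add: evalk_kills)
  ultimately show ?thesis unfolding eval_form_def Let_def by (simp only:)
qed

lemma eval_form_add:
  assumes "\<alpha> \<in> carrier (Ext k)" "\<beta> \<in> carrier (Ext k)"
  shows "eval_form n k U (\<alpha> \<oplus>\<^bsub>Ext k\<^esub> \<beta>) x ts = eval_form n k U \<alpha> x ts + eval_form n k U \<beta> x ts"
proof -
  interpret F: module UR "ext_free UR \<Omega> k" by (rule E.ext_free_module)
  obtain v where v: "v \<in> carrier (ext_free UR \<Omega> k)" "\<alpha> = ext_class UR \<Omega> k v" by (rule E.ext_power_cases[OF assms(1)])
  obtain w where w: "w \<in> carrier (ext_free UR \<Omega> k)" "\<beta> = ext_class UR \<Omega> k w" by (rule E.ext_power_cases[OF assms(2)])
  show ?thesis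
    unfolding v(2) w(2) additive_map_add[OF E.ext_class_additive v(1) w(1), symmetric] eval_form_class[OF v(1)]
      eval_form_class[OF w(1)] eval_form_class[OF F.M.a_closed[OF v(1) w(1)]]
    using additive_map_add[OF evalk_additive v(1) w(1)] by simp
qed

lemma eval_form_additive: "additive_map (Ext k) real_group (\<lambda>\<alpha>. eval_form n k U \<alpha> x ts)"
  unfolding additive_map_real using eval_form_add by blast

lemma eval_form_gen:
  assumes a: "a \<in> carrier S" and bs: "bs \<in> tuples k (carrier S)"
  shows "eval_form n k U (gen a bs) x ts = a x * dt k (\<lambda>i j. differential n U (bs ! i) x (ts ! j))"
proof -
  have R: "a \<in> carrier UR" using a by (simp add: UR_carrier)
  have "eval_form n k U (gen a bs) x ts = a x * dt k (\<lambda>i j. eval_1form n U (map kd bs ! i) x (ts ! j))"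
    unfolding gen_def E.tens_eq[OF map_kd[OF bs]] eval_form_class[OF E.simple_closed[OF map_kd[OF bs] R]]
    by (rule evalk_simple[OF R map_kd[OF bs]])
  also have "dt k (\<lambda>i j. eval_1form n U (map kd bs ! i) x (ts ! j)) = dt k (\<lambda>i j. differential n U (bs ! i) x (ts ! j))"
  proof (rule dt_cong)
    fix i j assume ij: "i < k" "j < k"
    have "map kd bs ! i = kd (bs ! i)" using ij bs by (simp add: tuples_length)
    then show "eval_1form n U (map kd bs ! i) x (ts ! j) = differential n U (bs ! i) x (ts ! j)"
      using eval_1form_d[OF x ts[OF ij(2)] tuples_nth[OF bs ij(1)]] by simp
  qed
  finally show ?thesis .
qed

end

end

section \<open>Pullback along coordinate maps of simplices\<close>

text \<open>Both kinds of maps that occur, inclusions of open sets and faces, are linear on the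
  ambient spaces. The last assumption says this in the form needed: the derivative of
  \<open>p\<close> at every point is \<open>p\<close> itself, so tangent vectors are pushed forward
  by \<open>p\<close>.\<close>

locale simplex_pullback = A: simplex_open n U + B: simplex_open m W for n U m W +
  fixes p :: "(nat \<Rightarrow> real) \<Rightarrow> nat \<Rightarrow> real"
  assumes p_U: "\<And>x. x \<in> W \<Longrightarrow> p x \<in> U"
    and p_euclid: "\<And>y. y \<in> euclid (Suc m) \<Longrightarrow> p y \<in> euclid (Suc n)"
    and p_smooth: "\<And>l. smooth_on_open (Suc m) (euclid (Suc m)) (\<lambda>y. p y l)"
    and p_linear: "\<And>x v l. x \<in> euclid (Suc m) \<Longrightarrow> l \<le> n \<Longrightarrow>
      (\<Sum>i\<le>m. partial_deriv i (\<lambda>y. p y l) x * v i) = p v l"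
begin

lemma preimage_open:
  assumes "openin (Euclidean_space (Suc n)) V"
  shows "openin (Euclidean_space (Suc m)) {y \<in> euclid (Suc m). p y \<in> V}"
proof -
  have "continuous_on (euclid (Suc m)) p"
    by (rule continuous_on_coordinatewise_then_product) (rule smooth_continuous[OF p_smooth])
  then have "continuous_map (subtopology (Euclidean_space (Suc m)) UNIV) (Euclidean_space (Suc n)) p"
    unfolding cm_Euclidean_space_iff_continuous_on using p_euclid by auto
  then have "continuous_map (Euclidean_space (Suc m)) (Euclidean_space (Suc n)) p" by simp
  from openin_continuous_map_preimage[OF this assms] show ?thesis .
qed

lemma pull_extension:
  assumes x: "x \<in> W" and F: "local_extension (Suc n) U f (p x) F"
  shows "local_extension (Suc m) W (\<lambda>x\<in>W. f (p x)) x (\<lambda>y. F (\<lambda>l. if l < Suc n then p y l else 0))"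
    and "i \<le> m \<Longrightarrow> partial_deriv i (\<lambda>y. F (\<lambda>l. if l < Suc n then p y l else 0)) x =
      (\<Sum>l<Suc n. partial_deriv l F (p x) * partial_deriv i (\<lambda>y. p y l) x)"
proof -
  obtain V where V: "openin (Euclidean_space (Suc n)) V" "p x \<in> V" "smooth_on_open (Suc n) V F"
    "\<And>y. y \<in> U \<Longrightarrow> y \<in> V \<Longrightarrow> F y = f y" using local_extensionE[OF F] by blast
  let ?V = "{y \<in> euclid (Suc m). p y \<in> V}"
  have pe: "(\<lambda>l. if l < Suc n then p y l else 0) = p y" if "y \<in> euclid (Suc m)" for y
    using p_euclid[OF that] by (auto simp: mem_euclid fun_eq_iff)
  have pV: "(\<lambda>l. if l < Suc n then p y l else 0) \<in> V" if "y \<in> ?V" for y using that pe[of y] by auto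
  have ps: "smooth_on_open (Suc m) ?V (\<lambda>y. p y l)" for l
    by (rule smooth_subset[OF p_smooth preimage_open[OF V(1)]]) auto
  have xV: "x \<in> ?V" using V(2) B.U_euclid[OF x] by simp
  show "local_extension (Suc m) W (\<lambda>x\<in>W. f (p x)) x (\<lambda>y. F (\<lambda>l. if l < Suc n then p y l else 0))"
  proof (rule local_extensionI[OF xV smooth_compose[OF preimage_open[OF V(1)] V(3) ps pV]])
    fix y assume "y \<in> W" "y \<in> ?V"
    then show "F (\<lambda>l. if l < Suc n then p y l else 0) = (\<lambda>x\<in>W. f (p x)) y"
      using V(4) p_U pe[of y] by simp
  qed
  show "partial_deriv i (\<lambda>y. F (\<lambda>l. if l < Suc n then p y l else 0)) x =
      (\<Sum>l<Suc n. partial_deriv l F (p x) * partial_deriv i (\<lambda>y. p y l) x)" if "i \<le> m"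
    using smooth_composite_partial[OF preimage_open[OF V(1)] V(3) ps pV xV, of i] that
    unfolding pe[OF B.U_euclid[OF x]] by simp
qed

definition pull :: "((nat \<Rightarrow> real) \<Rightarrow> real) \<Rightarrow> (nat \<Rightarrow> real) \<Rightarrow> real" where
  "pull = (\<lambda>s\<in>carrier (simplex_sec n U). \<lambda>x\<in>W. s (p x))"

lemma pull_closed:
  assumes f: "f \<in> carrier (simplex_sec n U)"
  shows "(\<lambda>x\<in>W. f (p x)) \<in> carrier (simplex_sec m W)"
  unfolding B.S_carrier
proof (rule smooth_functionsI)
  fix x assume x: "x \<in> W"
  obtain F where "local_extension (Suc n) U f (p x) F"
    using smooth_functionsD[OF f[unfolded A.S_carrier] p_U[OF x]] by blast
  from pull_extension(1)[OF x this] show "\<exists>F. local_extension (Suc m) W (\<lambda>x\<in>W. f (p x)) x F" by blast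
qed simp

lemma pull_hom: "pull \<in> cinf_hom (simplex_sec n U) (simplex_sec m W)"
  unfolding cinf_hom_def
proof (intro CollectI conjI allI ballI)
  show "pull \<in> carrier (simplex_sec n U) \<rightarrow>\<^sub>E carrier (simplex_sec m W)"
    unfolding pull_def using pull_closed by simp
  fix k g as assume g: "g \<in> Cinf k" and as: "as \<in> tuples k (carrier (simplex_sec n U))"
  have eq: "map (\<lambda>f. f x) (map pull as) = map (\<lambda>f. f (p x)) as" if "x \<in> W" for x
    using as that by (auto simp: tuples_def pull_def)
  show "pull (smooth_op (simplex_sec n U) g as) = smooth_op (simplex_sec m W) g (map pull as)"
  proof -
    have "pull (smooth_op (simplex_sec n U) g as) = (\<lambda>x\<in>W. smooth_op (simplex_sec n U) g as (p x))"
      unfolding pull_def using A.op_closed[OF g as] by simp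
    also have "\<dots> = smooth_op (simplex_sec m W) g (map pull as)"
      unfolding B.S_op by (rule restrict_ext) (simp only: eq A.S_op restrict_apply' p_U)
    finally show ?thesis .
  qed
qed

lemma differential_pull:
  assumes f: "f \<in> carrier (simplex_sec n U)" and x: "x \<in> W" and v: "B.tangent v" "A.tangent (p v)"
  shows "differential m W (pull f) x v = differential n U f (p x) (p v)"
proof -
  obtain F where F: "local_extension (Suc n) U f (p x) F"
    using smooth_functionsD[OF f[unfolded A.S_carrier] p_U[OF x]] by blast
  have "differential m W (pull f) x v =
      (\<Sum>i\<le>m. partial_deriv i (\<lambda>y. F (\<lambda>l. if l < Suc n then p y l else 0)) x * v i)"
    using B.differential_eq[OF x pull_extension(1)[OF x F] v(1)] f by (simp add: pull_def)
  also have "\<dots> = (\<Sum>i\<le>m. \<Sum>l<Suc n. partial_deriv l F (p x) * (partial_deriv i (\<lambda>y. p y l) x * v i))"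
    by (intro sum.cong refl) (simp add: pull_extension(2)[OF x F] sum_distrib_right mult.assoc del: sum.lessThan_Suc)
  also have "\<dots> = (\<Sum>l<Suc n. partial_deriv l F (p x) * (\<Sum>i\<le>m. partial_deriv i (\<lambda>y. p y l) x * v i))"
    by (subst sum.swap) (simp add: sum_distrib_left del: sum.lessThan_Suc)
  also have "\<dots> = (\<Sum>l\<le>n. partial_deriv l F (p x) * p v l)"
    unfolding lessThan_Suc_atMost by (intro sum.cong refl) (simp add: p_linear[OF B.U_euclid[OF x]])
  also have "\<dots> = differential n U f (p x) (p v)"
    by (rule A.differential_eq[OF p_U[OF x] F v(2), symmetric])
  finally show ?thesis .
qed

sublocale hom: smooth_ring_hom "simplex_sec n U" "simplex_sec m W" pull
  by (intro smooth_ring_hom.intro smooth_ring_hom_axioms.intro A.smooth_ring_axioms B.smooth_ring_axioms pull_hom)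

text \<open>Both sides are additive in the form. On generators the determinants agree entry by
  entry, since the differential of a pulled back function on \<open>v\<close> is the differential of
  the function on \<open>p v\<close>.\<close>

lemma eval_form_pull:
  assumes \<alpha>: "\<alpha> \<in> carrier (\<Lambda>\<Omega> (simplex_sec n U) k)" and x: "x \<in> W" and len: "length ts = k"
    and ts: "\<And>t. t \<in> set ts \<Longrightarrow> B.tangent t" "\<And>t. t \<in> set ts \<Longrightarrow> A.tangent (p t)"
  shows "eval_form m k W (\<Lambda>\<Omega>_map (simplex_sec n U) (simplex_sec m W) pull k \<alpha>) x ts = eval_form n k U \<alpha> (p x) (map p ts)"
proof -
  have tB: "B.tangent (ts ! j)" and tA: "A.tangent (map p ts ! j)" if "j < k" for j
    using ts len that by simp_all
  show ?thesis
  proof (rule A.gen_eqI[where A = "\<lambda>\<alpha>. eval_form m k W (\<Lambda>\<Omega>_map (simplex_sec n U) (simplex_sec m W) pull k \<alpha>) x ts"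
        and B = "\<lambda>\<alpha>. eval_form n k U \<alpha> (p x) (map p ts)", OF real_group _ A.eval_form_additive[OF p_U[OF x] tA] _ \<alpha>[unfolded A.\<Lambda>\<Omega>_eq]])
    show "additive_map (A.Ext k) real_group (\<lambda>\<alpha>. eval_form m k W (\<Lambda>\<Omega>_map (simplex_sec n U) (simplex_sec m W) pull k \<alpha>) x ts)"
      by (rule additive_map_comp[OF hom.\<Lambda>\<Omega>_map_additive[unfolded A.\<Lambda>\<Omega>_eq B.\<Lambda>\<Omega>_eq] B.eval_form_additive[OF x tB]])
    fix a bs assume a: "a \<in> carrier (simplex_sec n U)" and bs: "bs \<in> tuples k (carrier (simplex_sec n U))"
    have pc: "pull f \<in> carrier (simplex_sec m W)" if "f \<in> carrier (simplex_sec n U)" for f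
      using pull_closed[OF that] that by (simp add: pull_def)
    have pa: "pull a x = a (p x)" using a x by (simp add: pull_def)
    have d: "dt k (\<lambda>i j. differential m W (map pull bs ! i) x (ts ! j)) = dt k (\<lambda>i j. differential n U (bs ! i) (p x) (map p ts ! j))"
    proof (rule dt_cong)
      fix i j assume ij: "i < k" "j < k"
      have "map pull bs ! i = pull (bs ! i)" "map p ts ! j = p (ts ! j)"
        using ij bs len by (simp_all add: tuples_length)
      then show "differential m W (map pull bs ! i) x (ts ! j) = differential n U (bs ! i) (p x) (map p ts ! j)"
        using differential_pull[OF tuples_nth[OF bs ij(1)] x tB[OF ij(2)]] tA[OF ij(2)] by simp
    qed
    have e1: "eval_form m k W (B.gen (pull a) (map pull bs)) x ts =
        pull a x * dt k (\<lambda>i j. differential m W (map pull bs ! i) x (ts ! j))"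
      by (rule B.eval_form_gen[OF x]) (rule tB pc[OF a] tuples_map[OF bs pc]; assumption?)+
    have e2: "eval_form n k U (A.gen a bs) (p x) (map p ts) =
        a (p x) * dt k (\<lambda>i j. differential n U (bs ! i) (p x) (map p ts ! j))"
      by (rule A.eval_form_gen[OF p_U[OF x]]) (rule tA a bs; assumption?)+
    show "eval_form m k W (\<Lambda>\<Omega>_map (simplex_sec n U) (simplex_sec m W) pull k (A.gen a bs)) x ts =
        eval_form n k U (A.gen a bs) (p x) (map p ts)"
      unfolding hom.\<Lambda>\<Omega>_map_gen[OF a bs] e1 e2 pa d ..
  qed
qed

end

section \<open>Restrictions and faces as coordinate maps\<close>

lemma restriction_pullback:
  assumes "simplex_open n U" "simplex_open n W" "W \<subseteq> U"
  shows "simplex_pullback n U n W (\<lambda>x. x)"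
proof (intro simplex_pullback.intro simplex_pullback_axioms.intro assms(1,2))
  show "smooth_on_open (Suc n) (euclid (Suc n)) (\<lambda>y. y l)" for l by (rule smooth_coord[OF openin_euclid])
  show "(\<Sum>i\<le>n. partial_deriv i (\<lambda>y. y l) x * v i) = v l" if "l \<le> n" for x v l
  proof -
    have "(\<Sum>i\<le>n. partial_deriv i (\<lambda>y. y l) x * v i) = (\<Sum>i\<le>n. if i = l then v i else 0)"
      by (intro sum.cong refl) (simp add: partial_deriv_coord)
    also have "\<dots> = v l" using that by simp
    finally show ?thesis .
  qed
qed (use assms(3) in auto)

lemma face_pullback:
  assumes U: "simplex_open (Suc m) U" and W: "simplex_open m W" and WU: "\<And>x. x \<in> W \<Longrightarrow> simplical_face i x \<in> U"
    and i: "i \<le> Suc m"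
  shows "simplex_pullback (Suc m) U m W (simplical_face i)"
proof (intro simplex_pullback.intro simplex_pullback_axioms.intro U W WU)
  have "(\<lambda>y. simplical_face i y l) = (if l < i then (\<lambda>y. y l) else if l = i then (\<lambda>y. 0) else (\<lambda>y. y (l - 1)))" for l
    by (auto simp: simplical_face_def fun_eq_iff)
  note eq = this
  show "smooth_on_open (Suc m) (euclid (Suc m)) (\<lambda>y. simplical_face i y l)" for l
    unfolding eq by (simp add: smooth_coord smooth_const openin_euclid)
  show "simplical_face i y \<in> euclid (Suc (Suc m))" if "y \<in> euclid (Suc m)" for y
    using that i by (auto simp: mem_euclid simplical_face_def)
  fix x v :: "nat \<Rightarrow> real" and l assume l: "l \<le> Suc m"
  consider "l < i" | "l = i" | "l > i" by linarith
  then show "(\<Sum>j\<le>m. partial_deriv j (\<lambda>y. simplical_face i y l) x * v j) = simplical_face i v l"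
  proof cases
    case 1
    then have "(\<Sum>j\<le>m. partial_deriv j (\<lambda>y. simplical_face i y l) x * v j) = (\<Sum>j\<le>m. if j = l then v j else 0)"
      unfolding eq by (intro sum.cong refl) (simp add: partial_deriv_coord)
    also have "\<dots> = v l" using 1 i by simp
    finally show ?thesis using 1 by (simp add: simplical_face_def)
  next
    case 2
    then show ?thesis unfolding eq by (simp add: partial_deriv_const simplical_face_def)
  next
    case 3
    then have "(\<Sum>j\<le>m. partial_deriv j (\<lambda>y. simplical_face i y l) x * v j) = (\<Sum>j\<le>m. if j = l - 1 then v j else 0)"
      unfolding eq by (intro sum.cong refl) (simp add: partial_deriv_coord)
    also have "\<dots> = v (l - 1)" using 3 l by simp
    finally show ?thesis using 3 by (simp add: simplical_face_def)
  qed
qed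

section \<open>The fundamental theorem of calculus on the simplex\<close>

interpretation lebesgue_product: product_sigma_finite "\<lambda>_::nat. lborel :: real measure"
  by unfold_locales

lemma compact_standard_simplex: "compact (standard_simplex k)"
  using compactin_standard_simplex[of k] by (simp add: euclidean_product_topology)

text \<open>The index set is an arbitrary set rather than \<open>{1..k}\<close>, because integrating
  out one coordinate leaves the others with a gap in their numbering.\<close>

definition chart :: "nat set \<Rightarrow> (nat \<Rightarrow> real) set" where
  "chart I = {z \<in> I \<rightarrow>\<^sub>E {0..}. (\<Sum>i\<in>I. z i) \<le> 1}"

lemma simplex_chart_domain_eq: "simplex_chart_domain k = chart {1..k}"
  by (simp add: simplex_chart_domain_def chart_def)

definition chart_integral :: "nat set \<Rightarrow> ((nat \<Rightarrow> real) \<Rightarrow> real) \<Rightarrow> real" where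
  "chart_integral I f = (\<integral>z. indicator (chart I) z * f z \<partial>(\<Pi>\<^sub>M i\<in>I. lborel))"

definition chart_integrable :: "nat set \<Rightarrow> ((nat \<Rightarrow> real) \<Rightarrow> real) \<Rightarrow> bool" where
  "chart_integrable I f \<longleftrightarrow> integrable (\<Pi>\<^sub>M i\<in>I. lborel) (\<lambda>z. indicator (chart I) z * f z)"

lemma chart_bound: "finite I \<Longrightarrow> z \<in> chart I \<Longrightarrow> i \<in> I \<Longrightarrow> z i \<le> 1"
  using member_le_sum[of i I z] by (force simp: chart_def PiE_iff)

lemma component_measurable:
  "i \<in> I \<Longrightarrow> (\<lambda>z. z i) \<in> borel_measurable (\<Pi>\<^sub>M i\<in>I. (lborel :: real measure))"
  using measurable_component_singleton[of i I "\<lambda>_. lborel :: real measure"] by simp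

lemma sets_chart: 
  assumes I: "finite I"
  shows "chart I \<in> sets (\<Pi>\<^sub>M i\<in>I. lborel)"
proof -
  have "chart I = {z \<in> space (\<Pi>\<^sub>M i\<in>I. lborel). (\<forall>i\<in>I. 0 \<le> z i) \<and> (\<Sum>i\<in>I. z i) \<le> 1}"
    by (auto simp: chart_def space_PiM PiE_iff)
  also have "\<dots> \<in> sets (\<Pi>\<^sub>M i\<in>I. lborel)"
  proof (rule sets.sets_Collect_conj)
    show "{z \<in> space (\<Pi>\<^sub>M i\<in>I. lborel). \<forall>i\<in>I. 0 \<le> z i} \<in> sets (\<Pi>\<^sub>M i\<in>I. (lborel :: real measure))"
      using I by (intro sets.sets_Collect_finite_All borel_measurable_le borel_measurable_const component_measurable)
    show "{z \<in> space (\<Pi>\<^sub>M i\<in>I. lborel). (\<Sum>i\<in>I. z i) \<le> 1} \<in> sets (\<Pi>\<^sub>M i\<in>I. (lborel :: real measure))"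
      by (intro borel_measurable_le borel_measurable_sum borel_measurable_const component_measurable)
  qed
  finally show ?thesis .
qed

lemma emeasure_chart_finite:
  assumes I: "finite I"
  shows "emeasure (\<Pi>\<^sub>M i\<in>I. lborel) (chart I) < \<infinity>"
proof -
  have "emeasure (\<Pi>\<^sub>M i\<in>I. lborel) (chart I) \<le> emeasure (\<Pi>\<^sub>M i\<in>I. lborel) (Pi\<^sub>E I (\<lambda>_. {0..1::real}))"
  proof (rule emeasure_mono)
    show "chart I \<subseteq> Pi\<^sub>E I (\<lambda>_. {0..1})"
    proof
      fix z assume z: "z \<in> chart I"
      then have "z \<in> I \<rightarrow>\<^sub>E {0..}" by (simp add: chart_def)
      then show "z \<in> Pi\<^sub>E I (\<lambda>_. {0..1})" using chart_bound[OF I z] by (simp add: PiE_iff)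
    qed
    show "Pi\<^sub>E I (\<lambda>_. {0..1::real}) \<in> sets (\<Pi>\<^sub>M i\<in>I. lborel)"
      using I by (intro sets_PiM_I_finite) auto
  qed
  also have "\<dots> = (\<Prod>i\<in>I. 1)" using I by (subst lebesgue_product.emeasure_PiM) auto
  finally show ?thesis by (simp add: order_le_less_trans)
qed

text \<open>\<open>f\<close> is controlled on the simplex only. Extended by zero it is Borel
  measurable, as the simplex is closed, and bounded, as the simplex is compact; the chart has finite
  measure.\<close>

lemma chart_integrableI:
  assumes I: "finite I" and q: "\<And>i. (\<lambda>z. q z i) \<in> borel_measurable (\<Pi>\<^sub>M i\<in>I. lborel)"
    and qK: "\<And>z. z \<in> chart I \<Longrightarrow> q z \<in> standard_simplex k"
    and f: "continuous_on (standard_simplex k) f"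
  shows "chart_integrable I (\<lambda>z. f (q z))"
proof -
  let ?K = "standard_simplex k"
  let ?f = "\<lambda>x. indicator ?K x *\<^sub>R f x"
  have "closed ?K" by (rule compact_imp_closed[OF compact_standard_simplex])
  then have "?f \<in> borel_measurable borel"
    by (intro borel_measurable_continuous_on_indicator f) simp
  from measurable_compose[OF measurable_coordinatewise_then_product[OF q] this]
  have m: "(\<lambda>z. ?f (q z)) \<in> borel_measurable (\<Pi>\<^sub>M i\<in>I. lborel)" .
  have "bounded (f ` ?K)"
    by (intro compact_imp_bounded compact_continuous_image f compact_standard_simplex)
  then obtain B where B: "\<And>x. x \<in> ?K \<Longrightarrow> norm (f x) \<le> B" unfolding bounded_iff by blast
  have "integrable (\<Pi>\<^sub>M i\<in>I. lborel) (\<lambda>z. indicator (chart I) z *\<^sub>R ?f (q z))"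
    by (rule integrableI_bounded_set_indicator[OF sets_chart[OF I] m emeasure_chart_finite[OF I], of B])
       (intro AE_I2 impI, simp add: B[unfolded real_norm_def] qK)
  moreover have "(\<lambda>z. indicator (chart I) z *\<^sub>R ?f (q z)) = (\<lambda>z. indicator (chart I) z * f (q z))"
    using qK by (auto simp: fun_eq_iff indicator_def)
  ultimately show ?thesis unfolding chart_integrable_def by (simp only:)
qed

lemma chart_integral_cong:
  "(\<And>z. z \<in> chart I \<Longrightarrow> f z = g z) \<Longrightarrow> chart_integral I f = chart_integral I g"
  unfolding chart_integral_def by (rule Bochner_Integration.integral_cong) (auto simp: indicator_def)

lemma chart_integral_diff:
  "chart_integrable I f \<Longrightarrow> chart_integrable I g \<Longrightarrow>
    chart_integral I (\<lambda>z. f z - g z) = chart_integral I f - chart_integral I g"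
  unfolding chart_integral_def chart_integrable_def
  by (simp add: right_diff_distrib)

lemma chart_insert:
  assumes I: "finite I" "j \<notin> I" and z: "z \<in> I \<rightarrow>\<^sub>E UNIV"
  shows "z(j := t) \<in> chart (insert j I) \<longleftrightarrow> z \<in> chart I \<and> t \<in> {0..1 - (\<Sum>i\<in>I. z i)}"
proof -
  have "(\<Sum>i\<in>I. (z(j := t)) i) = (\<Sum>i\<in>I. z i)"
    by (rule sum.cong) (use I in auto)
  then have s: "(\<Sum>i\<in>insert j I. (z(j := t)) i) = t + (\<Sum>i\<in>I. z i)" using I by simp
  have "z(j := t) \<in> insert j I \<rightarrow>\<^sub>E {0..} \<longleftrightarrow> z \<in> I \<rightarrow>\<^sub>E {0..} \<and> 0 \<le> t"
    using z I by (auto simp: PiE_iff extensional_def)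
  then show ?thesis unfolding chart_def mem_Collect_eq s by auto
qed

text \<open>Fubini's theorem; the fibre of the larger chart over a point of the smaller one is the
  interval that the coordinates already fixed leave for coordinate \<open>j\<close>.\<close>

lemma chart_integral_insert:
  assumes I: "finite I" "j \<notin> I" and f: "chart_integrable (insert j I) f"
  shows "chart_integral (insert j I) f =
    chart_integral I (\<lambda>z. \<integral>t. indicator {0..1 - (\<Sum>i\<in>I. z i)} t * f (z(j := t)) \<partial>lborel)"
proof -
  have "chart_integral (insert j I) f =
      (\<integral>z. (\<integral>t. indicator (chart (insert j I)) (z(j := t)) * f (z(j := t)) \<partial>lborel) \<partial>(\<Pi>\<^sub>M i\<in>I. lborel))"
    unfolding chart_integral_def
    by (rule lebesgue_product.product_integral_insert[OF I f[unfolded chart_integrable_def]])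
  also have "\<dots> = chart_integral I (\<lambda>z. \<integral>t. indicator {0..1 - (\<Sum>i\<in>I. z i)} t * f (z(j := t)) \<partial>lborel)"
    unfolding chart_integral_def
  proof (rule Bochner_Integration.integral_cong[OF refl])
    fix z assume "z \<in> space (\<Pi>\<^sub>M i\<in>I. (lborel :: real measure))"
    then have z: "z \<in> I \<rightarrow>\<^sub>E UNIV" by (simp add: space_PiM)
    have ind: "indicator (chart (insert j I)) (z(j := t)) =
        (indicator (chart I) z * indicator {0..1 - (\<Sum>i\<in>I. z i)} t :: real)" for t
      using chart_insert[OF I z, of t] by (simp add: indicator_def)
    show "(\<integral>t. indicator (chart (insert j I)) (z(j := t)) * f (z(j := t)) \<partial>lborel) =
        indicator (chart I) z * (\<integral>t. indicator {0..1 - (\<Sum>i\<in>I. z i)} t * f (z(j := t)) \<partial>lborel)"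
      unfolding ind mult.assoc by (rule integral_mult_right_zero)
  qed
  finally show ?thesis .
qed

text \<open>Over a point \<open>z\<close> of the chart of \<open>L\<close>, both integrals run over
  the same interval from 0 to \<open>s = 1 - (\<Sum>i\<in>L. z i)\<close>, and the substitution
  \<open>t \<mapsto> s - t\<close> exchanges them. By the last assumption \<open>g\<close> sees the
  coordinates outside \<open>L\<close> only through its second argument.\<close>

lemma chart_integral_reflect:
  assumes L: "finite L" "a \<notin> L" "b \<notin> L"
    and g: "chart_integrable (insert a L) (\<lambda>z. g z (z a))"
      "chart_integrable (insert b L) (\<lambda>z. g z (1 - (\<Sum>i\<in>L. z i) - z b))"
    and gL: "\<And>z c t r. c \<notin> L \<Longrightarrow> g (z(c := t)) r = g z r"
  shows "chart_integral (insert a L) (\<lambda>z. g z (z a)) =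
    chart_integral (insert b L) (\<lambda>z. g z (1 - (\<Sum>i\<in>L. z i) - z b))"
  unfolding chart_integral_insert[OF L(1,2) g(1)] chart_integral_insert[OF L(1,3) g(2)]
proof (rule chart_integral_cong)
  fix z :: "nat \<Rightarrow> real"
  have sL: "(\<Sum>i\<in>L. (z(b := t)) i) = (\<Sum>i\<in>L. z i)" for t
    by (rule sum.cong) (use L in auto)
  define s where "s = 1 - (\<Sum>i\<in>L. z i)"
  have "(\<integral>t. indicator {0..s} t * g z t \<partial>lborel) = (\<integral>t. indicator {0..s} (s + (-1) * t) * g z (s + (-1) * t) \<partial>lborel)"
    by (subst lborel_integral_real_affine[where c = "-1" and t = s]) simp_all
  also have "\<dots> = (\<integral>t. indicator {0..s} t * g z (s - t) \<partial>lborel)"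
    by (rule Bochner_Integration.integral_cong) (auto simp: indicator_def)
  finally show "(\<integral>t. indicator {0..1 - sum z L} t * g (z(a := t)) ((z(a := t)) a) \<partial>lborel) =
    (\<integral>t. indicator {0..1 - sum z L} t * g (z(b := t)) (1 - sum (z(b := t)) L - (z(b := t)) b) \<partial>lborel)"
    unfolding sL gL[OF L(2)] gL[OF L(3)] fun_upd_same s_def .
qed

text \<open>All factors carry the same measure, so renaming coordinates along a bijection preserves
  the product measure, as is checked on boxes. The inequalities of the chart are symmetric in the
  coordinates.\<close>

lemma chart_integral_reindex:
  assumes I: "finite I" and \<theta>: "bij_betw \<theta> I J" and f: "chart_integrable I f"
  shows "chart_integral I f = chart_integral J (\<lambda>y. f (\<lambda>i\<in>I. y (\<theta> i)))"
proof -
  have J: "finite J" using \<theta> I bij_betw_finite by blast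
  let ?T = "\<lambda>y. \<lambda>i\<in>I. y (\<theta> i)"
  let ?M = "\<lambda>I. Pi\<^sub>M I (\<lambda>_::nat. lborel :: real measure)"
  have \<theta>J: "\<theta> i \<in> J" if "i \<in> I" for i using \<theta> that by (auto simp: bij_betw_def)
  have T: "?T \<in> ?M J \<rightarrow>\<^sub>M ?M I"
    by (rule measurable_restrict) (rule measurable_component_singleton[OF \<theta>J])
  have D: "distr (?M J) (?M I) ?T = ?M I"
  proof (rule lebesgue_product.PiM_eqI[OF I])
    fix A :: "nat \<Rightarrow> real set" assume A: "\<And>i. i \<in> I \<Longrightarrow> A i \<in> sets lborel"
    let ?\<eta> = "the_inv_into I \<theta>"
    have inj: "inj_on \<theta> I" using \<theta> by (auto simp: bij_betw_def)
    have \<eta>: "?\<eta> (\<theta> i) = i" if "i \<in> I" for i by (rule the_inv_into_f_f[OF inj that])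
    have J': "J = \<theta> ` I" using \<theta> by (auto simp: bij_betw_def)
    have vim: "?T -` Pi\<^sub>E I A \<inter> space (?M J) = Pi\<^sub>E J (\<lambda>j. A (?\<eta> j))"
      unfolding space_PiM J' by (auto simp: PiE_iff \<eta>)
    have "emeasure (distr (?M J) (?M I) ?T) (Pi\<^sub>E I A) = emeasure (?M J) (Pi\<^sub>E J (\<lambda>j. A (?\<eta> j)))"
      unfolding vim[symmetric] by (rule emeasure_distr[OF T sets_PiM_I_finite[OF I A]])
    also have "\<dots> = (\<Prod>j\<in>J. emeasure lborel (A (?\<eta> j)))"
      by (rule lebesgue_product.emeasure_PiM[OF J]) (use A in \<open>auto simp: J' \<eta>\<close>)
    also have "\<dots> = (\<Prod>i\<in>I. emeasure lborel (A i))"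
      unfolding prod.reindex_bij_betw[OF \<theta>, symmetric] by (rule prod.cong) (simp_all add: \<eta>)
    finally show "emeasure (distr (?M J) (?M I) ?T) (Pi\<^sub>E I A) = (\<Prod>i\<in>I. emeasure lborel (A i))" .
  qed simp
  have ind: "indicator (chart I) (?T y) = (indicator (chart J) y :: real)" if y: "y \<in> space (?M J)" for y
  proof -
    have "(\<Sum>i\<in>I. ?T y i) = (\<Sum>i\<in>I. y (\<theta> i))" by (rule sum.cong) auto
    then have "(\<Sum>i\<in>I. ?T y i) = (\<Sum>j\<in>J. y j)"
      by (simp only: sum.reindex_bij_betw[OF \<theta>])
    moreover have "?T y \<in> I \<rightarrow>\<^sub>E {0..} \<longleftrightarrow> y \<in> J \<rightarrow>\<^sub>E {0..}"
      using y \<theta> by (auto simp: space_PiM PiE_iff bij_betw_def)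
    ultimately have "?T y \<in> chart I \<longleftrightarrow> y \<in> chart J"
      unfolding chart_def mem_Collect_eq by presburger
    then show ?thesis by (simp only: indicator_def)
  qed
  have "chart_integral I f = integral\<^sup>L (distr (?M J) (?M I) ?T) (\<lambda>z. indicator (chart I) z * f z)"
    unfolding D chart_integral_def ..
  also have "\<dots> = (\<integral>y. indicator (chart I) (?T y) * f (?T y) \<partial>?M J)"
    by (rule integral_distr[OF T]) (use f in \<open>simp add: chart_integrable_def\<close>)
  also have "\<dots> = chart_integral J (\<lambda>y. f (?T y))"
    unfolding chart_integral_def by (rule Bochner_Integration.integral_cong) (simp_all only: ind)
  finally show ?thesis .
qed

section \<open>Varying one coordinate of the simplex\<close>

lemma sum_fun_upd_remove:
  fixes z :: "nat \<Rightarrow> real"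
  assumes "j \<in> K" "finite K"
  shows "(\<Sum>i\<in>K. (z(j := t)) i) = t + (\<Sum>i\<in>K - {j}. z i)"
proof -
  have "(\<Sum>i\<in>K - {j}. (z(j := t)) i) = (\<Sum>i\<in>K - {j}. z i)" by (rule sum.cong) auto
  then show ?thesis using assms by (simp add: sum.remove[where x = j])
qed

lemma simplex_param_upd:
  assumes j: "j \<in> {1..k}"
  shows "simplex_param k (z(j := t)) =
    (\<lambda>i. if i = 0 then 1 - (t + (\<Sum>i\<in>{1..k} - {j}. z i)) else if i = j then t else if i \<le> k then z i else 0)"
  unfolding simplex_param_def sum_fun_upd_remove[OF j finite_atLeastAtMost] using j by (auto simp: fun_eq_iff)

lemma simplex_param_simplex:
  assumes z: "z \<in> chart {1..k}"
  shows "simplex_param k z \<in> standard_simplex k"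
proof -
  have 0: "0 \<le> z i" if "i \<in> {1..k}" for i using z that by (auto simp: chart_def)
  then have s: "0 \<le> (\<Sum>i=1..k. z i)" by (rule sum_nonneg)
  have "(\<Sum>i=1..k. simplex_param k z i) = (\<Sum>i=1..k. z i)"
    by (rule sum.cong) (auto simp: simplex_param_def)
  then have "(\<Sum>i\<le>k. simplex_param k z i) = 1"
    by (simp add: atMost_atLeast0 sum.atLeast_Suc_atMost[of 0] simplex_param_def)
  moreover have "0 \<le> simplex_param k z i \<and> simplex_param k z i \<le> 1" for i
    using z s 0 chart_bound[OF _ z, of i] by (auto simp: simplex_param_def chart_def)
  ultimately show ?thesis by (simp add: standard_simplex_def simplex_param_def)
qed

lemma chart_upd:
  assumes j: "j \<in> {1..k}" and z: "z \<in> chart ({1..k} - {j})" and t: "t \<in> {0..1 - (\<Sum>i\<in>{1..k} - {j}. z i)}"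
  shows "simplex_param k (z(j := t)) \<in> standard_simplex k"
proof (rule simplex_param_simplex)
  have "insert j ({1..k} - {j}) = {1..k}" using j by auto
  moreover have "z \<in> ({1..k} - {j}) \<rightarrow>\<^sub>E UNIV" using z by (auto simp: chart_def)
  ultimately show "z(j := t) \<in> chart {1..k}"
    using chart_insert[of "{1..k} - {j}" j z t] z t by simp
qed

lemma chart_slack_nonneg: "z \<in> chart I \<Longrightarrow> 0 \<le> 1 - (\<Sum>i\<in>I. z i)"
  by (simp add: chart_def)

lemma integrable_param:
  assumes f: "continuous_on (standard_simplex k) f"
  shows "chart_integrable {1..k} (\<lambda>z. f (simplex_param k z))"
proof (rule chart_integrableI[OF _ _ simplex_param_simplex f])
  show "(\<lambda>z. simplex_param k z i) \<in> borel_measurable (\<Pi>\<^sub>M i\<in>{1..k}. lborel)" for i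
  proof -
    consider "i = 0" | "i \<in> {1..k}" | "i > k" by fastforce
    then show ?thesis
      by cases (auto simp: simplex_param_def
          intro!: borel_measurable_diff borel_measurable_sum borel_measurable_const component_measurable)
  qed
qed simp

lemma integrable_param_upd:
  assumes f: "continuous_on (standard_simplex k) f" and j: "j \<in> {1..k}"
    and c: "c \<in> borel_measurable (\<Pi>\<^sub>M i\<in>{1..k} - {j}. lborel)"
    and c01: "\<And>z. z \<in> chart ({1..k} - {j}) \<Longrightarrow> c z \<in> {0..1 - (\<Sum>i\<in>{1..k} - {j}. z i)}"
  shows "chart_integrable ({1..k} - {j}) (\<lambda>z. f (simplex_param k (z(j := c z))))"
proof (rule chart_integrableI[OF _ _ chart_upd[OF j _ c01] f])
  show "(\<lambda>z. simplex_param k (z(j := c z)) i) \<in> borel_measurable (\<Pi>\<^sub>M i\<in>{1..k} - {j}. lborel)" for i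
  proof -
    consider "i = 0" | "i = j" "i \<noteq> 0" | "i \<in> {1..k} - {j}" | "i > k" "i \<noteq> j" using j by fastforce
    then show ?thesis
      unfolding simplex_param_upd[OF j]
      using c by cases (auto simp del: One_nat_def
          intro!: borel_measurable_diff borel_measurable_add borel_measurable_sum borel_measurable_const component_measurable)
  qed
qed simp_all

lemma slack_measurable: "(\<lambda>z. 1 - (\<Sum>i\<in>I. z i)) \<in> borel_measurable (\<Pi>\<^sub>M i\<in>I. (lborel :: real measure))"
  by (intro borel_measurable_diff borel_measurable_sum borel_measurable_const component_measurable)

text \<open>Increasing coordinate \<open>j\<close> lowers \<open>x_0\<close> by the same amount, so
  the fibre is a segment in direction \<open>coord_vector j\<close> and the fundamental theorem
  applies on it. The derivative is taken within a set because the ends of the segment lie on the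
  boundary of the simplex.\<close>

lemma integral_along_coordinate:
  assumes j: "j \<in> {1..k}" and z: "z \<in> chart ({1..k} - {j})"
    and D: "continuous_on (standard_simplex k) D"
    and der: "\<And>x t\<^sub>0 A. t\<^sub>0 \<in> A \<Longrightarrow> (\<And>t. t \<in> A \<Longrightarrow> (\<lambda>i. x i + t * coord_vector j i) \<in> standard_simplex k) \<Longrightarrow>
      ((\<lambda>t. h (\<lambda>i. x i + t * coord_vector j i)) has_real_derivative D (\<lambda>i. x i + t\<^sub>0 * coord_vector j i)) (at t\<^sub>0 within A)"
  defines "s \<equiv> 1 - (\<Sum>i\<in>{1..k} - {j}. z i)"
  shows "(\<integral>t. indicator {0..s} t * D (simplex_param k (z(j := t))) \<partial>lborel) =
    h (simplex_param k (z(j := s))) - h (simplex_param k (z(j := 0)))"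
proof -
  define x where "x = simplex_param k (z(j := 0))"
  have line: "simplex_param k (z(j := t)) = (\<lambda>i. x i + t * coord_vector j i)" for t
    unfolding x_def simplex_param_upd[OF j] using j by (auto simp: coord_vector_def fun_eq_iff)
  have mem: "(\<lambda>i. x i + t * coord_vector j i) \<in> standard_simplex k" if "t \<in> {0..s}" for t
    using chart_upd[OF j z that[unfolded s_def]] unfolding line .
  have "(\<integral>t. indicator {0..s} t *\<^sub>R D (\<lambda>i. x i + t * coord_vector j i) \<partial>lborel) =
      h (\<lambda>i. x i + s * coord_vector j i) - h (\<lambda>i. x i + 0 * coord_vector j i)"
  proof (rule integral_FTC_Icc)
    show "0 \<le> s" unfolding s_def by (rule chart_slack_nonneg[OF z])
    show "((\<lambda>t. h (\<lambda>i. x i + t * coord_vector j i)) has_vector_derivative D (\<lambda>i. x i + t * coord_vector j i)) (at t within {0..s})"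
      if "0 \<le> t" "t \<le> s" for t
      unfolding has_real_derivative_iff_has_vector_derivative[symmetric] by (rule der[OF _ mem]) (use that in simp_all)
    have "continuous_on {0..s} (\<lambda>t i. x i + t * coord_vector j i)"
      by (rule continuous_on_coordinatewise_then_product) (intro continuous_intros)
    then show "continuous_on {0..s} (\<lambda>t. D (\<lambda>i. x i + t * coord_vector j i))"
      by (rule continuous_on_compose2[OF D]) (use mem in blast)
  qed
  then show ?thesis unfolding line by simp
qed

section \<open>The ends of the fibres as faces\<close>

lemma bij_betw_remove_index:
  assumes "j \<in> {1..Suc m}"
  shows "bij_betw (\<lambda>i. if i < j then i else i - 1) ({1..Suc m} - {j}) {1..m}"
  by (rule bij_betwI[where g = "\<lambda>i. if i < j then i else Suc i"]) (use assms in \<open>auto split: if_splits\<close>)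

text \<open>Closing the gap at \<open>j\<close> makes the coordinates those of the standard chart of
  a face. The premise of \<open>face\<close> says that renaming keeps their sum, from which
  \<open>x_0\<close> or the dependent coordinate is computed.\<close>

lemma reindexed_face:
  assumes j: "j \<in> {1..Suc m}" and h: "chart_integrable ({1..Suc m} - {j}) h"
    and face: "\<And>y. (\<Sum>i\<in>{1..Suc m} - {j}. y (if i < j then i else i - 1)) = (\<Sum>i=1..m. y i) \<Longrightarrow>
      h (\<lambda>i\<in>{1..Suc m} - {j}. y (if i < j then i else i - 1)) = g y"
  shows "chart_integral ({1..Suc m} - {j}) h = chart_integral {1..m} g"
proof -
  have "chart_integral ({1..Suc m} - {j}) h =
      chart_integral {1..m} (\<lambda>y. h (\<lambda>i\<in>{1..Suc m} - {j}. y (if i < j then i else i - 1)))"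
    by (rule chart_integral_reindex[OF _ bij_betw_remove_index[OF j] h]) simp
  also have "\<dots> = chart_integral {1..m} g"
    by (rule chart_integral_cong, rule face, rule sum.reindex_bij_betw[OF bij_betw_remove_index[OF j]])
  finally show ?thesis .
qed

text \<open>
  For \<open>j \<noteq> 1\<close> the affine involution of the face \<open>x\<^sub>0 = 0\<close> that exchanges the roles of \<open>x\<^sub>1\<close> and \<open>x\<^sub>j\<close>
  as the dependent coordinate is a reflection of a line, hence preserves the measure.
\<close>

lemma top_face_index:
  assumes j: "j \<in> {1..Suc m}" and h: "continuous_on (standard_simplex (Suc m)) h"
  defines "T \<equiv> \<lambda>j. chart_integral ({1..Suc m} - {j}) (\<lambda>z. h (simplex_param (Suc m) (z(j := 1 - (\<Sum>i\<in>{1..Suc m} - {j}. z i)))))"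
  shows "T j = T 1"
proof (cases "j = 1")
  case False
  define L where "L = {1..Suc m} - {1, j}"
  have L: "finite L" "1 \<notin> L" "j \<notin> L" by (auto simp: L_def)
  have Ij: "{1..Suc m} - {j} = insert 1 L" and I1: "{1..Suc m} - {1} = insert j L"
    using j False by (auto simp: L_def)
  \<comment> \<open>A point of the face \<open>x_0 = 0\<close> in terms of the coordinates in
    \<open>L\<close> and the value \<open>r\<close> of \<open>x_1\<close>, with \<open>x_j\<close>
    dependent. In the chart without \<open>j\<close>, \<open>r\<close> is a coordinate; in the chart
    without 1 it is the remaining mass after \<open>x_j\<close>.\<close>
  define g where "g = (\<lambda>z r. h (\<lambda>i::nat. if i = 0 then 0 else if i = 1 then r else if i = j then 1 - (\<Sum>i\<in>L. z i) - r
    else if i \<le> Suc m then z i else 0))"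
  have int: "chart_integrable ({1..Suc m} - {l}) (\<lambda>z. h (simplex_param (Suc m) (z(l := 1 - (\<Sum>i\<in>{1..Suc m} - {l}. z i)))))"
    if "l \<in> {1..Suc m}" for l
    by (rule integrable_param_upd[OF h that slack_measurable]) (use chart_slack_nonneg in simp)
  have gj: "(\<lambda>z. h (simplex_param (Suc m) (z(j := 1 - (\<Sum>i\<in>{1..Suc m} - {j}. z i))))) = (\<lambda>z. g z (z 1))"
    unfolding simplex_param_upd[OF j] g_def Ij
    using L False j by (auto simp: fun_eq_iff intro!: arg_cong[where f = h])
  have one: "1 \<in> {1..Suc m}" by simp
  have g1: "(\<lambda>z. h (simplex_param (Suc m) (z(1 := 1 - (\<Sum>i\<in>{1..Suc m} - {1}. z i))))) = (\<lambda>z. g z (1 - (\<Sum>i\<in>L. z i) - z j))"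
    unfolding simplex_param_upd[OF one] g_def I1
    using L False j by (auto simp: fun_eq_iff intro!: arg_cong[where f = h])
  have gL: "g (z(c := t)) r = g z r" if c: "c \<notin> L" for z c t r
  proof -
    have "(\<Sum>i\<in>L. (z(c := t)) i) = (\<Sum>i\<in>L. z i)" by (rule sum.cong) (use c in auto)
    then show ?thesis unfolding g_def using c by (intro arg_cong[where f = h]) (auto simp: fun_eq_iff L_def)
  qed
  show ?thesis
    unfolding T_def gj g1 unfolding Ij I1
    by (rule chart_integral_reflect[where g = g, OF L int[OF j, unfolded gj, unfolded Ij] int[OF one, unfolded g1, unfolded I1] gL])
qed simp

text \<open>Fubini splits off coordinate \<open>j\<close>, and the fundamental theorem leaves the
  values at the two ends of each fibre: \<open>x_j = 0\<close>, which is the face \<open>j\<close>,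
  and \<open>x_0 = 0\<close>, which is the face 0. The second end appears in the coordinates other
  than \<open>j\<close>, whereas the standard chart of the face 0 uses those other than 1;
  \<open>top_face_index\<close> identifies the two integrals.\<close>

theorem simplex_integral_coordinate_derivative:
  assumes j: "j \<in> {1..Suc m}" and h: "continuous_on (standard_simplex (Suc m)) h"
    and D: "continuous_on (standard_simplex (Suc m)) D"
    and der: "\<And>x t\<^sub>0 A. t\<^sub>0 \<in> A \<Longrightarrow> (\<And>t. t \<in> A \<Longrightarrow> (\<lambda>i. x i + t * coord_vector j i) \<in> standard_simplex (Suc m)) \<Longrightarrow>
      ((\<lambda>t. h (\<lambda>i. x i + t * coord_vector j i)) has_real_derivative D (\<lambda>i. x i + t\<^sub>0 * coord_vector j i)) (at t\<^sub>0 within A)"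
  shows "chart_integral {1..Suc m} (\<lambda>z. D (simplex_param (Suc m) z)) =
    chart_integral {1..m} (\<lambda>y. h (simplical_face 0 (simplex_param m y))) -
    chart_integral {1..m} (\<lambda>y. h (simplical_face j (simplex_param m y)))"
proof -
  let ?I = "\<lambda>j. {1..Suc m} - {j}" and ?P = "simplex_param (Suc m)"
  let ?top = "\<lambda>j z. h (?P (z(j := 1 - (\<Sum>i\<in>?I j. z i))))"
  have I: "insert j (?I j) = {1..Suc m}" using j by auto
  have int: "chart_integrable (?I l) (?top l)" if "l \<in> {1..Suc m}" for l
    by (rule integrable_param_upd[OF h that slack_measurable]) (use chart_slack_nonneg in simp)
  have int0: "chart_integrable (?I j) (\<lambda>z. h (?P (z(j := 0))))"
    by (rule integrable_param_upd[OF h j borel_measurable_const]) (use chart_slack_nonneg in simp)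
  have "chart_integral {1..Suc m} (\<lambda>z. D (?P z)) =
      chart_integral (?I j) (\<lambda>z. \<integral>t. indicator {0..1 - (\<Sum>i\<in>?I j. z i)} t * D (?P (z(j := t))) \<partial>lborel)"
    by (rule chart_integral_insert[of "?I j" j "\<lambda>z. D (?P z)", unfolded I]) (simp_all add: integrable_param[OF D] del: One_nat_def)
  also have "\<dots> = chart_integral (?I j) (\<lambda>z. ?top j z - h (?P (z(j := 0))))"
    by (rule chart_integral_cong, rule integral_along_coordinate[OF j _ D der])
  also have "\<dots> = chart_integral (?I j) (?top j) - chart_integral (?I j) (\<lambda>z. h (?P (z(j := 0))))"
    by (rule chart_integral_diff[OF int[OF j] int0])
  also have "chart_integral (?I j) (?top j) = chart_integral (?I 1) (?top 1)"
    by (rule top_face_index[OF j h])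
  also have "\<dots> = chart_integral {1..m} (\<lambda>y. h (simplical_face 0 (simplex_param m y)))"
  proof (rule reindexed_face[OF _ int])
    show one: "1 \<in> {1..Suc m}" "1 \<in> {1..Suc m}" by simp_all
    fix y :: "nat \<Rightarrow> real"
    let ?z = "\<lambda>i\<in>?I 1. y (if i < 1 then i else i - 1)"
    assume s: "(\<Sum>i\<in>?I 1. y (if i < 1 then i else i - 1)) = (\<Sum>i=1..m. y i)"
    have "(\<Sum>i\<in>?I 1. ?z i) = (\<Sum>i\<in>?I 1. y (if i < 1 then i else i - 1))" by (rule sum.cong) auto
    then have s': "(\<Sum>i\<in>?I 1. ?z i) = (\<Sum>i=1..m. y i)" using s by (simp only:)
    show "?top 1 ?z = h (simplical_face 0 (simplex_param m y))"
      unfolding simplex_param_upd[OF one(1)] s'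
      by (rule arg_cong[where f = h]) (auto simp: fun_eq_iff simplical_face_def simplex_param_def)
  qed
  also have "chart_integral (?I j) (\<lambda>z. h (?P (z(j := 0)))) =
      chart_integral {1..m} (\<lambda>y. h (simplical_face j (simplex_param m y)))"
  proof (rule reindexed_face[OF j int0])
    fix y :: "nat \<Rightarrow> real"
    let ?z = "\<lambda>i\<in>?I j. y (if i < j then i else i - 1)"
    assume s: "(\<Sum>i\<in>?I j. y (if i < j then i else i - 1)) = (\<Sum>i=1..m. y i)"
    have "(\<Sum>i\<in>?I j. ?z i) = (\<Sum>i\<in>?I j. y (if i < j then i else i - 1))" by (rule sum.cong) auto
    then have s': "(\<Sum>i\<in>?I j. ?z i) = (\<Sum>i=1..m. y i)" using s by (simp only:)
    show "h (?P (?z(j := 0))) = h (simplical_face j (simplex_param m y))"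
      unfolding simplex_param_upd[OF j] s'
      by (rule arg_cong[where f = h]) (use j in \<open>auto simp: fun_eq_iff simplical_face_def simplex_param_def\<close>)
  qed
  finally show ?thesis .
qed

section \<open>Directional derivatives\<close>

lemma smooth_sum:
  assumes "openin (Euclidean_space n) V" "\<And>i. i \<in> I \<Longrightarrow> smooth_on_open n V (f i)"
  shows "smooth_on_open n V (\<lambda>x. \<Sum>i\<in>I. f i x)"
  unfolding smooth_on_open_iff
  by (intro conjI allI assms(1) Ck_sum[OF assms(1)]) (use assms(2) in \<open>simp add: smooth_on_open_iff\<close>)

lemma smooth_prod:
  assumes V: "openin (Euclidean_space n) V"
  shows "(\<And>i. i \<in> I \<Longrightarrow> smooth_on_open n V (f i)) \<Longrightarrow> smooth_on_open n V (\<lambda>x. \<Prod>i\<in>I. f i x)"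
  by (induction I rule: infinite_finite_induct) (simp_all add: smooth_const[OF V] smooth_mult)

lemma smooth_cmult: "smooth_on_open n V f \<Longrightarrow> smooth_on_open n V (\<lambda>x. c * f x)"
  by (rule smooth_mult[OF smooth_const]) (simp_all add: smooth_on_open_def)

lemma smooth_dt:
  assumes V: "openin (Euclidean_space n) V"
    and A: "\<And>i j. i < k \<Longrightarrow> j < k \<Longrightarrow> smooth_on_open n V (\<lambda>x. A x i j)"
  shows "smooth_on_open n V (\<lambda>x. dt k (A x))"
  unfolding dt_def
  by (intro smooth_sum[OF V] smooth_cmult smooth_prod[OF V] A) (simp_all add: permutes_lessThan)

definition dirderiv :: "nat \<Rightarrow> (nat \<Rightarrow> real) \<Rightarrow> ((nat \<Rightarrow> real) \<Rightarrow> real) \<Rightarrow> (nat \<Rightarrow> real) \<Rightarrow> real" where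
  "dirderiv n v f x = (\<Sum>r<n. partial_deriv r f x * v r)"

lemma smooth_dirderiv:
  assumes "smooth_on_open n V f"
  shows "smooth_on_open n V (dirderiv n v f)"
proof -
  have V: "openin (Euclidean_space n) V" using assms by (simp add: smooth_on_open_def)
  show ?thesis
    unfolding dirderiv_def
    by (intro smooth_sum[OF V] smooth_mult smooth_const[OF V] smooth_partial[OF assms]) simp
qed

lemma dirderiv_line:
  assumes "smooth_on_open n V f" "(\<lambda>i. x i + t\<^sub>0 * v i) \<in> V" "x \<in> euclid n" "v \<in> euclid n"
  shows "((\<lambda>t. f (\<lambda>i. x i + t * v i)) has_real_derivative dirderiv n v f (\<lambda>i. x i + t\<^sub>0 * v i)) (at t\<^sub>0)"
  unfolding dirderiv_def
proof (rule smooth_chain_path[where c = "\<lambda>t i. x i + t * v i", OF assms(1,2)])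
  show "(\<lambda>i. x i + t * v i) \<in> euclid n" for t using assms(3,4) by (simp add: mem_euclid)
  show "((\<lambda>t. x i + t * v i) has_real_derivative v i) (at t\<^sub>0)" for i
    by (auto intro!: derivative_eq_intros)
qed

lemma dirderivI:
  assumes "smooth_on_open n V f" "x \<in> V" "v \<in> euclid n"
    and "((\<lambda>t. f (\<lambda>i. x i + t * v i)) has_real_derivative D) (at 0)"
  shows "dirderiv n v f x = D"
proof -
  have "x \<in> euclid n" using assms(1,2) openin_euclid_subset unfolding smooth_on_open_def by blast
  then have "((\<lambda>t. f (\<lambda>i. x i + t * v i)) has_real_derivative dirderiv n v f x) (at 0)"
    using dirderiv_line[OF assms(1), of x 0 v] assms(2,3) by simp
  then show ?thesis by (rule DERIV_unique[OF _ assms(4)])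
qed

text \<open>The directions are constant, so no derivatives of \<open>u\<close> or \<open>v\<close>
  arise and the statement is the symmetry of second partial derivatives.\<close>

lemma dirderiv_commute:
  assumes f: "smooth_on_open n V f" and x: "x \<in> V" and uv: "u \<in> euclid n" "v \<in> euclid n"
  shows "dirderiv n u (dirderiv n v f) x = dirderiv n v (dirderiv n u f) x"
proof -
  have D: "dirderiv n u (dirderiv n v f) x = (\<Sum>r<n. \<Sum>s<n. partial_deriv s (partial_deriv r f) x * u s * v r)"
    if uv: "u \<in> euclid n" "v \<in> euclid n" for u v
  proof (rule dirderivI[OF smooth_dirderiv[OF f] x uv(1)])
    have xe: "x \<in> euclid n" using f x openin_euclid_subset unfolding smooth_on_open_def by blast
    have "((\<lambda>t. partial_deriv r f (\<lambda>i. x i + t * u i)) has_real_derivative dirderiv n u (partial_deriv r f) x) (at 0)"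
      if "r < n" for r
      using dirderiv_line[OF smooth_partial[OF f that], of x 0 u] x xe uv(1) by simp
    then have "((\<lambda>t. \<Sum>r<n. partial_deriv r f (\<lambda>i. x i + t * u i) * v r) has_real_derivative
        (\<Sum>r<n. dirderiv n u (partial_deriv r f) x * v r)) (at 0)"
      by (intro DERIV_sum DERIV_cmult_right) simp
    then show "((\<lambda>t. dirderiv n v f (\<lambda>i. x i + t * u i)) has_real_derivative
        (\<Sum>r<n. \<Sum>s<n. partial_deriv s (partial_deriv r f) x * u s * v r)) (at 0)"
      unfolding dirderiv_def by (simp only: sum_distrib_right)
  qed
  have "dirderiv n u (dirderiv n v f) x = (\<Sum>s<n. \<Sum>r<n. partial_deriv s (partial_deriv r f) x * u s * v r)"
    unfolding D[OF uv] by (rule sum.swap)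
  also have "\<dots> = (\<Sum>s<n. \<Sum>r<n. partial_deriv r (partial_deriv s f) x * v r * u s)"
    by (intro sum.cong refl) (simp add: smooth_partial_commute[OF f _ _ x])
  also have "\<dots> = dirderiv n v (dirderiv n u f) x"
    unfolding D[OF uv(2,1)] ..
  finally show ?thesis .
qed

lemma dt_has_derivative:
  assumes A: "\<And>i j. i < k \<Longrightarrow> j < k \<Longrightarrow> ((\<lambda>t. A t i j) has_real_derivative A' i j) (at t\<^sub>0)"
  shows "((\<lambda>t. dt k (A t)) has_real_derivative (\<Sum>i<k. dt k ((A t\<^sub>0)(i := A' i)))) (at t\<^sub>0)"
proof -
  have P: "((\<lambda>t. \<Prod>i<k. A t i (p i)) has_real_derivative (\<Sum>i<k. A' i (p i) * (\<Prod>l\<in>{..<k} - {i}. A t\<^sub>0 l (p l)))) (at t\<^sub>0)"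
    if p: "p permutes {..<k}" for p
    by (rule has_field_derivative_prod) (use A permutes_lessThan[OF p] in simp)
  have "((\<lambda>t. dt k (A t)) has_real_derivative
      (\<Sum>p | p permutes {..<k}. of_int (sign p) * (\<Sum>i<k. A' i (p i) * (\<Prod>l\<in>{..<k} - {i}. A t\<^sub>0 l (p l))))) (at t\<^sub>0)"
    unfolding dt_def by (intro DERIV_sum DERIV_cmult P) simp
  also have "(\<Sum>p | p permutes {..<k}. of_int (sign p) * (\<Sum>i<k. A' i (p i) * (\<Prod>l\<in>{..<k} - {i}. A t\<^sub>0 l (p l)))) =
      (\<Sum>i<k. \<Sum>p | p permutes {..<k}. of_int (sign p) * (A' i (p i) * (\<Prod>l\<in>{..<k} - {i}. A t\<^sub>0 l (p l))))"
    unfolding sum_distrib_left by (rule sum.swap)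
  also have "\<dots> = (\<Sum>i<k. dt k ((A t\<^sub>0)(i := A' i)))"
    by (rule sum.cong[OF refl]) (simp add: dt_split_row)
  finally show ?thesis .
qed

lemma skip_less: "l < m \<Longrightarrow> skip j l < Suc m"
  by (simp add: skip_def)

section \<open>The exterior derivative in coordinates\<close>

lemma additive_real_zero:
  assumes "abelian_group N" "additive_map N real_group F"
  shows "F \<zero>\<^bsub>N\<^esub> = 0"
proof -
  interpret N: abelian_group N by fact
  have "F (\<zero>\<^bsub>N\<^esub> \<oplus>\<^bsub>N\<^esub> \<zero>\<^bsub>N\<^esub>) = F \<zero>\<^bsub>N\<^esub> + F \<zero>\<^bsub>N\<^esub>"
    using additive_map_add[OF assms(2) N.zero_closed N.zero_closed] by simp
  then show ?thesis by simp
qed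

text \<open>
  Differentiating the rows of the determinants produces Hessians, whose contributions cancel by
  symmetry.
\<close>

lemma exterior_derivative_coordinates:
  assumes V: "openin (Euclidean_space n) V" "x \<in> V" and G0: "smooth_on_open n V G0"
    and G: "\<And>i. i < m \<Longrightarrow> smooth_on_open n V (G i)"
    and X: "\<And>l. l < Suc m \<Longrightarrow> X l \<in> euclid n"
  defines "F \<equiv> \<lambda>j y. G0 y * dt m (\<lambda>i l. dirderiv n (X (skip j l)) (G i) y)"
  shows "(\<Sum>j<Suc m. (-1) ^ j * dirderiv n (X j) (F j) x) =
    dt (Suc m) (\<lambda>i. case i of 0 \<Rightarrow> (\<lambda>j. dirderiv n (X j) G0 x) | Suc i \<Rightarrow> (\<lambda>l. dirderiv n (X l) (G i) x))"
    and "smooth_on_open n V (F j)"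
proof -
  let ?B = "\<lambda>j y i l. dirderiv n (X (skip j l)) (G i) y"
  show smF: "smooth_on_open n V (F j)" for j
    unfolding F_def by (intro smooth_mult G0 smooth_dt[OF V(1)] smooth_dirderiv G)
  define H where "H = (\<lambda>i0 j l. dirderiv n (X j) (dirderiv n (X l) (G i0)) x)"
  define Gx where "Gx = (\<lambda>i l. dirderiv n (X l) (G i) x)"
  have D: "dirderiv n (X j) (F j) x = dirderiv n (X j) G0 x * dt m (\<lambda>i l. Gx i (skip j l)) +
      G0 x * (\<Sum>i0<m. dt m (\<lambda>i l. (if i = i0 then H i0 j else Gx i) (skip j l)))" if j: "j < Suc m" for j
  proof (rule dirderivI[OF smF V(2) X[OF j]])
    have xe: "x \<in> euclid n" by (rule openin_euclid_subset[OF V])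
    have line: "((\<lambda>t. f (\<lambda>i. x i + t * X j i)) has_real_derivative dirderiv n (X j) f x) (at 0)"
      if "smooth_on_open n V f" for f
      using dirderiv_line[OF that, of x 0 "X j"] V(2) xe X[OF j] by simp
    have "((\<lambda>t. dt m (?B j (\<lambda>i. x i + t * X j i))) has_real_derivative
        (\<Sum>i0<m. dt m ((?B j (\<lambda>i. x i + 0 * X j i))(i0 := \<lambda>l. H i0 j (skip j l))))) (at 0)"
      unfolding H_def by (rule dt_has_derivative) (rule line[OF smooth_dirderiv[OF G]])
    also have "(\<Sum>i0<m. dt m ((?B j (\<lambda>i. x i + 0 * X j i))(i0 := \<lambda>l. H i0 j (skip j l)))) =
        (\<Sum>i0<m. dt m (\<lambda>i l. (if i = i0 then H i0 j else Gx i) (skip j l)))"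
      by (intro sum.cong refl dt_cong) (simp add: Gx_def)
    finally have "((\<lambda>t. F j (\<lambda>i. x i + t * X j i)) has_real_derivative
        (dirderiv n (X j) G0 x * dt m (?B j (\<lambda>i. x i + 0 * X j i)) +
        (\<Sum>i0<m. dt m (\<lambda>i l. (if i = i0 then H i0 j else Gx i) (skip j l))) * G0 (\<lambda>i. x i + 0 * X j i))) (at 0)"
      unfolding F_def by (rule DERIV_mult'[OF line[OF G0], THEN DERIV_cong]) simp
    then show "((\<lambda>t. F j (\<lambda>i. x i + t * X j i)) has_real_derivative
        (dirderiv n (X j) G0 x * dt m (\<lambda>i l. Gx i (skip j l)) +
        G0 x * (\<Sum>i0<m. dt m (\<lambda>i l. (if i = i0 then H i0 j else Gx i) (skip j l))))) (at 0)"
      by (simp add: Gx_def mult.commute)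
  qed
  \<comment> \<open>Differentiating row \<open>i0\<close> puts a Hessian there. The alternating sum
    over the differentiated direction vanishes for each \<open>i0\<close> separately.\<close>
  have Z: "(\<Sum>j<Suc m. (-1) ^ j * (\<Sum>i0<m. dt m (\<lambda>i l. (if i = i0 then H i0 j else Gx i) (skip j l)))) = 0"
  proof -
    have "(\<Sum>j<Suc m. (-1) ^ j * (\<Sum>i0<m. dt m (\<lambda>i l. (if i = i0 then H i0 j else Gx i) (skip j l)))) =
        (\<Sum>i0<m. \<Sum>j<Suc m. (-1) ^ j * dt m (\<lambda>i l. (if i = i0 then H i0 j else Gx i) (skip j l)))"
      unfolding sum_distrib_left by (rule sum.swap)
    also have "\<dots> = (\<Sum>i0<m. 0)"
      by (intro sum.cong[OF refl] dt_symmetric_zero) (simp_all add: H_def dirderiv_commute[OF G V(2) X X])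
    finally show ?thesis by simp
  qed
  have "(\<Sum>j<Suc m. (-1) ^ j * dirderiv n (X j) (F j) x) =
      (\<Sum>j<Suc m. (-1) ^ j * dirderiv n (X j) G0 x * dt m (\<lambda>i l. Gx i (skip j l))) +
      G0 x * (\<Sum>j<Suc m. (-1) ^ j * (\<Sum>i0<m. dt m (\<lambda>i l. (if i = i0 then H i0 j else Gx i) (skip j l))))"
    unfolding sum_distrib_left[of "G0 x"] sum.distrib[symmetric]
    by (rule sum.cong[OF refl]) (simp add: D algebra_simps del: sum.lessThan_Suc)
  also have "\<dots> = dt (Suc m) (\<lambda>i. case i of 0 \<Rightarrow> (\<lambda>j. dirderiv n (X j) G0 x) | Suc i \<Rightarrow> Gx i)"
    unfolding Z dt_first_row by simp
  finally show "(\<Sum>j<Suc m. (-1) ^ j * dirderiv n (X j) (F j) x) =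
    dt (Suc m) (\<lambda>i. case i of 0 \<Rightarrow> (\<lambda>j. dirderiv n (X j) G0 x) | Suc i \<Rightarrow> (\<lambda>l. dirderiv n (X l) (G i) x))"
    unfolding Gx_def .
qed

section \<open>The exterior derivative of an algebraic form on constant vector fields\<close>

context simplex_open
begin

lemma differential_dirderiv:
  assumes "x \<in> U" "local_extension (Suc n) U f x F" "tangent v"
  shows "differential n U f x v = dirderiv (Suc n) v F x"
  using differential_eq[OF assms] by (simp only: dirderiv_def lessThan_Suc_atMost)

lemma eval_form_gen_map:
  assumes "x \<in> U" "\<And>l. l < k \<Longrightarrow> tangent (Y l)" "a \<in> carrier S" "bs \<in> tuples k (carrier S)"
  shows "eval_form n k U (gen a bs) x (map Y [0..<k]) = a x * dt k (\<lambda>i l. differential n U (bs ! i) x (Y l))"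
proof -
  have "eval_form n k U (gen a bs) x (map Y [0..<k]) =
      a x * dt k (\<lambda>i j. differential n U (bs ! i) x (map Y [0..<k] ! j))"
    by (rule eval_form_gen[OF assms(1) _ assms(3,4)]) (simp add: assms(2))
  also have "dt k (\<lambda>i j. differential n U (bs ! i) x (map Y [0..<k] ! j)) = dt k (\<lambda>i l. differential n U (bs ! i) x (Y l))"
    by (rule dt_cong) simp
  finally show ?thesis .
qed

lemma eval_form_additive_map:
  assumes "x \<in> U" "\<And>l. l < k \<Longrightarrow> tangent (Y l)"
  shows "additive_map (Ext k) real_group (\<lambda>\<alpha>. eval_form n k U \<alpha> x (map Y [0..<k]))"
  by (rule eval_form_additive[OF assms(1)]) (simp add: assms(2))

definition contracted :: "nat \<Rightarrow> ((nat \<Rightarrow> real) \<Rightarrow> real) form \<Rightarrow> (nat \<Rightarrow> nat \<Rightarrow> real) \<Rightarrow> nat \<Rightarrow> (nat \<Rightarrow> real) \<Rightarrow> real" where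
  "contracted m \<alpha> X j y = eval_form n m U \<alpha> y (map (\<lambda>l. X (skip j l)) [0..<m])"

lemma contracted_additive:
  assumes "y \<in> U" "\<And>l. l < Suc m \<Longrightarrow> tangent (X l)"
  shows "additive_map (Ext m) real_group (\<lambda>\<alpha>. contracted m \<alpha> X j y)"
  unfolding contracted_def by (rule eval_form_additive_map[OF assms(1)]) (rule assms(2)[OF skip_less])

lemma eval_form_dmap_additive:
  assumes "x \<in> U" "\<And>l. l < Suc m \<Longrightarrow> tangent (X l)"
  shows "additive_map (Ext m) real_group (\<lambda>\<alpha>. eval_form n (Suc m) U (dmap m \<alpha>) x (map X [0..<Suc m]))"
  by (rule additive_map_comp[OF dmap_additive eval_form_additive_map[OF assms]])

text \<open>On a generator this is \<open>dt_differences\<close>, because a differential is linear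
  in the tangent vector.\<close>

lemma eval_form_differences:
  assumes x: "x \<in> U" and X: "\<And>l. l < Suc m \<Longrightarrow> tangent (X l)" and \<alpha>: "\<alpha> \<in> carrier (Ext m)"
  shows "eval_form n m U \<alpha> x (map (\<lambda>l i. X (Suc l) i - X 0 i) [0..<m]) = (\<Sum>j<Suc m. (-1) ^ j * contracted m \<alpha> X j x)"
proof (rule gen_eqI[where A = "\<lambda>\<alpha>. eval_form n m U \<alpha> x (map (\<lambda>l i. X (Suc l) i - X 0 i) [0..<m])"
      and B = "\<lambda>\<alpha>. \<Sum>j<Suc m. (-1) ^ j * contracted m \<alpha> X j x", OF real_group _ _ _ \<alpha>])
  have tan: "tangent (\<lambda>i. X (Suc l) i - X 0 i)" if "l < m" for l
    using X[of "Suc l"] X[of 0] that by (simp add: tangent_def sum_subtractf)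
  show "additive_map (Ext m) real_group (\<lambda>\<alpha>. eval_form n m U \<alpha> x (map (\<lambda>l i. X (Suc l) i - X 0 i) [0..<m]))"
    by (rule eval_form_additive_map[OF x tan])
  show "additive_map (Ext m) real_group (\<lambda>\<alpha>. \<Sum>j<Suc m. (-1) ^ j * contracted m \<alpha> X j x)"
  proof (rule additive_mapI)
    fix \<alpha> \<beta> assume ab: "\<alpha> \<in> carrier (Ext m)" "\<beta> \<in> carrier (Ext m)"
    have "contracted m (\<alpha> \<oplus>\<^bsub>Ext m\<^esub> \<beta>) X j x = contracted m \<alpha> X j x + contracted m \<beta> X j x" for j
      using additive_map_add[OF contracted_additive[OF x X] ab] by simp
    then show "(\<Sum>j<Suc m. (-1) ^ j * contracted m (\<alpha> \<oplus>\<^bsub>Ext m\<^esub> \<beta>) X j x) =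
        (\<Sum>j<Suc m. (-1) ^ j * contracted m \<alpha> X j x) \<oplus>\<^bsub>real_group\<^esub> (\<Sum>j<Suc m. (-1) ^ j * contracted m \<beta> X j x)"
      by (simp only: real_group_simps distrib_left sum.distrib)
  qed simp
  fix a bs assume a: "a \<in> carrier S" and bs: "bs \<in> tuples m (carrier S)"
  have d: "differential n U (bs ! i) x (\<lambda>r. X (Suc l) r - X 0 r) =
      differential n U (bs ! i) x (X (Suc l)) - differential n U (bs ! i) x (X 0)" if il: "i < m" "l < m" for i l
  proof -
    obtain F where F: "local_extension (Suc n) U (bs ! i) x F"
      using smooth_functionsD[OF tuples_nth[OF bs il(1), unfolded S_carrier] x] by blast
    have t: "tangent (X (Suc l))" "tangent (X 0)" using X il(2) by simp_all
    show ?thesis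
      unfolding differential_dirderiv[OF x F tan[OF il(2)]] differential_dirderiv[OF x F t(1)] differential_dirderiv[OF x F t(2)]
      by (simp only: dirderiv_def right_diff_distrib sum_subtractf)
  qed
  have "eval_form n m U (gen a bs) x (map (\<lambda>l i. X (Suc l) i - X 0 i) [0..<m]) =
      a x * dt m (\<lambda>i l. differential n U (bs ! i) x (\<lambda>r. X (Suc l) r - X 0 r))"
    by (rule eval_form_gen_map[OF x tan a bs])
  also have "\<dots> = a x * dt m (\<lambda>i l. differential n U (bs ! i) x (X (Suc l)) - differential n U (bs ! i) x (X 0))"
    by (rule arg_cong[where f = "(*) (a x)"], rule dt_cong, rule d)
  also have "\<dots> = (\<Sum>j<Suc m. (-1) ^ j * (a x * dt m (\<lambda>i l. differential n U (bs ! i) x (X (skip j l)))))"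
    unfolding dt_differences[where B = "\<lambda>i l. differential n U (bs ! i) x (X l)"] sum_distrib_left
    by (simp only: mult.left_commute)
  also have "\<dots> = (\<Sum>j<Suc m. (-1) ^ j * contracted m (gen a bs) X j x)"
    unfolding contracted_def
    by (rule sum.cong[OF refl], subst eval_form_gen_map[OF x _ a bs]) (use X skip_less in simp_all)
  finally show "eval_form n m U (gen a bs) x (map (\<lambda>l i. X (Suc l) i - X 0 i) [0..<m]) =
    (\<Sum>j<Suc m. (-1) ^ j * contracted m (gen a bs) X j x)" .
qed

text \<open>\<open>U\<close> may contain boundary points, where the contracted functions have no
  derivatives of their own in the ambient space; hence the existential smooth extensions
  \<open>F\<close>. They share one neighbourhood for all \<open>j\<close>, and for a sum of forms
  the neighbourhoods are intersected. On a generator, extensions of the coefficient and of the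
  differentiated functions supply \<open>F\<close>.\<close>

lemma eval_form_dmap:
  assumes x: "x \<in> U" and X: "\<And>l. l < Suc m \<Longrightarrow> tangent (X l)" "\<And>l. l < Suc m \<Longrightarrow> X l \<in> euclid (Suc n)"
    and \<alpha>: "\<alpha> \<in> carrier (Ext m)"
  shows "\<exists>V F. openin (Euclidean_space (Suc n)) V \<and> x \<in> V \<and> (\<forall>j. smooth_on_open (Suc n) V (F j)) \<and>
    (\<forall>j. \<forall>y\<in>U \<inter> V. F j y = contracted m \<alpha> X j y) \<and>
    eval_form n (Suc m) U (dmap m \<alpha>) x (map X [0..<Suc m]) = (\<Sum>j<Suc m. (-1) ^ j * dirderiv (Suc n) (X j) (F j) x)"
    (is "?Q \<alpha>")
  using \<alpha>
proof (induction rule: gen_induct)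
  case zero
  have "contracted m \<zero>\<^bsub>Ext m\<^esub> X j y = 0" if "y \<in> U" for j y
    by (rule additive_real_zero[OF Ext_abelian_group contracted_additive[OF that X(1)]])
  moreover have "eval_form n (Suc m) U (dmap m \<zero>\<^bsub>Ext m\<^esub>) x (map X [0..<Suc m]) = 0"
    by (rule additive_real_zero[OF Ext_abelian_group eval_form_dmap_additive[OF x X(1)]])
  moreover have "dirderiv (Suc n) (X j) (\<lambda>_. 0) x = 0" for j
    by (simp add: dirderiv_def partial_deriv_const)
  ultimately show ?case
    using openin_euclid U_euclid[OF x] smooth_const[OF openin_euclid]
    by (intro exI[of _ "euclid (Suc n)"] exI[of _ "\<lambda>_ _. 0"]) (simp del: upt_Suc)
next
  case (gen a bs)
  have abs: "a # bs \<in> tuples (Suc m) (carrier S)" using gen by (simp add: tuples_Cons)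
  obtain V E where V: "openin (Euclidean_space (Suc n)) V" "x \<in> V" "\<And>l. l < Suc m \<Longrightarrow> smooth_on_open (Suc n) V (E l)"
    "\<And>l y. l < Suc m \<Longrightarrow> y \<in> U \<Longrightarrow> y \<in> V \<Longrightarrow> E l y = ((a # bs) ! l) y"
    using common_neighbourhood[OF abs[unfolded S_carrier] x U_euclid[OF x]] by blast
  define F where "F = (\<lambda>j y. E 0 y * dt m (\<lambda>i l. dirderiv (Suc n) (X (skip j l)) (E (Suc i)) y))"
  have Feq: "(\<lambda>y. E 0 y * dt m (\<lambda>i l. dirderiv (Suc n) (X (skip j l)) (E (Suc i)) y)) = F j" for j
    by (simp add: F_def)
  note L = exterior_derivative_coordinates[OF V(1,2) V(3)[of 0], of m "\<lambda>i. E (Suc i)" X, OF _ V(3)[of "Suc _"] X(2), unfolded Feq]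
  have ext: "local_extension (Suc n) U ((a # bs) ! l) y (E l)" if "l < Suc m" "y \<in> V" for l y
    by (rule local_extensionI[OF that(2) V(3)[OF that(1)] V(4)[OF that(1)]])
  have diff: "differential n U ((a # bs) ! l) y v = dirderiv (Suc n) v (E l) y"
    if "l < Suc m" "y \<in> U" "y \<in> V" "tangent v" for l y v
    by (rule differential_dirderiv[OF that(2) ext[OF that(1,3)] that(4)])
  have sF: "smooth_on_open (Suc n) V (F j)" for j by (rule L(2)) simp_all
  have F: "F j y = contracted m (gen a bs) X j y" if y: "y \<in> U \<inter> V" for j y
  proof -
    have yU: "y \<in> U" "y \<in> V" using y by simp_all
    have "contracted m (gen a bs) X j y = a y * dt m (\<lambda>i l. differential n U (bs ! i) y (X (skip j l)))"
      unfolding contracted_def by (rule eval_form_gen_map[OF yU(1) _ gen]) (rule X(1)[OF skip_less])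
    also have "dt m (\<lambda>i l. differential n U (bs ! i) y (X (skip j l))) = dt m (\<lambda>i l. dirderiv (Suc n) (X (skip j l)) (E (Suc i)) y)"
      by (rule dt_cong) (use diff[OF _ yU X(1)[OF skip_less], of "Suc _"] in simp)
    also have "a y = E 0 y" using V(4)[of 0 y] yU by simp
    finally show ?thesis by (simp add: F_def)
  qed
  have "eval_form n (Suc m) U (dmap m (gen a bs)) x (map X [0..<Suc m]) =
      dt (Suc m) (\<lambda>i l. differential n U ((a # bs) ! i) x (X l))"
  proof -
    have one: "\<one>\<^bsub>UR\<^esub> \<in> carrier S" using UR.one_closed by (simp add: UR_carrier)
    have "eval_form n (Suc m) U (gen \<one>\<^bsub>UR\<^esub> (a # bs)) x (map X [0..<Suc m]) =
        \<one>\<^bsub>UR\<^esub> x * dt (Suc m) (\<lambda>i l. differential n U ((a # bs) ! i) x (X l))"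
      by (rule eval_form_gen_map[OF x X(1) one abs])
    then show ?thesis unfolding dmap_gen[OF gen] ring_one[OF x] by (simp only: mult_1)
  qed
  also have "\<dots> = dt (Suc m) (\<lambda>i. case i of 0 \<Rightarrow> (\<lambda>j. dirderiv (Suc n) (X j) (E 0) x) | Suc i \<Rightarrow> (\<lambda>l. dirderiv (Suc n) (X l) (E (Suc i)) x))"
    by (rule dt_cong) (use diff[OF _ x V(2) X(1)] in \<open>simp split: nat.split\<close>)
  also have "\<dots> = (\<Sum>j<Suc m. (-1) ^ j * dirderiv (Suc n) (X j) (F j) x)"
    by (rule L(1)[symmetric]) simp_all
  finally show ?case
    using V(1,2) sF F by blast
next
  case (add \<alpha> \<beta>)
  obtain V F where V: "openin (Euclidean_space (Suc n)) V" "x \<in> V" "\<And>j. smooth_on_open (Suc n) V (F j)"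
    and F: "\<And>j y. y \<in> U \<inter> V \<Longrightarrow> F j y = contracted m \<alpha> X j y"
    and dF: "eval_form n (Suc m) U (dmap m \<alpha>) x (map X [0..<Suc m]) = (\<Sum>j<Suc m. (-1) ^ j * dirderiv (Suc n) (X j) (F j) x)"
    using add.IH(1) by blast
  obtain W G where W: "openin (Euclidean_space (Suc n)) W" "x \<in> W" "\<And>j. smooth_on_open (Suc n) W (G j)"
    and G: "\<And>j y. y \<in> U \<inter> W \<Longrightarrow> G j y = contracted m \<beta> X j y"
    and dG: "eval_form n (Suc m) U (dmap m \<beta>) x (map X [0..<Suc m]) = (\<Sum>j<Suc m. (-1) ^ j * dirderiv (Suc n) (X j) (G j) x)"
    using add.IH(2) by blast
  have VW: "openin (Euclidean_space (Suc n)) (V \<inter> W)" "x \<in> V \<inter> W" using V W by auto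
  have sV: "smooth_on_open (Suc n) (V \<inter> W) (F j)" and sW: "smooth_on_open (Suc n) (V \<inter> W) (G j)" for j
    by (rule smooth_subset[OF V(3) VW(1)], simp, rule smooth_subset[OF W(3) VW(1)], simp)
  have c: "F j y + G j y = contracted m (\<alpha> \<oplus>\<^bsub>Ext m\<^esub> \<beta>) X j y" if y: "y \<in> U \<inter> (V \<inter> W)" for j y
  proof -
    have "y \<in> U" using y by simp
    from additive_map_add[OF contracted_additive[OF this X(1)] add.hyps]
    show ?thesis using F[of y j] G[of y j] y by simp
  qed
  have d: "dirderiv (Suc n) (X j) (\<lambda>y. F j y + G j y) x = dirderiv (Suc n) (X j) (F j) x + dirderiv (Suc n) (X j) (G j) x" for j
    unfolding dirderiv_def sum.distrib[symmetric]
    by (rule sum.cong[OF refl]) (simp add: partial_deriv_add[OF sV sW _ VW(2)] distrib_right)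
  have "eval_form n (Suc m) U (dmap m (\<alpha> \<oplus>\<^bsub>Ext m\<^esub> \<beta>)) x (map X [0..<Suc m]) =
      (\<Sum>j<Suc m. (-1) ^ j * dirderiv (Suc n) (X j) (\<lambda>y. F j y + G j y) x)"
    using additive_map_add[OF eval_form_dmap_additive[OF x X(1)] add.hyps]
    by (simp only: real_group_simps dF dG d distrib_left sum.distrib)
  then show ?case
    using VW c smooth_add[OF sV sW]
    by (intro exI[of _ "V \<inter> W"] exI[of _ "\<lambda>j y. F j y + G j y"]) blast
qed

end

section \<open>Locally smooth functions on the simplex\<close>

lemma simplex_open_simplex: "simplex_open n (standard_simplex n)"
  by (rule simplex_open.intro) (auto simp: openin_simplex_iff)

lemma continuous_on_locally:
  fixes f :: "'x::topological_space \<Rightarrow> 'y::topological_space"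
  assumes "\<And>x. x \<in> S \<Longrightarrow> \<exists>W. open W \<and> x \<in> W \<and> continuous_on (S \<inter> W) f"
  shows "continuous_on S f"
  unfolding continuous_on_def
proof
  fix x assume x: "x \<in> S"
  obtain W where W: "open W" "x \<in> W" "continuous_on (S \<inter> W) f" using assms[OF x] by blast
  have "at x within S = at x within (S \<inter> W)" by (rule at_within_nhd[OF W(2,1)]) auto
  then show "(f \<longlongrightarrow> f x) (at x within S)" using W x unfolding continuous_on_def by simp
qed

lemma local_extension_open:
  assumes "simplex_open n U" "local_extension (Suc n) (standard_simplex n) f x F" "x \<in> standard_simplex n"
  obtains W where "open W" "x \<in> W" "smooth_on_open (Suc n) (euclid (Suc n) \<inter> W) F"
    "\<And>y. y \<in> standard_simplex n \<Longrightarrow> y \<in> W \<Longrightarrow> F y = f y"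
proof -
  obtain V where V: "openin (Euclidean_space (Suc n)) V" "x \<in> V" "smooth_on_open (Suc n) V F"
    "\<And>y. y \<in> standard_simplex n \<Longrightarrow> y \<in> V \<Longrightarrow> F y = f y" using local_extensionE[OF assms(2)] by blast
  obtain W where W: "open W" "V = euclid (Suc n) \<inter> W" using V(1) unfolding openin_Euclidean_space_iff by blast
  show thesis
    by (rule that[OF W(1)]) (use V W standard_simplex_euclid in auto)
qed

text \<open>Local smoothness without the requirement, in \<open>smooth_functions\<close>, of being
  undefined off the simplex: the functions to which it is applied arise by evaluating
  pullbacks.\<close>

locale smooth_simplex_function =
  fixes n :: nat and f :: "(nat \<Rightarrow> real) \<Rightarrow> real"
  assumes extension: "\<And>x. x \<in> standard_simplex n \<Longrightarrow> \<exists>F. local_extension (Suc n) (standard_simplex n) f x F"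
begin

sublocale simplex_open n "standard_simplex n" by (rule simplex_open_simplex)

lemma extensionE:
  assumes "x \<in> standard_simplex n"
  obtains W F where "open W" "x \<in> W" "smooth_on_open (Suc n) (euclid (Suc n) \<inter> W) F"
    "\<forall>y\<in>standard_simplex n \<inter> W. F y = f y"
    "\<forall>y\<in>standard_simplex n \<inter> W. \<forall>v. tangent v \<longrightarrow>
      differential n (standard_simplex n) f y v = dirderiv (Suc n) v F y"
proof -
  obtain F where F: "local_extension (Suc n) (standard_simplex n) f x F" using extension[OF assms] by blast
  obtain W where W: "open W" "x \<in> W" "smooth_on_open (Suc n) (euclid (Suc n) \<inter> W) F"
    "\<And>y. y \<in> standard_simplex n \<Longrightarrow> y \<in> W \<Longrightarrow> F y = f y"
    using local_extension_open[OF simplex_open_simplex F assms] by blast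
  show thesis
  proof (rule that[OF W(1-3)], use W(4) in blast, intro ballI allI impI)
    fix y v assume "y \<in> standard_simplex n \<inter> W" and v: "tangent v"
    then have y: "y \<in> standard_simplex n" "y \<in> W" by simp_all
    have "local_extension (Suc n) (standard_simplex n) f y F"
      by (rule local_extensionI[OF _ W(3)]) (use y standard_simplex_euclid W(4) in auto)
    then show "differential n (standard_simplex n) f y v = dirderiv (Suc n) v F y"
      by (rule differential_dirderiv[OF y(1) _ v])
  qed
qed

lemma smooth_imp_continuous_on_simplex:
  "smooth_on_open (Suc n) (euclid (Suc n) \<inter> W) F \<Longrightarrow> continuous_on (standard_simplex n \<inter> W) F"
  by (rule continuous_on_subset[OF smooth_continuous]) (use standard_simplex_euclid in auto)

lemma continuous: "continuous_on (standard_simplex n) f"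
proof (rule continuous_on_locally)
  fix x assume "x \<in> standard_simplex n"
  then obtain W F where W: "open W" "x \<in> W" "smooth_on_open (Suc n) (euclid (Suc n) \<inter> W) F"
    "\<forall>y\<in>standard_simplex n \<inter> W. F y = f y"
    "\<forall>y\<in>standard_simplex n \<inter> W. \<forall>v. tangent v \<longrightarrow>
      differential n (standard_simplex n) f y v = dirderiv (Suc n) v F y" by (rule extensionE)
  have "continuous_on (standard_simplex n \<inter> W) f"
    using smooth_imp_continuous_on_simplex[OF W(3)] by (rule continuous_on_eq) (use W(4) in blast)
  then show "\<exists>W. open W \<and> x \<in> W \<and> continuous_on (standard_simplex n \<inter> W) f" using W(1,2) by blast
qed

lemma continuous_differential:
  assumes v: "tangent v"
  shows "continuous_on (standard_simplex n) (\<lambda>x. differential n (standard_simplex n) f x v)"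
proof (rule continuous_on_locally)
  fix x assume "x \<in> standard_simplex n"
  then obtain W F where W: "open W" "x \<in> W" "smooth_on_open (Suc n) (euclid (Suc n) \<inter> W) F"
    "\<forall>y\<in>standard_simplex n \<inter> W. F y = f y"
    "\<forall>y\<in>standard_simplex n \<inter> W. \<forall>v. tangent v \<longrightarrow>
      differential n (standard_simplex n) f y v = dirderiv (Suc n) v F y" by (rule extensionE)
  have "continuous_on (standard_simplex n \<inter> W) (\<lambda>x. differential n (standard_simplex n) f x v)"
    using smooth_imp_continuous_on_simplex[OF smooth_dirderiv[OF W(3)]] by (rule continuous_on_eq) (use W(5) v in simp)
  then show "\<exists>W. open W \<and> x \<in> W \<and> continuous_on (standard_simplex n \<inter> W) (\<lambda>x. differential n (standard_simplex n) f x v)"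
    using W(1,2) by blast
qed

text \<open>The segment may end on the boundary, so the derivative is taken within the set
  \<open>A\<close> of parameters that stay in the simplex. There \<open>f\<close> agrees near
  \<open>t\<^sub>0\<close> with a smooth extension, which has a two-sided derivative.\<close>

lemma derivative_along_line:
  assumes v: "tangent v" "v \<in> euclid (Suc n)" and t: "t\<^sub>0 \<in> A"
    and A: "\<And>t. t \<in> A \<Longrightarrow> (\<lambda>i. x i + t * v i) \<in> standard_simplex n"
  shows "((\<lambda>t. f (\<lambda>i. x i + t * v i)) has_real_derivative
    differential n (standard_simplex n) f (\<lambda>i. x i + t\<^sub>0 * v i) v) (at t\<^sub>0 within A)"
proof -
  let ?c = "\<lambda>t i. x i + t * v i"
  obtain W F where W: "open W" "?c t\<^sub>0 \<in> W" "smooth_on_open (Suc n) (euclid (Suc n) \<inter> W) F"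
    "\<forall>y\<in>standard_simplex n \<inter> W. F y = f y"
    "\<forall>y\<in>standard_simplex n \<inter> W. \<forall>v. tangent v \<longrightarrow>
      differential n (standard_simplex n) f y v = dirderiv (Suc n) v F y" by (rule extensionE[OF A[OF t]])
  have cE: "?c t\<^sub>0 \<in> euclid (Suc n)" by (rule standard_simplex_euclid[OF A[OF t]])
  have xE: "x \<in> euclid (Suc n)"
    unfolding mem_euclid
  proof (intro allI impI)
    fix i assume "Suc n \<le> i"
    then have "x i + t\<^sub>0 * v i = 0" "v i = 0" using cE v(2) by (simp_all add: mem_euclid)
    then show "x i = 0" by simp
  qed
  have F: "((\<lambda>t. F (?c t)) has_real_derivative dirderiv (Suc n) v F (?c t\<^sub>0)) (at t\<^sub>0 within A)"
    by (rule has_field_derivative_at_within[OF dirderiv_line[OF W(3) IntI[OF cE W(2)] xE v(2)]])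
  have "(?c \<longlongrightarrow> ?c t\<^sub>0) (nhds t\<^sub>0)"
    by (rule tendsto_fun_componentwise) (intro tendsto_intros filterlim_ident)
  then have ev: "eventually (\<lambda>t. ?c t \<in> W) (nhds t\<^sub>0)"
    using W(1,2) by (rule topological_tendstoD)
  have "eventually (\<lambda>t. t \<in> A \<longrightarrow> F (?c t) = f (?c t)) (nhds t\<^sub>0)"
    using ev
  proof eventually_elim
    case (elim s)
    show ?case by (intro impI bspec[OF W(4)] IntI A elim)
  qed
  from has_field_derivative_cong_ev[OF refl this refl refl t]
  have "((\<lambda>t. f (?c t)) has_real_derivative dirderiv (Suc n) v F (?c t\<^sub>0)) (at t\<^sub>0 within A)"
    using F by (rule iffD1)
  moreover have "differential n (standard_simplex n) f (?c t\<^sub>0) v = dirderiv (Suc n) v F (?c t\<^sub>0)"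
    using bspec[OF W(5) IntI[OF A[OF t] W(2)]] v(1) by blast
  ultimately show ?thesis by (simp only:)
qed

end

section \<open>Naturality and germs of forms\<close>

text \<open>Commutation of the ring maps carries over to forms because a map of forms acts on a
  generator by acting on its coefficient and on the functions under \<open>d\<close>.\<close>

lemma \<Lambda>\<Omega>_map_square:
  assumes "smooth_ring_hom C D \<phi>" "smooth_ring_hom D E \<psi>" "smooth_ring_hom C D' \<phi>'" "smooth_ring_hom D' E \<psi>'"
    and eq: "\<And>a. a \<in> carrier C \<Longrightarrow> \<psi> (\<phi> a) = \<psi>' (\<phi>' a)" and \<alpha>: "\<alpha> \<in> carrier (\<Lambda>\<Omega> C k)"
  shows "\<Lambda>\<Omega>_map D E \<psi> k (\<Lambda>\<Omega>_map C D \<phi> k \<alpha>) = \<Lambda>\<Omega>_map D' E \<psi>' k (\<Lambda>\<Omega>_map C D' \<phi>' k \<alpha>)"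
proof -
  interpret A: smooth_ring_hom C D \<phi> by fact
  interpret B: smooth_ring_hom D E \<psi> by fact
  interpret A': smooth_ring_hom C D' \<phi>' by fact
  interpret B': smooth_ring_hom D' E \<psi>' by fact
  show ?thesis
  proof (rule A.C.gen_eqI[where A = "\<lambda>\<alpha>. \<Lambda>\<Omega>_map D E \<psi> k (\<Lambda>\<Omega>_map C D \<phi> k \<alpha>)"
        and B = "\<lambda>\<alpha>. \<Lambda>\<Omega>_map D' E \<psi>' k (\<Lambda>\<Omega>_map C D' \<phi>' k \<alpha>)", OF B.D.Ext_abelian_group])
    show "additive_map (A.C.Ext k) (B.D.Ext k) (\<lambda>\<alpha>. \<Lambda>\<Omega>_map D E \<psi> k (\<Lambda>\<Omega>_map C D \<phi> k \<alpha>))"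
      by (rule additive_map_comp[OF A.\<Lambda>\<Omega>_map_additive B.\<Lambda>\<Omega>_map_additive, unfolded A.C.\<Lambda>\<Omega>_eq B.D.\<Lambda>\<Omega>_eq])
    show "additive_map (A.C.Ext k) (B.D.Ext k) (\<lambda>\<alpha>. \<Lambda>\<Omega>_map D' E \<psi>' k (\<Lambda>\<Omega>_map C D' \<phi>' k \<alpha>))"
      by (rule additive_map_comp[OF A'.\<Lambda>\<Omega>_map_additive B'.\<Lambda>\<Omega>_map_additive, unfolded A.C.\<Lambda>\<Omega>_eq B.D.\<Lambda>\<Omega>_eq])
    show "\<alpha> \<in> carrier (A.C.Ext k)" using \<alpha> unfolding A.C.\<Lambda>\<Omega>_eq .
    fix a bs assume a: "a \<in> carrier C" and bs: "bs \<in> tuples k (carrier C)"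
    have m: "map \<psi> (map \<phi> bs) = map \<psi>' (map \<phi>' bs)"
      using bs eq by (auto simp: tuples_def)
    have t: "map \<phi> bs \<in> tuples k (carrier D)" "map \<phi>' bs \<in> tuples k (carrier D')"
      by (rule tuples_map[OF bs A.\<phi>_closed], assumption, rule tuples_map[OF bs A'.\<phi>_closed], assumption)
    show "\<Lambda>\<Omega>_map D E \<psi> k (\<Lambda>\<Omega>_map C D \<phi> k (A.C.gen a bs)) = \<Lambda>\<Omega>_map D' E \<psi>' k (\<Lambda>\<Omega>_map C D' \<phi>' k (A.C.gen a bs))"
      unfolding A.\<Lambda>\<Omega>_map_gen[OF a bs] A'.\<Lambda>\<Omega>_map_gen[OF a bs]
        B.\<Lambda>\<Omega>_map_gen[OF A.\<phi>_closed[OF a] t(1)] B'.\<Lambda>\<Omega>_map_gen[OF A'.\<phi>_closed[OF a] t(2)] eq[OF a] m ..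
  qed
qed

lemma \<Lambda>\<Omega>_map_compose:
  assumes "smooth_ring_hom C D \<phi>" "smooth_ring_hom D E \<psi>" and \<alpha>: "\<alpha> \<in> carrier (\<Lambda>\<Omega> C k)"
  shows "\<Lambda>\<Omega>_map C E (compose (carrier C) \<psi> \<phi>) k \<alpha> = \<Lambda>\<Omega>_map D E \<psi> k (\<Lambda>\<Omega>_map C D \<phi> k \<alpha>)"
proof -
  interpret A: smooth_ring_hom C D \<phi> by fact
  interpret B: smooth_ring_hom D E \<psi> by fact
  let ?\<chi> = "compose (carrier C) \<psi> \<phi>"
  have \<chi>: "?\<chi> a = \<psi> (\<phi> a)" if "a \<in> carrier C" for a using that by (simp add: compose_def)
  have m\<chi>: "map ?\<chi> bs = map \<psi> (map \<phi> bs)" if "bs \<in> tuples q (carrier C)" for q bs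
    using that by (auto simp: tuples_def \<chi>)
  have hom: "?\<chi> \<in> cinf_hom C E"
    unfolding cinf_hom_def
  proof (intro CollectI conjI allI ballI)
    show "?\<chi> \<in> carrier C \<rightarrow>\<^sub>E carrier E"
      by (rule PiE_I) (simp_all add: \<chi> A.\<phi>_closed B.\<phi>_closed compose_def)
    fix q g as assume g: "g \<in> Cinf q" and as: "as \<in> tuples q (carrier C)"
    show "?\<chi> (smooth_op C g as) = smooth_op E g (map ?\<chi> as)"
      unfolding \<chi>[OF A.C.op_closed[OF g as]] m\<chi>[OF as] cinf_hom_op[OF A.smooth_hom g as]
      by (rule cinf_hom_op[OF B.smooth_hom g tuples_map[OF as A.\<phi>_closed]])
  qed
  interpret H: smooth_ring_hom C E ?\<chi>
    by (intro smooth_ring_hom.intro smooth_ring_hom_axioms.intro A.C.smooth_ring_axioms B.D.smooth_ring_axioms hom)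
  show ?thesis
  proof (rule A.C.gen_eqI[where A = "\<Lambda>\<Omega>_map C E ?\<chi> k" and B = "\<lambda>\<alpha>. \<Lambda>\<Omega>_map D E \<psi> k (\<Lambda>\<Omega>_map C D \<phi> k \<alpha>)", OF B.D.Ext_abelian_group])
    show "additive_map (A.C.Ext k) (B.D.Ext k) (\<lambda>\<alpha>. \<Lambda>\<Omega>_map D E \<psi> k (\<Lambda>\<Omega>_map C D \<phi> k \<alpha>))"
      by (rule additive_map_comp[OF A.\<Lambda>\<Omega>_map_additive B.\<Lambda>\<Omega>_map_additive, unfolded A.C.\<Lambda>\<Omega>_eq B.D.\<Lambda>\<Omega>_eq])
    show "additive_map (A.C.Ext k) (B.D.Ext k) (\<Lambda>\<Omega>_map C E ?\<chi> k)"
      by (rule H.\<Lambda>\<Omega>_map_additive[unfolded A.C.\<Lambda>\<Omega>_eq B.D.\<Lambda>\<Omega>_eq])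
    show "\<alpha> \<in> carrier (A.C.Ext k)" using \<alpha> unfolding A.C.\<Lambda>\<Omega>_eq .
    fix a bs assume a: "a \<in> carrier C" and bs: "bs \<in> tuples k (carrier C)"
    have t: "map \<phi> bs \<in> tuples k (carrier D)" by (rule tuples_map[OF bs A.\<phi>_closed])
    show "\<Lambda>\<Omega>_map C E ?\<chi> k (A.C.gen a bs) = \<Lambda>\<Omega>_map D E \<psi> k (\<Lambda>\<Omega>_map C D \<phi> k (A.C.gen a bs))"
      unfolding A.\<Lambda>\<Omega>_map_gen[OF a bs] H.\<Lambda>\<Omega>_map_gen[OF a bs]
        B.\<Lambda>\<Omega>_map_gen[OF A.\<phi>_closed[OF a] t] \<chi>[OF a] m\<chi>[OF bs] ..
  qed
qed

lemma \<Lambda>\<Omega>_map_closed: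
  assumes "smooth_ring_hom C D \<phi>" "\<alpha> \<in> carrier (\<Lambda>\<Omega> C k)"
  shows "\<Lambda>\<Omega>_map C D \<phi> k \<alpha> \<in> carrier (\<Lambda>\<Omega> D k)"
  using additive_map_closed[OF smooth_ring_hom.\<Lambda>\<Omega>_map_additive[OF assms(1)] assms(2)] .

lemma ext_deriv_closed:
  assumes "smooth_ring C" "\<alpha> \<in> carrier (\<Lambda>\<Omega> C k)"
  shows "ext_deriv C k \<alpha> \<in> carrier (\<Lambda>\<Omega> C (Suc k))"
proof -
  interpret smooth_ring C by fact
  show ?thesis
    using additive_map_closed[OF dmap_additive] assms(2) unfolding \<Lambda>\<Omega>_eq ext_deriv_eq by blast
qed

text \<open>On generators the derivative moves the coefficient under \<open>d\<close> and leaves the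
  unit as coefficient, and ring maps preserve the unit.\<close>

lemma \<Lambda>\<Omega>_map_ext_deriv:
  assumes "smooth_ring_hom C D \<phi>" and \<alpha>: "\<alpha> \<in> carrier (\<Lambda>\<Omega> C k)"
  shows "\<Lambda>\<Omega>_map C D \<phi> (Suc k) (ext_deriv C k \<alpha>) = ext_deriv D k (\<Lambda>\<Omega>_map C D \<phi> k \<alpha>)"
proof -
  interpret H: smooth_ring_hom C D \<phi> by fact
  show ?thesis
    unfolding H.C.ext_deriv_eq H.D.ext_deriv_eq
  proof (rule H.C.gen_eqI[where A = "\<lambda>\<alpha>. \<Lambda>\<Omega>_map C D \<phi> (Suc k) (H.C.dmap k \<alpha>)" and B = "\<lambda>\<alpha>. H.D.dmap k (\<Lambda>\<Omega>_map C D \<phi> k \<alpha>)",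
        OF H.D.Ext_abelian_group])
    show "additive_map (H.C.Ext k) (H.D.Ext (Suc k)) (\<lambda>\<alpha>. \<Lambda>\<Omega>_map C D \<phi> (Suc k) (H.C.dmap k \<alpha>))"
      by (rule additive_map_comp[OF H.C.dmap_additive H.\<Lambda>\<Omega>_map_additive[unfolded H.C.\<Lambda>\<Omega>_eq H.D.\<Lambda>\<Omega>_eq]])
    show "additive_map (H.C.Ext k) (H.D.Ext (Suc k)) (\<lambda>\<alpha>. H.D.dmap k (\<Lambda>\<Omega>_map C D \<phi> k \<alpha>))"
      by (rule additive_map_comp[OF H.\<Lambda>\<Omega>_map_additive[unfolded H.C.\<Lambda>\<Omega>_eq H.D.\<Lambda>\<Omega>_eq] H.D.dmap_additive])
    show "\<alpha> \<in> carrier (H.C.Ext k)" using \<alpha> unfolding H.C.\<Lambda>\<Omega>_eq .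
    fix a bs assume a: "a \<in> carrier C" and bs: "bs \<in> tuples k (carrier C)"
    have one: "\<one>\<^bsub>underlying_ring C\<^esub> \<in> carrier C" using H.C.UR.one_closed by (simp add: H.C.UR_carrier)
    have abs: "a # bs \<in> tuples (Suc k) (carrier C)" using a bs by (simp add: tuples_Cons)
    have t: "map \<phi> bs \<in> tuples k (carrier D)" by (rule tuples_map[OF bs H.\<phi>_closed])
    show "\<Lambda>\<Omega>_map C D \<phi> (Suc k) (H.C.dmap k (H.C.gen a bs)) = H.D.dmap k (\<Lambda>\<Omega>_map C D \<phi> k (H.C.gen a bs))"
      unfolding H.C.dmap_gen[OF a bs] H.\<Lambda>\<Omega>_map_gen[OF a bs] H.\<Lambda>\<Omega>_map_gen[OF one abs]
        H.D.dmap_gen[OF H.\<phi>_closed[OF a] t] list.map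
        ring_hom_one[OF cinf_hom_ring_hom[OF H.smooth_hom]] ..
  qed
qed

section \<open>Germs of forms and their values at a point\<close>

lemma form_germI:
  "openin (space_top X) V \<Longrightarrow> x \<in> V \<Longrightarrow> w \<in> carrier (\<Lambda>\<Omega> (sec X V) k) \<Longrightarrow> (V, w) \<in> form_germ X k x V w"
  unfolding form_germ_def germ_def by blast

lemma form_germE:
  assumes "(V, w) \<in> form_germ X k x V\<^sub>0 w\<^sub>0"
  obtains W where "openin (space_top X) V" "x \<in> V" "w \<in> carrier (\<Lambda>\<Omega> (sec X V) k)" "openin (space_top X) W"
    "x \<in> W" "W \<subseteq> V\<^sub>0" "W \<subseteq> V"
    "\<Lambda>\<Omega>_map (sec X V\<^sub>0) (sec X W) (res X V\<^sub>0 W) k w\<^sub>0 = \<Lambda>\<Omega>_map (sec X V) (sec X W) (res X V W) k w"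
  using assms unfolding form_germ_def germ_def by blast

definition tangents :: "nat \<Rightarrow> nat \<Rightarrow> (nat \<Rightarrow> real) list \<Rightarrow> bool" where
  "tangents n k vs \<longleftrightarrow> length vs = k \<and> (\<forall>v\<in>set vs. (\<Sum>i\<le>n. v i) = 0)"

lemma simplex_space_simps [simp]: "sec (simplex_space n) = simplex_sec n"
  by (simp add: simplex_space_def)

lemma simplex_res_pull:
  assumes U: "simplex_open n U" and W: "simplex_open n W" and WU: "W \<subseteq> U"
  shows "smooth_ring_hom (simplex_sec n U) (simplex_sec n W) (res (simplex_space n) U W)"
    and "\<alpha> \<in> carrier (\<Lambda>\<Omega> (simplex_sec n U) k) \<Longrightarrow> x \<in> W \<Longrightarrow> tangents n k vs \<Longrightarrow>
      eval_form n k W (\<Lambda>\<Omega>_map (simplex_sec n U) (simplex_sec n W) (res (simplex_space n) U W) k \<alpha>) x vs = eval_form n k U \<alpha> x vs"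
proof -
  interpret P: simplex_pullback n U n W "\<lambda>x. x" by (rule restriction_pullback[OF U W WU])
  have res: "res (simplex_space n) U W = P.pull"
    by (simp add: simplex_space_def P.pull_def restrict_def)
  show "smooth_ring_hom (simplex_sec n U) (simplex_sec n W) (res (simplex_space n) U W)"
    unfolding res by (rule P.hom.smooth_ring_hom_axioms)
  assume a: "\<alpha> \<in> carrier (\<Lambda>\<Omega> (simplex_sec n U) k)" "x \<in> W" and vs: "tangents n k vs"
  have len: "length vs = k" using vs by (simp add: tangents_def)
  have "P.B.tangent v" "P.A.tangent v" if "v \<in> set vs" for v
    using vs that by (simp_all add: tangents_def P.A.tangent_def)
  from P.eval_form_pull[OF a len this]
  show "eval_form n k W (\<Lambda>\<Omega>_map (simplex_sec n U) (simplex_sec n W) (res (simplex_space n) U W) k \<alpha>) x vs = eval_form n k U \<alpha> x vs"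
    unfolding res by simp
qed

text \<open>Representatives of one germ have equal restrictions to a smaller neighbourhood of
  \<open>x\<close>, and restriction does not change the value at \<open>x\<close>.\<close>

lemma eval_form_germ:
  assumes U: "simplex_open n U" and \<alpha>: "\<alpha> \<in> carrier (\<Lambda>\<Omega> (simplex_sec n U) k)" and vs: "tangents n k vs"
    and g: "(V, \<beta>) \<in> form_germ (simplex_space n) k x U \<alpha>"
  shows "eval_form n k V \<beta> x vs = eval_form n k U \<alpha> x vs"
proof -
  obtain W where V: "openin (space_top (simplex_space n)) V" "x \<in> V" and \<beta>: "\<beta> \<in> carrier (\<Lambda>\<Omega> (simplex_sec n V) k)"
    and W: "openin (space_top (simplex_space n)) W" "x \<in> W" "W \<subseteq> U" "W \<subseteq> V"
    and eq: "\<Lambda>\<Omega>_map (simplex_sec n U) (simplex_sec n W) (res (simplex_space n) U W) k \<alpha> =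
      \<Lambda>\<Omega>_map (simplex_sec n V) (simplex_sec n W) (res (simplex_space n) V W) k \<beta>"
    using form_germE[OF g] unfolding simplex_space_simps by metis
  have o: "simplex_open n V" "simplex_open n W" using V(1) W(1) by (simp_all add: simplex_open_def)
  show ?thesis
    using simplex_res_pull(2)[OF U o(2) W(3) \<alpha> W(2) vs] simplex_res_pull(2)[OF o W(4) \<beta> W(2) vs] eq by (simp only:)
qed

text \<open>\<open>pullback\<close> takes \<open>the_elem\<close> of the values on all
  representatives of a germ that is itself a union over the representatives of
  \<open>\<omega>\<close>. It therefore suffices to have one representative of
  \<open>\<omega>\<close> and one value \<open>c\<close> common to all of them.\<close>

lemma pullback_eqI:
  assumes ne: "(V\<^sub>0, w\<^sub>0) \<in> \<omega> (on_points \<sigma> x)" and x: "x \<in> standard_simplex n"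
    and M: "on_points \<sigma> x \<in> topspace (space_top M)" and vs: "tangents n k vs"
    and \<omega>: "\<And>V w. (V, w) \<in> \<omega> (on_points \<sigma> x) \<Longrightarrow> on_points \<sigma> x \<in> V \<and> simplex_open n (preim (simplex_space n) \<sigma> V) \<and>
      \<Lambda>\<Omega>_map (sec M V) (simplex_sec n (preim (simplex_space n) \<sigma> V)) (on_sections \<sigma> V) k w
        \<in> carrier (\<Lambda>\<Omega> (simplex_sec n (preim (simplex_space n) \<sigma> V)) k) \<and>
      eval_form n k (preim (simplex_space n) \<sigma> V)
        (\<Lambda>\<Omega>_map (sec M V) (simplex_sec n (preim (simplex_space n) \<sigma> V)) (on_sections \<sigma> V) k w) x vs = c"
  shows "pullback M n \<sigma> k \<omega> x vs = c"
proof -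
  let ?p = "preim (simplex_space n) \<sigma>"
  let ?q = "\<lambda>V. \<Lambda>\<Omega>_map (sec M V) (simplex_sec n (?p V)) (on_sections \<sigma> V) k"
  let ?G = "form_map (simplex_space n) M \<sigma> k (topspace (space_top M)) \<omega> x"
  have xp: "x \<in> ?p V \<longleftrightarrow> on_points \<sigma> x \<in> V" for V
    using x by (simp add: preim_def topspace_simplex)
  have G: "?G = (\<Union>(V, w)\<in>\<omega> (on_points \<sigma> x). form_germ (simplex_space n) k x (?p V) (?q V w))"
    using xp M by (simp add: form_map_def)
  have "eval_form n k U \<alpha> x vs = c" if g: "(U, \<alpha>) \<in> ?G" for U \<alpha>
  proof -
    obtain V w where V: "(V, w) \<in> \<omega> (on_points \<sigma> x)" "(U, \<alpha>) \<in> form_germ (simplex_space n) k x (?p V) (?q V w)"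
      using g unfolding G by blast
    have o: "simplex_open n (?p V)" and c: "?q V w \<in> carrier (\<Lambda>\<Omega> (simplex_sec n (?p V)) k)"
      and e: "eval_form n k (?p V) (?q V w) x vs = c" using \<omega>[OF V(1)] by blast+
    show ?thesis using eval_form_germ[OF o c vs V(2)] e by (rule trans)
  qed
  moreover have "(?p V\<^sub>0, ?q V\<^sub>0 w\<^sub>0) \<in> ?G"
  proof -
    have o: "simplex_open n (?p V\<^sub>0)" and c: "?q V\<^sub>0 w\<^sub>0 \<in> carrier (\<Lambda>\<Omega> (simplex_sec n (?p V\<^sub>0)) k)"
      and y: "on_points \<sigma> x \<in> V\<^sub>0" using \<omega>[OF ne] by blast+
    have "(?p V\<^sub>0, ?q V\<^sub>0 w\<^sub>0) \<in> form_germ (simplex_space n) k x (?p V\<^sub>0) (?q V\<^sub>0 w\<^sub>0)"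
      by (rule form_germI) (use o c y xp in \<open>simp_all add: simplex_open_def\<close>)
    then show ?thesis unfolding G using ne by blast
  qed
  ultimately have "(\<lambda>(U, \<alpha>). eval_form n k U \<alpha> x vs) ` ?G = {c}" by force
  then show ?thesis by (simp add: pullback_def to_dR_def)
qed

section \<open>Pullbacks of algebraic forms to simplices\<close>

lemma continuous_simplical_face: "continuous_on A (simplical_face i :: (nat \<Rightarrow> real) \<Rightarrow> nat \<Rightarrow> real)"
proof (rule continuous_on_coordinatewise_then_product)
  fix l
  have eq: "(\<lambda>y::nat \<Rightarrow> real. simplical_face i y l) = (if l < i then (\<lambda>y. y l) else if l = i then (\<lambda>y. 0) else (\<lambda>y. y (l - 1)))"
    by (auto simp: simplical_face_def fun_eq_iff)
  have proj: "continuous_on A (\<lambda>y::nat \<Rightarrow> real. y r)" for r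
    by (rule continuous_on_subset[OF continuous_on_product_coordinates]) simp
  show "continuous_on A (\<lambda>y::nat \<Rightarrow> real. simplical_face i y l)"
    unfolding eq by (simp add: proj continuous_on_const)
qed

lemma simplical_face_simplex:
  "i \<le> Suc m \<Longrightarrow> y \<in> standard_simplex m \<Longrightarrow> simplical_face i y \<in> standard_simplex (Suc m)"
  using simplical_face_in_standard_simplex[of "Suc m" i y] by simp

lemma form_germD:
  assumes "(V, w) \<in> form_germ X k x V\<^sub>0 w\<^sub>0"
  shows "openin (space_top X) V" "x \<in> V" "w \<in> carrier (\<Lambda>\<Omega> (sec X V) k)"
  using assms unfolding form_germ_def germ_def by blast+

section \<open>Pulling algebraic forms back along a simplex\<close>

locale simplex_in_space =
  fixes M :: "('m, 'a) cinf_space" and k :: nat and \<sigma> :: "('m, 'a) cinf_simplex"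
  assumes sheaf: "cinf_sheaf M" and \<sigma>: "is_cinf_map (simplex_space k) M \<sigma>"
begin

abbreviation "pre \<equiv> preim (simplex_space k) \<sigma>"

lemma M_ring: "openin (space_top M) V \<Longrightarrow> smooth_ring (sec M V)"
  unfolding smooth_ring_def by (rule sheaf[unfolded cinf_sheaf_def, THEN conjunct1, rule_format])

lemma res_hom:
  assumes "openin (space_top M) V" "openin (space_top M) W" "W \<subseteq> V"
  shows "smooth_ring_hom (sec M V) (sec M W) (res M V W)"
proof (intro smooth_ring_hom.intro smooth_ring_hom_axioms.intro M_ring assms(1,2))
  show "res M V W \<in> cinf_hom (sec M V) (sec M W)"
    by (rule sheaf[unfolded cinf_sheaf_def, THEN conjunct2, THEN conjunct1, rule_format]) (intro conjI assms)
qed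

lemma continuous_points: "continuous_map (space_top (simplex_space k)) (space_top M) (on_points \<sigma>)"
  by (rule \<sigma>[unfolded is_cinf_map_def, THEN conjunct1])

lemmas \<sigma>_rest = \<sigma>[unfolded is_cinf_map_def, THEN conjunct2, THEN conjunct2, THEN conjunct2]

lemma point_closed: "x \<in> standard_simplex k \<Longrightarrow> on_points \<sigma> x \<in> topspace (space_top M)"
  using continuous_map_image_subset_topspace[OF continuous_points] unfolding topspace_simplex by (rule subsetD) (rule imageI)

lemma in_pre: "x \<in> pre V \<longleftrightarrow> x \<in> standard_simplex k \<and> on_points \<sigma> x \<in> V"
  by (simp add: preim_def topspace_simplex)

lemma pre_open: "openin (space_top M) V \<Longrightarrow> simplex_open k (pre V)"
  unfolding preim_def by (rule simplex_open.intro[OF openin_continuous_map_preimage[OF continuous_points]])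

lemma section_hom:
  assumes V: "openin (space_top M) V"
  shows "smooth_ring_hom (sec M V) (simplex_sec k (pre V)) (on_sections \<sigma> V)"
proof (intro smooth_ring_hom.intro smooth_ring_hom_axioms.intro M_ring[OF V])
  interpret simplex_open k "pre V" by (rule pre_open[OF V])
  show "smooth_ring S" by (rule smooth_ring_axioms)
  have "on_sections \<sigma> V \<in> cinf_hom (sec M V) (sec (simplex_space k) (pre V))"
    by (rule \<sigma>_rest[THEN conjunct1, rule_format, OF V])
  then show "on_sections \<sigma> V \<in> cinf_hom (sec M V) (simplex_sec k (pre V))" by simp
qed

definition pulled :: "nat \<Rightarrow> 'm set \<Rightarrow> 'a form \<Rightarrow> ((nat \<Rightarrow> real) \<Rightarrow> real) form" where
  "pulled q V w = \<Lambda>\<Omega>_map (sec M V) (simplex_sec k (pre V)) (on_sections \<sigma> V) q w"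

lemma pulled_closed:
  "openin (space_top M) V \<Longrightarrow> w \<in> carrier (\<Lambda>\<Omega> (sec M V) q) \<Longrightarrow> pulled q V w \<in> carrier (\<Lambda>\<Omega> (simplex_sec k (pre V)) q)"
  unfolding pulled_def by (rule \<Lambda>\<Omega>_map_closed[OF section_hom])

text \<open>\<open>on_sections \<sigma>\<close> commutes with restriction of sections, hence so do
  the induced maps of forms, and restriction on the simplex preserves values.\<close>

lemma eval_pulled_res:
  assumes V: "openin (space_top M) V" and W: "openin (space_top M) W" "W \<subseteq> V" and w: "w \<in> carrier (\<Lambda>\<Omega> (sec M V) q)"
    and x: "x \<in> pre W" and vs: "tangents k q vs"
  shows "eval_form k q (pre W) (pulled q W (\<Lambda>\<Omega>_map (sec M V) (sec M W) (res M V W) q w)) x vs =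
    eval_form k q (pre V) (pulled q V w) x vs"
proof -
  have sub: "pre W \<subseteq> pre V" using W(2) by (auto simp: preim_def)
  note R = simplex_res_pull[OF pre_open[OF V] pre_open[OF W(1)] sub]
  have nat: "on_sections \<sigma> W (res M V W s) = res (simplex_space k) (pre V) (pre W) (on_sections \<sigma> V s)"
    if "s \<in> carrier (sec M V)" for s
    by (rule \<sigma>_rest[THEN conjunct2, rule_format]) (intro conjI V W, rule that)
  have "pulled q W (\<Lambda>\<Omega>_map (sec M V) (sec M W) (res M V W) q w) =
      \<Lambda>\<Omega>_map (simplex_sec k (pre V)) (simplex_sec k (pre W)) (res (simplex_space k) (pre V) (pre W)) q (pulled q V w)"
    unfolding pulled_def
    by (rule \<Lambda>\<Omega>_map_square[OF res_hom[OF V W] section_hom[OF W(1)] section_hom[OF V] R(1) _ w]) (rule nat)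
  then show ?thesis using R(2)[OF pulled_closed[OF V w] x vs] by (simp only:)
qed

lemma eval_pulled_germ:
  assumes V\<^sub>0: "openin (space_top M) V\<^sub>0" and w\<^sub>0: "w\<^sub>0 \<in> carrier (\<Lambda>\<Omega> (sec M V\<^sub>0) q)" and x: "x \<in> standard_simplex k"
    and vs: "tangents k q vs" and g: "(V, w) \<in> form_germ M q (on_points \<sigma> x) V\<^sub>0 w\<^sub>0"
  shows "eval_form k q (pre V) (pulled q V w) x vs = eval_form k q (pre V\<^sub>0) (pulled q V\<^sub>0 w\<^sub>0) x vs"
proof -
  obtain W where V: "openin (space_top M) V" and w: "w \<in> carrier (\<Lambda>\<Omega> (sec M V) q)" and W: "openin (space_top M) W"
    "on_points \<sigma> x \<in> W" "W \<subseteq> V\<^sub>0" "W \<subseteq> V"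
    and eq: "\<Lambda>\<Omega>_map (sec M V\<^sub>0) (sec M W) (res M V\<^sub>0 W) q w\<^sub>0 = \<Lambda>\<Omega>_map (sec M V) (sec M W) (res M V W) q w"
    by (rule form_germE[OF g])
  have xW: "x \<in> pre W" using x W(2) by (simp add: in_pre)
  show ?thesis
    using eval_pulled_res[OF V W(1,4) w xW vs] eval_pulled_res[OF V\<^sub>0 W(1,3) w\<^sub>0 xW vs] eq by (simp only:)
qed

lemma pulled_ext_deriv:
  "openin (space_top M) V \<Longrightarrow> w \<in> carrier (\<Lambda>\<Omega> (sec M V) q) \<Longrightarrow>
    pulled (Suc q) V (ext_deriv (sec M V) q w) = ext_deriv (simplex_sec k (pre V)) q (pulled q V w)"
  unfolding pulled_def by (rule \<Lambda>\<Omega>_map_ext_deriv[OF section_hom])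

text \<open>The derivative commutes with restriction, so the derivatives of two representatives of a
  germ still agree on the smaller neighbourhood.\<close>

lemma eval_pulled_ext_deriv_germ:
  assumes V\<^sub>0: "openin (space_top M) V\<^sub>0" and w\<^sub>0: "w\<^sub>0 \<in> carrier (\<Lambda>\<Omega> (sec M V\<^sub>0) q)" and x: "x \<in> standard_simplex k"
    and vs: "tangents k (Suc q) vs" and g: "(V, w) \<in> form_germ M q (on_points \<sigma> x) V\<^sub>0 w\<^sub>0"
  shows "eval_form k (Suc q) (pre V) (pulled (Suc q) V (ext_deriv (sec M V) q w)) x vs =
    eval_form k (Suc q) (pre V\<^sub>0) (pulled (Suc q) V\<^sub>0 (ext_deriv (sec M V\<^sub>0) q w\<^sub>0)) x vs"
proof -
  obtain W where V: "openin (space_top M) V" and w: "w \<in> carrier (\<Lambda>\<Omega> (sec M V) q)" and W: "openin (space_top M) W"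
    "on_points \<sigma> x \<in> W" "W \<subseteq> V\<^sub>0" "W \<subseteq> V"
    and eq: "\<Lambda>\<Omega>_map (sec M V\<^sub>0) (sec M W) (res M V\<^sub>0 W) q w\<^sub>0 = \<Lambda>\<Omega>_map (sec M V) (sec M W) (res M V W) q w"
    by (rule form_germE[OF g])
  have xW: "x \<in> pre W" using x W(2) by (simp add: in_pre)
  have "\<Lambda>\<Omega>_map (sec M V\<^sub>0) (sec M W) (res M V\<^sub>0 W) (Suc q) (ext_deriv (sec M V\<^sub>0) q w\<^sub>0) =
      \<Lambda>\<Omega>_map (sec M V) (sec M W) (res M V W) (Suc q) (ext_deriv (sec M V) q w)"
    unfolding \<Lambda>\<Omega>_map_ext_deriv[OF res_hom[OF V W(1,4)] w] \<Lambda>\<Omega>_map_ext_deriv[OF res_hom[OF V\<^sub>0 W(1,3)] w\<^sub>0] eq ..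
  then show ?thesis
    using eval_pulled_res[OF V W(1,4) ext_deriv_closed[OF M_ring[OF V] w] xW vs]
      eval_pulled_res[OF V\<^sub>0 W(1,3) ext_deriv_closed[OF M_ring[OF V\<^sub>0] w\<^sub>0] xW vs] by (simp only:)
qed

lemma pullback_form:
  assumes V\<^sub>0: "openin (space_top M) V\<^sub>0" and w\<^sub>0: "w\<^sub>0 \<in> carrier (\<Lambda>\<Omega> (sec M V\<^sub>0) q)" and x: "x \<in> pre V\<^sub>0"
    and vs: "tangents k q vs" and \<gamma>: "\<gamma> (on_points \<sigma> x) = form_germ M q (on_points \<sigma> x) V\<^sub>0 w\<^sub>0"
  shows "pullback M k \<sigma> q \<gamma> x vs = eval_form k q (pre V\<^sub>0) (pulled q V\<^sub>0 w\<^sub>0) x vs"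
proof (rule pullback_eqI[OF _ _ point_closed vs])
  show x': "x \<in> standard_simplex k" "x \<in> standard_simplex k" using x by (simp_all add: in_pre)
  show "(V\<^sub>0, w\<^sub>0) \<in> \<gamma> (on_points \<sigma> x)"
    unfolding \<gamma> by (rule form_germI[OF V\<^sub>0 _ w\<^sub>0]) (use x in \<open>simp add: in_pre\<close>)
  fix V w assume g: "(V, w) \<in> \<gamma> (on_points \<sigma> x)"
  have V: "openin (space_top M) V" "on_points \<sigma> x \<in> V" "w \<in> carrier (\<Lambda>\<Omega> (sec M V) q)"
    by (rule form_germD[OF g[unfolded \<gamma>]])+
  show "on_points \<sigma> x \<in> V \<and> simplex_open k (pre V) \<and>
      \<Lambda>\<Omega>_map (sec M V) (simplex_sec k (pre V)) (on_sections \<sigma> V) q w \<in> carrier (\<Lambda>\<Omega> (simplex_sec k (pre V)) q) \<and>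
      eval_form k q (pre V) (\<Lambda>\<Omega>_map (sec M V) (simplex_sec k (pre V)) (on_sections \<sigma> V) q w) x vs =
        eval_form k q (pre V\<^sub>0) (pulled q V\<^sub>0 w\<^sub>0) x vs"
    unfolding pulled_def[of q V, symmetric]
    by (intro conjI V(2) pre_open V(1) pulled_closed V(3) eval_pulled_germ[OF V\<^sub>0 w\<^sub>0 x'(1) vs g[unfolded \<gamma>]])
qed

lemma pullback_form_d:
  assumes V\<^sub>0: "openin (space_top M) V\<^sub>0" and w\<^sub>0: "w\<^sub>0 \<in> carrier (\<Lambda>\<Omega> (sec M V\<^sub>0) q)" and x: "x \<in> pre V\<^sub>0"
    and vs: "tangents k (Suc q) vs" and \<gamma>: "\<gamma> (on_points \<sigma> x) = form_germ M q (on_points \<sigma> x) V\<^sub>0 w\<^sub>0"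
  shows "pullback M k \<sigma> (Suc q) (form_d M q (topspace (space_top M)) \<gamma>) x vs =
    eval_form k (Suc q) (pre V\<^sub>0) (ext_deriv (simplex_sec k (pre V\<^sub>0)) q (pulled q V\<^sub>0 w\<^sub>0)) x vs"
proof (rule pullback_eqI[OF _ _ point_closed vs])
  let ?y = "on_points \<sigma> x"
  let ?d = "form_d M q (topspace (space_top M)) \<gamma>"
  show x': "x \<in> standard_simplex k" "x \<in> standard_simplex k" using x by (simp_all add: in_pre)
  have y: "?y \<in> V\<^sub>0" using x by (simp add: in_pre)
  have d: "?d ?y = (\<Union>(V, w)\<in>form_germ M q ?y V\<^sub>0 w\<^sub>0. form_germ M (Suc q) ?y V (ext_deriv (sec M V) q w))"
    using point_closed[OF x'(1)] by (simp add: form_d_def \<gamma>)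
  have "(V\<^sub>0, ext_deriv (sec M V\<^sub>0) q w\<^sub>0) \<in> form_germ M (Suc q) ?y V\<^sub>0 (ext_deriv (sec M V\<^sub>0) q w\<^sub>0)"
    by (rule form_germI[OF V\<^sub>0 y ext_deriv_closed[OF M_ring[OF V\<^sub>0] w\<^sub>0]])
  then show "(V\<^sub>0, ext_deriv (sec M V\<^sub>0) q w\<^sub>0) \<in> ?d ?y"
    unfolding d using form_germI[OF V\<^sub>0 y w\<^sub>0] by blast
  fix V' w' assume "(V', w') \<in> ?d ?y"
  \<comment> \<open>Two layers of representatives: \<open>(V, w)\<close> represents the germ of
    \<open>\<gamma>\<close>, and \<open>(V', w')\<close> represents the germ of the derivative of
    \<open>w\<close>. Each layer is removed by its own independence statement.\<close>
  then obtain V w where g: "(V, w) \<in> form_germ M q ?y V\<^sub>0 w\<^sub>0"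
    and g': "(V', w') \<in> form_germ M (Suc q) ?y V (ext_deriv (sec M V) q w)" unfolding d by blast
  have V: "openin (space_top M) V" "?y \<in> V" "w \<in> carrier (\<Lambda>\<Omega> (sec M V) q)"
    by (rule form_germD[OF g])+
  have V': "openin (space_top M) V'" "?y \<in> V'" "w' \<in> carrier (\<Lambda>\<Omega> (sec M V') (Suc q))"
    by (rule form_germD[OF g'])+
  have "eval_form k (Suc q) (pre V') (pulled (Suc q) V' w') x vs =
      eval_form k (Suc q) (pre V) (pulled (Suc q) V (ext_deriv (sec M V) q w)) x vs"
    by (rule eval_pulled_germ[OF V(1) ext_deriv_closed[OF M_ring[OF V(1)] V(3)] x'(1) vs g'])
  also have "\<dots> = eval_form k (Suc q) (pre V\<^sub>0) (pulled (Suc q) V\<^sub>0 (ext_deriv (sec M V\<^sub>0) q w\<^sub>0)) x vs"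
    by (rule eval_pulled_ext_deriv_germ[OF V\<^sub>0 w\<^sub>0 x'(1) vs g])
  also have "\<dots> = eval_form k (Suc q) (pre V\<^sub>0) (ext_deriv (simplex_sec k (pre V\<^sub>0)) q (pulled q V\<^sub>0 w\<^sub>0)) x vs"
    unfolding pulled_ext_deriv[OF V\<^sub>0 w\<^sub>0] ..
  finally have e: "eval_form k (Suc q) (pre V') (pulled (Suc q) V' w') x vs = \<dots>" .
  show "?y \<in> V' \<and> simplex_open k (pre V') \<and>
      \<Lambda>\<Omega>_map (sec M V') (simplex_sec k (pre V')) (on_sections \<sigma> V') (Suc q) w' \<in> carrier (\<Lambda>\<Omega> (simplex_sec k (pre V')) (Suc q)) \<and>
      eval_form k (Suc q) (pre V') (\<Lambda>\<Omega>_map (sec M V') (simplex_sec k (pre V')) (on_sections \<sigma> V') (Suc q) w') x vs =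
        eval_form k (Suc q) (pre V\<^sub>0) (ext_deriv (simplex_sec k (pre V\<^sub>0)) q (pulled q V\<^sub>0 w\<^sub>0)) x vs"
    unfolding pulled_def[of "Suc q" V', symmetric]
    by (intro conjI V'(2) pre_open V'(1) pulled_closed V'(3) e)
qed

end

section \<open>Faces of a simplex in the space\<close>

lemma face_simps:
  assumes "y \<in> standard_simplex m"
  shows "on_points (face M (Suc m) \<sigma> i) y = on_points \<sigma> (simplical_face i y)"
  using assms by (simp add: face_def cinf_comp_def compose_def face_map_def topspace_simplex)

lemma preim_face:
  assumes i: "i \<le> Suc m"
  shows "preim (simplex_space m) (face M (Suc m) \<sigma> i) V =
    {y \<in> standard_simplex m. simplical_face i y \<in> preim (simplex_space (Suc m)) \<sigma> V}"
  using simplical_face_simplex[OF i] by (auto simp: preim_def topspace_simplex face_simps)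

lemma face_preimage_open:
  assumes "simplex_open (Suc m) U" and i: "i \<le> Suc m"
  shows "simplex_open m {y \<in> standard_simplex m. simplical_face i y \<in> U}"
proof -
  obtain W where W: "open W" "U = standard_simplex (Suc m) \<inter> W"
    using assms(1) by (auto simp: simplex_open_def openin_simplex_iff)
  have "{y \<in> standard_simplex m. simplical_face i y \<in> U} = standard_simplex m \<inter> simplical_face i -` W"
    unfolding W(2) using simplical_face_simplex[OF i] by auto
  moreover have "open (simplical_face i -` W)"
    by (rule open_vimage[OF W(1) continuous_simplical_face])
  ultimately show ?thesis by (auto simp: simplex_open_def openin_simplex_iff)
qed

section \<open>Stokes' theorem\<close>

text \<open>The vector from vertex 0 to vertex \<open>l + 1\<close>. The shift lets the tangent
  fields be counted from 0, as the rows and columns of \<open>dt\<close> are, while the chart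
  coordinates start at 1.\<close>

definition edge :: "nat \<Rightarrow> nat \<Rightarrow> real" where
  "edge l = coord_vector (Suc l)"

lemma edge_tangent: "l < n \<Longrightarrow> (\<Sum>i\<le>n. edge l i) = 0"
proof -
  assume l: "l < n"
  have "(\<Sum>i\<le>n. edge l i) = (\<Sum>i\<le>n. (if i = Suc l then 1 else 0) - (if i = 0 then 1 else 0))"
    by (rule sum.cong) (auto simp: edge_def coord_vector_def)
  also have "\<dots> = (\<Sum>i\<le>n. if i = Suc l then 1 else 0) - (\<Sum>i\<le>n. if i = 0 then 1 else 0)"
    by (rule sum_subtractf)
  also have "\<dots> = 0" using l by simp
  finally show ?thesis .
qed

lemma edge_euclid: "l < n \<Longrightarrow> edge l \<in> euclid (Suc n)"
  by (auto simp: mem_euclid edge_def coord_vector_def)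

lemma edges_tangents: "(\<And>l. l < q \<Longrightarrow> Y l < n) \<Longrightarrow> tangents n q (map (\<lambda>l. edge (Y l)) [0..<q])"
  by (auto simp: tangents_def edge_tangent)

text \<open>The face \<open>j + 1\<close> lacks the end of edge \<open>j\<close> but keeps vertex 0,
  so its own edges are the remaining ones in their order.\<close>

lemma face_edge_Suc: "simplical_face (Suc j) (edge l) = edge (skip j l)"
  by (auto simp: fun_eq_iff simplical_face_def edge_def coord_vector_def skip_def)

lemma face_edge_0: "simplical_face 0 (edge l) = (\<lambda>i. edge (Suc l) i - edge 0 i)"
  by (auto simp: fun_eq_iff simplical_face_def edge_def coord_vector_def)

lemma coordinate_edges: "map coord_vector [1..<Suc k] = map edge [0..<k]"
  by (simp add: edge_def[abs_def] map_Suc_upt[symmetric] comp_def del: upt_Suc)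

lemma integral_simplex_chart:
  "integral_simplex k \<omega> = chart_integral {1..k} (\<lambda>y. \<omega> (simplex_param k y) (map edge [0..<k]))"
  unfolding integral_simplex_def set_lebesgue_integral_def chart_integral_def simplex_chart_domain_eq coordinate_edges
  by simp

text \<open>Different indices may give the same simplex, and then their coefficients merge or cancel
  in the chain. Regrouping the sum by simplices shows that the integral is insensitive to
  this.\<close>

lemma integral_over_sum_of_simplices:
  "integral_over_chain M k (\<Sum>i\<in>I. Poly_Mapping.single (f i) (c i)) \<gamma> = (\<Sum>i\<in>I. c i * integral_over_simplex M k (f i) \<gamma>)"
  if I: "finite I"
proof -
  let ?c = "\<Sum>i\<in>I. Poly_Mapping.single (f i) (c i)"
  let ?J = "\<lambda>\<tau>. integral_over_simplex M k \<tau> \<gamma>"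
  have l: "Poly_Mapping.lookup ?c \<tau> = (\<Sum>i\<in>I. if f i = \<tau> then c i else 0)" for \<tau>
    by (simp add: lookup_sum lookup_single when_def)
  have z: "Poly_Mapping.lookup ?c \<tau> = 0" if "\<tau> \<notin> f ` I" for \<tau>
    unfolding l by (rule sum.neutral) (use that in auto)
  have "integral_over_chain M k ?c \<gamma> = (\<Sum>\<tau>\<in>f ` I. Poly_Mapping.lookup ?c \<tau> * ?J \<tau>)"
    unfolding integral_over_chain_def
  proof (rule sum.mono_neutral_left)
    show "finite (f ` I)" using I by simp
    show "Poly_Mapping.keys ?c \<subseteq> f ` I"
    proof
      fix \<tau> assume "\<tau> \<in> Poly_Mapping.keys ?c"
      then have "Poly_Mapping.lookup ?c \<tau> \<noteq> 0" by (simp only: in_keys_iff not_False_eq_True)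
      then show "\<tau> \<in> f ` I" using z by blast
    qed
    show "\<forall>\<tau>\<in>f ` I - Poly_Mapping.keys ?c. Poly_Mapping.lookup ?c \<tau> * ?J \<tau> = 0"
    proof
      fix \<tau> assume "\<tau> \<in> f ` I - Poly_Mapping.keys ?c"
      then have "Poly_Mapping.lookup ?c \<tau> = 0" by (simp only: Diff_iff in_keys_iff not_not)
      then show "Poly_Mapping.lookup ?c \<tau> * ?J \<tau> = 0" by (simp only: mult_zero_left)
    qed
  qed
  also have "\<dots> = (\<Sum>\<tau>\<in>f ` I. \<Sum>i\<in>I. if f i = \<tau> then c i * ?J \<tau> else 0)"
    unfolding l sum_distrib_right by (intro sum.cong refl) simp
  also have "\<dots> = (\<Sum>i\<in>I. \<Sum>\<tau>\<in>f ` I. if f i = \<tau> then c i * ?J \<tau> else 0)" by (rule sum.swap)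
  also have "\<dots> = (\<Sum>i\<in>I. c i * ?J (f i))"
    by (rule sum.cong[OF refl]) (use I in simp)
  finally show ?thesis .
qed

lemma chart_integral_sum:
  assumes "\<And>j. j \<in> J \<Longrightarrow> chart_integrable I (f j)"
  shows "chart_integral I (\<lambda>z. \<Sum>j\<in>J. c j * f j z) = (\<Sum>j\<in>J. c j * chart_integral I (f j))"
proof -
  have "chart_integral I (\<lambda>z. \<Sum>j\<in>J. c j * f j z) = (\<integral>z. (\<Sum>j\<in>J. c j * (indicator (chart I) z * f j z)) \<partial>(\<Pi>\<^sub>M i\<in>I. lborel))"
    unfolding chart_integral_def sum_distrib_left by (simp only: mult.left_commute)
  also have "\<dots> = (\<Sum>j\<in>J. c j * chart_integral I (f j))"
    unfolding chart_integral_def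
    by (subst Bochner_Integration.integral_sum) (use assms in \<open>auto simp: chart_integrable_def\<close>)
  finally show ?thesis .
qed

section \<open>From the local formula for the derivative to the integrals\<close>

locale form_on_simplex = simplex_in_space M "Suc m" \<sigma>
  for M :: "('m, 'a) cinf_space" and m :: nat and \<sigma> :: "('m, 'a) cinf_simplex" +
  fixes \<gamma> :: "'m \<Rightarrow> ('m, 'a) form_germ"
  assumes \<gamma>: "\<gamma> \<in> global_forms M m"
begin

abbreviation "d\<gamma> \<equiv> form_d M m (topspace (space_top M)) \<gamma>"
abbreviation "\<Delta> \<equiv> standard_simplex (Suc m)"

text \<open>Defined through \<open>pullback\<close> on the whole simplex at once, because
  \<open>\<gamma>\<close> is represented by algebraic forms only near each point.\<close>

definition contraction :: "nat \<Rightarrow> (nat \<Rightarrow> real) \<Rightarrow> real" where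
  "contraction j x = pullback M (Suc m) \<sigma> m \<gamma> x (map (\<lambda>l. edge (skip j l)) [0..<m])"

lemma local_form:
  assumes x: "x \<in> \<Delta>"
  obtains V w where "openin (space_top M) V" "w \<in> carrier (\<Lambda>\<Omega> (sec M V) m)" "x \<in> pre V"
    "\<forall>y\<in>V. \<gamma> y = form_germ M m y V w"
proof -
  have y: "on_points \<sigma> x \<in> topspace (space_top M)" by (rule point_closed[OF x])
  have "\<exists>V w. openin (space_top M) V \<and> on_points \<sigma> x \<in> V \<and> V \<subseteq> topspace (space_top M) \<and>
      w \<in> carrier (\<Lambda>\<Omega> (sec M V) m) \<and> (\<forall>y\<in>V. \<gamma> y = form_germ M m y V w)"
    by (rule \<gamma>[unfolded forms_def sheafify_def mem_Collect_eq form_germ_def[symmetric], THEN conjunct2, THEN bspec, OF y])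
  then show thesis
  proof (elim exE conjE)
    fix V w assume V: "openin (space_top M) V" "on_points \<sigma> x \<in> V" "w \<in> carrier (\<Lambda>\<Omega> (sec M V) m)"
      "\<forall>y\<in>V. \<gamma> y = form_germ M m y V w"
    show thesis by (rule that[OF V(1,3) _ V(4)]) (use V(2) x in \<open>simp add: in_pre\<close>)
  qed
qed

text \<open>The sections of a face are those of \<open>\<sigma>\<close> followed by the coordinate
  pullback along the face map. By functoriality its pullback is computed from the form already
  pulled back to the large simplex, at the image point and on the image vectors.\<close>

lemma pullback_face:
  assumes V\<^sub>0: "openin (space_top M) V\<^sub>0" and w\<^sub>0: "w\<^sub>0 \<in> carrier (\<Lambda>\<Omega> (sec M V\<^sub>0) q)" and i: "i \<le> Suc m"
    and y: "y \<in> standard_simplex m" "simplical_face i y \<in> pre V\<^sub>0"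
    and vs: "tangents m q vs" "tangents (Suc m) q (map (simplical_face i) vs)"
    and \<gamma>y: "\<gamma> (on_points \<sigma> (simplical_face i y)) = form_germ M q (on_points \<sigma> (simplical_face i y)) V\<^sub>0 w\<^sub>0"
  shows "pullback M m (face M (Suc m) \<sigma> i) q \<gamma> y vs =
    eval_form (Suc m) q (pre V\<^sub>0) (pulled q V\<^sub>0 w\<^sub>0) (simplical_face i y) (map (simplical_face i) vs)"
proof (rule pullback_eqI[OF _ y(1) _ vs(1)])
  let ?x = "simplical_face i y"
  have x: "?x \<in> \<Delta>" using y(2) by (simp add: in_pre)
  have p: "on_points (face M (Suc m) \<sigma> i) y = on_points \<sigma> ?x" by (rule face_simps[OF y(1)])
  show "(V\<^sub>0, w\<^sub>0) \<in> \<gamma> (on_points (face M (Suc m) \<sigma> i) y)"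
    unfolding p \<gamma>y by (rule form_germI[OF V\<^sub>0 _ w\<^sub>0]) (use y in \<open>simp add: in_pre\<close>)
  show "on_points (face M (Suc m) \<sigma> i) y \<in> topspace (space_top M)" unfolding p by (rule point_closed[OF x])
  fix V w assume g: "(V, w) \<in> \<gamma> (on_points (face M (Suc m) \<sigma> i) y)"
  have V: "openin (space_top M) V" "on_points \<sigma> ?x \<in> V" "w \<in> carrier (\<Lambda>\<Omega> (sec M V) q)"
    by (rule form_germD[OF g[unfolded p \<gamma>y]])+
  let ?W = "{y \<in> standard_simplex m. simplical_face i y \<in> pre V}"
  have W: "preim (simplex_space m) (face M (Suc m) \<sigma> i) V = ?W" by (rule preim_face[OF i])
  have U: "simplex_open (Suc m) (pre V)" by (rule pre_open[OF V(1)])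
  interpret P: simplex_pullback "Suc m" "pre V" m ?W "simplical_face i"
    by (rule face_pullback[OF U face_preimage_open[OF U i] _ i]) simp
  have yW: "y \<in> ?W" using y(1) x V(2) by (simp add: in_pre)
  have "on_sections (face_map (Suc m) i) (pre V) = P.pull"
    using P.A.openU unfolding face_map_def P.pull_def by simp
  then have s: "on_sections (face M (Suc m) \<sigma> i) V = compose (carrier (sec M V)) P.pull (on_sections \<sigma> V)"
    using V(1) by (simp add: face_def cinf_comp_def)
  have c: "pulled q V w \<in> carrier (\<Lambda>\<Omega> (simplex_sec (Suc m) (pre V)) q)"
    by (rule pulled_closed[OF V(1,3)])
  have e: "\<Lambda>\<Omega>_map (sec M V) (simplex_sec m ?W) (on_sections (face M (Suc m) \<sigma> i) V) q w =
      \<Lambda>\<Omega>_map (simplex_sec (Suc m) (pre V)) (simplex_sec m ?W) P.pull q (pulled q V w)"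
    unfolding s pulled_def
    by (rule \<Lambda>\<Omega>_map_compose[OF section_hom[OF V(1)] P.hom.smooth_ring_hom_axioms V(3)])
  have len: "length vs = q" using vs(1) by (simp add: tangents_def)
  have t: "P.B.tangent v" "P.A.tangent (simplical_face i v)" if "v \<in> set vs" for v
    using vs that by (simp_all add: tangents_def P.A.tangent_def P.B.tangent_def)
  have "eval_form m q ?W (\<Lambda>\<Omega>_map (simplex_sec (Suc m) (pre V)) (simplex_sec m ?W) P.pull q (pulled q V w)) y vs =
      eval_form (Suc m) q (pre V) (pulled q V w) ?x (map (simplical_face i) vs)"
    by (rule P.eval_form_pull[OF c yW len t])
  also have "\<dots> = eval_form (Suc m) q (pre V\<^sub>0) (pulled q V\<^sub>0 w\<^sub>0) ?x (map (simplical_face i) vs)"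
    by (rule eval_pulled_germ[OF V\<^sub>0 w\<^sub>0 x vs(2) g[unfolded p \<gamma>y]])
  finally have ev: "eval_form m q ?W (\<Lambda>\<Omega>_map (sec M V) (simplex_sec m ?W) (on_sections (face M (Suc m) \<sigma> i) V) q w) y vs = \<dots>"
    unfolding e .
  show "on_points (face M (Suc m) \<sigma> i) y \<in> V \<and> simplex_open m (preim (simplex_space m) (face M (Suc m) \<sigma> i) V) \<and>
      \<Lambda>\<Omega>_map (sec M V) (simplex_sec m (preim (simplex_space m) (face M (Suc m) \<sigma> i) V)) (on_sections (face M (Suc m) \<sigma> i) V) q w
        \<in> carrier (\<Lambda>\<Omega> (simplex_sec m (preim (simplex_space m) (face M (Suc m) \<sigma> i) V)) q) \<and>
      eval_form m q (preim (simplex_space m) (face M (Suc m) \<sigma> i) V)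
        (\<Lambda>\<Omega>_map (sec M V) (simplex_sec m (preim (simplex_space m) (face M (Suc m) \<sigma> i) V)) (on_sections (face M (Suc m) \<sigma> i) V) q w) y vs =
      eval_form (Suc m) q (pre V\<^sub>0) (pulled q V\<^sub>0 w\<^sub>0) ?x (map (simplical_face i) vs)"
    unfolding W
  proof (intro conjI ev)
    show "on_points (face M (Suc m) \<sigma> i) y \<in> V" unfolding p by (rule V(2))
    show "simplex_open m ?W" by (rule P.B.simplex_open_axioms)
    show "\<Lambda>\<Omega>_map (sec M V) (simplex_sec m ?W) (on_sections (face M (Suc m) \<sigma> i) V) q w \<in> carrier (\<Lambda>\<Omega> (simplex_sec m ?W) q)"
      unfolding e by (rule \<Lambda>\<Omega>_map_closed[OF P.hom.smooth_ring_hom_axioms c])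
  qed
qed

text \<open>Both conclusions concern the same \<open>F\<close>: as an extension it shows that the
  contractions are smooth, and through its derivatives it computes \<open>d\<gamma>\<close>. The
  uniqueness of derivatives in tangent directions then makes the formula independent of the point at
  which \<open>F\<close> was chosen.\<close>

lemma local_contraction:
  assumes x: "x \<in> \<Delta>"
  shows "\<exists>F. (\<forall>j. local_extension (Suc (Suc m)) \<Delta> (contraction j) x (F j)) \<and>
    pullback M (Suc m) \<sigma> (Suc m) d\<gamma> x (map edge [0..<Suc m]) = (\<Sum>j<Suc m. (-1) ^ j * dirderiv (Suc (Suc m)) (edge j) (F j) x)"
proof -
  obtain V w where V: "openin (space_top M) V" "w \<in> carrier (\<Lambda>\<Omega> (sec M V) m)" "x \<in> pre V"
    "\<forall>y\<in>V. \<gamma> y = form_germ M m y V w" by (rule local_form[OF x])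
  interpret A: simplex_open "Suc m" "pre V" by (rule pre_open[OF V(1)])
  have tan: "A.tangent (edge l)" "edge l \<in> euclid (Suc (Suc m))" if "l < Suc m" for l
    using edge_tangent[OF that] edge_euclid[OF that] by (simp_all add: A.tangent_def)
  have \<alpha>: "pulled m V w \<in> carrier (A.Ext m)" using pulled_closed[OF V(1,2)] unfolding A.\<Lambda>\<Omega>_eq .
  have "\<exists>V' F. openin (Euclidean_space (Suc (Suc m))) V' \<and> x \<in> V' \<and> (\<forall>j. smooth_on_open (Suc (Suc m)) V' (F j)) \<and>
      (\<forall>j. \<forall>y\<in>pre V \<inter> V'. F j y = A.contracted m (pulled m V w) edge j y) \<and>
      eval_form (Suc m) (Suc m) (pre V) (A.dmap m (pulled m V w)) x (map edge [0..<Suc m]) =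
        (\<Sum>j<Suc m. (-1) ^ j * dirderiv (Suc (Suc m)) (edge j) (F j) x)"
    by (rule A.eval_form_dmap[OF V(3) _ _ \<alpha>]) (rule tan, assumption)+
  then obtain V' F where V'F: "openin (Euclidean_space (Suc (Suc m))) V' \<and> x \<in> V' \<and> (\<forall>j. smooth_on_open (Suc (Suc m)) V' (F j)) \<and>
      (\<forall>j. \<forall>y\<in>pre V \<inter> V'. F j y = A.contracted m (pulled m V w) edge j y) \<and>
      eval_form (Suc m) (Suc m) (pre V) (A.dmap m (pulled m V w)) x (map edge [0..<Suc m]) =
        (\<Sum>j<Suc m. (-1) ^ j * dirderiv (Suc (Suc m)) (edge j) (F j) x)"
    by (elim exE) (rule that)
  note V' = V'F[THEN conjunct1] V'F[THEN conjunct2, THEN conjunct1] V'F[THEN conjunct2, THEN conjunct2, THEN conjunct1]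
  note F = V'F[THEN conjunct2, THEN conjunct2, THEN conjunct2, THEN conjunct1, rule_format]
  note D = V'F[THEN conjunct2, THEN conjunct2, THEN conjunct2, THEN conjunct2]
  have \<gamma>V: "\<gamma> (on_points \<sigma> y) = form_germ M m (on_points \<sigma> y) V w" if "y \<in> pre V" for y
    by (rule bspec[OF V(4) conjunct2[OF that[unfolded in_pre]]])
  have c: "contraction j y = A.contracted m (pulled m V w) edge j y" if y: "y \<in> pre V" for j y
    unfolding contraction_def A.contracted_def
    by (rule pullback_form[where \<gamma> = \<gamma>, OF V(1,2) y edges_tangents \<gamma>V[OF y]]) (rule skip_less)
  have "tangents (Suc m) (Suc m) (map edge [0..<Suc m])"
    using edges_tangents[of "Suc m" "\<lambda>l. l" "Suc m"] by simp
  from pullback_form_d[where \<gamma> = \<gamma>, OF V(1,2,3) this \<gamma>V[OF V(3)]]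
  have d: "pullback M (Suc m) \<sigma> (Suc m) d\<gamma> x (map edge [0..<Suc m]) = (\<Sum>j<Suc m. (-1) ^ j * dirderiv (Suc (Suc m)) (edge j) (F j) x)"
    unfolding A.ext_deriv_eq D .
  \<comment> \<open>\<open>F\<close> agrees with the contraction on \<open>pre V\<close> only, which
    is open in the simplex. Shrinking \<open>V'\<close> by an ambient open set \<open>W\<close>
    makes them agree at every point of the simplex in the neighbourhood.\<close>
  obtain W where W: "open W" "pre V = \<Delta> \<inter> W" using A.openU by (auto simp: openin_simplex_iff)
  have VW: "openin (Euclidean_space (Suc (Suc m))) (V' \<inter> W)"
  proof -
    obtain W' where "open W'" "V' = euclid (Suc (Suc m)) \<inter> W'" using V'(1) unfolding openin_Euclidean_space_iff by blast
    then show ?thesis using W(1) unfolding openin_Euclidean_space_iff by (intro exI[of _ "W' \<inter> W"]) auto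
  qed
  have "local_extension (Suc (Suc m)) \<Delta> (contraction j) x (F j)" for j
  proof (rule local_extensionI[of x "V' \<inter> W"])
    show "x \<in> V' \<inter> W" using V'(2) V(3) W(2) by simp
    show "smooth_on_open (Suc (Suc m)) (V' \<inter> W) (F j)" by (rule smooth_subset[OF V'(3)[rule_format] VW]) simp
    fix y assume y: "y \<in> \<Delta>" "y \<in> V' \<inter> W"
    then have yV: "y \<in> pre V" "y \<in> pre V \<inter> V'" using W(2) by simp_all
    show "F j y = contraction j y" unfolding c[OF yV(1)] by (rule F[OF yV(2)])
  qed
  then show ?thesis by (intro exI[of _ F] conjI allI d)
qed

lemma smooth_contraction: "smooth_simplex_function (Suc m) (contraction j)"
proof (rule smooth_simplex_function.intro)
  fix x assume "x \<in> \<Delta>"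
  from local_contraction[OF this] show "\<exists>F. local_extension (Suc (Suc m)) \<Delta> (contraction j) x F"
    by (elim exE conjE) (rule exI, rule spec)
qed

definition derivative :: "nat \<Rightarrow> (nat \<Rightarrow> real) \<Rightarrow> real" where
  "derivative j x = differential (Suc m) \<Delta> (contraction j) x (edge j)"

lemma pullback_d:
  assumes x: "x \<in> \<Delta>"
  shows "pullback M (Suc m) \<sigma> (Suc m) d\<gamma> x (map edge [0..<Suc m]) = (\<Sum>j<Suc m. (-1) ^ j * derivative j x)"
proof -
  interpret B: simplex_open "Suc m" \<Delta> by (rule simplex_open_simplex)
  obtain F where F: "\<forall>j. local_extension (Suc (Suc m)) \<Delta> (contraction j) x (F j)"
    and d: "pullback M (Suc m) \<sigma> (Suc m) d\<gamma> x (map edge [0..<Suc m]) = (\<Sum>j<Suc m. (-1) ^ j * dirderiv (Suc (Suc m)) (edge j) (F j) x)"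
    using local_contraction[OF x] by (elim exE conjE) (rule that)
  have "derivative j x = dirderiv (Suc (Suc m)) (edge j) (F j) x" if "j < Suc m" for j
    unfolding derivative_def
    by (rule B.differential_dirderiv[OF x]) (use F edge_tangent[OF that] in \<open>simp_all add: B.tangent_def\<close>)
  then show ?thesis unfolding d by (intro sum.cong refl) simp
qed

lemma pullback_face_Suc:
  assumes j: "j < Suc m" and y: "y \<in> standard_simplex m"
  shows "pullback M m (face M (Suc m) \<sigma> (Suc j)) m \<gamma> y (map edge [0..<m]) = contraction j (simplical_face (Suc j) y)"
proof -
  have i: "Suc j \<le> Suc m" using j by simp
  let ?x = "simplical_face (Suc j) y"
  have x: "?x \<in> \<Delta>" by (rule simplical_face_simplex[OF i y])
  obtain V w where V: "openin (space_top M) V" "w \<in> carrier (\<Lambda>\<Omega> (sec M V) m)" "?x \<in> pre V"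
    "\<forall>y\<in>V. \<gamma> y = form_germ M m y V w" by (rule local_form[OF x])
  have \<gamma>V: "\<gamma> (on_points \<sigma> ?x) = form_germ M m (on_points \<sigma> ?x) V w"
    by (rule bspec[OF V(4) conjunct2[OF V(3)[unfolded in_pre]]])
  have e: "map (simplical_face (Suc j)) (map edge [0..<m]) = map (\<lambda>l. edge (skip j l)) [0..<m]"
    by (simp add: face_edge_Suc)
  have t: "tangents (Suc m) m (map (\<lambda>l. edge (skip j l)) [0..<m])"
    by (rule edges_tangents) (rule skip_less)
  have "tangents m m (map edge [0..<m])" using edges_tangents[of m "\<lambda>l. l" m] by simp
  from pullback_face[OF V(1,2) i y V(3) this t[folded e] \<gamma>V]
  have "pullback M m (face M (Suc m) \<sigma> (Suc j)) m \<gamma> y (map edge [0..<m]) =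
      eval_form (Suc m) m (pre V) (pulled m V w) ?x (map (\<lambda>l. edge (skip j l)) [0..<m])"
    unfolding e .
  also have "\<dots> = contraction j ?x"
    unfolding contraction_def by (rule pullback_form[where \<gamma> = \<gamma>, OF V(1,2,3) t \<gamma>V, symmetric])
  finally show ?thesis .
qed

lemma pullback_face_0:
  assumes y: "y \<in> standard_simplex m"
  shows "pullback M m (face M (Suc m) \<sigma> 0) m \<gamma> y (map edge [0..<m]) = (\<Sum>j<Suc m. (-1) ^ j * contraction j (simplical_face 0 y))"
proof -
  let ?x = "simplical_face 0 y"
  have x: "?x \<in> \<Delta>" by (rule simplical_face_simplex[OF _ y]) simp
  obtain V w where V: "openin (space_top M) V" "w \<in> carrier (\<Lambda>\<Omega> (sec M V) m)" "?x \<in> pre V"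
    "\<forall>y\<in>V. \<gamma> y = form_germ M m y V w" by (rule local_form[OF x])
  interpret A: simplex_open "Suc m" "pre V" by (rule pre_open[OF V(1)])
  have tan: "A.tangent (edge l)" if "l < Suc m" for l using edge_tangent[OF that] by (simp add: A.tangent_def)
  have \<alpha>: "pulled m V w \<in> carrier (A.Ext m)" using pulled_closed[OF V(1,2)] unfolding A.\<Lambda>\<Omega>_eq .
  have \<gamma>V: "\<gamma> (on_points \<sigma> ?x) = form_germ M m (on_points \<sigma> ?x) V w"
    by (rule bspec[OF V(4) conjunct2[OF V(3)[unfolded in_pre]]])
  have e: "map (simplical_face 0) (map edge [0..<m]) = map (\<lambda>l i. edge (Suc l) i - edge 0 i) [0..<m]"
    by (simp add: face_edge_0)
  have t: "tangents (Suc m) m (map (\<lambda>l i. edge (Suc l) i - edge 0 i) [0..<m])"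
    by (auto simp: tangents_def sum_subtractf edge_tangent simp del: sum.atMost_Suc)
  have c: "contraction j ?x = A.contracted m (pulled m V w) edge j ?x" for j
    unfolding contraction_def A.contracted_def
    by (rule pullback_form[where \<gamma> = \<gamma>, OF V(1,2,3) edges_tangents \<gamma>V]) (rule skip_less)
  have "tangents m m (map edge [0..<m])" using edges_tangents[of m "\<lambda>l. l" m] by simp
  from pullback_face[OF V(1,2) le0 y V(3) this t[folded e] \<gamma>V]
  have "pullback M m (face M (Suc m) \<sigma> 0) m \<gamma> y (map edge [0..<m]) =
      eval_form (Suc m) m (pre V) (pulled m V w) ?x (map (\<lambda>l i. edge (Suc l) i - edge 0 i) [0..<m])"
    unfolding e .
  also have "\<dots> = (\<Sum>j<Suc m. (-1) ^ j * contraction j ?x)"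
    unfolding c by (rule A.eval_form_differences[OF V(3) tan \<alpha>])
  finally show ?thesis .
qed

lemma integral_face_Suc:
  "j < Suc m \<Longrightarrow> integral_over_simplex M m (face M (Suc m) \<sigma> (Suc j)) \<gamma> =
    chart_integral {1..m} (\<lambda>y. contraction j (simplical_face (Suc j) (simplex_param m y)))"
  unfolding integral_over_simplex_def integral_simplex_chart
  by (rule chart_integral_cong) (rule pullback_face_Suc[OF _ simplex_param_simplex])

lemma integral_face_0:
  "integral_over_simplex M m (face M (Suc m) \<sigma> 0) \<gamma> =
    (\<Sum>j<Suc m. (-1) ^ j * chart_integral {1..m} (\<lambda>y. contraction j (simplical_face 0 (simplex_param m y))))"
proof -
  have "continuous_on (standard_simplex m) (\<lambda>y. contraction j (simplical_face 0 y))" for j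
    by (rule continuous_on_compose2[OF smooth_simplex_function.continuous[OF smooth_contraction] continuous_simplical_face])
       (use simplical_face_simplex[of 0 m] in auto)
  from chart_integral_sum[OF integrable_param[OF this]]
  have "chart_integral {1..m} (\<lambda>y. \<Sum>j<Suc m. (-1) ^ j * contraction j (simplical_face 0 (simplex_param m y))) =
      (\<Sum>j<Suc m. (-1) ^ j * chart_integral {1..m} (\<lambda>y. contraction j (simplical_face 0 (simplex_param m y))))" .
  moreover have "integral_over_simplex M m (face M (Suc m) \<sigma> 0) \<gamma> =
      chart_integral {1..m} (\<lambda>y. \<Sum>j<Suc m. (-1) ^ j * contraction j (simplical_face 0 (simplex_param m y)))"
    unfolding integral_over_simplex_def integral_simplex_chart
    by (rule chart_integral_cong) (rule pullback_face_0[OF simplex_param_simplex])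
  ultimately show ?thesis by (rule trans[rotated])
qed

lemma integral_derivative:
  assumes j: "j < Suc m"
  shows "chart_integrable {1..Suc m} (\<lambda>z. derivative j (simplex_param (Suc m) z))"
    and "chart_integral {1..Suc m} (\<lambda>z. derivative j (simplex_param (Suc m) z)) =
      chart_integral {1..m} (\<lambda>y. contraction j (simplical_face 0 (simplex_param m y))) -
      integral_over_simplex M m (face M (Suc m) \<sigma> (Suc j)) \<gamma>"
proof -
  interpret h: smooth_simplex_function "Suc m" "contraction j" by (rule smooth_contraction)
  have t: "h.tangent (edge j)" using edge_tangent[OF j] by (simp add: h.tangent_def)
  have c: "continuous_on \<Delta> (derivative j)"
    unfolding derivative_def by (rule h.continuous_differential[OF t])
  then show "chart_integrable {1..Suc m} (\<lambda>z. derivative j (simplex_param (Suc m) z))"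
    by (rule integrable_param)
  show "chart_integral {1..Suc m} (\<lambda>z. derivative j (simplex_param (Suc m) z)) =
      chart_integral {1..m} (\<lambda>y. contraction j (simplical_face 0 (simplex_param m y))) -
      integral_over_simplex M m (face M (Suc m) \<sigma> (Suc j)) \<gamma>"
    unfolding integral_face_Suc[OF j]
  proof (rule simplex_integral_coordinate_derivative[OF _ h.continuous c])
    show "Suc j \<in> {1..Suc m}" using j by simp
    fix x :: "nat \<Rightarrow> real" and t\<^sub>0 and A :: "real set"
    assume "t\<^sub>0 \<in> A" "\<And>t. t \<in> A \<Longrightarrow> (\<lambda>i. x i + t * coord_vector (Suc j) i) \<in> \<Delta>"
    then show "((\<lambda>t. contraction j (\<lambda>i. x i + t * coord_vector (Suc j) i)) has_real_derivative
        derivative j (\<lambda>i. x i + t\<^sub>0 * coord_vector (Suc j) i)) (at t\<^sub>0 within A)"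
      unfolding derivative_def edge_def[symmetric]
      by (rule h.derivative_along_line[OF t edge_euclid[OF j]])
  qed
qed

lemma stokes: "integral_over_simplex M (Suc m) \<sigma> d\<gamma> = integral_over_chain M m (boundary M (Suc m) \<sigma>) \<gamma>"
proof -
  let ?I = "\<lambda>i. integral_over_simplex M m (face M (Suc m) \<sigma> i) \<gamma>"
  let ?D = "\<lambda>j. chart_integral {1..Suc m} (\<lambda>z. derivative j (simplex_param (Suc m) z))"
  let ?C = "\<lambda>j. chart_integral {1..m} (\<lambda>y. contraction j (simplical_face 0 (simplex_param m y)))"
  have "integral_over_simplex M (Suc m) \<sigma> d\<gamma> =
      chart_integral {1..Suc m} (\<lambda>z. \<Sum>j<Suc m. (-1) ^ j * derivative j (simplex_param (Suc m) z))"
    unfolding integral_over_simplex_def integral_simplex_chart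
    by (rule chart_integral_cong) (rule pullback_d[OF simplex_param_simplex])
  also have "\<dots> = (\<Sum>j<Suc m. (-1) ^ j * ?D j)"
    by (rule chart_integral_sum, rule integral_derivative(1)) (simp only: lessThan_iff)
  also have "\<dots> = (\<Sum>j<Suc m. (-1) ^ j * (?C j - ?I (Suc j)))"
    by (rule sum.cong[OF refl]) (simp only: lessThan_iff integral_derivative(2))
  \<comment> \<open>The integrals over the face 0, with their alternating signs, add up to the
    integral of the pullback to that face by \<open>integral_face_0\<close>; the minus sign of the
    other term raises the exponent by one, to the index of its face.\<close>
  also have "\<dots> = ?I 0 + (\<Sum>j<Suc m. (-1) ^ Suc j * ?I (Suc j))"
    unfolding integral_face_0 sum.distrib[symmetric] by (simp add: right_diff_distrib del: sum.lessThan_Suc)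
  also have "\<dots> = (\<Sum>i\<le>Suc m. (-1) ^ i * ?I i)"
    unfolding lessThan_Suc_atMost sum.atMost_Suc_shift by (simp del: power_Suc)
  also have "\<dots> = integral_over_chain M m (boundary M (Suc m) \<sigma>) \<gamma>"
    unfolding boundary_def by (rule integral_over_sum_of_simplices[symmetric]) simp
  finally show ?thesis .
qed

end

theorem theorem6p9:
  fixes M :: "('m, 'a) cinf_space"
    and \<gamma> :: "'m \<Rightarrow> ('m, 'a) form_germ"
    and \<sigma> :: "('m, 'a) cinf_simplex"
    and k :: nat
  assumes "local_cinf_ringed_space M"
    and "k \<ge> 1"
    and "\<gamma> \<in> global_forms M (k - 1)"
    and "\<sigma> \<in> cinf_simplices M k"
  shows "integral_over_simplex M k \<sigma> (form_d M (k - 1) (topspace (space_top M)) \<gamma>)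
       = integral_over_chain M (k - 1) (boundary M k \<sigma>) \<gamma>"
proof -
  obtain m where k: "k = Suc m" using assms(2) by (cases k) simp_all
  interpret form_on_simplex M m \<sigma> \<gamma>
    by (intro form_on_simplex.intro simplex_in_space.intro form_on_simplex_axioms.intro)
       (use assms k in \<open>simp_all add: local_cinf_ringed_space_def cinf_simplices_def\<close>)
  show ?thesis using stokes k by simp
qed

end
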